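(* Let $n\ge2$, $m\ge2$, and $d\ge m$ be integers. If $$A_n(d,m)-H_n(d,m)>D_n(m),$$ then the involutive cone incidence $$\widetilde\rho_m:\mathbb P(\widetilde{\mathcal F}^m_d)\longrightarrow\mathbb B^m_d$$ in $\mathbb P^{2n-1}$ is birational.
   Context: Numerical functions (with $\binom ab=0$ when $a<b$): $$A_n(d,m)=\binom{d+2n-2}{2n-2}-\binom{d-m+2n-2}{2n-2},\quad H_n(d,m)=\binom{d+2n-3}{2n-3}-\binom{d-m+2n-3}{2n-3},\quad D_n(m)=\binom{m+2n-3}{m}+2n-2.$$ We work over $\mathbb C$; $(V,\omega)$ is a complex symplectic vector space of dimension $2n$ and $\mathbb P^{2n-1}=\mathbb P(V)$. For a hyperplane $H=V(\ell)$, the polar point is $\sigma(H)=[v_\ell]\in H$, where $\ell(u)=\omega(v_\ell,u)$ for all $u\in V$. For a vector bundle $E$ on a base $B$, $\pi:\mathbb P(E)\to B$ parametrizes one-dimensional subspaces of the fibers, with tautological line subbundle $\mathcal O_{\mathbb P(E)}(-1)=\mathcal O_E(-1)\subset\pi^*E$; $\operatorname{Sym}^kE=0$ for $k<0$; pullbacks of bundles are not written. Let $\check{\mathbb P}^{2n-1}$ be the space of hyperplanes of $\mathbb P(V)$ and $\mathcal F=V^\vee\otimes\mathcal O_{\check{\mathbb P}^{2n-1}}$. The tautological sequence $0\to\mathcal O_{\check{\mathbb P}^{2n-1}}(-1)\to\mathcal F\to\mathcal Q\to0$ defines $\mathcal Q$ (its fiber at $H$ is the space of linear forms on $H$). The bundle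 $\mathbb P(\mathcal Q^\vee)$ parametrizes pairs $(H,p)$ with $p\in H$; on it $0\to\mathcal G\to\mathcal Q\to\mathcal O_{\mathcal Q^\vee}(1)\to0$ defines $\mathcal G$, whose fiber at $(H,p)$ is the space of linear forms on $H$ vanishing at $p$. Let $s_\sigma:\check{\mathbb P}^{2n-1}\to\mathbb P(\mathcal Q^\vee)$, $H\mapsto(H,\sigma(H))$, and $\mathcal G_\sigma=s_\sigma^*\mathcal G$. Set $\mathbb Y_m=\mathbb P(\operatorname{Sym}^m\mathcal G_\sigma)$: its points are pairs $(H,[q])$ with $H$ a hyperplane and $q\ne0$ a degree-$m$ form on $H$ that is a polynomial in the linear forms on $H$ vanishing at $\sigma(H)$ (the equation of a possibly nonreduced cone in $H$ whose vertex contains $\sigma(H)$). Over $\mathbb Y_m$, multiplication gives an inclusion $\mathcal O_{\operatorname{Sym}^m\mathcal G_\sigma}(-1)\otimes\operatorname{Sym}^{d-m}\mathcal Q\hookrightarrow\operatorname{Sym}^d\mathcal Q$, and $\widetilde{\mathcal F}^m_d\subset\operatorname{Sym}^d\mathcal F$ is the inverse image of this subbundle under $\operatorname{Sym}^d\mathcal F\to\operatorname{Sym}^d\mathcal Q$. Thus the fiber of $\widetilde{\mathcal F}^m_d$ over $(H,[q])$ consists of the degree-$d$ forms on $V$ whose restriction to $H$ is a multiple of $q$. The involutive cone incidence $\widetilde\rho_m:\mathbb P(\widetilde{\mathcal F}^m_d)\to\mathbb P(\operatorname{Sym}^dV^\vee)$ is the map induced by $\widetilde{\mathcal F}^m_d\subset\operatorname{Sym}^dV^\vee\otimes\mathcal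 O$, and $\mathbb B^m_d$ is its image. *)

theory Defs
  imports "HOL-Analysis.Analysis"
begin

section \<open>Numerical functions\<close>

text \<open>
  For natural numbers, \<open>x choose y = 0\<close> when \<open>x < y\<close>. The summand \<open>- m\<close> is subtracted last, so that
  for \<open>n \<ge> 2\<close> the truncated subtraction gives the value prescribed by this convention also when
  \<open>d < m\<close>.
\<close>

definition A_num :: "nat \<Rightarrow> nat \<Rightarrow> nat \<Rightarrow> int" where
  "A_num n d m = int ((d + (2*n - 2)) choose (2*n - 2)) - int ((d + (2*n - 2) - m) choose (2*n - 2))"

definition H_num :: "nat \<Rightarrow> nat \<Rightarrow> nat \<Rightarrow> int" where
  "H_num n d m = int ((d + (2*n - 3)) choose (2*n - 3)) - int ((d + (2*n - 3) - m) choose (2*n - 3))"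

definition D_num :: "nat \<Rightarrow> nat \<Rightarrow> int" where
  "D_num n m = int ((m + (2*n - 3)) choose m) + 2 * int n - 2"


section \<open>Spaces with functions\<close>

text \<open>
  A complex variety is given as a set of points with a topology and, for each open set, the
  complex-valued functions that are regular on it (only the values on that set are relevant).
\<close>

record 'a fspace =
  points :: "'a set"
  opens :: "'a set set"
  regular :: "'a set \<Rightarrow> ('a \<Rightarrow> complex) set"

definition open_subspace :: "'a fspace \<Rightarrow> 'a set \<Rightarrow> 'a fspace" where
  "open_subspace X U = \<lparr>points = U, opens = {T \<in> opens X. T \<subseteq> U}, regular = regular X\<rparr>"

definition morphism :: "'a fspace \<Rightarrow> 'b fspace \<Rightarrow> ('a \<Rightarrow> 'b) \<Rightarrow> bool" where
  "morphism X Y \<phi> \<longleftrightarrow>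
     \<phi> ` points X \<subseteq> points Y \<and>
     (\<forall>T \<in> opens Y. \<phi> -` T \<inter> points X \<in> opens X \<and>
        (\<forall>h \<in> regular Y T. h \<circ> \<phi> \<in> regular X (\<phi> -` T \<inter> points X)))"

definition isomorphism :: "'a fspace \<Rightarrow> 'b fspace \<Rightarrow> ('a \<Rightarrow> 'b) \<Rightarrow> bool" where
  "isomorphism X Y \<phi> \<longleftrightarrow>
     morphism X Y \<phi> \<and>
     (\<exists>\<psi>. morphism Y X \<psi> \<and> (\<forall>x \<in> points X. \<psi> (\<phi> x) = x) \<and> (\<forall>y \<in> points Y. \<phi> (\<psi> y) = y))"

definition dense_open :: "'a fspace \<Rightarrow> 'a set \<Rightarrow> bool" where
  "dense_open X U \<longleftrightarrow> U \<in> opens X \<and> (\<forall>T \<in> opens X. T \<noteq> {} \<longrightarrow> T \<inter> U \<noteq> {})"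

definition birational_morphism :: "'a fspace \<Rightarrow> 'b fspace \<Rightarrow> ('a \<Rightarrow> 'b) \<Rightarrow> bool" where
  "birational_morphism X Y \<phi> \<longleftrightarrow>
     morphism X Y \<phi> \<and>
     (\<exists>U W. dense_open X U \<and> dense_open Y W \<and>
        isomorphism (open_subspace X U) (open_subspace Y W) \<phi>)"


section \<open>Zariski topology and regular functions\<close>

inductive_set polynomials :: "('a \<Rightarrow> complex) set \<Rightarrow> ('a \<Rightarrow> complex) set"
  for C :: "('a \<Rightarrow> complex) set" where
  const: "(\<lambda>_. c) \<in> polynomials C"
| coord: "x \<in> C \<Longrightarrow> x \<in> polynomials C"
| add: "p \<in> polynomials C \<Longrightarrow> q \<in> polynomials C \<Longrightarrow> (\<lambda>z. p z + q z) \<in> polynomials C"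
| mult: "p \<in> polynomials C \<Longrightarrow> q \<in> polynomials C \<Longrightarrow> (\<lambda>z. p z * q z) \<in> polynomials C"

definition zariski_open :: "('a \<Rightarrow> complex) set \<Rightarrow> 'a set \<Rightarrow> 'a set \<Rightarrow> bool" where
  "zariski_open C Z U \<longleftrightarrow> (\<exists>S \<subseteq> polynomials C. U = {z \<in> Z. \<exists>p \<in> S. p z \<noteq> 0})"

definition regular_on :: "('a \<Rightarrow> complex) set \<Rightarrow> 'a set \<Rightarrow> ('a \<Rightarrow> complex) \<Rightarrow> bool" where
  "regular_on C U h \<longleftrightarrow>
     (\<forall>z \<in> U. \<exists>p \<in> polynomials C. \<exists>q \<in> polynomials C.
        q z \<noteq> 0 \<and> (\<forall>w \<in> U. q w \<noteq> 0 \<longrightarrow> h w = p w / q w))"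

text \<open>
  The quotient structure along \<open>\<pi>\<close> of the quasi-affine variety \<open>Z\<close> with coordinate functions \<open>C\<close>:
  a set is open iff its preimage is, and a function is regular iff its pullback is. If \<open>\<pi>\<close> has
  regular local sections and is open (as for \<open>E - {0} \<rightarrow> \<P>(E)\<close>), this is the usual structure on the
  image variety.
\<close>

definition quotient_space :: "('a \<Rightarrow> complex) set \<Rightarrow> ('a \<Rightarrow> 'b) \<Rightarrow> 'a set \<Rightarrow> 'b fspace" where
  "quotient_space C \<pi> Z =
     \<lparr>points = \<pi> ` Z,
      opens = {U. U \<subseteq> \<pi> ` Z \<and> zariski_open C Z (\<pi> -` U \<inter> Z)},
      regular = (\<lambda>U. {h. regular_on C (\<pi> -` U \<inter> Z) (h \<circ> \<pi>)})\<rparr>"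


section \<open>Forms and projective spaces of forms\<close>

text \<open>
  Functions on a subspace \<open>W\<close> are represented by their extension by zero. As the field is infinite,
  symmetric powers of spaces of linear forms are spaces of functions: \<open>sym_power k W L\<close> is the
  span of the \<open>k\<close>-fold products on \<open>W\<close> of elements of \<open>L\<close>.
\<close>

definition restr :: "'v set \<Rightarrow> ('v \<Rightarrow> complex) \<Rightarrow> 'v \<Rightarrow> complex" where
  "restr W f = (\<lambda>u. if u \<in> W then f u else 0)"

definition sym_power :: "nat \<Rightarrow> 'v set \<Rightarrow> ('v \<Rightarrow> complex) set \<Rightarrow> ('v \<Rightarrow> complex) set" where
  "sym_power k W L =
     {restr W (\<lambda>u. \<Sum>j<N. c j * (\<Prod>i<k. \<alpha> j i u)) | (N::nat) c \<alpha>. \<forall>j<N. \<forall>i<k. \<alpha> j i \<in> L}"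

definition line :: "('v \<Rightarrow> complex) \<Rightarrow> ('v \<Rightarrow> complex) set" where
  "line f = {(\<lambda>u. c * f u) | c. True}"

definition proj :: "('v \<Rightarrow> complex) set \<Rightarrow> ('v \<Rightarrow> complex) set set" where
  "proj E = line ` (E - {\<lambda>_. 0})"

text \<open>
  A subset \<open>B\<close> of \<open>\<P>(E)\<close> with its induced structure. The coordinate functions are the evaluations;
  they span the dual of a finite-dimensional space \<open>E\<close> of functions.
\<close>

definition evaluations :: "(('v \<Rightarrow> complex) \<Rightarrow> complex) set" where
  "evaluations = range (\<lambda>u f. f u)"

definition proj_subspace ::
    "('v \<Rightarrow> complex) set \<Rightarrow> ('v \<Rightarrow> complex) set set \<Rightarrow> ('v \<Rightarrow> complex) set fspace" where
  "proj_subspace E B = quotient_space evaluations line {f \<in> E - {\<lambda>_. 0}. line f \<in> B}"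


section \<open>The involutive cone incidence\<close>

definition linear_forms :: "(complex^'i \<Rightarrow> complex) set" where
  "linear_forms = {\<alpha>. Vector_Spaces.linear (*s) (*) \<alpha>}"

definition symplectic_form :: "(complex^'i \<Rightarrow> complex^'i \<Rightarrow> complex) \<Rightarrow> bool" where
  "symplectic_form \<omega> \<longleftrightarrow>
     (\<forall>v. \<omega> v \<in> linear_forms) \<and> (\<forall>u. (\<lambda>v. \<omega> v u) \<in> linear_forms) \<and>
     (\<forall>v. \<omega> v v = 0) \<and>
     (\<forall>v. (\<forall>u. \<omega> v u = 0) \<longrightarrow> v = 0)"

definition zero_set :: "('v \<Rightarrow> complex) \<Rightarrow> 'v set" where
  "zero_set f = {u. f u = 0}"

definition hyperplanes :: "(complex^'i) set set" where
  "hyperplanes = zero_set ` (linear_forms - {\<lambda>_. 0})"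

text \<open>The nonzero vectors \<open>v\<^sub>l\<close> on the line \<open>\<sigma>(H)\<close>, one for each equation \<open>l\<close> of \<open>H\<close>.\<close>

definition polar_vectors ::
    "(complex^'i \<Rightarrow> complex^'i \<Rightarrow> complex) \<Rightarrow> (complex^'i) set \<Rightarrow> (complex^'i) set" where
  "polar_vectors \<omega> H =
     {v. \<exists>l \<in> linear_forms - {\<lambda>_. 0}. H = zero_set l \<and> (\<forall>u. l u = \<omega> v u)}"

text \<open>The fibers of \<open>\<Q>\<close> and \<open>\<G>\<^sub>\<sigma>\<close> at \<open>H\<close>.\<close>

definition Q_fiber :: "(complex^'i) set \<Rightarrow> (complex^'i \<Rightarrow> complex) set" where
  "Q_fiber H = restr H ` linear_forms"

definition G_fiber ::
    "(complex^'i \<Rightarrow> complex^'i \<Rightarrow> complex) \<Rightarrow> (complex^'i) set \<Rightarrow> (complex^'i \<Rightarrow> complex) set" where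
  "G_fiber \<omega> H = {\<alpha> \<in> Q_fiber H. \<forall>v \<in> polar_vectors \<omega> H. \<alpha> v = 0}"

definition Y_points ::
    "(complex^'i \<Rightarrow> complex^'i \<Rightarrow> complex) \<Rightarrow> nat \<Rightarrow>
     ((complex^'i) set \<times> (complex^'i \<Rightarrow> complex) set) set" where
  "Y_points \<omega> m = {(H, a). H \<in> hyperplanes \<and> a \<in> proj (sym_power m H (G_fiber \<omega> H))}"

definition forms :: "nat \<Rightarrow> (complex^'i \<Rightarrow> complex) set" where
  "forms d = sym_power d UNIV linear_forms"

text \<open>
  The fiber of \<open>\<F>\<^sup>m\<^sub>d\<close> at \<open>(H, a)\<close>; the line \<open>a\<close> is the fiber of the tautological bundle. It is used
  only for \<open>d \<ge> m\<close>.
\<close>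

definition F_fiber ::
    "nat \<Rightarrow> nat \<Rightarrow> (complex^'i) set \<Rightarrow> (complex^'i \<Rightarrow> complex) set \<Rightarrow> (complex^'i \<Rightarrow> complex) set" where
  "F_fiber m d H a =
     {f \<in> forms d. \<exists>q \<in> a. \<exists>g \<in> sym_power (d - m) H (Q_fiber H). restr H f = (\<lambda>u. q u * g u)}"

definition incidence_points ::
    "(complex^'i \<Rightarrow> complex^'i \<Rightarrow> complex) \<Rightarrow> nat \<Rightarrow> nat \<Rightarrow>
     ((complex^'i) set \<times> (complex^'i \<Rightarrow> complex) set \<times> (complex^'i \<Rightarrow> complex) set) set" where
  "incidence_points \<omega> m d = {(H, a, b). (H, a) \<in> Y_points \<omega> m \<and> b \<in> proj (F_fiber m d H a)}"

text \<open>
  The variety structure of \<open>\<P>(\<F>\<^sup>m\<^sub>d)\<close>. A triple \<open>(l, p, f)\<close> of forms on \<open>V\<close> represents the point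
  \<open>(H, [q], [f])\<close> with \<open>H = V(l)\<close> and \<open>q = p|\<^sub>H\<close>. These triples form a quasi-affine variety. Its
  projection to \<open>\<P>(\<F>\<^sup>m\<^sub>d)\<close> is Zariski-locally trivial, because the dual projective space and the two projective bundles
  have local sections to the punctured bundles, and \<open>Sym\<^sup>m \<F> \<rightarrow> Sym\<^sup>m \<Q>\<close> is a surjection of
  vector bundles and so splits locally. The fibers are the choices of the scalars for \<open>l\<close>, \<open>q\<close>,
  \<open>f\<close> and of the lift \<open>p\<close> of \<open>q\<close>.
\<close>

definition represent ::
    "(complex^'i \<Rightarrow> complex) \<times> (complex^'i \<Rightarrow> complex) \<times> (complex^'i \<Rightarrow> complex) \<Rightarrow>
     (complex^'i) set \<times> (complex^'i \<Rightarrow> complex) set \<times> (complex^'i \<Rightarrow> complex) set" where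
  "represent = (\<lambda>(l, p, f). (zero_set l, line (restr (zero_set l) p), line f))"

definition representatives ::
    "(complex^'i \<Rightarrow> complex^'i \<Rightarrow> complex) \<Rightarrow> nat \<Rightarrow> nat \<Rightarrow>
     ((complex^'i \<Rightarrow> complex) \<times> (complex^'i \<Rightarrow> complex) \<times> (complex^'i \<Rightarrow> complex)) set" where
  "representatives \<omega> m d =
     {(l, p, f). l \<in> linear_forms - {\<lambda>_. 0} \<and> p \<in> forms m \<and> f \<in> forms d \<and>
        represent (l, p, f) \<in> incidence_points \<omega> m d}"

definition triple_evaluations ::
    "((complex^'i \<Rightarrow> complex) \<times> (complex^'i \<Rightarrow> complex) \<times> (complex^'i \<Rightarrow> complex) \<Rightarrow> complex) set" where
  "triple_evaluations =
     range (\<lambda>u (l, p, f). l u) \<union> range (\<lambda>u (l, p, f). p u) \<union> range (\<lambda>u (l, p, f). f u)"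

definition cone_incidence ::
    "(complex^'i \<Rightarrow> complex^'i \<Rightarrow> complex) \<Rightarrow> nat \<Rightarrow> nat \<Rightarrow>
     ((complex^'i) set \<times> (complex^'i \<Rightarrow> complex) set \<times> (complex^'i \<Rightarrow> complex) set) fspace" where
  "cone_incidence \<omega> m d = quotient_space triple_evaluations represent (representatives \<omega> m d)"

definition incidence_map ::
    "(complex^'i) set \<times> (complex^'i \<Rightarrow> complex) set \<times> (complex^'i \<Rightarrow> complex) set \<Rightarrow>
     (complex^'i \<Rightarrow> complex) set" where
  "incidence_map = (\<lambda>(H, a, b). b)"

definition cone_locus ::
    "(complex^'i \<Rightarrow> complex^'i \<Rightarrow> complex) \<Rightarrow> nat \<Rightarrow> nat \<Rightarrow> (complex^'i \<Rightarrow> complex) set fspace" where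
  "cone_locus \<omega> m d =
     proj_subspace (forms d) (incidence_map ` points (cone_incidence \<omega> m d))"

lemma sym_power_restr_lift:
  assumes "q \<in> sym_power m H (Q_fiber H)"
  shows "\<exists>p \<in> forms m. restr H p = q"
proof -
  from assms obtain N :: nat and c \<alpha> where
    q: "q = restr H (\<lambda>u. \<Sum>j<N. c j * (\<Prod>i<m. \<alpha> j i u))" and \<alpha>: "\<forall>j<N. \<forall>i<m. \<alpha> j i \<in> Q_fiber H"
    unfolding sym_power_def by blast
  define \<beta> where "\<beta> j i = (SOME b. b \<in> linear_forms \<and> \<alpha> j i = restr H b)" for j i
  have \<beta>: "\<beta> j i \<in> linear_forms \<and> \<alpha> j i = restr H (\<beta> j i)" if "j < N" "i < m" for j i
  proof -
    have "\<exists>b. b \<in> linear_forms \<and> \<alpha> j i = restr H b"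
      using \<alpha> that unfolding Q_fiber_def by blast
    then show ?thesis
      unfolding \<beta>_def by (rule someI_ex)
  qed
  have "restr UNIV (\<lambda>u. \<Sum>j<N. c j * (\<Prod>i<m. \<beta> j i u)) \<in> forms m"
    unfolding forms_def sym_power_def using \<beta> by blast
  moreover have "restr H (restr UNIV (\<lambda>u. \<Sum>j<N. c j * (\<Prod>i<m. \<beta> j i u))) = q"
    unfolding q restr_def using \<beta>
    by (intro ext) (auto intro!: sum.cong prod.cong simp: restr_def)
  ultimately show ?thesis by blast
qed

text \<open>The representatives cover all points of \<open>\<P>(\<F>\<^sup>m\<^sub>d)\<close>, and the locus is the image.\<close>

lemma points_cone_incidence: "points (cone_incidence \<omega> m d) = incidence_points \<omega> m d"
proof
  show "points (cone_incidence \<omega> m d) \<subseteq> incidence_points \<omega> m d"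
    by (auto simp: cone_incidence_def quotient_space_def representatives_def)
  show "incidence_points \<omega> m d \<subseteq> points (cone_incidence \<omega> m d)"
  proof
    fix x assume x: "x \<in> incidence_points \<omega> m d"
    obtain H a b where xe: "x = (H, a, b)" by (cases x)
    from x xe obtain l q f where l: "l \<in> linear_forms - {\<lambda>_. 0}" "H = zero_set l"
      and q: "q \<in> sym_power m H (G_fiber \<omega> H)" "a = line q"
      and f: "f \<in> F_fiber m d H a" "b = line f"
      unfolding incidence_points_def Y_points_def hyperplanes_def proj_def by blast
    have "q \<in> sym_power m H (Q_fiber H)"
      using q(1) unfolding sym_power_def G_fiber_def by blast
    then obtain p where p: "p \<in> forms m" "restr H p = q"
      using sym_power_restr_lift by blast
    have r: "represent (l, p, f) = x"
      using l q f p xe by (simp add: represent_def)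
    have "(l, p, f) \<in> representatives \<omega> m d"
      using r x l p f by (auto simp: representatives_def F_fiber_def)
    with r show "x \<in> points (cone_incidence \<omega> m d)"
      unfolding cone_incidence_def quotient_space_def by force
  qed
qed

lemma points_cone_locus:
  "points (cone_locus \<omega> m d) = incidence_map ` incidence_points \<omega> m d"
proof -
  have image: "line ` {f \<in> E. line f \<in> B} = B" if "B \<subseteq> line ` E"
    for E :: "(complex^'i \<Rightarrow> complex) set" and B
    using that by blast
  have "incidence_map ` incidence_points \<omega> m d \<subseteq> line ` (forms d - {\<lambda>_. 0})"
    by (auto simp: incidence_map_def incidence_points_def proj_def F_fiber_def)
  from image[OF this] show ?thesis
    unfolding cone_locus_def proj_subspace_def quotient_space_def points_cone_incidence
    by simp
qed

end

theory Submission
  imports Defs "HOL-Library.Countable_Set" "HOL-Library.Multiset" "HOL-Computational_Algebra.Fundamental_Theorem_Algebra"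
begin

text \<open>
  Two decompositions \<open>f = q g + l h\<close> of the same form, with \<open>q\<close> a cone over the polar point of the
  hyperplane \<open>l = 0\<close>, must use the same hyperplane when the data of one of them are algebraically
  independent over a countable field \<open>k\<close> containing the coefficients of \<open>\<omega>\<close>: there are derivations of
  \<open>\<complex>\<close> that vary \<open>h\<close> arbitrarily and kill the rest of these data, and differentiating the other
  decomposition confines the resulting multiples of \<open>l\<close> to a space that is too small by the
  hypothesis on \<open>A\<close>, \<open>H\<close> and \<open>D\<close>. Hence every field homomorphism fixing \<open>k\<close> and the values of \<open>f\<close> fixes the
  ratios of the coordinates of the polar vector \<open>v\<close>, which are therefore rational functions of \<open>f\<close>.
  Finally, the coefficient of \<open>s^(d - m)\<close> in \<open>f (u + s v)\<close> is a multiple of \<open>q u\<close> for \<open>u\<close> in the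
  hyperplane, so \<open>q\<close> is recovered from \<open>f\<close> as well and the incidence map has a rational inverse.
\<close>

section \<open>Subfields of the complex numbers and extension of homomorphisms\<close>

text \<open>A derivation does not commute with evaluation at an arbitrary vector; identities are
  therefore differentiated only at vectors with natural coordinates, which all derivations kill, and
  polynomiality spreads them to the rest. The numbers count forms of degree \<open>d\<close> on the
  second hyperplane \<open>l1 = 0\<close>. If \<open>q\<close> is not identically zero on its
  intersection with the first one, \<open>l0 = 0\<close>, then A - H is the dimension of the
  multiples of \<open>l0\<close> modulo those of \<open>q\<close>. Modulo \<open>q\<close>,
  differentiating the second decomposition supplies at most D dimensions:
  \<open>(m + 2n - 3) choose m\<close> for the cones of degree \<open>m\<close> over
  \<open>v\<close>, times \<open>g\<close>; \<open>2n - 1\<close> for the motions of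
  \<open>v\<close>, one coordinate being normalized to 1; less one, as \<open>q\<close> itself is
  such a cone. If \<open>q\<close> vanishes on the intersection, this count breaks down. Then
  \<open>l0\<close> divides \<open>q\<close> on \<open>l1 = 0\<close>, the cofactor has degree
  \<open>m - 1\<close>, differentiating \<open>q0\<close> leaves \<open>v\<close> a single direction
  to move in, and a cruder inequality suffices. The generic point has actual complex numbers as
  coordinates, independent over a countable field, so that derivations and homomorphisms can be
  applied to it directly.\<close>

definition complex_subfield :: "complex set \<Rightarrow> bool" where
  "complex_subfield K \<longleftrightarrow> 0 \<in> K \<and> 1 \<in> K \<and> (\<forall>x\<in>K. \<forall>y\<in>K. x + y \<in> K \<and> x * y \<in> K) \<and>
     (\<forall>x\<in>K. - x \<in> K \<and> inverse x \<in> K)"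

lemma complex_subfieldD:
  assumes "complex_subfield K"
  shows "0 \<in> K" "1 \<in> K" "x \<in> K \<Longrightarrow> y \<in> K \<Longrightarrow> x + y \<in> K" "x \<in> K \<Longrightarrow> y \<in> K \<Longrightarrow> x * y \<in> K"
    "x \<in> K \<Longrightarrow> - x \<in> K" "x \<in> K \<Longrightarrow> inverse x \<in> K" "x \<in> K \<Longrightarrow> y \<in> K \<Longrightarrow> x - y \<in> K"
    "x \<in> K \<Longrightarrow> y \<in> K \<Longrightarrow> x / y \<in> K"
  using assms unfolding complex_subfield_def diff_conv_add_uminus divide_inverse by blast+

lemma complex_subfield_sum: "complex_subfield K \<Longrightarrow> (\<And>i. i \<in> A \<Longrightarrow> f i \<in> K) \<Longrightarrow> sum f A \<in> K"
  by (induction A rule: infinite_finite_induct) (auto simp: complex_subfieldD)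

lemma complex_subfield_power: "complex_subfield K \<Longrightarrow> x \<in> K \<Longrightarrow> x ^ n \<in> K"
  by (induction n) (auto simp: complex_subfieldD)

lemma complex_subfield_of_nat: "complex_subfield K \<Longrightarrow> of_nat n \<in> K"
  by (induction n) (auto simp: complex_subfieldD)

definition poly_over :: "complex set \<Rightarrow> complex poly \<Rightarrow> bool" where
  "poly_over K p \<longleftrightarrow> (\<forall>i. coeff p i \<in> K)"

lemma poly_over_0 [simp]: "complex_subfield K \<Longrightarrow> poly_over K 0"
  and poly_over_1 [simp]: "complex_subfield K \<Longrightarrow> poly_over K 1"
  and poly_over_const: "complex_subfield K \<Longrightarrow> c \<in> K \<Longrightarrow> poly_over K [:c:]"
  and poly_over_X: "complex_subfield K \<Longrightarrow> poly_over K [:0, 1:]"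
  and poly_over_add: "complex_subfield K \<Longrightarrow> poly_over K p \<Longrightarrow> poly_over K q \<Longrightarrow> poly_over K (p + q)"
  and poly_over_diff: "complex_subfield K \<Longrightarrow> poly_over K p \<Longrightarrow> poly_over K q \<Longrightarrow> poly_over K (p - q)"
  and poly_over_minus: "complex_subfield K \<Longrightarrow> poly_over K p \<Longrightarrow> poly_over K (- p)"
  and poly_over_mult: "complex_subfield K \<Longrightarrow> poly_over K p \<Longrightarrow> poly_over K q \<Longrightarrow> poly_over K (p * q)"
  and poly_over_monom: "complex_subfield K \<Longrightarrow> c \<in> K \<Longrightarrow> poly_over K (monom c n)"
  and poly_over_pderiv: "complex_subfield K \<Longrightarrow> poly_over K p \<Longrightarrow> poly_over K (pderiv p)"
  by (auto simp: poly_over_def coeff_pCons coeff_mult coeff_pderiv complex_subfieldD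
      intro!: complex_subfield_sum complex_subfieldD(4) complex_subfieldD(3) complex_subfield_of_nat split: nat.splits)

text \<open>Long division only ever divides by the leading coefficient of \<open>m\<close>, so
  quotient and remainder keep their coefficients in \<open>K\<close>.\<close>

lemma poly_over_division:
  assumes K: "complex_subfield K" and m: "poly_over K m" "m \<noteq> 0" and p: "poly_over K p"
  shows "\<exists>q r. poly_over K q \<and> poly_over K r \<and> p = m * q + r \<and> (r = 0 \<or> degree r < degree m)"
  using p
proof (induction "degree p" arbitrary: p rule: less_induct)
  case less
  show ?case
  proof (cases "p = 0 \<or> degree p < degree m")
    case True
    then show ?thesis using less.prems K by (intro exI[of _ 0] exI[of _ p]) auto
  next
    case False
    define s where "s = monom (lead_coeff p / lead_coeff m) (degree p - degree m)"
    have s: "poly_over K s"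
      unfolding s_def using less.prems m K
      by (intro poly_over_monom complex_subfieldD(8)) (auto simp: poly_over_def)
    have s0: "s \<noteq> 0" using False m by (auto simp: s_def)
    have deg: "degree (m * s) = degree p"
      using False m s0 
      by (simp add: degree_mult_eq s_def degree_monom_eq not_less)
    have lc: "lead_coeff (m * s) = lead_coeff p"
      using m s0
      by (simp add: lead_coeff_mult del: coeff_mult_degree_sum) (simp add: s_def degree_monom_eq)
    define p' where "p' = p - m * s"
    have p': "poly_over K p'" unfolding p'_def using less.prems m s K by (simp add: poly_over_diff poly_over_mult)
    consider "p' = 0" | "degree p' < degree p" 
      unfolding p'_def using deg lc
      by (metis (no_types, lifting) coeff_diff degree_diff_le diff_self le_less leading_coeff_0_iff order_refl)
    then show ?thesis
    proof cases
      case 1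
      then show ?thesis using s K unfolding p'_def by (intro exI[of _ s] exI[of _ 0]) auto
    next
      case 2
      from less.hyps[OF this p'] obtain q r where "poly_over K q" "poly_over K r" "p' = m * q + r"
        "r = 0 \<or> degree r < degree m" by blast
      then show ?thesis using s K unfolding p'_def
        by (intro exI[of _ "q + s"] exI[of _ r]) (auto simp: poly_over_add algebra_simps)
    qed
  qed
qed

section \<open>Transcendental elements and simple extensions\<close>

definition transcendental_over :: "complex set \<Rightarrow> complex \<Rightarrow> bool" where
  "transcendental_over S a \<longleftrightarrow> (\<forall>p. poly_over S p \<and> poly p a = 0 \<longrightarrow> p = 0)"

lemma countable_poly_over:
  assumes "countable S"
  shows "countable {p. poly_over S p}"
proof (rule countable_subset)
  show "{p. poly_over S p} \<subseteq> Poly ` lists S"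
  proof
    fix p assume "p \<in> {p. poly_over S p}"
    then have "coeffs p \<in> lists S" by (auto simp: poly_over_def coeffs_def)
    then show "p \<in> Poly ` lists S" by (metis Poly_coeffs image_eqI)
  qed
  show "countable (Poly ` lists S)" using assms by (intro countable_image countable_lists)
qed

text \<open>The nonzero polynomials over \<open>S\<close> have only countably many roots in all, and
  the complex numbers are uncountable. The set \<open>F\<close> reserves values to be
  avoided.\<close>

lemma ex_transcendental_over:
  assumes "countable S" "countable F"
  shows "\<exists>b. b \<notin> F \<and> transcendental_over S b"
proof -
  have "countable {p. poly_over S p}" using assms(1) by (rule countable_poly_over)
  then have "countable (F \<union> (\<Union>p\<in>{p. poly_over S p} - {0}. {x. poly p x = 0}))"
    using assms by (intro countable_Un countable_UN) (auto intro: countable_finite poly_roots_finite)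
  then obtain b where "b \<notin> F \<union> (\<Union>p\<in>{p. poly_over S p} - {0}. {x. poly p x = 0})"
    using uncountable_UNIV_complex by (metis UNIV_eq_I)
  then show ?thesis by (auto simp: transcendental_over_def intro!: exI[of _ b])
qed

text \<open>The field \<open>K(a)\<close>. Fractions describe it for algebraic and for
  transcendental \<open>a\<close> alike, so one extension lemma serves both cases.\<close>

definition adjoin :: "complex set \<Rightarrow> complex \<Rightarrow> complex set" where
  "adjoin K a = {poly p a / poly q a | p q. poly_over K p \<and> poly_over K q \<and> poly q a \<noteq> 0}"

lemma adjoinI: "poly_over K p \<Longrightarrow> poly_over K q \<Longrightarrow> poly q a \<noteq> 0 \<Longrightarrow> poly p a / poly q a \<in> adjoin K a"
  by (auto simp: adjoin_def)

lemma adjoin_superset: "complex_subfield K \<Longrightarrow> K \<subseteq> adjoin K a"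
proof
  fix x assume "complex_subfield K" "x \<in> K"
  then show "x \<in> adjoin K a"
    using adjoinI[of K "[:x:]" "[:1:]" a] by (simp add: poly_over_const complex_subfieldD)
qed

lemma adjoin_mem: "complex_subfield K \<Longrightarrow> a \<in> adjoin K a"
  using adjoinI[of K "[:0,1:]" "[:1:]" a] by (simp add: poly_over_const complex_subfieldD poly_over_X)

lemma adjoin_subfield:
  assumes K: "complex_subfield K"
  shows "complex_subfield (adjoin K a)"
proof -
  have add: "x + y \<in> adjoin K a" and mult: "x * y \<in> adjoin K a" if xy: "x \<in> adjoin K a" "y \<in> adjoin K a" for x y
  proof -
    from xy obtain p q p' q' where *: "poly_over K p" "poly_over K q" "poly q a \<noteq> 0"
      "poly_over K p'" "poly_over K q'" "poly q' a \<noteq> 0" "x = poly p a / poly q a" "y = poly p' a / poly q' a"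
      unfolding adjoin_def by blast
    have qq: "poly_over K (q * q')" "poly (q * q') a \<noteq> 0" using * K by (simp_all add: poly_over_mult)
    have "x + y = poly (p * q' + p' * q) a / poly (q * q') a" using * by (simp add: add_frac_eq)
    then show "x + y \<in> adjoin K a"
      using adjoinI[OF poly_over_add[OF K poly_over_mult[OF K *(1,5)] poly_over_mult[OF K *(4,2)]] qq] by (simp only:)
    have "x * y = poly (p * p') a / poly (q * q') a" using * by simp
    then show "x * y \<in> adjoin K a"
      using adjoinI[OF poly_over_mult[OF K *(1,4)] qq] by (simp only:)
  qed
  have min: "- x \<in> adjoin K a" and inv: "inverse x \<in> adjoin K a" if x: "x \<in> adjoin K a" for x
  proof -
    from x obtain p q where *: "poly_over K p" "poly_over K q" "poly q a \<noteq> 0" "x = poly p a / poly q a"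
      unfolding adjoin_def by blast
    show "- x \<in> adjoin K a" using adjoinI[OF poly_over_minus[OF K *(1)] *(2,3)] *(4) by simp
    show "inverse x \<in> adjoin K a"
    proof (cases "poly p a = 0")
      case True
      then have "inverse x = 0" using *(4) by simp
      then show ?thesis using subsetD[OF adjoin_superset[OF K] complex_subfieldD(1)[OF K]] by simp
    next
      case False
      then show ?thesis using adjoinI[OF *(2,1) False] *(4) by simp
    qed
  qed
  show ?thesis
    unfolding complex_subfield_def
    using add mult min inv subsetD[OF adjoin_superset[OF K, of a]] complex_subfieldD(1,2)[OF K] by simp
qed

lemma adjoin_countable: "countable K \<Longrightarrow> countable (adjoin K a)"
proof -
  assume K: "countable K"
  have "adjoin K a \<subseteq> (\<lambda>(p, q). poly p a / poly q a) ` ({p. poly_over K p} \<times> {p. poly_over K p})"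
    unfolding adjoin_def by force
  then show ?thesis
    by (rule countable_subset) (intro countable_image countable_SIGMA countable_poly_over K)
qed

text \<open>The target is any commutative ring: with complex values these are field homomorphisms,
  with values in the dual numbers they encode derivations. Only the values on \<open>L\<close>
  matter, and \<open>\<sigma> 1 = 1\<close> excludes the zero map.\<close>

definition hom_on :: "complex set \<Rightarrow> (complex \<Rightarrow> 'r::comm_ring_1) \<Rightarrow> bool" where
  "hom_on L \<sigma> \<longleftrightarrow> \<sigma> 1 = 1 \<and> (\<forall>x\<in>L. \<forall>y\<in>L. \<sigma> (x + y) = \<sigma> x + \<sigma> y \<and> \<sigma> (x * y) = \<sigma> x * \<sigma> y)"

lemma hom_onD:
  assumes "hom_on L \<sigma>"
  shows "\<sigma> 1 = 1" "x \<in> L \<Longrightarrow> y \<in> L \<Longrightarrow> \<sigma> (x + y) = \<sigma> x + \<sigma> y" "x \<in> L \<Longrightarrow> y \<in> L \<Longrightarrow> \<sigma> (x * y) = \<sigma> x * \<sigma> y"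
  using assms unfolding hom_on_def by blast+

context
  fixes L :: "complex set" and \<sigma> :: "complex \<Rightarrow> 'r::comm_ring_1"
  assumes L: "complex_subfield L" and hom: "hom_on L \<sigma>"
begin

lemma hom_on_0: "\<sigma> 0 = 0"
  using hom_onD(2)[OF hom, of 0 0] complex_subfieldD[OF L] by simp

lemma hom_on_minus: "x \<in> L \<Longrightarrow> \<sigma> (- x) = - \<sigma> x"
  using hom_onD(2)[OF hom, of x "- x"] complex_subfieldD[OF L] hom_on_0 by (simp add: eq_neg_iff_add_eq_0 add.commute)

lemma hom_on_diff: "x \<in> L \<Longrightarrow> y \<in> L \<Longrightarrow> \<sigma> (x - y) = \<sigma> x - \<sigma> y"
  using hom_onD(2)[OF hom, of x "- y"] complex_subfieldD[OF L] hom_on_minus by simp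

lemma hom_on_sum: "(\<And>i. i \<in> A \<Longrightarrow> f i \<in> L) \<Longrightarrow> \<sigma> (sum f A) = (\<Sum>i\<in>A. \<sigma> (f i))"
  by (induction A rule: infinite_finite_induct) (auto simp: hom_on_0 hom_onD[OF hom] complex_subfield_sum[OF L])

lemma hom_on_unit: "x \<in> L \<Longrightarrow> x \<noteq> 0 \<Longrightarrow> \<sigma> x * \<sigma> (inverse x) = 1"
  using hom_onD(3)[OF hom, of x "inverse x"] hom_onD(1)[OF hom] complex_subfieldD[OF L] by simp

lemma hom_on_poly_1: "map_poly \<sigma> 1 = 1"
  by (rule poly_eqI) (simp add: coeff_map_poly hom_on_0 coeff_1 hom_onD[OF hom])

lemma hom_on_poly_add: "poly_over L p \<Longrightarrow> poly_over L q \<Longrightarrow> map_poly \<sigma> (p + q) = map_poly \<sigma> p + map_poly \<sigma> q"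
  by (rule poly_eqI) (simp add: coeff_map_poly hom_on_0 hom_onD[OF hom] poly_over_def)

lemma hom_on_poly_diff: "poly_over L p \<Longrightarrow> poly_over L q \<Longrightarrow> map_poly \<sigma> (p - q) = map_poly \<sigma> p - map_poly \<sigma> q"
  by (rule poly_eqI) (simp add: coeff_map_poly hom_on_0 hom_on_diff poly_over_def)

lemma hom_on_poly_mult: "poly_over L p \<Longrightarrow> poly_over L q \<Longrightarrow> map_poly \<sigma> (p * q) = map_poly \<sigma> p * map_poly \<sigma> q"
  by (rule poly_eqI) (simp add: coeff_map_poly hom_on_0 coeff_mult hom_on_sum hom_onD[OF hom] poly_over_def complex_subfieldD[OF L])

lemma hom_on_poly_const: "map_poly \<sigma> [:c:] = [:\<sigma> c:]"
  by (rule poly_eqI) (simp add: coeff_map_poly hom_on_0 coeff_pCons split: nat.splits)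

lemma hom_on_poly_X: "map_poly \<sigma> [:0, 1:] = [:0, 1:]"
  by (rule poly_eqI) (simp add: coeff_map_poly hom_on_0 coeff_pCons hom_onD[OF hom] split: nat.splits)

text \<open>The extension sends \<open>p(a) / q(a)\<close> to \<open>p(b) / q(b)\<close> with
  coefficients transported by \<open>\<sigma>\<close>. The first assumption makes this well defined;
  the second asks for units rather than nonzero values, because the target may have zero
  divisors.\<close>

lemma hom_on_adjoin:
  assumes zero: "\<And>p. poly_over L p \<Longrightarrow> poly p a = 0 \<Longrightarrow> poly (map_poly \<sigma> p) b = 0"
    and unit: "\<And>p. poly_over L p \<Longrightarrow> poly p a \<noteq> 0 \<Longrightarrow> \<exists>y. poly (map_poly \<sigma> p) b * y = 1"
  shows "\<exists>\<sigma>'. hom_on (adjoin L a) \<sigma>' \<and> (\<forall>x\<in>L. \<sigma>' x = \<sigma> x) \<and> \<sigma>' a = b"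
proof -
  let ?e = "\<lambda>p. poly (map_poly \<sigma> p) b"
  note e = hom_on_poly_add hom_on_poly_diff hom_on_poly_mult
  \<comment> \<open>The value is pinned down by an equation valid for all fractions that represent
    \<open>x\<close>, so the function chosen below prefers no representation.\<close>
  have ex: "\<exists>z. \<forall>p q. poly_over L p \<and> poly_over L q \<and> poly q a \<noteq> 0 \<and> x = poly p a / poly q a \<longrightarrow> z * ?e q = ?e p"
    if "x \<in> adjoin L a" for x
  proof -
    from that obtain p q where *: "poly_over L p" "poly_over L q" "poly q a \<noteq> 0" "x = poly p a / poly q a"
      unfolding adjoin_def by blast
    obtain y where y: "?e q * y = 1" using unit[OF *(2,3)] by blast
    show ?thesis
    proof (intro exI[of _ "?e p * y"] allI impI)
      fix p' q' assume **: "poly_over L p' \<and> poly_over L q' \<and> poly q' a \<noteq> 0 \<and> x = poly p' a / poly q' a"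
      then have "poly (p * q' - p' * q) a = 0" using * by (simp add: field_simps)
      then have "?e (p * q' - p' * q) = 0" using * ** by (intro zero poly_over_diff poly_over_mult L) auto
      then have "?e p * ?e q' = ?e p' * ?e q" using * ** L by (simp add: e poly_over_mult)
      then have "?e p * y * ?e q' = ?e p' * (?e q * y)" by (simp add: algebra_simps)
      then show "?e p * y * ?e q' = ?e p'" using y by simp
    qed
  qed
  then obtain \<sigma>' where \<sigma>': "\<And>x p q. x \<in> adjoin L a \<Longrightarrow> poly_over L p \<Longrightarrow> poly_over L q \<Longrightarrow> poly q a \<noteq> 0 \<Longrightarrow>
      x = poly p a / poly q a \<Longrightarrow> \<sigma>' x * ?e q = ?e p"
    by metis
  have ev: "\<sigma>' (poly p a) = ?e p" if "poly_over L p" for p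
    using \<sigma>'[of "poly p a" p 1] that L adjoinI[of L p 1 a] by (simp add: hom_on_poly_1)
  have K: "\<sigma>' x = \<sigma> x" if "x \<in> L" for x
    using ev[of "[:x:]"] that by (simp add: hom_on_poly_const poly_over_const L)
  have A: "\<sigma>' a = b" using ev[of "[:0,1:]"] by (simp add: hom_on_poly_X poly_over_X L)
  have hm: "\<sigma>' (x + y) = \<sigma>' x + \<sigma>' y \<and> \<sigma>' (x * y) = \<sigma>' x * \<sigma>' y" if xy: "x \<in> adjoin L a" "y \<in> adjoin L a" for x y
  proof -
    from xy obtain p q p' q' where *: "poly_over L p" "poly_over L q" "poly q a \<noteq> 0"
      "poly_over L p'" "poly_over L q'" "poly q' a \<noteq> 0" "x = poly p a / poly q a" "y = poly p' a / poly q' a"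
      unfolding adjoin_def by blast
    have qq: "poly_over L (q * q')" "poly (q * q') a \<noteq> 0" using * L by (auto intro: poly_over_mult)
    obtain u where u: "?e (q * q') * u = 1" using unit[OF qq] by blast
    note h = \<sigma>'[OF xy(1) *(1,2,3,7)] \<sigma>'[OF xy(2) *(4,5,6,8)]
    have sub: "x + y \<in> adjoin L a" "x * y \<in> adjoin L a"
      using complex_subfieldD(3,4)[OF adjoin_subfield[OF L] xy] .
    have s: "\<sigma>' (x + y) * ?e (q * q') = ?e (p * q' + p' * q)"
    proof (rule \<sigma>'[OF sub(1) _ qq])
      show "poly_over L (p * q' + p' * q)" using * L by (simp add: poly_over_add poly_over_mult)
      show "x + y = poly (p * q' + p' * q) a / poly (q * q') a" using * by (simp add: add_frac_eq)
    qed
    have t: "\<sigma>' (x * y) * ?e (q * q') = ?e (p * p')"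
    proof (rule \<sigma>'[OF sub(2) _ qq])
      show "poly_over L (p * p')" using * L by (simp add: poly_over_mult)
      show "x * y = poly (p * p') a / poly (q * q') a" using * by simp
    qed
    have eqq: "?e (q * q') = ?e q * ?e q'" using *(2,5) by (simp add: e)
    have "?e (p * q' + p' * q) = ?e p * ?e q' + ?e p' * ?e q"
      using *(1,2,4,5) L by (simp add: e poly_over_mult)
    also have "\<dots> = (\<sigma>' x * ?e q) * ?e q' + (\<sigma>' y * ?e q') * ?e q" by (simp only: h)
    also have "\<dots> = (\<sigma>' x + \<sigma>' y) * ?e (q * q')" unfolding eqq by (simp add: algebra_simps)
    finally have "?e (p * q' + p' * q) = (\<sigma>' x + \<sigma>' y) * ?e (q * q')" .
    \<comment> \<open>The images of the denominators are units, so multiplying by \<open>u\<close>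
      cancels them.\<close>
    with s have "\<sigma>' (x + y) * (?e (q * q') * u) = (\<sigma>' x + \<sigma>' y) * (?e (q * q') * u)"
      by (simp only: mult.assoc[symmetric])
    moreover have "?e (p * p') = ?e p * ?e p'" using *(1,4) by (simp add: e)
    then have "?e (p * p') = (\<sigma>' x * ?e q) * (\<sigma>' y * ?e q')" by (simp only: h)
    then have "?e (p * p') = (\<sigma>' x * \<sigma>' y) * ?e (q * q')" unfolding eqq by (simp add: algebra_simps)
    with t have "\<sigma>' (x * y) * (?e (q * q') * u) = (\<sigma>' x * \<sigma>' y) * (?e (q * q') * u)"
      by (simp only: mult.assoc[symmetric])
    ultimately show ?thesis using u by simp
  qed
  have "\<sigma>' 1 = 1" using K[of 1] hom_onD(1)[OF hom] complex_subfieldD[OF L] by simp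
  then show ?thesis using hm K A unfolding hom_on_def by blast
qed

text \<open>Minimality of the degree stands in for irreducibility: a polynomial vanishing at
  \<open>a\<close> is a multiple of \<open>\<mu>\<close>, and for any other one the inverse of its
  value at \<open>a\<close> is again a polynomial value.\<close>

lemma hom_on_adjoin_algebraic:
  assumes \<mu>: "poly_over L \<mu>" "\<mu> \<noteq> 0" "poly \<mu> a = 0"
    and min: "\<And>p. poly_over L p \<Longrightarrow> poly p a = 0 \<Longrightarrow> p \<noteq> 0 \<Longrightarrow> degree \<mu> \<le> degree p"
    and root: "poly (map_poly \<sigma> \<mu>) b = 0"
  shows "\<exists>\<sigma>'. hom_on (adjoin L a) \<sigma>' \<and> (\<forall>x\<in>L. \<sigma>' x = \<sigma> x) \<and> \<sigma>' a = b"
proof (rule hom_on_adjoin)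
  show zero: "poly (map_poly \<sigma> p) b = 0" if p: "poly_over L p" "poly p a = 0" for p
  proof -
    obtain q r where qr: "poly_over L q" "poly_over L r" "p = \<mu> * q + r" "r = 0 \<or> degree r < degree \<mu>"
      using poly_over_division[OF L \<mu>(1,2) p(1)] by blast
    have "poly r a = 0" using qr p \<mu> by simp
    then have "r = 0" using qr min[of r] by force
    then show ?thesis using qr \<mu> root by (simp add: hom_on_poly_mult)
  qed
  \<comment> \<open>Euclid's algorithm: the remainder of \<open>\<mu>\<close> by \<open>p\<close>
    has the value \<open>- p(a) q(a)\<close>, smaller degree than \<open>p\<close>, and is nonzero
    at \<open>a\<close> by minimality. An inverse of it therefore yields one of
    \<open>p(a)\<close>.\<close>
  have inv: "\<exists>u. poly_over L u \<and> poly u a * poly p a = 1"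
    if "poly_over L p" "poly p a \<noteq> 0" "degree p < degree \<mu>" for p
    using that
  proof (induction "degree p" arbitrary: p rule: less_induct)
    case less
    have p0: "p \<noteq> 0" using less.prems by auto
    obtain q r where qr: "poly_over L q" "poly_over L r" "\<mu> = p * q + r" "r = 0 \<or> degree r < degree p"
      using poly_over_division[OF L less.prems(1) p0 \<mu>(1)] by blast
    show ?case
    proof (cases "degree p = 0")
      case True
      then obtain c where c: "p = [:c:]" by (metis degree_eq_zeroE)
      then have "c \<in> L" "c \<noteq> 0" using less.prems(1) p0 by (auto simp: poly_over_def dest: spec[of _ 0])
      then show ?thesis using c L
        by (intro exI[of _ "[:inverse c:]"]) (auto intro!: poly_over_const complex_subfieldD)
    next
      case False
      have r0: "r \<noteq> 0"
      proof
        assume "r = 0"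
        then have \<mu>pq: "\<mu> = p * q" using qr by simp
        then have "q \<noteq> 0" "poly q a = 0" using \<mu> less.prems by auto
        moreover have "degree q < degree \<mu>" using \<mu>pq False p0 \<open>q \<noteq> 0\<close> by (simp add: degree_mult_eq)
        ultimately show False using min[OF qr(1)] by force
      qed
      then have dr: "degree r < degree p" using qr by simp
      then have "poly r a \<noteq> 0" using min[OF qr(2)] r0 less.prems by force
      then obtain u where u: "poly_over L u" "poly u a * poly r a = 1"
        using less.hyps[OF dr qr(2)] dr less.prems by auto
      have "poly r a = - (poly p a * poly q a)" using \<mu> qr(3) by (simp add: eq_neg_iff_add_eq_0 add.commute)
      then have "poly (- (u * q)) a * poly p a = 1" using u by (simp add: algebra_simps)
      then show ?thesis using u qr L by (intro exI[of _ "- (u * q)"]) (auto intro!: poly_over_minus poly_over_mult)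
    qed
  qed
  show "\<exists>y. poly (map_poly \<sigma> p) b * y = 1" if p: "poly_over L p" "poly p a \<noteq> 0" for p
  proof -
    obtain q r where qr: "poly_over L q" "poly_over L r" "p = \<mu> * q + r" "r = 0 \<or> degree r < degree \<mu>"
      using poly_over_division[OF L \<mu>(1,2) p(1)] by blast
    have "poly r a \<noteq> 0" using qr p \<mu> by simp
    moreover from this have "degree r < degree \<mu>" using qr by auto
    ultimately obtain u where u: "poly_over L u" "poly u a * poly r a = 1" using inv[OF qr(2)] by blast
    have up: "poly_over L (u * p - 1)" using u p L by (intro poly_over_diff poly_over_mult) auto
    have "poly (u * p - 1) a = 0" using u qr \<mu> by simp
    then have "poly (map_poly \<sigma> (u * p - 1)) b = 0" using zero[OF up] by blast
    then have "poly (map_poly \<sigma> u) b * poly (map_poly \<sigma> p) b = 1"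
      using u p L by (simp add: hom_on_poly_diff hom_on_poly_mult poly_over_mult hom_on_poly_1)
    then show ?thesis by (metis mult.commute)
  qed
qed

end

lemma ex_minimal_poly:
  assumes "\<not> transcendental_over L a"
  obtains \<mu> where "poly_over L \<mu>" "\<mu> \<noteq> 0" "poly \<mu> a = 0"
    "\<And>p. poly_over L p \<Longrightarrow> poly p a = 0 \<Longrightarrow> p \<noteq> 0 \<Longrightarrow> degree \<mu> \<le> degree p"
proof -
  let ?P = "\<lambda>p. poly_over L p \<and> p \<noteq> 0 \<and> poly p a = 0"
  obtain p where "?P p" using assms by (auto simp: transcendental_over_def)
  then have "?P (arg_min degree ?P)" "\<And>q. ?P q \<Longrightarrow> degree (arg_min degree ?P) \<le> degree q"
    using arg_min_nat_lemma[of ?P p degree] by blast+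
  then show ?thesis using that by blast
qed

text \<open>Over a countable field a transcendental element can be sent to a transcendental one, because
  the complex numbers are uncountable.\<close>

lemma hom_on_extend_countable:
  fixes \<sigma> :: "complex \<Rightarrow> complex"
  assumes "finite A" "complex_subfield L" "countable L" "hom_on L \<sigma>"
  shows "\<exists>L' \<sigma>'. complex_subfield L' \<and> hom_on L' \<sigma>' \<and> L \<union> A \<subseteq> L' \<and> (\<forall>x\<in>L. \<sigma>' x = \<sigma> x)"
proof -
  have "\<exists>L' \<sigma>'. complex_subfield L' \<and> countable L' \<and> hom_on L' \<sigma>' \<and> L \<union> A \<subseteq> L' \<and> (\<forall>x\<in>L. \<sigma>' x = \<sigma> x)"
    using assms(1)
  proof (induction A)
    case empty
    then show ?case using assms by (intro exI[of _ L] exI[of _ \<sigma>]) auto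
  next
    case (insert a A)
    then obtain M \<tau> where M: "complex_subfield M" "countable M" "hom_on M \<tau>" "L \<union> A \<subseteq> M" "\<forall>x\<in>L. \<tau> x = \<sigma> x"
      by blast
    \<comment> \<open>Homomorphisms of fields are injective, so transported nonzero polynomials stay
      nonzero.\<close>
    have inj: "\<tau> x \<noteq> 0" if "x \<in> M" "x \<noteq> 0" for x
      using hom_on_unit[OF M(1,3) that] by auto
    have "\<exists>b \<sigma>'. hom_on (adjoin M a) \<sigma>' \<and> (\<forall>x\<in>M. \<sigma>' x = \<tau> x) \<and> \<sigma>' a = b"
    proof (cases "transcendental_over M a")
      case True
      obtain b where b: "transcendental_over (\<tau> ` M) b"
        using ex_transcendental_over[of "\<tau> ` M" "{}"] M(2) by auto
      have "\<exists>\<sigma>'. hom_on (adjoin M a) \<sigma>' \<and> (\<forall>x\<in>M. \<sigma>' x = \<tau> x) \<and> \<sigma>' a = b"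
      proof (rule hom_on_adjoin[OF M(1,3)])
        fix p assume p: "poly_over M p"
        show "poly (map_poly \<tau> p) b = 0" if "poly p a = 0"
          using True p that by (auto simp: transcendental_over_def)
        show "\<exists>y. poly (map_poly \<tau> p) b * y = 1" if "poly p a \<noteq> 0"
        proof -
          have "poly_over (\<tau> ` M) (map_poly \<tau> p)"
            using p by (auto simp: poly_over_def coeff_map_poly hom_on_0[OF M(1,3)])
          moreover have "map_poly \<tau> p \<noteq> 0"
          proof -
            have "p \<noteq> 0" using that by auto
            then have "coeff (map_poly \<tau> p) (degree p) \<noteq> 0"
              using inj p by (simp add: coeff_map_poly hom_on_0[OF M(1,3)] poly_over_def)
            then show ?thesis by auto
          qed
          ultimately have "poly (map_poly \<tau> p) b \<noteq> 0" using b unfolding transcendental_over_def by blast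
          then show ?thesis by (intro exI[of _ "inverse (poly (map_poly \<tau> p) b)"]) simp
        qed
      qed
      then show ?thesis by blast
    next
      case False
      then obtain \<mu> where \<mu>: "poly_over M \<mu>" "\<mu> \<noteq> 0" "poly \<mu> a = 0"
        "\<And>p. poly_over M p \<Longrightarrow> poly p a = 0 \<Longrightarrow> p \<noteq> 0 \<Longrightarrow> degree \<mu> \<le> degree p"
        using ex_minimal_poly by metis
      have "degree \<mu> > 0"
        using \<mu>(2,3) by (metis bot_nat_0.not_eq_extremum degree_eq_zeroE mult_zero_right pCons_0_0 poly_pCons poly_0 add.right_neutral)
      moreover have "coeff (map_poly \<tau> \<mu>) (degree \<mu>) \<noteq> 0"
        using inj \<mu> by (simp add: coeff_map_poly hom_on_0[OF M(1,3)] poly_over_def)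
      then have "degree (map_poly \<tau> \<mu>) \<ge> degree \<mu>" by (rule le_degree)
      ultimately obtain b where "poly (map_poly \<tau> \<mu>) b = 0"
        using alg_closed_imp_poly_has_root[of "map_poly \<tau> \<mu>"] by auto
      then show ?thesis using hom_on_adjoin_algebraic[OF M(1,3) \<mu>] by blast
    qed
    then obtain \<sigma>' where s: "hom_on (adjoin M a) \<sigma>'" "\<forall>x\<in>M. \<sigma>' x = \<tau> x" by blast
    show ?case
      using s M adjoin_subfield[OF M(1), of a] adjoin_countable[OF M(2), of a] adjoin_superset[OF M(1), of a]
        adjoin_mem[OF M(1), of a]
      by (intro exI[of _ "adjoin M a"] exI[of _ \<sigma>']) (auto simp: subset_iff)
  qed
  then show ?thesis by blast
qed

text \<open>A transcendental \<open>z\<close> can be sent to another transcendental number. An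
  algebraic \<open>z\<close> is a simple root of its minimal polynomial, which has degree at least
  two since \<open>z\<close> is not in \<open>K\<close>, so it can be sent to another root.
  Extending to \<open>A\<close> comes afterwards and does not change the image of
  \<open>z\<close>.\<close>

lemma hom_on_moving:
  assumes K: "complex_subfield K" "countable K" and z: "z \<notin> K" and "finite A"
  shows "\<exists>L \<sigma>. complex_subfield L \<and> hom_on L (\<sigma> :: complex \<Rightarrow> complex) \<and> K \<union> A \<union> {z} \<subseteq> L \<and> (\<forall>x\<in>K. \<sigma> x = x) \<and> \<sigma> z \<noteq> z"
proof -
  have idh: "hom_on K (\<lambda>x. x)" by (simp add: hom_on_def)
  have idp: "map_poly (\<lambda>x. x) p = p" for p :: "complex poly" by (rule poly_eqI) (simp add: coeff_map_poly)
  have "\<exists>b \<sigma>. b \<noteq> z \<and> hom_on (adjoin K z) (\<sigma> :: complex \<Rightarrow> complex) \<and> (\<forall>x\<in>K. \<sigma> x = x) \<and> \<sigma> z = b"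
  proof (cases "transcendental_over K z")
    case True
    obtain b where b: "b \<noteq> z" "transcendental_over K b"
      using ex_transcendental_over[of K "{z}"] K(2) by auto
    have "\<exists>\<sigma>'. hom_on (adjoin K z) \<sigma>' \<and> (\<forall>x\<in>K. \<sigma>' x = x) \<and> \<sigma>' z = b"
    proof (rule hom_on_adjoin[OF K(1) idh], unfold idp)
      fix p assume p: "poly_over K p"
      show "poly p b = 0" if "poly p z = 0"
        using True p that by (auto simp: transcendental_over_def)
      show "\<exists>y. poly p b * y = 1" if "poly p z \<noteq> 0"
      proof -
        have "poly p b \<noteq> 0" using b p that unfolding transcendental_over_def by auto
        then show ?thesis by (intro exI[of _ "inverse (poly p b)"]) simp
      qed
    qed
    then show ?thesis using b by blast
  next
    case False
    then obtain \<mu> where \<mu>: "poly_over K \<mu>" "\<mu> \<noteq> 0" "poly \<mu> z = 0"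
      "\<And>p. poly_over K p \<Longrightarrow> poly p z = 0 \<Longrightarrow> p \<noteq> 0 \<Longrightarrow> degree \<mu> \<le> degree p"
      using ex_minimal_poly by metis
    obtain r where r: "\<mu> = [:- z, 1:] * r" using \<mu>(3) by (auto simp: poly_eq_0_iff_dvd dvd_def)
    then have r0: "r \<noteq> 0" using \<mu>(2) by auto
    have deg: "degree \<mu> = Suc (degree r)" unfolding r using r0 by (subst degree_mult_eq) auto
    have rz: "poly r z \<noteq> 0"
    proof
      assume "poly r z = 0"
      then have "poly (pderiv \<mu>) z = 0" unfolding r pderiv_mult by (simp add: pderiv_pCons)
      moreover have "pderiv \<mu> \<noteq> 0" using deg by (simp add: pderiv_eq_0_iff)
      moreover have "poly_over K (pderiv \<mu>)" using \<mu>(1) K by (simp add: poly_over_pderiv)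
      ultimately have "degree \<mu> \<le> degree (pderiv \<mu>)" using \<mu>(4) by blast
      then show False using deg by (simp add: degree_pderiv)
    qed
    \<comment> \<open>A linear minimal polynomial would put \<open>z\<close> into
      \<open>K\<close>.\<close>
    have "degree r > 0"
    proof (rule ccontr)
      assume "\<not> degree r > 0"
      then obtain c where c: "r = [:c:]" by (metis degree_eq_zeroE neq0_conv)
      then have \<mu>c: "\<mu> = [:- z * c, c:]" "c \<noteq> 0" using r r0 by auto
      then have "- z * c \<in> K" "c \<in> K" using \<mu>(1) unfolding poly_over_def
        by (metis coeff_pCons_0, metis coeff_pCons_0 coeff_pCons_Suc)
      then have "- ((- z * c) / c) \<in> K" by (rule complex_subfieldD(5)[OF K(1) complex_subfieldD(8)[OF K(1)]])
      then show False using z \<mu>c by simp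
    qed
    then obtain b where b: "poly r b = 0" using alg_closed_imp_poly_has_root by blast
    then have "poly \<mu> b = 0" "b \<noteq> z" using r rz by auto
    then show ?thesis using hom_on_adjoin_algebraic[OF K(1) idh \<mu>] by (simp add: idp) blast
  qed
  then obtain \<sigma> where s: "hom_on (adjoin K z) (\<sigma> :: complex \<Rightarrow> complex)" "\<forall>x\<in>K. \<sigma> x = x" "\<sigma> z \<noteq> z" by blast
  from hom_on_extend_countable[OF assms(4) adjoin_subfield[OF K(1)] adjoin_countable[OF K(2)] s(1)]
  obtain L \<sigma>' where "complex_subfield L" "hom_on L \<sigma>'" "adjoin K z \<union> A \<subseteq> L" "\<forall>x\<in>adjoin K z. \<sigma>' x = \<sigma> x" by blast
  then show ?thesis using s adjoin_superset[OF K(1), of z] adjoin_mem[OF K(1), of z]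
    by (intro exI[of _ L] exI[of _ \<sigma>']) (auto simp: subset_iff)
qed

section \<open>Extension of derivations\<close>

text \<open>The numbers a + b \<epsilon> with \<epsilon>^2 = 0. Sending x to x + \<delta>(x)
  \<epsilon> is a ring homomorphism exactly when \<delta> is a derivation, so the extension lemmas
  for homomorphisms also extend derivations.\<close>

datatype dual = Dual (dual_re: complex) (dual_eps: complex)

instantiation dual :: comm_ring_1
begin

definition "0 = Dual 0 0"
definition "1 = Dual 1 0"
definition "x + y = Dual (dual_re x + dual_re y) (dual_eps x + dual_eps y)"
definition "- x = Dual (- dual_re x) (- dual_eps x)"
definition "x - y = Dual (dual_re x - dual_re y) (dual_eps x - dual_eps y)"
definition "x * y = Dual (dual_re x * dual_re y) (dual_re x * dual_eps y + dual_eps x * dual_re y)"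

instance
  by standard (auto simp: zero_dual_def one_dual_def plus_dual_def uminus_dual_def minus_dual_def times_dual_def
      algebra_simps intro: dual.expand)

end

lemma dual_re_simps [simp]: "dual_re 0 = 0" "dual_re 1 = 1" "dual_re (x + y) = dual_re x + dual_re y"
  "dual_re (x * y) = dual_re x * dual_re y"
  and dual_eps_simps [simp]: "dual_eps 0 = 0" "dual_eps 1 = 0" "dual_eps (x + y) = dual_eps x + dual_eps y"
  "dual_eps (x * y) = dual_re x * dual_eps y + dual_eps x * dual_re y"
  by (simp_all add: zero_dual_def one_dual_def plus_dual_def times_dual_def)

lemma dual_re_power [simp]: "dual_re (x ^ n) = dual_re x ^ n"
  by (induction n) auto

lemma dual_eps_power: "dual_eps (x ^ n) = of_nat n * dual_re x ^ (n - 1) * dual_eps x"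
proof (induction n)
  case (Suc n)
  then show ?case by (cases n) (auto simp: algebra_simps)
qed simp

lemma dual_re_sum [simp]: "dual_re (sum f A) = (\<Sum>i\<in>A. dual_re (f i))"
  and dual_eps_sum [simp]: "dual_eps (sum f A) = (\<Sum>i\<in>A. dual_eps (f i))"
  by (induction A rule: infinite_finite_induct) auto

definition deriv_on :: "complex set \<Rightarrow> (complex \<Rightarrow> complex) \<Rightarrow> bool" where
  "deriv_on L \<delta> \<longleftrightarrow> (\<forall>x\<in>L. \<forall>y\<in>L. \<delta> (x + y) = \<delta> x + \<delta> y \<and> \<delta> (x * y) = x * \<delta> y + \<delta> x * y)"

lemma deriv_on_hom:
  assumes "complex_subfield L" "deriv_on L \<delta>"
  shows "hom_on L (\<lambda>x. Dual x (\<delta> x))"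
proof -
  have "\<delta> (1 * 1) = 1 * \<delta> 1 + \<delta> 1 * 1" using assms complex_subfieldD(2) unfolding deriv_on_def by blast
  then have "\<delta> 1 = 0" by simp
  then show ?thesis using assms unfolding hom_on_def deriv_on_def
    by (auto simp: one_dual_def plus_dual_def times_dual_def)
qed

lemma hom_deriv_on:
  assumes "hom_on L \<sigma>" "\<And>x. x \<in> L \<Longrightarrow> dual_re (\<sigma> x) = x"
  shows "deriv_on L (\<lambda>x. dual_eps (\<sigma> x))"
  using assms unfolding hom_on_def deriv_on_def by auto

text \<open>A homomorphism on \<open>L(a)\<close> is determined on \<open>L\<close> and at
  \<open>a\<close>. This applies to the real part of a dual-valued extension: it must be the
  identity for the infinitesimal part to be a derivation.\<close>

lemma hom_on_adjoin_id:
  fixes \<rho> :: "complex \<Rightarrow> complex"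
  assumes L: "complex_subfield L" and h: "hom_on (adjoin L a) \<rho>" and id: "\<And>x. x \<in> L \<Longrightarrow> \<rho> x = x" "\<rho> a = a"
    and x: "x \<in> adjoin L a"
  shows "\<rho> x = x"
proof -
  note F = adjoin_subfield[OF L, of a]
  have pw: "\<rho> (a ^ n) = a ^ n" for n
    using id by (induction n) (auto simp: hom_onD[OF h] adjoin_mem[OF L] complex_subfield_power[OF F])
  have Fc: "c \<in> adjoin L a" if "c \<in> L" for c using that adjoin_superset[OF L] by blast
  have ev: "\<rho> (poly p a) = poly p a" and mem: "poly p a \<in> adjoin L a" if "poly_over L p" for p
  proof -
    have c: "coeff p i \<in> L" for i using that by (auto simp: poly_over_def)
    have t: "coeff p i * a ^ i \<in> adjoin L a" for i
      by (intro complex_subfieldD(4)[OF F] complex_subfield_power[OF F] Fc c adjoin_mem[OF L])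
    show "\<rho> (poly p a) = poly p a"
      unfolding poly_altdef using t
      by (subst hom_on_sum[OF F h])
         (auto intro!: sum.cong simp: pw id c hom_onD[OF h] Fc adjoin_mem[OF L] complex_subfield_power[OF F])
    show "poly p a \<in> adjoin L a" unfolding poly_altdef by (intro complex_subfield_sum[OF F] t)
  qed
  obtain p q where *: "poly_over L p" "poly_over L q" "poly q a \<noteq> 0" "x = poly p a / poly q a"
    using x unfolding adjoin_def by blast
  then have "\<rho> (x * poly q a) = poly p a" using ev by simp
  then have "\<rho> x * poly q a = poly p a" using hom_onD(3)[OF h x mem[OF *(2)]] ev[OF *(2)] by simp
  then have "\<rho> x = poly p a / poly q a" using *(3) by (simp add: eq_divide_eq)
  then show ?thesis using *(4) by simp
qed

lemma pderiv_sum: "pderiv (sum f A) = (\<Sum>x\<in>A. pderiv (f x))"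
  by (induction A rule: infinite_finite_induct) (simp_all add: pderiv_add)

text \<open>At a transcendental \<open>a\<close> the value \<open>c\<close> is free. At an algebraic
  \<open>a\<close> it is forced by differentiating the relation \<open>\<mu>(a) = 0\<close>, which
  can be solved because \<open>a\<close> is a simple root.\<close>

lemma deriv_on_adjoin:
  assumes L: "complex_subfield L" and d: "deriv_on L \<delta>"
  shows "\<exists>\<delta>'. deriv_on (adjoin L a) \<delta>' \<and> (\<forall>x\<in>L. \<delta>' x = \<delta> x) \<and> (transcendental_over L a \<longrightarrow> \<delta>' a = c)"
proof -
  let ?\<sigma> = "\<lambda>x. Dual x (\<delta> x)"
  note h = deriv_on_hom[OF assms]
  have \<delta>0: "\<delta> 0 = 0" using hom_on_0[OF L h] by (simp add: zero_dual_def)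
  have c: "coeff (map_poly ?\<sigma> p) i = ?\<sigma> (coeff p i)" for p i
    by (simp add: coeff_map_poly zero_dual_def \<delta>0)
  have deg: "degree (map_poly ?\<sigma> p) \<le> degree p" for p
    by (rule degree_le) (simp add: c coeff_eq_0 zero_dual_def \<delta>0)
  have ev: "poly (map_poly ?\<sigma> p) b = (\<Sum>i\<le>degree p. ?\<sigma> (coeff p i) * b ^ i)" for p b
  proof -
    have "map_poly ?\<sigma> p = (\<Sum>i\<le>degree p. monom (?\<sigma> (coeff p i)) i)"
      using poly_as_sum_of_monoms'[OF deg, of p] c by simp
    then show ?thesis by (simp add: poly_sum poly_monom)
  qed
  have re: "dual_re (poly (map_poly ?\<sigma> p) b) = poly p (dual_re b)" for p b
    unfolding ev by (simp add: poly_altdef)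
  \<comment> \<open>First-order Taylor expansion: the derivatives of the coefficients contribute the
    sum, the increment \<open>e\<close> of the argument the formal derivative.\<close>
  have eps: "dual_eps (poly (map_poly ?\<sigma> p) (Dual a e)) =
      (\<Sum>i\<le>degree p. \<delta> (coeff p i) * a ^ i) + e * poly (pderiv p) a" for p e
  proof -
    have "poly (pderiv p) a = (\<Sum>i\<le>degree p. coeff p i * (of_nat i * a ^ (i - 1)))"
    proof -
      have "pderiv p = pderiv (\<Sum>i\<le>degree p. monom (coeff p i) i)" by (simp only: poly_as_sum_of_monoms)
      also have "\<dots> = (\<Sum>i\<le>degree p. monom (of_nat i * coeff p i) (i - 1))"
        by (simp only: pderiv_sum pderiv_monom)
      finally have "poly (pderiv p) a = poly (\<Sum>i\<le>degree p. monom (of_nat i * coeff p i) (i - 1)) a" by simp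
      then show ?thesis by (simp add: poly_sum poly_monom mult_ac)
    qed
    then show ?thesis unfolding ev
      by (simp add: dual_eps_power sum.distrib sum_distrib_left algebra_simps)
  qed
  \<comment> \<open>A dual number with nonzero real part is invertible, which supplies the unit
    condition of the extension lemma.\<close>
  have unit: "\<exists>y. x * y = 1" if "dual_re x \<noteq> 0" for x
    using that by (intro exI[of _ "Dual (inverse (dual_re x)) (- dual_eps x / (dual_re x)\<^sup>2)"])
      (auto simp: times_dual_def one_dual_def power2_eq_square field_simps)
  have "\<exists>b \<sigma>'. dual_re b = a \<and> hom_on (adjoin L a) \<sigma>' \<and> (\<forall>x\<in>L. \<sigma>' x = ?\<sigma> x) \<and> \<sigma>' a = b \<and>
      (transcendental_over L a \<longrightarrow> b = Dual a c)"
  proof (cases "transcendental_over L a")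
    case True
    have "\<exists>\<sigma>'. hom_on (adjoin L a) \<sigma>' \<and> (\<forall>x\<in>L. \<sigma>' x = ?\<sigma> x) \<and> \<sigma>' a = Dual a c"
    proof (rule hom_on_adjoin[OF L h])
      fix p assume p: "poly_over L p"
      show "poly (map_poly ?\<sigma> p) (Dual a c) = 0" if "poly p a = 0"
        using True p that by (auto simp: transcendental_over_def)
      show "\<exists>y. poly (map_poly ?\<sigma> p) (Dual a c) * y = 1" if "poly p a \<noteq> 0"
        using that by (intro unit) (simp add: re)
    qed
    then show ?thesis by (intro exI[of _ "Dual a c"]) auto
  next
    case False
    then obtain \<mu> where \<mu>: "poly_over L \<mu>" "\<mu> \<noteq> 0" "poly \<mu> a = 0"
      "\<And>p. poly_over L p \<Longrightarrow> poly p a = 0 \<Longrightarrow> p \<noteq> 0 \<Longrightarrow> degree \<mu> \<le> degree p"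
      using ex_minimal_poly by metis
    have deg0: "degree \<mu> \<noteq> 0"
    proof
      assume "degree \<mu> = 0"
      then obtain e where "\<mu> = [:e:]" by (metis degree_eq_zeroE)
      then show False using \<mu> by simp
    qed
    have pd: "poly (pderiv \<mu>) a \<noteq> 0"
    proof
      assume "poly (pderiv \<mu>) a = 0"
      moreover have "pderiv \<mu> \<noteq> 0" using deg0 by (simp add: pderiv_eq_0_iff)
      moreover have "poly_over L (pderiv \<mu>)" using \<mu>(1) L by (simp add: poly_over_pderiv)
      ultimately have "degree \<mu> \<le> degree (pderiv \<mu>)" using \<mu>(4) by blast
      then show False using deg0 by (simp add: degree_pderiv)
    qed
    \<comment> \<open>With this \<open>e\<close>, a + e \<epsilon> is a root of \<open>\<mu>\<close>
      with transported coefficients.\<close>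
    define e where "e = - (\<Sum>i\<le>degree \<mu>. \<delta> (coeff \<mu> i) * a ^ i) / poly (pderiv \<mu>) a"
    have "poly (map_poly ?\<sigma> \<mu>) (Dual a e) = 0"
    proof (rule dual.expand)
      show "dual_re (poly (map_poly ?\<sigma> \<mu>) (Dual a e)) = dual_re 0 \<and> dual_eps (poly (map_poly ?\<sigma> \<mu>) (Dual a e)) = dual_eps 0"
        using pd \<mu>(3) by (simp add: re eps e_def)
    qed
    from hom_on_adjoin_algebraic[OF L h \<mu> this] False show ?thesis
      by (intro exI[of _ "Dual a e"]) auto
  qed
  then obtain b \<sigma>' where s: "dual_re b = a" "hom_on (adjoin L a) \<sigma>'" "\<forall>x\<in>L. \<sigma>' x = ?\<sigma> x" "\<sigma>' a = b"
    "transcendental_over L a \<longrightarrow> b = Dual a c" by blast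
  have "hom_on (adjoin L a) (\<lambda>x. dual_re (\<sigma>' x))" using s(2) by (auto simp: hom_on_def)
  then have "dual_re (\<sigma>' x) = x" if "x \<in> adjoin L a" for x
    using hom_on_adjoin_id[OF L, of a "\<lambda>x. dual_re (\<sigma>' x)"] s that by auto
  then have "deriv_on (adjoin L a) (\<lambda>x. dual_eps (\<sigma>' x))" by (rule hom_deriv_on[OF s(2)])
  then show ?thesis using s by (intro exI[of _ "\<lambda>x. dual_eps (\<sigma>' x)"]) auto
qed

text \<open>Zorn's lemma: a maximal extension is defined everywhere, since otherwise one more
  element could be adjoined.\<close>

lemma deriv_on_extend_UNIV:
  assumes L: "complex_subfield L" and d: "deriv_on L \<delta>"
  shows "\<exists>\<delta>'. deriv_on UNIV \<delta>' \<and> (\<forall>x\<in>L. \<delta>' x = \<delta> x)"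
proof -
  \<comment> \<open>Partial derivations are compared through their graphs: extension becomes
    inclusion, and the arbitrary values outside the domain drop out.\<close>
  define gr where "gr = (\<lambda>M (\<epsilon> :: complex \<Rightarrow> complex). {(x, \<epsilon> x) | x. x \<in> M})"
  define \<A> where "\<A> = {gr M \<epsilon> | M \<epsilon>. complex_subfield M \<and> deriv_on M \<epsilon> \<and> gr L \<delta> \<subseteq> gr M \<epsilon>}"
  have gr: "(x, y) \<in> gr M \<epsilon> \<longleftrightarrow> x \<in> M \<and> y = \<epsilon> x" for x y M \<epsilon> by (auto simp: gr_def)
  have "\<exists>G\<in>\<A>. \<forall>X\<in>\<A>. G \<subseteq> X \<longrightarrow> X = G"
  proof (rule subset_Zorn_nonempty)
    show "\<A> \<noteq> {}" using L d unfolding \<A>_def by blast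
    fix \<C> assume C: "\<C> \<noteq> {}" "subset.chain \<A> \<C>"
    define M where "M = fst ` \<Union>\<C>"
    define \<epsilon> where "\<epsilon> x = (THE y. (x, y) \<in> \<Union>\<C>)" for x
    have two: "\<exists>N \<eta>. gr N \<eta> \<in> \<C> \<and> complex_subfield N \<and> deriv_on N \<eta> \<and> {u, v} \<subseteq> gr N \<eta>"
      if "u \<in> \<Union>\<C>" "v \<in> \<Union>\<C>" for u v
    proof -
      from that obtain G H where GH: "G \<in> \<C>" "u \<in> G" "H \<in> \<C>" "v \<in> H" by blast
      then have "G \<subseteq> H \<or> H \<subseteq> G" using C(2) by (auto simp: subset.chain_def)
      then obtain X where X: "X \<in> \<C>" "{u, v} \<subseteq> X" using GH by blast
      then have "X \<in> \<A>" using C(2) by (auto simp: subset.chain_def)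
      then show ?thesis using X unfolding \<A>_def by blast
    qed
    have uniq: "y = y'" if u: "(x, y) \<in> \<Union>\<C>" "(x, y') \<in> \<Union>\<C>" for x y y'
    proof -
      obtain N \<eta> where "(x, y) \<in> gr N \<eta>" "(x, y') \<in> gr N \<eta>" using two[OF u] by blast
      then show ?thesis by (simp only: gr)
    qed
    have \<epsilon>: "(x, y) \<in> \<Union>\<C> \<longleftrightarrow> x \<in> M \<and> y = \<epsilon> x" for x y
    proof
      assume "(x, y) \<in> \<Union>\<C>"
      moreover from this have "\<epsilon> x = y" unfolding \<epsilon>_def using uniq by (intro the_equality)
      ultimately show "x \<in> M \<and> y = \<epsilon> x" unfolding M_def by (metis fst_conv image_eqI)
    next
      assume *: "x \<in> M \<and> y = \<epsilon> x"
      then obtain z where "z \<in> \<Union>\<C>" "x = fst z" unfolding M_def by blast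
      then have y': "(x, snd z) \<in> \<Union>\<C>" by simp
      then have "\<epsilon> x = snd z" unfolding \<epsilon>_def using uniq by (intro the_equality)
      then show "(x, y) \<in> \<Union>\<C>" using * y' by simp
    qed
    have eq: "\<Union>\<C> = gr M \<epsilon>"
    proof (rule set_eqI)
      fix z :: "complex \<times> complex" show "z \<in> \<Union>\<C> \<longleftrightarrow> z \<in> gr M \<epsilon>" using \<epsilon>[of "fst z" "snd z"] gr[of "fst z" "snd z"] by simp
    qed
    have cl: "\<exists>N \<eta>. N \<subseteq> M \<and> complex_subfield N \<and> deriv_on N \<eta> \<and> x \<in> N \<and> y \<in> N \<and> (\<forall>z\<in>N. \<epsilon> z = \<eta> z)"
      if xy: "x \<in> M" "y \<in> M" for x y
    proof -
      obtain N \<eta> where N: "gr N \<eta> \<in> \<C>" "complex_subfield N" "deriv_on N \<eta>" "(x, \<epsilon> x) \<in> gr N \<eta>" "(y, \<epsilon> y) \<in> gr N \<eta>"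
      proof -
        have "(x, \<epsilon> x) \<in> \<Union>\<C>" "(y, \<epsilon> y) \<in> \<Union>\<C>" using xy \<epsilon> by simp_all
        from two[OF this] show ?thesis using that by blast
      qed
      have "z \<in> M \<and> \<epsilon> z = \<eta> z" if "z \<in> N" for z
      proof -
        have "(z, \<eta> z) \<in> \<Union>\<C>" using N(1) that gr by blast
        then show ?thesis using \<epsilon> by simp
      qed
      moreover have "x \<in> N" "y \<in> N" using N(4,5) by (simp_all only: gr)
      ultimately show ?thesis using N(2,3) by blast
    qed
    obtain G0 where "G0 \<in> \<C>" using C(1) by blast
    then have G0: "gr L \<delta> \<subseteq> G0" using C(2) unfolding subset.chain_def \<A>_def by blast
    have M01: "0 \<in> M" "1 \<in> M"
    proof -
      have "(0, \<delta> 0) \<in> gr L \<delta>" "(1, \<delta> 1) \<in> gr L \<delta>" using complex_subfieldD(1,2)[OF L] by (simp_all add: gr)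
      then have "(0, \<delta> 0) \<in> \<Union>\<C>" "(1, \<delta> 1) \<in> \<Union>\<C>" using G0 \<open>G0 \<in> \<C>\<close> by blast+
      then show "0 \<in> M" "1 \<in> M" using \<epsilon> by simp_all
    qed
    have "complex_subfield M"
      unfolding complex_subfield_def
    proof (intro conjI ballI M01)
      fix x y assume "x \<in> M" "y \<in> M"
      then obtain N where "N \<subseteq> M" "complex_subfield N" "x \<in> N" "y \<in> N" using cl by blast
      then show "x + y \<in> M" "x * y \<in> M" using complex_subfieldD(3,4)[of N x y] by (simp_all add: subset_iff)
    next
      fix x assume "x \<in> M"
      then obtain N where "N \<subseteq> M" "complex_subfield N" "x \<in> N" using cl by blast
      then show "- x \<in> M" "inverse x \<in> M" using complex_subfieldD(5,6)[of N x] by (simp_all add: subset_iff)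
    qed
    moreover have "deriv_on M \<epsilon>"
      unfolding deriv_on_def
    proof (intro ballI)
      fix x y assume "x \<in> M" "y \<in> M"
      then obtain N \<eta> where N: "complex_subfield N" "deriv_on N \<eta>" "x \<in> N" "y \<in> N" "\<forall>z\<in>N. \<epsilon> z = \<eta> z" using cl by blast
      moreover have "x + y \<in> N" "x * y \<in> N" using complex_subfieldD(3,4)[OF N(1,3,4)] .
      ultimately show "\<epsilon> (x + y) = \<epsilon> x + \<epsilon> y \<and> \<epsilon> (x * y) = x * \<epsilon> y + \<epsilon> x * y"
        unfolding deriv_on_def by simp
    qed
    ultimately show "\<Union>\<C> \<in> \<A>" using eq G0 \<open>G0 \<in> \<C>\<close> unfolding \<A>_def by blast
  qed
  then obtain G where G: "G \<in> \<A>" "\<forall>X\<in>\<A>. G \<subseteq> X \<longrightarrow> X = G" by blast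
  then obtain M \<epsilon> where M: "complex_subfield M" "deriv_on M \<epsilon>" "gr L \<delta> \<subseteq> gr M \<epsilon>" and GM: "G = gr M \<epsilon>"
    unfolding \<A>_def by auto
  have max: "X = gr M \<epsilon>" if "X \<in> \<A>" "gr M \<epsilon> \<subseteq> X" for X
    using G(2) that GM by simp
  have "M = UNIV"
  proof (rule ccontr)
    assume "M \<noteq> UNIV"
    then obtain a where a: "a \<notin> M" by blast
    obtain \<eta> where \<eta>: "deriv_on (adjoin M a) \<eta>" "\<forall>x\<in>M. \<eta> x = \<epsilon> x" using deriv_on_adjoin[OF M(1,2)] by blast
    have sub: "gr M \<epsilon> \<subseteq> gr (adjoin M a) \<eta>" using \<eta>(2) adjoin_superset[OF M(1), of a] by (auto simp: gr_def)
    have "gr L \<delta> \<subseteq> gr (adjoin M a) \<eta>" using M(3) sub by (rule subset_trans)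
    then have "gr (adjoin M a) \<eta> \<in> \<A>" using \<eta>(1) adjoin_subfield[OF M(1), of a] unfolding \<A>_def
      by (intro CollectI exI[of _ "adjoin M a"] exI[of _ \<eta>]) simp
    then have "gr (adjoin M a) \<eta> = gr M \<epsilon>" using max sub by blast
    moreover have "(a, \<eta> a) \<in> gr (adjoin M a) \<eta>" using adjoin_mem[OF M(1)] by (simp add: gr)
    ultimately show False using a by (simp add: gr)
  qed
  moreover have "\<epsilon> x = \<delta> x" if "x \<in> L" for x
  proof -
    have "(x, \<delta> x) \<in> gr M \<epsilon>" using M(3) that by (simp add: gr subset_iff)
    then show ?thesis by (simp add: gr)
  qed
  ultimately show ?thesis using M(2) by blast
qed

section \<open>Generic sequences\<close>

text \<open>A tower in which each new element is transcendental over the field before it; the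
  elements are thus algebraically independent over \<open>k\<close>. For countable \<open>k\<close>
  every stage is countable, which keeps the construction going.\<close>

primrec generic_field :: "complex set \<Rightarrow> nat \<Rightarrow> complex set" where
  "generic_field k 0 = k"
| "generic_field k (Suc n) = adjoin (generic_field k n) (SOME b. transcendental_over (generic_field k n) b)"

definition generic_seq :: "complex set \<Rightarrow> nat \<Rightarrow> complex" where
  "generic_seq k n = (SOME b. transcendental_over (generic_field k n) b)"

context
  fixes k :: "complex set"
  assumes k: "complex_subfield k" "countable k"
begin

lemma generic_field_subfield: "complex_subfield (generic_field k n)"
  by (induction n) (auto simp: k adjoin_subfield)

lemma generic_field_countable: "countable (generic_field k n)"
  by (induction n) (auto simp: k adjoin_countable)

lemma generic_field_Suc: "generic_field k (Suc n) = adjoin (generic_field k n) (generic_seq k n)"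
  by (simp add: generic_seq_def)

lemma generic_seq_transcendental: "transcendental_over (generic_field k n) (generic_seq k n)"
  unfolding generic_seq_def
  using someI_ex[of "transcendental_over (generic_field k n)"]
    ex_transcendental_over[OF generic_field_countable, of "{}"] by blast

lemma generic_field_mono: "m \<le> n \<Longrightarrow> generic_field k m \<subseteq> generic_field k n"
proof (induction n rule: dec_induct)
  case (step n)
  then show ?case using adjoin_superset[OF generic_field_subfield] unfolding generic_field_Suc by blast
qed simp

lemma generic_field_base: "k \<subseteq> generic_field k n"
  using generic_field_mono[of 0 n] by simp

lemma generic_seq_mem: "i < n \<Longrightarrow> generic_seq k i \<in> generic_field k n"
  using generic_field_mono[of "Suc i" n] adjoin_mem[OF generic_field_subfield] unfolding generic_field_Suc by fastforce

text \<open>Each member of the sequence is transcendental over the preceding field, so its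
  derivative can be prescribed freely. Only then is the derivation extended to all complex
  numbers.\<close>

lemma ex_derivation:
  shows "\<exists>\<delta>. deriv_on UNIV \<delta> \<and> (\<forall>x\<in>k. \<delta> x = 0) \<and> (\<forall>i<n. \<delta> (generic_seq k i) = c i)"
proof -
  have "\<exists>\<delta>. deriv_on (generic_field k n) \<delta> \<and> (\<forall>x\<in>k. \<delta> x = 0) \<and> (\<forall>i<n. \<delta> (generic_seq k i) = c i)"
  proof (induction n)
    case 0
    have "deriv_on k (\<lambda>_. 0)" by (simp add: deriv_on_def)
    then show ?case by auto
  next
    case (Suc n)
    then obtain \<delta> where \<delta>: "deriv_on (generic_field k n) \<delta>" "\<forall>x\<in>k. \<delta> x = 0" "\<forall>i<n. \<delta> (generic_seq k i) = c i"
      by blast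
    obtain \<delta>' where "deriv_on (generic_field k (Suc n)) \<delta>'" "\<forall>x\<in>generic_field k n. \<delta>' x = \<delta> x" "\<delta>' (generic_seq k n) = c n"
      using deriv_on_adjoin[OF generic_field_subfield \<delta>(1), of "generic_seq k n" "c n"] generic_seq_transcendental
      unfolding generic_field_Suc by blast
    then show ?case using \<delta> generic_field_base[of n] generic_seq_mem[of _ n]
      by (intro exI[of _ \<delta>']) (auto simp: less_Suc_eq subset_iff)
  qed
  then obtain \<delta> where \<delta>: "deriv_on (generic_field k n) \<delta>" "\<forall>x\<in>k. \<delta> x = 0" "\<forall>i<n. \<delta> (generic_seq k i) = c i"
    by blast
  obtain \<delta>' where "deriv_on UNIV \<delta>'" "\<forall>x\<in>generic_field k n. \<delta>' x = \<delta> x"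
    using deriv_on_extend_UNIV[OF generic_field_subfield \<delta>(1)] by blast
  then show ?thesis using \<delta> generic_field_base[of n] generic_seq_mem[of _ n]
    by (intro exI[of _ \<delta>']) (simp add: subset_iff)
qed

end

section \<open>Polynomial functions over a subfield\<close>

text \<open>The variant of \<open>polynomials\<close> with constants in \<open>k\<close>. The
  constants are tracked because the derivations and homomorphisms used below act trivially on
  \<open>k\<close>, and because a countable \<open>k\<close> and countably many coordinates give
  only countably many such functions.\<close>

inductive_set kpolys :: "complex set \<Rightarrow> ('a \<Rightarrow> complex) set \<Rightarrow> ('a \<Rightarrow> complex) set"
  for k :: "complex set" and C :: "('a \<Rightarrow> complex) set" where
  const: "c \<in> k \<Longrightarrow> (\<lambda>_. c) \<in> kpolys k C"
| coord: "x \<in> C \<Longrightarrow> x \<in> kpolys k C"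
| add: "p \<in> kpolys k C \<Longrightarrow> q \<in> kpolys k C \<Longrightarrow> (\<lambda>z. p z + q z) \<in> kpolys k C"
| mult: "p \<in> kpolys k C \<Longrightarrow> q \<in> kpolys k C \<Longrightarrow> (\<lambda>z. p z * q z) \<in> kpolys k C"

lemma polynomials_eq_kpolys: "polynomials C = kpolys UNIV C"
proof
  show "polynomials C \<subseteq> kpolys UNIV C"
  proof
    fix p assume "p \<in> polynomials C" then show "p \<in> kpolys UNIV C"
      by induction (auto intro: kpolys.intros)
  qed
  show "kpolys UNIV C \<subseteq> polynomials C"
  proof
    fix p assume "p \<in> kpolys UNIV C" then show "p \<in> polynomials C"
      by induction (auto intro: polynomials.intros)
  qed
qed

lemma kpolys_mono: "F \<in> kpolys k C \<Longrightarrow> k \<subseteq> l \<Longrightarrow> C \<subseteq> D \<Longrightarrow> F \<in> kpolys l D"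
  by (induction rule: kpolys.induct) (auto intro: kpolys.intros)

lemma kpolys_compose:
  assumes "F \<in> kpolys k C" "\<And>c. c \<in> C \<Longrightarrow> (\<lambda>t. c (\<Phi> t)) \<in> kpolys k D"
  shows "(\<lambda>t. F (\<Phi> t)) \<in> kpolys k D"
  using assms by (induction rule: kpolys.induct) (auto intro: kpolys.intros)

context
  fixes k :: "complex set"
  assumes k: "complex_subfield k"
begin

lemma kpolys_sum: "(\<And>i. i \<in> A \<Longrightarrow> F i \<in> kpolys k C) \<Longrightarrow> (\<lambda>z. \<Sum>i\<in>A. F i z) \<in> kpolys k C"
  by (induction A rule: infinite_finite_induct) (auto intro: kpolys.intros complex_subfieldD[OF k])

lemma kpolys_prod: "(\<And>i. i \<in> A \<Longrightarrow> F i \<in> kpolys k C) \<Longrightarrow> (\<lambda>z. \<Prod>i\<in>A. F i z) \<in> kpolys k C"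
  by (induction A rule: infinite_finite_induct) (auto intro: kpolys.intros complex_subfieldD[OF k])

lemma kpolys_power: "F \<in> kpolys k C \<Longrightarrow> (\<lambda>z. F z ^ n) \<in> kpolys k C"
  by (induction n) (auto intro: kpolys.intros complex_subfieldD[OF k])

lemma kpolys_minus: "F \<in> kpolys k C \<Longrightarrow> (\<lambda>z. - F z) \<in> kpolys k C"
  using kpolys.mult[OF kpolys.const[of "-1" k C]] complex_subfieldD(2,5)[OF k] by fastforce

lemma kpolys_diff: "F \<in> kpolys k C \<Longrightarrow> G \<in> kpolys k C \<Longrightarrow> (\<lambda>z. F z - G z) \<in> kpolys k C"
  using kpolys.add[OF _ kpolys_minus, of F C G] by simp

end

lemma kpolys_countable:
  assumes "countable k" "countable C"
  shows "countable (kpolys k C)"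
proof -
  define S where "S n = ((\<lambda>B. B \<union> (\<lambda>(p, q) z. p z + q z) ` (B \<times> B) \<union> (\<lambda>(p, q) z. p z * q z) ` (B \<times> B)) ^^ n)
      ((\<lambda>c _. c) ` k \<union> C)" for n
  have S_Suc: "S (Suc n) = S n \<union> (\<lambda>(p, q) z. p z + q z) ` (S n \<times> S n) \<union> (\<lambda>(p, q) z. p z * q z) ` (S n \<times> S n)" for n
    by (simp add: S_def)
  have mono: "S m \<subseteq> S n" if "m \<le> n" for m n
    using that by (induction n rule: dec_induct) (auto simp: S_Suc)
  have c: "countable (S n)" for n
  proof (induction n)
    case 0 then show ?case using assms by (simp add: S_def)
  next
    case (Suc n)
    then show ?case by (simp only: S_Suc) (intro countable_Un countable_image countable_SIGMA)
  qed
  have "F \<in> (\<Union>n. S n)" if "F \<in> kpolys k C" for F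
    using that
  proof induction
    case (const c) then have "(\<lambda>_. c) \<in> S 0" by (auto simp: S_def) then show ?case by blast
  next
    case (coord x) then have "x \<in> S 0" by (auto simp: S_def) then show ?case by blast
  next
    case (add p q)
    then obtain m n where "p \<in> S m" "q \<in> S n" by blast
    then have "p \<in> S (max m n)" "q \<in> S (max m n)" using mono[of m "max m n"] mono[of n "max m n"] by auto
    then have "(\<lambda>z. p z + q z) \<in> S (Suc (max m n))" unfolding S_Suc by force
    then show ?case by blast
  next
    case (mult p q)
    then obtain m n where "p \<in> S m" "q \<in> S n" by blast
    then have "p \<in> S (max m n)" "q \<in> S (max m n)" using mono[of m "max m n"] mono[of n "max m n"] by auto
    then have "(\<lambda>z. p z * q z) \<in> S (Suc (max m n))" unfolding S_Suc by force
    then show ?case by blast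
  qed
  moreover have "countable (\<Union>n. S n)" using c by (intro countable_UN) auto
  ultimately show ?thesis by (meson countable_subset subsetI)
qed

text \<open>Reduces questions in many variables to one-variable polynomials over \<open>K\<close>,
  along a curve whose coordinates are themselves such polynomials.\<close>

lemma kpolys_curve:
  assumes K: "complex_subfield K" "k \<subseteq> K" and F: "F \<in> kpolys k C"
    and c: "\<And>c. c \<in> C \<Longrightarrow> \<exists>P. poly_over K P \<and> (\<forall>s. c (\<gamma> s) = poly P s)"
  shows "\<exists>P. poly_over K P \<and> (\<forall>s. F (\<gamma> s) = poly P s)"
  using F
proof induction
  case (const e)
  then show ?case using K by (intro exI[of _ "[:e:]"]) (auto simp: poly_over_const)
next
  case (coord x) then show ?case using c by blast
next
  case (add p q)
  then obtain P Q where "poly_over K P" "poly_over K Q" "\<forall>s. p (\<gamma> s) = poly P s" "\<forall>s. q (\<gamma> s) = poly Q s" by blast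
  then show ?case using K by (intro exI[of _ "P + Q"]) (auto simp: poly_over_add)
next
  case (mult p q)
  then obtain P Q where "poly_over K P" "poly_over K Q" "\<forall>s. p (\<gamma> s) = poly P s" "\<forall>s. q (\<gamma> s) = poly Q s" by blast
  then show ?case using K by (intro exI[of _ "P * Q"]) (auto simp: poly_over_mult)
qed

lemma complex_subfield_UNIV: "complex_subfield UNIV" and poly_over_UNIV [simp]: "poly_over UNIV p"
  by (auto simp: complex_subfield_def poly_over_def)

lemma kpolys_curve_UNIV:
  assumes F: "F \<in> kpolys k C" and c: "\<And>c. c \<in> C \<Longrightarrow> \<exists>P. \<forall>s. c (\<gamma> s) = poly P s"
  shows "\<exists>P. \<forall>s. F (\<gamma> s) = poly P s"
  using kpolys_curve[OF complex_subfield_UNIV _ F, of \<gamma>] c by auto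

text \<open>Irreducibility in elementary form: along the curve both functions are nonzero
  one-variable polynomials, hence so is their product.\<close>

lemma kpolys_common_nonzero:
  assumes F: "F \<in> kpolys k C" and G: "G \<in> kpolys k C" and c: "\<And>c. c \<in> C \<Longrightarrow> \<exists>P. \<forall>s. c (\<gamma> s) = poly P s"
    and nz: "F (\<gamma> a) \<noteq> 0" "G (\<gamma> b) \<noteq> 0"
  shows "\<exists>s. F (\<gamma> s) \<noteq> 0 \<and> G (\<gamma> s) \<noteq> 0"
proof -
  obtain P where P: "\<And>s. F (\<gamma> s) = poly P s" using kpolys_curve_UNIV[OF F, of \<gamma>] c by blast
  obtain Q where Q: "\<And>s. G (\<gamma> s) = poly Q s" using kpolys_curve_UNIV[OF G, of \<gamma>] c by blast
  have "P * Q \<noteq> 0" using nz P Q by auto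
  then obtain s where "poly (P * Q) s \<noteq> 0" by (metis poly_all_0_iff_0)
  then show ?thesis using P Q by auto
qed

lemma poly_zero_on_nat: "(\<And>n. poly P (of_nat n) = (0::complex)) \<Longrightarrow> P = 0"
proof (rule ccontr)
  assume *: "\<And>n. poly P (of_nat n) = (0::complex)" "P \<noteq> 0"
  then have "finite (range (of_nat :: nat \<Rightarrow> complex))" by (intro finite_subset[OF _ poly_roots_finite[OF *(2)]]) auto
  then show False using finite_imageD[of "of_nat :: nat \<Rightarrow> complex" UNIV] inj_of_nat by auto
qed

abbreviation coords :: "(('a \<Rightarrow> complex) \<Rightarrow> complex) set" where
  "coords \<equiv> range (\<lambda>i x. x i)"

lemma kpolys_coords_dep:
  fixes F :: "(nat \<Rightarrow> complex) \<Rightarrow> complex"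
  shows "F \<in> kpolys k coords \<Longrightarrow> \<exists>N. \<forall>x y. (\<forall>i<N. x i = y i) \<longrightarrow> F x = F y"
proof (induction rule: kpolys.induct)
  case (coord x)
  then obtain i where "x = (\<lambda>y. y i)" by blast
  then show ?case by (intro exI[of _ "Suc i"]) auto
next
  case (add p q)
  then obtain M N where "\<forall>x y. (\<forall>i<M. x i = y i) \<longrightarrow> p x = p y" "\<forall>x y. (\<forall>i<N. x i = y i) \<longrightarrow> q x = q y" by blast
  then have "p x + q x = p y + q y" if "\<forall>i<max M N. x i = y i" for x y
    using that by (metis less_max_iff_disj)
  then show ?case by blast
next
  case (mult p q)
  then obtain M N where "\<forall>x y. (\<forall>i<M. x i = y i) \<longrightarrow> p x = p y" "\<forall>x y. (\<forall>i<N. x i = y i) \<longrightarrow> q x = q y" by blast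
  then have "p x * q x = p y * q y" if "\<forall>i<max M N. x i = y i" for x y
    using that by (metis less_max_iff_disj)
  then show ?case by blast
qed auto

text \<open>A one-variable polynomial vanishing at all natural numbers is zero, so natural values
  can be replaced by arbitrary ones a coordinate at a time. Only finitely many coordinates
  matter.\<close>

lemma kpolys_zero_on_nat:
  fixes F :: "(nat \<Rightarrow> complex) \<Rightarrow> complex"
  assumes F: "F \<in> kpolys k coords" and z: "\<And>x. F (\<lambda>i. of_nat (x i)) = 0"
  shows "F y = 0"
proof -
  obtain N where N: "\<And>x y. (\<forall>i<N. x i = y i) \<Longrightarrow> F x = F y" using kpolys_coords_dep[OF F] by blast
  have "\<forall>x. F (\<lambda>i. if i < n then y i else of_nat (x i)) = 0" for n
  proof (induction n)
    case 0 then show ?case using z by simp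
  next
    case (Suc n)
    show ?case
    proof
      fix x
      let ?\<gamma> = "\<lambda>s i. if i < n then y i else if i = n then s else of_nat (x i)"
      obtain P where P: "\<And>s. F (?\<gamma> s) = poly P s"
      proof -
        have "\<exists>P. \<forall>s. F (?\<gamma> s) = poly P s"
        proof (rule kpolys_curve_UNIV[OF F])
          fix c :: "(nat \<Rightarrow> complex) \<Rightarrow> complex" assume "c \<in> coords"
          then obtain j where j: "c = (\<lambda>x. x j)" by blast
          show "\<exists>P. \<forall>s. c (?\<gamma> s) = poly P s"
          proof (cases "j = n")
            case True
            then show ?thesis by (intro exI[of _ "[:0, 1:]"]) (simp add: j)
          next
            case False
            then show ?thesis by (intro exI[of _ "[:if j < n then y j else of_nat (x j):]"]) (simp add: j)
          qed
        qed
        then show ?thesis using that by blast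
      qed
      have "poly P (of_nat e) = 0" for e
      proof -
        have "?\<gamma> (of_nat e) = (\<lambda>i. if i < n then y i else of_nat ((x(n := e)) i))" by auto
        then show ?thesis using Suc P by metis
      qed
      then have "P = 0" by (rule poly_zero_on_nat)
      then have "F (?\<gamma> (y n)) = 0" by (simp add: P)
      moreover have "?\<gamma> (y n) = (\<lambda>i. if i < Suc n then y i else of_nat (x i))" by (auto simp: less_Suc_eq)
      ultimately show "F (\<lambda>i. if i < Suc n then y i else of_nat (x i)) = 0" by simp
    qed
  qed
  from spec[OF this[of N], of "\<lambda>_. 0"] show ?thesis
    using N[of y "\<lambda>i. if i < N then y i else of_nat 0"] by simp
qed

text \<open>A polynomial over \<open>k\<close> vanishing at the generic sequence is specialised to natural numbers one
  coordinate at a time, beginning with the last one.\<close>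

lemma generic_seq_zero:
  fixes F :: "(nat \<Rightarrow> complex) \<Rightarrow> complex"
  assumes k: "complex_subfield k" "countable k" and F: "F \<in> kpolys k coords" and z: "F (generic_seq k) = 0"
  shows "F y = 0"
proof (rule kpolys_zero_on_nat[OF F])
  fix x0
  let ?\<tau> = "generic_seq k"
  obtain N where N: "\<And>x y. (\<forall>i<N. x i = y i) \<Longrightarrow> F x = F y" using kpolys_coords_dep[OF F] by blast
  have "\<forall>x. F (\<lambda>i. if i < n then ?\<tau> i else of_nat (x i)) = 0" if "n \<le> N" for n
    using that
  proof (induction n rule: inc_induct)
    case base
    show ?case
    proof
      fix x show "F (\<lambda>i. if i < N then ?\<tau> i else of_nat (x i)) = 0"
        using z N[of ?\<tau> "\<lambda>i. if i < N then ?\<tau> i else of_nat (x i)"] by simp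
    qed
  next
    case (step n)
    show ?case
    proof
      fix x
      let ?\<gamma> = "\<lambda>s i. if i < n then ?\<tau> i else if i = n then s else of_nat (x i)"
      let ?K = "generic_field k n"
      note K = generic_field_subfield[OF k, of n]
      obtain P where P: "poly_over ?K P" "\<And>s. F (?\<gamma> s) = poly P s"
      proof -
        have "\<exists>P. poly_over ?K P \<and> (\<forall>s. F (?\<gamma> s) = poly P s)"
        proof (rule kpolys_curve[OF K generic_field_base[OF k] F])
          fix c :: "(nat \<Rightarrow> complex) \<Rightarrow> complex" assume "c \<in> coords"
          then obtain j where j: "c = (\<lambda>x. x j)" by blast
          consider "j < n" | "j = n" | "j > n" by linarith
          then show "\<exists>P. poly_over ?K P \<and> (\<forall>s. c (?\<gamma> s) = poly P s)"
          proof cases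
            case 1
            then show ?thesis using generic_seq_mem[OF k 1]
              by (intro exI[of _ "[:?\<tau> j:]"]) (auto simp: j poly_over_const K)
          next
            case 2
            then show ?thesis by (intro exI[of _ "[:0, 1:]"]) (auto simp: j poly_over_X K)
          next
            case 3
            then show ?thesis using complex_subfield_of_nat[OF K]
              by (intro exI[of _ "[:of_nat (x j):]"]) (auto simp: j poly_over_const K)
          qed
        qed
        then show ?thesis using that by blast
      qed
      have "?\<gamma> (?\<tau> n) = (\<lambda>i. if i < Suc n then ?\<tau> i else of_nat (x i))" by (auto simp: less_Suc_eq)
      then have "poly P (?\<tau> n) = 0" using step.IH P(2) by metis
      \<comment> \<open>Here transcendence enters: the coefficients of \<open>P\<close> lie in the
        field generated over \<open>k\<close> by the earlier members of the sequence.\<close>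
      then have "P = 0" using generic_seq_transcendental[OF k, of n] P(1) unfolding transcendental_over_def by blast
      then have "F (?\<gamma> (of_nat (x n))) = 0" by (simp add: P)
      moreover have "?\<gamma> (of_nat (x n)) = (\<lambda>i. if i < n then ?\<tau> i else of_nat (x i))" by auto
      ultimately show "F (\<lambda>i. if i < n then ?\<tau> i else of_nat (x i)) = 0" by simp
    qed
  qed
  from this[of 0] show "F (\<lambda>i. of_nat (x0 i)) = 0" by simp
qed

lemma hom_on_kpolys:
  fixes \<sigma> :: "complex \<Rightarrow> complex"
  assumes L: "complex_subfield L" and h: "hom_on L \<sigma>" and k: "k \<subseteq> L" "\<And>x. x \<in> k \<Longrightarrow> \<sigma> x = x"
    and t: "\<And>i. i \<in> A \<Longrightarrow> t i \<in> L" and F: "F \<in> kpolys k ((\<lambda>i x. x i) ` A)"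
  shows "F t \<in> L \<and> \<sigma> (F t) = F (\<lambda>i. \<sigma> (t i))"
  using F
proof induction
  case (const c) then show ?case using k by auto
next
  case (coord x) then show ?case using t by auto
next
  case (add p q) then show ?case using hom_onD[OF h] complex_subfieldD[OF L] by simp
next
  case (mult p q) then show ?case using hom_onD[OF h] complex_subfieldD[OF L] by simp
qed

section \<open>Polynomial functions on a vector space\<close>

abbreviation vcoords :: "(complex^'i \<Rightarrow> complex) set" where
  "vcoords \<equiv> range (\<lambda>i u. u $ i)"

abbreviation vpolys :: "(complex^'i \<Rightarrow> complex) set" where
  "vpolys \<equiv> kpolys UNIV vcoords"

text \<open>Coordinates of this kind lie in every subfield, are fixed by every field homomorphism
  and killed by every derivation, while polynomial functions are still determined by their values at
  such points.\<close>

definition nat_point :: "complex^'i \<Rightarrow> bool" where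
  "nat_point u \<longleftrightarrow> (\<forall>i. \<exists>n. u $ i = of_nat n)"

lemma vpolys_const: "(\<lambda>_. c) \<in> vpolys" and vpolys_coord: "(\<lambda>u. u $ i) \<in> vpolys"
  and vpolys_add: "F \<in> vpolys \<Longrightarrow> G \<in> vpolys \<Longrightarrow> (\<lambda>u. F u + G u) \<in> vpolys"
  and vpolys_mult: "F \<in> vpolys \<Longrightarrow> G \<in> vpolys \<Longrightarrow> (\<lambda>u. F u * G u) \<in> vpolys"
  by (auto intro: kpolys.intros)

lemmas vpolys_sum = kpolys_sum[OF complex_subfield_UNIV, where C = vcoords]
lemmas vpolys_prod = kpolys_prod[OF complex_subfield_UNIV, where C = vcoords]
lemmas vpolys_power = kpolys_power[OF complex_subfield_UNIV, where C = vcoords]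
lemmas vpolys_minus = kpolys_minus[OF complex_subfield_UNIV, where C = vcoords]
lemmas vpolys_diff = kpolys_diff[OF complex_subfield_UNIV, where C = vcoords]

lemmas vpolys_intros = vpolys_const vpolys_coord vpolys_add vpolys_mult vpolys_sum vpolys_prod vpolys_power
  vpolys_minus vpolys_diff

lemma vpolys_compose:
  assumes "F \<in> vpolys" "\<And>i. (\<lambda>t. \<Phi> t $ i) \<in> kpolys UNIV D"
  shows "(\<lambda>t. F (\<Phi> t)) \<in> kpolys UNIV D"
  by (rule kpolys_compose[OF assms(1)]) (use assms(2) in auto)

lemma vpolys_zero_on_nat:
  assumes F: "F \<in> vpolys" and z: "\<And>u. nat_point u \<Longrightarrow> F u = 0"
  shows "F u = 0"
proof -
  have "(\<lambda>x. F (\<chi> i. x (to_nat i))) \<in> kpolys UNIV coords"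
    by (rule vpolys_compose[OF F]) (auto intro: kpolys.coord)
  then have "F (\<chi> i. (\<lambda>n. u $ from_nat n) (to_nat i)) = 0"
    by (rule kpolys_zero_on_nat) (auto intro!: z simp: nat_point_def)
  then show ?thesis by simp
qed

lemma vpolys_eq_on_nat:
  assumes "F \<in> vpolys" "G \<in> vpolys" "\<And>u. nat_point u \<Longrightarrow> F u = G u"
  shows "F = G"
proof
  fix u show "F u = G u" using vpolys_zero_on_nat[OF vpolys_diff[OF assms(1,2)], of u] assms(3) by simp
qed

lemma vpolys_line:
  fixes a b :: "complex^'i"
  assumes "F \<in> vpolys"
  shows "\<exists>P. \<forall>s. F (a + s *s b) = poly P s"
proof (rule kpolys_curve_UNIV[OF assms])
  fix c :: "complex^'i \<Rightarrow> complex" assume "c \<in> vcoords"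
  then obtain i where "c = (\<lambda>u. u $ i)" by blast
  then show "\<exists>P. \<forall>s. c (a + s *s b) = poly P s"
    by (intro exI[of _ "[:a $ i, b $ i:]"]) auto
qed

definition line_closed :: "(complex^'i) set \<Rightarrow> bool" where
  "line_closed S \<longleftrightarrow> (\<forall>u\<in>S. \<forall>w\<in>S. \<forall>s. u + s *s (w - u) \<in> S)"

text \<open>Join a point where \<open>F\<close> is nonzero to one where \<open>G\<close> is: along
  this line both are nonzero one-variable polynomials. \<open>S\<close> plays the role of an affine
  subspace.\<close>

lemma vpolys_domain:
  assumes F: "F \<in> vpolys" and G: "G \<in> vpolys" and S: "line_closed S" and z: "\<And>u. u \<in> S \<Longrightarrow> F u * G u = 0"
  shows "(\<forall>u\<in>S. F u = 0) \<or> (\<forall>u\<in>S. G u = 0)"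
proof (rule ccontr)
  assume "\<not> ?thesis"
  then obtain u w where uw: "u \<in> S" "w \<in> S" "F u \<noteq> 0" "G w \<noteq> 0" by blast
  obtain P where P: "\<And>s. F (u + s *s (w - u)) = poly P s" using vpolys_line[OF F] by blast
  obtain Q where Q: "\<And>s. G (u + s *s (w - u)) = poly Q s" using vpolys_line[OF G] by blast
  have "poly (P * Q) s = 0" for s using z[of "u + s *s (w - u)"] S uw P Q unfolding line_closed_def by simp
  then have "P * Q = 0" by (metis poly_all_0_iff_0)
  then show False using P[of 0] Q[of 1] uw by auto
qed

lemma deriv_on_simps:
  assumes "deriv_on UNIV \<delta>"
  shows "\<delta> (x + y) = \<delta> x + \<delta> y" "\<delta> (x * y) = x * \<delta> y + \<delta> x * y" "\<delta> 0 = 0" "\<delta> 1 = 0" "\<delta> (of_nat n) = 0"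
    "\<delta> (- x) = - \<delta> x" "\<delta> (x - y) = \<delta> x - \<delta> y" "\<delta> (sum f A) = (\<Sum>a\<in>A. \<delta> (f a))"
proof -
  show add: "\<delta> (x + y) = \<delta> x + \<delta> y" for x y using assms by (simp add: deriv_on_def)
  show mult: "\<delta> (x * y) = x * \<delta> y + \<delta> x * y" for x y using assms by (simp add: deriv_on_def)
  show z: "\<delta> 0 = 0" using add[of 0 0] by simp
  show o: "\<delta> 1 = 0" using mult[of 1 1] by simp
  show "\<delta> (of_nat n) = 0" by (induction n) (auto simp: z o add)
  show m: "\<delta> (- x) = - \<delta> x" for x using add[of x "- x"] z by (simp add: eq_neg_iff_add_eq_0 add.commute)
  show "\<delta> (x - y) = \<delta> x - \<delta> y" using add[of x "- y"] m by simp
  show "\<delta> (sum f A) = (\<Sum>a\<in>A. \<delta> (f a))" by (induction A rule: infinite_finite_induct) (auto simp: z add)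
qed

text \<open>The derivation acts on the coefficients; the coordinates of a natural point contribute
  nothing.\<close>

lemma vpolys_derivation:
  assumes d: "deriv_on UNIV \<delta>" and F: "F \<in> vpolys"
  shows "\<exists>F'\<in>vpolys. \<forall>u. nat_point u \<longrightarrow> \<delta> (F u) = F' u"
  using F
proof induction
  case (const c) then show ?case by (intro bexI[of _ "\<lambda>_. \<delta> c"]) (auto intro: vpolys_intros)
next
  case (coord x)
  then show ?case
    by (intro bexI[of _ "\<lambda>_. 0"]) (auto intro: vpolys_intros simp: nat_point_def, metis deriv_on_simps(5)[OF d])
next
  case (add p q)
  then obtain p' q' where "p' \<in> vpolys" "q' \<in> vpolys" "\<forall>u. nat_point u \<longrightarrow> \<delta> (p u) = p' u" "\<forall>u. nat_point u \<longrightarrow> \<delta> (q u) = q' u"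
    by blast
  then show ?case by (intro bexI[of _ "\<lambda>u. p' u + q' u"]) (auto intro: vpolys_intros simp: deriv_on_simps(1)[OF d])
next
  case (mult p q)
  then obtain p' q' where "p' \<in> vpolys" "q' \<in> vpolys" "\<forall>u. nat_point u \<longrightarrow> \<delta> (p u) = p' u" "\<forall>u. nat_point u \<longrightarrow> \<delta> (q u) = q' u"
    by blast
  then show ?case using mult.hyps
    by (intro bexI[of _ "\<lambda>u. p u * q' u + p' u * q u"]) (auto intro!: vpolys_intros simp: deriv_on_simps(2)[OF d])
qed

section \<open>Forms and monomials\<close>

lemma linear_forms_iff:
  "\<alpha> \<in> linear_forms \<longleftrightarrow> (\<forall>x y. \<alpha> (x + y) = \<alpha> x + \<alpha> y) \<and> (\<forall>c x. \<alpha> (c *s x) = c * \<alpha> x)"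
  unfolding linear_forms_def Vector_Spaces.linear_iff
  using vec.vector_space_axioms vector_space_over_itself.vector_space_axioms by auto

lemma linear_formsD:
  assumes "\<alpha> \<in> linear_forms"
  shows "\<alpha> (x + y) = \<alpha> x + \<alpha> y" "\<alpha> (c *s x) = c * \<alpha> x" "\<alpha> 0 = 0" "\<alpha> (- x) = - \<alpha> x" "\<alpha> (x - y) = \<alpha> x - \<alpha> y"
    "\<alpha> (sum f A) = (\<Sum>a\<in>A. \<alpha> (f a))"
proof -
  show add: "\<alpha> (x + y) = \<alpha> x + \<alpha> y" and sc: "\<alpha> (c *s x) = c * \<alpha> x" for x y c
    using assms unfolding linear_forms_iff by blast+
  show z: "\<alpha> 0 = 0" using sc[of 0 0] by simp
  show m: "\<alpha> (- x) = - \<alpha> x" for x using sc[of "-1" x] by simp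
  show "\<alpha> (x - y) = \<alpha> x - \<alpha> y" using add[of x "- y"] m by simp
  show "\<alpha> (sum f A) = (\<Sum>a\<in>A. \<alpha> (f a))"
    by (induction A rule: infinite_finite_induct) (auto simp: z add)
qed

lemma vec_expand: "(\<Sum>i\<in>UNIV. u $ i *s axis i 1) = (u :: complex^'i)"
  by (simp add: vec_eq_iff axis_def if_distrib[of "\<lambda>x. _ * x"] cong: if_cong)

lemma linear_forms_expand: "\<alpha> \<in> linear_forms \<Longrightarrow> \<alpha> u = (\<Sum>i\<in>UNIV. u $ i * \<alpha> (axis i 1))"
  using linear_formsD(6)[of \<alpha> "\<lambda>i. u $ i *s axis i 1" UNIV] by (simp add: vec_expand linear_formsD(2))

lemma linear_forms_vpolys: "\<alpha> \<in> linear_forms \<Longrightarrow> \<alpha> \<in> vpolys"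
proof -
  assume a: "\<alpha> \<in> linear_forms"
  have eq: "\<alpha> = (\<lambda>u. \<Sum>i\<in>UNIV. u $ i * \<alpha> (axis i 1))" by (rule ext) (rule linear_forms_expand[OF a])
  show "\<alpha> \<in> vpolys" by (subst eq) (intro vpolys_intros)
qed

lemma linear_forms_coord: "(\<lambda>u. u $ i) \<in> linear_forms"
  by (simp add: linear_forms_iff)

lemma linear_forms_comb:
  "\<alpha> \<in> linear_forms \<Longrightarrow> \<beta> \<in> linear_forms \<Longrightarrow> (\<lambda>u. \<alpha> u + \<beta> u) \<in> linear_forms"
  "\<alpha> \<in> linear_forms \<Longrightarrow> (\<lambda>u. c * \<alpha> u) \<in> linear_forms"
  "(\<And>i. i \<in> A \<Longrightarrow> \<gamma> i \<in> linear_forms) \<Longrightarrow> (\<lambda>u. \<Sum>i\<in>A. \<gamma> i u) \<in> linear_forms"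
  by (auto simp: linear_forms_iff algebra_simps sum.distrib sum_distrib_left)

definition linear_map :: "(complex^'i \<Rightarrow> complex^'i) \<Rightarrow> bool" where
  "linear_map M \<longleftrightarrow> (\<forall>x y. M (x + y) = M x + M y) \<and> (\<forall>c x. M (c *s x) = c *s M x)"

lemma linear_forms_compose: "\<alpha> \<in> linear_forms \<Longrightarrow> linear_map M \<Longrightarrow> (\<lambda>u. \<alpha> (M u)) \<in> linear_forms"
  by (simp add: linear_forms_iff linear_map_def)

section \<open>Monomials and homogeneous polynomials with explicit coefficients\<close>

definition mons :: "'i set \<Rightarrow> nat \<Rightarrow> ('i::finite \<Rightarrow> nat) set" where
  "mons J k = {\<alpha>. (\<forall>i. i \<notin> J \<longrightarrow> \<alpha> i = 0) \<and> (\<Sum>i\<in>UNIV. \<alpha> i) = k}"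

definition mvmono :: "('i \<Rightarrow> nat) \<Rightarrow> complex^'i \<Rightarrow> complex" where
  "mvmono \<alpha> u = (\<Prod>i\<in>UNIV. (u $ i) ^ \<alpha> i)"

text \<open>Only the values of \<open>c\<close> on \<open>mons UNIV d\<close> count; coefficient
  families may be arbitrary elsewhere.\<close>

definition hform :: "nat \<Rightarrow> (('i \<Rightarrow> nat) \<Rightarrow> complex) \<Rightarrow> complex^'i \<Rightarrow> complex" where
  "hform d c u = (\<Sum>\<alpha>\<in>mons UNIV d. c \<alpha> * mvmono \<alpha> u)"

text \<open>Exponents of total degree \<open>k\<close> are the multiplicity functions of multisets
  of size \<open>k\<close>, whence the binomial count.\<close>

lemma bij_betw_mons: "bij_betw count (multisets_of_size J k) (mons J k)"
proof (rule bij_betwI')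
  fix X Y :: "'i multiset" show "(count X = count Y) = (X = Y)" by (simp add: multiset_eq_iff fun_eq_iff)
next
  fix X assume "X \<in> multisets_of_size J k"
  then show "count X \<in> mons J k"
    by (auto simp: multisets_of_size_def mons_def size_multiset_overloaded_eq count_eq_zero_iff intro!: sum.mono_neutral_right)
next
  fix \<alpha> assume a: "\<alpha> \<in> mons J k"
  have c: "count (Abs_multiset \<alpha>) = \<alpha>" by (simp add: count_Abs_multiset)
  then have "size (Abs_multiset \<alpha>) = (\<Sum>i\<in>UNIV. \<alpha> i)"
    by (simp add: size_multiset_overloaded_eq) (auto simp: count_eq_zero_iff[symmetric] c intro!: sum.mono_neutral_left)
  moreover have "x \<in> J" if "x \<in># Abs_multiset \<alpha>" for x
  proof (rule ccontr)
    assume "x \<notin> J"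
    then have "count (Abs_multiset \<alpha>) x = 0" using a c by (simp add: mons_def)
    then show False using that by (metis not_in_iff)
  qed
  ultimately have "Abs_multiset \<alpha> \<in> multisets_of_size J k"
    using a by (auto simp: multisets_of_size_def mons_def)
  then show "\<exists>X\<in>multisets_of_size J k. \<alpha> = count X" using c by force
qed

lemma card_mons: "card (mons J k) = (card J + k - 1) choose k"
  using bij_betw_same_card[OF bij_betw_mons, of J k] card_multisets_of_size[of J k] by simp

lemma finite_mons [simp]:
  fixes J :: "'i::finite set"
  shows "finite (mons J k)"
proof -
  have "mons J k \<subseteq> {\<alpha>. \<forall>i. \<alpha> i \<in> {..k}}"
    by (auto simp: mons_def intro: member_le_sum)
  then show ?thesis by (rule finite_subset) (use finite_PiE[of "UNIV :: 'i set" "\<lambda>_. {..k}"] in \<open>simp add: PiE_UNIV_domain Pi_def\<close>)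
qed

lemma mvmono_vpolys: "mvmono \<alpha> \<in> vpolys"
  unfolding mvmono_def[abs_def] by (intro vpolys_intros)

lemma hform_vpolys: "hform d c \<in> vpolys"
  unfolding hform_def[abs_def] by (intro vpolys_intros mvmono_vpolys)

lemma mvmono_upd: "mvmono (\<alpha>(i := e)) u = (u $ i) ^ e * mvmono (\<alpha>(i := 0)) u"
proof -
  have "mvmono (\<alpha>(i := e)) u = (u $ i) ^ e * (\<Prod>j\<in>UNIV - {i}. (u $ j) ^ \<alpha> j)" for e
    unfolding mvmono_def by (subst prod.remove[of UNIV i]) (auto intro!: prod.cong)
  from this[of e] this[of 0] show ?thesis by simp
qed

text \<open>Induction on the set of variables that occur: freezing all coordinates but one turns the
  relation into a one-variable identity, and each of its coefficients is a relation in fewer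
  variables.\<close>

lemma mvmono_independent:
  fixes c :: "('i::finite \<Rightarrow> nat) \<Rightarrow> complex"
  assumes "finite M" "\<And>u. (\<Sum>\<alpha>\<in>M. c \<alpha> * mvmono \<alpha> u) = 0" "\<alpha> \<in> M"
  shows "c \<alpha> = 0"
proof -
  have "\<forall>M c. finite M \<longrightarrow> (\<forall>\<alpha>\<in>M. \<forall>i. i \<notin> J \<longrightarrow> \<alpha> i = 0) \<longrightarrow> (\<forall>u. (\<Sum>\<alpha>\<in>M. c \<alpha> * mvmono \<alpha> u) = 0) \<longrightarrow> (\<forall>\<alpha>\<in>M. c \<alpha> = 0)"
    if "finite J" for J :: "'i set"
    using that
  proof (induction J)
    case empty
    show ?case
    proof (intro allI impI ballI)
      fix M :: "('i \<Rightarrow> nat) set" and c \<alpha>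
      assume *: "finite M" "\<forall>\<alpha>\<in>M. \<forall>i. i \<notin> {} \<longrightarrow> \<alpha> i = 0" "\<forall>u. (\<Sum>\<alpha>\<in>M. c \<alpha> * mvmono \<alpha> u) = 0" "\<alpha> \<in> M"
      have "\<beta> = (\<lambda>_. 0)" if "\<beta> \<in> M" for \<beta> using *(2) that by blast
      then have "M = {\<alpha>}" using *(4) by blast
      moreover have "mvmono \<alpha> u = 1" for u
      proof -
        have "\<alpha> i = 0" for i using *(2,4) by blast
        then show ?thesis by (simp add: mvmono_def)
      qed
      ultimately show "c \<alpha> = 0" using *(3) by simp
    qed
  next
    case (insert j J)
    show ?case
    proof (intro allI impI ballI)
      fix M :: "('i \<Rightarrow> nat) set" and c \<alpha>
      assume M: "finite M" "\<forall>\<alpha>\<in>M. \<forall>i. i \<notin> insert j J \<longrightarrow> \<alpha> i = 0" and z: "\<forall>u. (\<Sum>\<alpha>\<in>M. c \<alpha> * mvmono \<alpha> u) = 0" and a: "\<alpha> \<in> M"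
      define e where "e = \<alpha> j"
      \<comment> \<open>These exponents share with \<open>\<alpha>\<close> the power of the variable
        \<open>j\<close>; they are the ones that enter the coefficient of degree \<open>e\<close> of
        \<open>P\<close> below.\<close>
      define N where "N = {\<beta>\<in>M. \<beta> j = e}"
      let ?r = "\<lambda>\<beta>. \<beta>(j := 0)"
      have inj: "inj_on ?r N"
      proof (rule inj_onI)
        fix x y assume "x \<in> N" "y \<in> N" "?r x = ?r y"
        then have "(?r x)(j := e) = (?r y)(j := e)" "x j = e" "y j = e" by (simp_all add: N_def)
        then show "x = y" by (simp add: fun_upd_idem)
      qed
      have inv: "(?r \<beta>)(j := e) = \<beta>" if "\<beta> \<in> N" for \<beta> using that by (simp add: N_def fun_upd_idem)
      have zero: "\<forall>u. (\<Sum>\<gamma>\<in>?r ` N. c (\<gamma>(j := e)) * mvmono \<gamma> u) = 0"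
      proof
        fix u
        define P where "P = (\<Sum>\<beta>\<in>M. monom (c \<beta> * mvmono (?r \<beta>) u) (\<beta> j))"
        have "poly P s = 0" for s
        proof -
          define w where "w = (\<chi> i. if i = j then s else u $ i)"
          have r: "mvmono (?r \<beta>) w = mvmono (?r \<beta>) u" for \<beta>
            unfolding mvmono_def w_def by (intro prod.cong) auto
          have "mvmono \<beta> w = s ^ \<beta> j * mvmono (?r \<beta>) u" for \<beta>
            using mvmono_upd[of \<beta> j "\<beta> j" w] unfolding r fun_upd_triv by (simp add: w_def)
          then have "poly P s = (\<Sum>\<beta>\<in>M. c \<beta> * mvmono \<beta> w)"
            unfolding P_def poly_sum poly_monom by (intro sum.cong) (simp_all only: mult_ac)
          then show ?thesis using z by simp
        qed
        then have "P = 0" by (metis poly_all_0_iff_0)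
        then have "coeff P e = 0" by simp
        then have "(\<Sum>\<beta>\<in>N. c \<beta> * mvmono (?r \<beta>) u) = 0"
          unfolding P_def N_def by (simp add: coeff_sum M(1) sum.inter_filter)
        then show "(\<Sum>\<gamma>\<in>?r ` N. c (\<gamma>(j := e)) * mvmono \<gamma> u) = 0" by (subst sum.reindex[OF inj]) (simp add: inv del: fun_upd_upd)
      qed
      have fin: "finite (?r ` N)" using M(1) by (simp add: N_def)
      have supp: "\<forall>\<gamma>\<in>?r ` N. \<forall>i. i \<notin> J \<longrightarrow> \<gamma> i = 0"
      proof (intro ballI allI impI)
        fix \<gamma> i assume "\<gamma> \<in> ?r ` N" "i \<notin> J"
        then obtain \<beta> where "\<beta> \<in> M" "\<gamma> = ?r \<beta>" unfolding N_def by blast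
        then show "\<gamma> i = 0" using M(2) \<open>i \<notin> J\<close> by (cases "i = j") auto
      qed
      note insert.IH[THEN spec, of "?r ` N", THEN spec, of "\<lambda>\<gamma>. c (\<gamma>(j := e))", THEN mp, OF fin, THEN mp, OF supp, THEN mp, OF zero]
      moreover have "\<alpha> \<in> N" using a by (simp add: N_def e_def)
      ultimately have "c ((?r \<alpha>)(j := e)) = 0" by blast
      then show "c \<alpha> = 0" unfolding inv[OF \<open>\<alpha> \<in> N\<close>] .
    qed
  qed
  note this[of UNIV, THEN spec, of M, THEN spec, of c, THEN mp, OF _ assms(1)]
  then show ?thesis using assms(2,3) by simp
qed

lemma hform_add: "hform d c u + hform d c' u = hform d (\<lambda>\<alpha>. c \<alpha> + c' \<alpha>) u"
  and hform_scale: "b * hform d c u = hform d (\<lambda>\<alpha>. b * c \<alpha>) u"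
  and hform_sum: "(\<Sum>x\<in>X. hform d (e x) u) = hform d (\<lambda>\<alpha>. \<Sum>x\<in>X. e x \<alpha>) u"
  by (simp_all add: hform_def algebra_simps sum.distrib sum_distrib_left sum_distrib_right)
     (subst sum.swap, simp)

lemma mvmono_0: "mvmono (\<lambda>_. 0) u = 1"
  by (simp add: mvmono_def)

lemma mons_0: "mons J 0 = {\<lambda>_. 0}"
  by (auto simp: mons_def)

lemma hform_0: "hform 0 c u = c (\<lambda>_. 0)"
  by (simp add: hform_def mons_0 mvmono_0)

lemma coord_times_hform:
  fixes u :: "complex^'i"
  shows
  "u $ i * hform d c u = hform (Suc d) (\<lambda>\<alpha>. if \<alpha> i = 0 then 0 else c (\<alpha>(i := \<alpha> i - 1))) u"
proof -
  have s: "(\<Sum>x\<in>UNIV. (\<alpha>(i := e)) x) = e + (\<Sum>x\<in>UNIV - {i}. \<alpha> x)" for \<alpha> :: "'i \<Rightarrow> nat" and e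
    by (subst sum.remove[of _ i]) auto
  have s': "(\<Sum>x\<in>UNIV. \<alpha> x) = \<alpha> i + (\<Sum>x\<in>UNIV - {i}. \<alpha> x)" for \<alpha> :: "'i \<Rightarrow> nat"
    by (subst sum.remove[of _ i]) auto
  have m: "mvmono (\<alpha>(i := Suc (\<alpha> i))) u = u $ i * mvmono \<alpha> u" for \<alpha>
    using mvmono_upd[of \<alpha> i "Suc (\<alpha> i)" u] mvmono_upd[of \<alpha> i "\<alpha> i" u] by simp
  have "u $ i * hform d c u = (\<Sum>\<alpha>\<in>mons UNIV d. c \<alpha> * mvmono (\<alpha>(i := Suc (\<alpha> i))) u)"
    by (simp add: hform_def sum_distrib_left m mult_ac)
  also have "\<dots> = (\<Sum>\<alpha>\<in>{\<alpha>\<in>mons UNIV (Suc d). \<alpha> i \<noteq> 0}. c (\<alpha>(i := \<alpha> i - 1)) * mvmono \<alpha> u)"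
    by (rule sum.reindex_bij_witness[of _ "\<lambda>\<alpha>. \<alpha>(i := \<alpha> i - 1)" "\<lambda>\<alpha>. \<alpha>(i := Suc (\<alpha> i))"])
       (auto simp: mons_def s s'[of "_ :: 'i \<Rightarrow> nat"])
  also have "\<dots> = hform (Suc d) (\<lambda>\<alpha>. if \<alpha> i = 0 then 0 else c (\<alpha>(i := \<alpha> i - 1))) u"
    unfolding hform_def by (intro sum.mono_neutral_cong_left) auto
  finally show ?thesis .
qed

lemma linear_times_hform:
  assumes "\<alpha> \<in> linear_forms"
  shows "\<exists>c'. \<forall>u. \<alpha> u * hform d c u = hform (Suc d) c' u"
proof -
  have "\<alpha> u * hform d c u = (\<Sum>i\<in>UNIV. \<alpha> (axis i 1) * (u $ i * hform d c u))" for u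
    by (subst linear_forms_expand[OF assms]) (simp add: sum_distrib_right sum_distrib_left mult_ac)
  then have "\<alpha> u * hform d c u = (\<Sum>i\<in>UNIV. hform (Suc d) (\<lambda>\<beta>. \<alpha> (axis i 1) *
      (if \<beta> i = 0 then 0 else c (\<beta>(i := \<beta> i - 1)))) u)" for u
    unfolding coord_times_hform by (subst hform_scale[symmetric]) simp
  then have "\<alpha> u * hform d c u = hform (Suc d) (\<lambda>\<beta>. \<Sum>i\<in>UNIV. \<alpha> (axis i 1) *
      (if \<beta> i = 0 then 0 else c (\<beta>(i := \<beta> i - 1)))) u" for u
    by (simp only: hform_sum)
  then show ?thesis by blast
qed

lemma forms_def': "forms d = {(\<lambda>u. \<Sum>j<N. c j * (\<Prod>i<d. \<alpha> j i u)) | (N::nat) c \<alpha>. \<forall>j<N. \<forall>i<d. \<alpha> j i \<in> linear_forms}"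
  by (simp add: forms_def sym_power_def restr_def)

lemma prod_linear_hform:
  "(\<And>i. i < d \<Longrightarrow> \<alpha> i \<in> linear_forms) \<Longrightarrow> \<exists>c. \<forall>u. (\<Prod>i<d. \<alpha> i u) = hform d c u"
proof (induction d)
  case 0 then show ?case by (intro exI[of _ "\<lambda>_. 1"]) (simp add: hform_0)
next
  case (Suc d)
  then obtain c where "\<forall>u. (\<Prod>i<d. \<alpha> i u) = hform d c u" by auto
  then show ?case using linear_times_hform[of "\<alpha> d" d c] Suc.prems by (simp add: mult.commute)
qed

lemma mvmono_prod_linear:
  "\<alpha> \<in> mons UNIV d \<Longrightarrow> \<exists>\<beta>. (\<forall>i<d. \<beta> i \<in> linear_forms) \<and> (\<forall>u. mvmono \<alpha> u = (\<Prod>i<d. \<beta> i u))"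
proof (induction d arbitrary: \<alpha>)
  case 0 then show ?case by (simp add: mons_0 mvmono_0)
next
  case (Suc d)
  then obtain i where i: "\<alpha> i \<noteq> 0" by (fastforce simp: mons_def)
  let ?\<alpha> = "\<alpha>(i := \<alpha> i - 1)"
  have "(\<Sum>x\<in>UNIV. \<alpha> x) = \<alpha> i + (\<Sum>x\<in>UNIV - {i}. \<alpha> x)" "(\<Sum>x\<in>UNIV. ?\<alpha> x) = \<alpha> i - 1 + (\<Sum>x\<in>UNIV - {i}. \<alpha> x)"
    by (subst sum.remove[of _ i]; auto)+
  then have "?\<alpha> \<in> mons UNIV d" using Suc.prems i by (simp add: mons_def)
  then obtain \<beta> where b: "\<forall>i<d. \<beta> i \<in> linear_forms" "\<forall>u. mvmono ?\<alpha> u = (\<Prod>i<d. \<beta> i u)" using Suc.IH by blast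
  have "mvmono \<alpha> u = mvmono ?\<alpha> u * u $ i" for u
  proof -
    obtain e where e: "\<alpha> i = Suc e" using i not0_implies_Suc by blast
    have "mvmono \<alpha> u = u $ i ^ Suc e * mvmono (\<alpha>(i := 0)) u"
      using mvmono_upd[of \<alpha> i "\<alpha> i" u, unfolded fun_upd_triv] by (simp only: e)
    moreover have "mvmono ?\<alpha> u = u $ i ^ e * mvmono (\<alpha>(i := 0)) u"
      using mvmono_upd[of \<alpha> i e u] by (simp add: e)
    ultimately show ?thesis by simp
  qed
  then show ?case using b
    by (intro exI[of _ "\<beta>(d := \<lambda>u. u $ i)"]) (auto simp: less_Suc_eq linear_forms_coord)
qed

text \<open>Trades the span of products of linear forms for coefficients, on which derivations act
  and which serve as parameters.\<close>

lemma forms_eq_hforms: "forms d = range (hform d)"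
proof
  show "forms d \<subseteq> range (hform d)"
  proof
    fix f :: "complex^'i \<Rightarrow> complex" assume "f \<in> forms d"
    then obtain N :: nat and c \<alpha> where f: "f = (\<lambda>u. \<Sum>j<N. c j * (\<Prod>i<d. \<alpha> j i u))" "\<forall>j<N. \<forall>i<d. \<alpha> j i \<in> linear_forms"
      unfolding forms_def' by blast
    have "\<forall>j. \<exists>e. j < N \<longrightarrow> (\<forall>u. (\<Prod>i<d. \<alpha> j i u) = hform d e u)" using f(2) prod_linear_hform by blast
    then obtain e where "\<And>j u. j < N \<Longrightarrow> (\<Prod>i<d. \<alpha> j i u) = hform d (e j) u" by metis
    then have "f = (\<lambda>u. \<Sum>j<N. hform d (\<lambda>\<beta>. c j * e j \<beta>) u)" unfolding f(1) by (auto simp: hform_scale)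
    then have "f = hform d (\<lambda>\<beta>. \<Sum>j<N. c j * e j \<beta>)" by (simp add: hform_sum fun_eq_iff)
    then show "f \<in> range (hform d)" by blast
  qed
  show "range (hform d) \<subseteq> forms d"
  proof
    fix f :: "complex^'i \<Rightarrow> complex" assume "f \<in> range (hform d)"
    then obtain c where f: "f = hform d c" by blast
    have "\<forall>\<alpha>\<in>mons UNIV d. \<exists>\<beta>. (\<forall>i<d. \<beta> i \<in> linear_forms) \<and> (\<forall>u :: complex^'i. mvmono \<alpha> u = (\<Prod>i<d. \<beta> i u))"
      using mvmono_prod_linear by blast
    from bchoice[OF this] obtain \<beta> :: "('i \<Rightarrow> nat) \<Rightarrow> nat \<Rightarrow> complex^'i \<Rightarrow> complex" where
      b: "\<And>\<alpha>. \<alpha> \<in> mons UNIV d \<Longrightarrow> (\<forall>i<d. \<beta> \<alpha> i \<in> linear_forms) \<and> (\<forall>u. mvmono \<alpha> u = (\<Prod>i<d. \<beta> \<alpha> i u))"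
      by blast
    obtain h where h: "bij_betw h {..<card (mons UNIV d :: ('i \<Rightarrow> nat) set)} (mons UNIV d :: ('i \<Rightarrow> nat) set)"
      using ex_bij_betw_nat_finite[OF finite_mons, of UNIV d] unfolding atLeast0LessThan by blast
    have A: "f = (\<lambda>u. \<Sum>j<card (mons UNIV d :: ('i \<Rightarrow> nat) set). c (h j) * (\<Prod>i<d. \<beta> (h j) i u))"
    proof
      fix u
      have "f u = (\<Sum>\<alpha>\<in>mons UNIV d. c \<alpha> * (\<Prod>i<d. \<beta> \<alpha> i u))" unfolding f hform_def using b by (intro sum.cong) auto
      then show "f u = (\<Sum>j<card (mons UNIV d :: ('i \<Rightarrow> nat) set). c (h j) * (\<Prod>i<d. \<beta> (h j) i u))"
        using sum.reindex_bij_betw[OF h, of "\<lambda>\<alpha>. c \<alpha> * (\<Prod>i<d. \<beta> \<alpha> i u)"] by simp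
    qed
    have B: "\<forall>j<card (mons UNIV d :: ('i \<Rightarrow> nat) set). \<forall>i<d. \<beta> (h j) i \<in> linear_forms"
      using b h by (auto simp: bij_betw_def)
    show "f \<in> forms d" unfolding forms_def' mem_Collect_eq using A B
      by (intro exI[of _ "card (mons UNIV d :: ('i \<Rightarrow> nat) set)"] exI[of _ "\<lambda>j. c (h j)"] exI[of _ "\<lambda>j. \<beta> (h j)"] conjI)
  qed
qed

section \<open>Products, substitutions, division and expansion of forms\<close>

lemma forms_add: "f \<in> forms d \<Longrightarrow> g \<in> forms d \<Longrightarrow> (\<lambda>u. f u + g u) \<in> forms d"
  and forms_scale: "f \<in> forms d \<Longrightarrow> (\<lambda>u. b * f u) \<in> forms d"
  unfolding forms_eq_hforms by (auto simp: hform_add hform_scale)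

lemma forms_0: "(\<lambda>u. 0) \<in> forms d"
proof -
  have "(\<lambda>u. 0) = hform d (\<lambda>_. 0)" by (simp add: hform_def fun_eq_iff)
  then show ?thesis unfolding forms_eq_hforms by blast
qed

lemma forms_minus: "f \<in> forms d \<Longrightarrow> (\<lambda>u. - f u) \<in> forms d"
  using forms_scale[of f d "-1"] by simp

lemma forms_diff: "f \<in> forms d \<Longrightarrow> g \<in> forms d \<Longrightarrow> (\<lambda>u. f u - g u) \<in> forms d"
  using forms_add[OF _ forms_minus, of f d g] by simp

lemma forms_prod: "(\<And>i. i < d \<Longrightarrow> \<alpha> i \<in> linear_forms) \<Longrightarrow> (\<lambda>u. \<Prod>i<d. \<alpha> i u) \<in> forms d"
  using prod_linear_hform[of d \<alpha>] unfolding forms_eq_hforms by (auto simp: fun_eq_iff image_def)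

lemma forms_const: "(\<lambda>_. c) \<in> forms 0"
  using forms_scale[OF forms_prod[of 0], of "\<lambda>_ _. 0" c] by simp

lemma forms_linear: "\<alpha> \<in> linear_forms \<Longrightarrow> \<alpha> \<in> forms 1"
  using forms_prod[of 1 "\<lambda>_. \<alpha>"] by simp

lemma forms_induct [consumes 1, case_names zero add prod]:
  assumes "f \<in> forms d" and "P (\<lambda>_. 0)" and "\<And>f g. P f \<Longrightarrow> P g \<Longrightarrow> P (\<lambda>u. f u + g u)"
    and "\<And>c \<alpha>. (\<And>i. i < d \<Longrightarrow> \<alpha> i \<in> linear_forms) \<Longrightarrow> P (\<lambda>u. c * (\<Prod>i<d. \<alpha> i u))"
  shows "P f"
proof -
  obtain N :: nat and c \<alpha> where f: "f = (\<lambda>u. \<Sum>j<N. c j * (\<Prod>i<d. \<alpha> j i u))" "\<forall>j<N. \<forall>i<d. \<alpha> j i \<in> linear_forms"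
    using assms(1) unfolding forms_def' by blast
  have "P (\<lambda>u. \<Sum>j<M. c j * (\<Prod>i<d. \<alpha> j i u))" if "M \<le> N" for M
    using that by (induction M) (use assms f(2) in auto)
  then show ?thesis using f by blast
qed

lemma forms_mult:
  assumes "f \<in> forms a" "g \<in> forms b"
  shows "(\<lambda>u. f u * g u) \<in> forms (a + b)"
  using assms(1)
proof (induction rule: forms_induct)
  case (prod c \<alpha>)
  show ?case using assms(2)
  proof (induction rule: forms_induct)
    case (prod c' \<beta>)
    let ?\<gamma> = "\<lambda>i. if i < a then \<alpha> i else \<beta> (i - a)"
    have "(\<Prod>i<a + b. ?\<gamma> i u) = (\<Prod>i<a. \<alpha> i u) * (\<Prod>i<b. \<beta> i u)" for u
    proof -
      have "(\<Prod>i<a + b. ?\<gamma> i u) = (\<Prod>i<a. ?\<gamma> i u) * (\<Prod>i\<in>{a..<a + b}. ?\<gamma> i u)"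
        using prod.atLeastLessThan_concat[of 0 a "a + b" "\<lambda>i. ?\<gamma> i u"] by (simp add: atLeast0LessThan)
      also have "(\<Prod>i\<in>{a..<a + b}. ?\<gamma> i u) = (\<Prod>i<b. \<beta> i u)"
        using prod.shift_bounds_nat_ivl[of "\<lambda>i. ?\<gamma> i u" 0 a b] by (simp add: atLeast0LessThan add.commute)
      finally show ?thesis by simp
    qed
    moreover have "(\<lambda>u. (c * c') * (\<Prod>i<a + b. ?\<gamma> i u)) \<in> forms (a + b)"
      using prod \<open>\<And>i. i < a \<Longrightarrow> \<alpha> i \<in> linear_forms\<close> by (intro forms_scale forms_prod) auto
    ultimately show ?case by (simp add: mult_ac)
  qed (auto simp: forms_0 forms_add algebra_simps)
qed (auto simp: forms_0 forms_add algebra_simps)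

lemma forms_power: "\<alpha> \<in> linear_forms \<Longrightarrow> (\<lambda>u. \<alpha> u ^ d) \<in> forms d"
  using forms_prod[of d "\<lambda>_. \<alpha>"] by simp

lemma forms_compose:
  assumes "f \<in> forms d" "linear_map M"
  shows "(\<lambda>u. f (M u)) \<in> forms d"
  using assms(1)
proof (induction rule: forms_induct)
  case zero show ?case by (rule forms_0)
next
  case (add f g) then show ?case by (rule forms_add)
next
  case (prod c \<alpha>)
  show ?case by (rule forms_scale[OF forms_prod]) (rule linear_forms_compose[OF prod assms(2)])
qed

lemma forms_vpolys: "f \<in> forms d \<Longrightarrow> f \<in> vpolys"
  unfolding forms_eq_hforms using hform_vpolys by blast

lemma forms_homogeneous: "f \<in> forms d \<Longrightarrow> f (s *s u) = s ^ d * f u"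
  by (induction rule: forms_induct) (auto simp: algebra_simps linear_formsD(2) prod.distrib)

text \<open>Moving \<open>u\<close> by \<open>- l u\<close> along \<open>w\<close> changes every
  linear factor by a multiple of \<open>l u\<close>. When \<open>l w = 1\<close>, the moved point
  lies on \<open>l = 0\<close>, and this is division by a linear form with remainder.\<close>

lemma forms_factor:
  assumes "f \<in> forms d" "l \<in> linear_forms"
  shows "\<exists>r\<in>forms (d - 1). \<forall>u. f u - f (u - l u *s w) = l u * r u"
  using assms(1)
proof (induction rule: forms_induct)
  case zero then show ?case by (intro bexI[of _ "\<lambda>_. 0"]) (auto simp: forms_0)
next
  case (add f g)
  then obtain r s where rs: "r \<in> forms (d - 1)" "s \<in> forms (d - 1)"
    "\<And>u. f u - f (u - l u *s w) = l u * r u" "\<And>u. g u - g (u - l u *s w) = l u * s u" by blast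
  show ?case
  proof (intro bexI allI)
    show "(\<lambda>u. r u + s u) \<in> forms (d - 1)" using rs(1,2) by (rule forms_add)
    show "f u + g u - (f (u - l u *s w) + g (u - l u *s w)) = l u * (r u + s u)" for u
      by (simp only: add_diff_add rs(3,4) distrib_left)
  qed
next
  case (prod c \<alpha>)
  have "\<exists>r\<in>forms (e - 1). \<forall>u. (\<Prod>i<e. \<alpha> i u) - (\<Prod>i<e. \<alpha> i (u - l u *s w)) = l u * r u" if "e \<le> d" for e
    using that
  proof (induction e)
    case 0 then show ?case by (intro bexI[of _ "\<lambda>_. 0"]) (auto simp: forms_0)
  next
    case (Suc e)
    then obtain r where r: "r \<in> forms (e - 1)" "\<And>u. (\<Prod>i<e. \<alpha> i u) - (\<Prod>i<e. \<alpha> i (u - l u *s w)) = l u * r u" by auto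
    have ae: "\<alpha> e \<in> linear_forms" using prod Suc.prems by simp
    \<comment> \<open>Telescoping of the product. For \<open>e = 0\<close> the cofactor is just the
      constant \<open>\<alpha> e w\<close>: there \<open>e - 1 = 0\<close> by truncation, and the
      summand with \<open>r\<close> would have one degree too many.\<close>
    define r' where "r' u = (if e = 0 then 0 else r u * (\<alpha> e u - l u * \<alpha> e w)) + (\<Prod>i<e. \<alpha> i u) * \<alpha> e w" for u
    have "(\<lambda>u. (\<Prod>i<e. \<alpha> i u) * \<alpha> e w) \<in> forms e"
      using forms_scale[OF forms_prod[of e \<alpha>], of "\<alpha> e w"] prod Suc.prems by (simp add: mult.commute)
    moreover have "(\<lambda>u. if e = 0 then 0 else r u * (\<alpha> e u - l u * \<alpha> e w)) \<in> forms e"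
    proof (cases e)
      case (Suc e')
      have "(\<lambda>u. \<alpha> e u - \<alpha> e w * l u) \<in> forms 1"
        by (intro forms_diff forms_linear ae forms_scale assms(2))
      from forms_mult[OF r(1) this] Suc show ?thesis by (simp add: mult.commute)
    qed (simp add: forms_0)
    ultimately have "r' \<in> forms e" unfolding r'_def[abs_def] by (rule forms_add[rotated])
    moreover have "(\<Prod>i<Suc e. \<alpha> i u) - (\<Prod>i<Suc e. \<alpha> i (u - l u *s w)) = l u * r' u" for u
    proof -
      have A: "\<alpha> e (u - l u *s w) = \<alpha> e u - l u * \<alpha> e w" by (simp add: linear_formsD[OF ae])
      have B: "(\<Prod>i<e. \<alpha> i (u - l u *s w)) = (\<Prod>i<e. \<alpha> i u) - l u * r u" using r(2)[of u] by (simp add: algebra_simps)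
      show ?thesis
      proof (cases "e = 0")
        case True
        then show ?thesis using A by (simp add: r'_def)
      next
        case False
        then show ?thesis unfolding prod.lessThan_Suc A B by (simp add: r'_def algebra_simps)
      qed
    qed
    ultimately show ?case by auto
  qed
  then obtain r where "r \<in> forms (d - 1)" "\<And>u. (\<Prod>i<d. \<alpha> i u) - (\<Prod>i<d. \<alpha> i (u - l u *s w)) = l u * r u" by blast
  note r = this
  show ?case
  proof (intro bexI allI)
    show "(\<lambda>u. c * r u) \<in> forms (d - 1)" using r(1) by (rule forms_scale)
    show "c * (\<Prod>i<d. \<alpha> i u) - c * (\<Prod>i<d. \<alpha> i (u - l u *s w)) = l u * (c * r u)" for u
      by (simp only: right_diff_distrib[symmetric] r(2) mult.left_commute)
  qed
qed

text \<open>Taylor's formula in the direction \<open>v\<close>. That the top coefficient is the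
  constant \<open>f v\<close> serves twice: it shows that a form nonzero at \<open>v\<close> cannot
  vanish along a line in this direction, and it separates a cone from its cofactor.\<close>

lemma forms_expand_line:
  assumes "f \<in> forms d"
  shows "\<exists>F. (\<forall>j\<le>d. F j \<in> forms (d - j)) \<and> (\<forall>u s. f (u + s *s v) = (\<Sum>j\<le>d. s ^ j * F j u)) \<and> (\<forall>u. F d u = f v)"
  using assms
proof (induction rule: forms_induct)
  case zero then show ?case by (intro exI[of _ "\<lambda>_ _. 0"]) (auto simp: forms_0)
next
  case (add f g)
  from add(1) obtain F where F: "\<And>j. j \<le> d \<Longrightarrow> F j \<in> forms (d - j)" "\<And>u s. f (u + s *s v) = (\<Sum>j\<le>d. s ^ j * F j u)"
    "\<And>u. F d u = f v" by blast
  from add(2) obtain G where G: "\<And>j. j \<le> d \<Longrightarrow> G j \<in> forms (d - j)" "\<And>u s. g (u + s *s v) = (\<Sum>j\<le>d. s ^ j * G j u)"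
    "\<And>u. G d u = g v" by blast
  show ?case
  proof (intro exI conjI allI impI)
    show "(\<lambda>u. F j u + G j u) \<in> forms (d - j)" if "j \<le> d" for j using F(1)[OF that] G(1)[OF that] by (rule forms_add)
    show "f (u + s *s v) + g (u + s *s v) = (\<Sum>j\<le>d. s ^ j * (F j u + G j u))" for u s
      by (simp only: F(2) G(2) distrib_left sum.distrib)
    show "F d u + G d u = f v + g v" for u by (simp only: F(3) G(3))
  qed
next
  case (prod c \<alpha>)
  have "\<exists>F. (\<forall>j\<le>e. F j \<in> forms (e - j)) \<and> (\<forall>u s. (\<Prod>i<e. \<alpha> i (u + s *s v)) = (\<Sum>j\<le>e. s ^ j * F j u)) \<and>
    (\<forall>u. F e u = (\<Prod>i<e. \<alpha> i v))" if "e \<le> d" for e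
    using that
  proof (induction e)
    case 0 then show ?case by (intro exI[of _ "\<lambda>_ _. 1"]) (auto simp: forms_const)
  next
    case (Suc e)
    then obtain F where F: "\<And>j. j \<le> e \<Longrightarrow> F j \<in> forms (e - j)" "\<And>u s. (\<Prod>i<e. \<alpha> i (u + s *s v)) = (\<Sum>j\<le>e. s ^ j * F j u)"
      "\<And>u. F e u = (\<Prod>i<e. \<alpha> i v)" by auto
    have ae: "\<alpha> e \<in> linear_forms" using prod Suc.prems by simp
    define G where "G j u = (if j \<le> e then F j u * \<alpha> e u else 0) + (if j = 0 then 0 else \<alpha> e v * F (j - 1) u)" for j u
    have "G j \<in> forms (Suc e - j)" if "j \<le> Suc e" for j
    proof -
      have "(\<lambda>u. if j \<le> e then F j u * \<alpha> e u else 0) \<in> forms (Suc e - j)"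
        using forms_mult[OF F(1) forms_linear[OF ae], of j] by (cases "j \<le> e") (auto simp: forms_0 Suc_diff_le)
      moreover have "(\<lambda>u. if j = 0 then 0 else \<alpha> e v * F (j - 1) u) \<in> forms (Suc e - j)"
        using forms_scale[OF F(1), of "j - 1"] that by (cases j) (auto simp: forms_0)
      ultimately show ?thesis unfolding G_def[abs_def] by (rule forms_add)
    qed
    moreover have "(\<Prod>i<Suc e. \<alpha> i (u + s *s v)) = (\<Sum>j\<le>Suc e. s ^ j * G j u)" for u s
    proof -
      have 1: "(\<Sum>j\<le>Suc e. s ^ j * (if j \<le> e then F j u * \<alpha> e u else 0)) = (\<Sum>j\<le>e. s ^ j * F j u) * \<alpha> e u"
        by (simp add: sum_distrib_right mult.assoc)
      have 2: "(\<Sum>j\<le>Suc e. s ^ j * (if j = 0 then 0 else \<alpha> e v * F (j - 1) u)) = (\<Sum>j\<le>e. s ^ j * F j u) * (s * \<alpha> e v)"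
        by (subst sum.atMost_Suc_shift) (simp add: sum_distrib_right sum_distrib_left mult_ac)
      have "(\<Prod>i<Suc e. \<alpha> i (u + s *s v)) = (\<Sum>j\<le>e. s ^ j * F j u) * (\<alpha> e u + s * \<alpha> e v)"
        by (simp add: F(2) linear_formsD[OF ae])
      also have "\<dots> = (\<Sum>j\<le>Suc e. s ^ j * G j u)"
        unfolding G_def distrib_left[of "s ^ _"] sum.distrib 1 2 by (simp only: distrib_left)
      finally show ?thesis .
    qed
    moreover have "G (Suc e) u = (\<Prod>i<Suc e. \<alpha> i v)" for u by (simp add: G_def F(3))
    ultimately show ?case by blast
  qed
  then obtain F where F: "\<And>j. j \<le> d \<Longrightarrow> F j \<in> forms (d - j)" "\<And>u s. (\<Prod>i<d. \<alpha> i (u + s *s v)) = (\<Sum>j\<le>d. s ^ j * F j u)"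
    "\<And>u. F d u = (\<Prod>i<d. \<alpha> i v)" by blast
  show ?case
  proof (intro exI conjI allI impI)
    show "(\<lambda>u. c * F j u) \<in> forms (d - j)" if "j \<le> d" for j using F(1)[OF that] by (rule forms_scale)
    show "c * (\<Prod>i<d. \<alpha> i (u + s *s v)) = (\<Sum>j\<le>d. s ^ j * (c * F j u))" for u s
      by (simp only: F(2) sum_distrib_left mult.left_commute)
    show "c * F d u = c * (\<Prod>i<d. \<alpha> i v)" for u by (simp only: F(3))
  qed
qed

lemma forms_on_subspace:
  assumes "f \<in> forms d"
  shows "\<exists>c. \<forall>u. (\<forall>i. i \<notin> J \<longrightarrow> u $ i = 0) \<longrightarrow> f u = (\<Sum>\<alpha>\<in>mons J d. c \<alpha> * mvmono \<alpha> u)"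
proof -
  obtain c where c: "f = hform d c" using assms unfolding forms_eq_hforms by blast
  have "f u = (\<Sum>\<alpha>\<in>mons J d. c \<alpha> * mvmono \<alpha> u)" if u: "\<forall>i. i \<notin> J \<longrightarrow> u $ i = 0" for u
    unfolding c hform_def
  proof (rule sum.mono_neutral_right)
    show "\<forall>\<alpha>\<in>mons UNIV d - mons J d. c \<alpha> * mvmono \<alpha> u = 0"
    proof
      fix \<alpha> assume "\<alpha> \<in> mons UNIV d - mons J d"
      then obtain i where "i \<notin> J" "\<alpha> i \<noteq> 0" by (auto simp: mons_def)
      then have "mvmono \<alpha> u = 0" unfolding mvmono_def using u by (intro prod_zero) auto
      then show "c \<alpha> * mvmono \<alpha> u = 0" by simp
    qed
  next
    show "mons J d \<subseteq> mons UNIV d" by (auto simp: mons_def)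
  qed simp
  then show ?thesis by blast
qed

section \<open>Counting monomials\<close>

text \<open>Gaussian elimination: a pivot unknown \<open>p\<close> removes one equation together
  with one unknown.\<close>

lemma ex_nontrivial_solution:
  fixes a :: "'j \<Rightarrow> 'g \<Rightarrow> complex"
  assumes "finite G" "finite J" "card G < card J"
  shows "\<exists>c. (\<exists>j\<in>J. c j \<noteq> 0) \<and> (\<forall>g\<in>G. (\<Sum>j\<in>J. c j * a j g) = 0)"
  using assms
proof (induction G arbitrary: J a)
  case empty
  then obtain j where "j \<in> J" by (metis card.empty equals0I less_irrefl)
  then show ?case by (intro exI[of _ "\<lambda>_. 1"]) auto
next
  case (insert g G)
  show ?case
  proof (cases "\<forall>j\<in>J. a j g = 0")
    case True
    obtain c where "\<exists>j\<in>J. c j \<noteq> 0" "\<forall>h\<in>G. (\<Sum>j\<in>J. c j * a j h) = 0"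
      using insert.IH[of J a] insert.prems insert.hyps by auto
    moreover have "(\<Sum>j\<in>J. c j * a j g) = 0" using True by (intro sum.neutral) auto
    ultimately show ?thesis by blast
  next
    case False
    then obtain p where p: "p \<in> J" "a p g \<noteq> 0" by blast
    define J' where "J' = J - {p}"
    have J': "finite J'" "p \<notin> J'" "J = insert p J'" "card G < card J'"
      using p insert.prems insert.hyps by (auto simp: J'_def)
    obtain c where c: "\<exists>j\<in>J'. c j \<noteq> 0" "\<And>h. h \<in> G \<Longrightarrow> (\<Sum>j\<in>J'. c j * (a j h - a j g / a p g * a p h)) = 0"
      using insert.IH[OF J'(1,4), of "\<lambda>j h. a j h - a j g / a p g * a p h"] by blast
    define s where "s = (\<Sum>j\<in>J'. c j * a j g) / a p g"
    define c' where "c' = c(p := - s)"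
    have c'J': "(\<Sum>j\<in>J'. c' j * a j h) = (\<Sum>j\<in>J'. c j * a j h)" for h
      using J'(2) by (intro sum.cong) (auto simp: c'_def)
    have tot: "(\<Sum>j\<in>J. c' j * a j h) = (\<Sum>j\<in>J'. c j * a j h) - s * a p h" for h
      using J' by (simp add: c'J') (simp add: c'_def)
    have "(\<Sum>j\<in>J. c' j * a j h) = 0" if "h \<in> insert g G" for h
    proof (cases "h = g")
      case True
      then show ?thesis unfolding tot using p by (simp add: s_def)
    next
      case False
      then have "h \<in> G" using that by simp
      have "(\<Sum>j\<in>J'. c j * (a j h - a j g / a p g * a p h)) = (\<Sum>j\<in>J'. c j * a j h) - s * a p h"
        by (simp add: s_def right_diff_distrib sum_subtractf sum_divide_distrib sum_distrib_right mult.assoc)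
      then show ?thesis unfolding tot using c(2)[OF \<open>h \<in> G\<close>] by simp
    qed
    moreover have "\<exists>j\<in>J. c' j \<noteq> 0" using c(1) J' by (auto simp: c'_def)
    ultimately show ?thesis by blast
  qed
qed

text \<open>Comparison of dimensions in terms of families: a linear relation among the coefficient
  vectors would be one among the functions on \<open>S\<close>.\<close>

lemma card_le_spanning:
  fixes w :: "'j \<Rightarrow> 'u \<Rightarrow> complex" and e :: "'g \<Rightarrow> 'u \<Rightarrow> complex"
  assumes fin: "finite G" "finite J"
    and comb: "\<And>j. j \<in> J \<Longrightarrow> \<exists>a. \<forall>u\<in>S. w j u = (\<Sum>g\<in>G. a g * e g u)"
    and indep: "\<And>c j. (\<And>u. u \<in> S \<Longrightarrow> (\<Sum>j\<in>J. c j * w j u) = 0) \<Longrightarrow> j \<in> J \<Longrightarrow> c j = 0"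
  shows "card J \<le> card G"
proof (rule ccontr)
  assume "\<not> ?thesis"
  then have less: "card G < card J" by simp
  have "\<forall>j\<in>J. \<exists>a. \<forall>u\<in>S. w j u = (\<Sum>g\<in>G. a g * e g u)" using comb by blast
  from bchoice[OF this] obtain a where a: "\<And>j u. j \<in> J \<Longrightarrow> u \<in> S \<Longrightarrow> w j u = (\<Sum>g\<in>G. a j g * e g u)" by blast
  obtain c where c: "\<exists>j\<in>J. c j \<noteq> 0" "\<forall>g\<in>G. (\<Sum>j\<in>J. c j * a j g) = 0"
    using ex_nontrivial_solution[OF fin less, of a] by blast
  have "(\<Sum>j\<in>J. c j * w j u) = 0" if "u \<in> S" for u
  proof -
    have "(\<Sum>j\<in>J. c j * w j u) = (\<Sum>j\<in>J. \<Sum>g\<in>G. c j * a j g * e g u)"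
      using a that by (intro sum.cong) (auto simp: sum_distrib_left mult.assoc)
    also have "\<dots> = (\<Sum>g\<in>G. (\<Sum>j\<in>J. c j * a j g) * e g u)"
      by (subst sum.swap) (simp add: sum_distrib_right)
    also have "\<dots> = 0" using c(2) by (intro sum.neutral) auto
    finally show ?thesis .
  qed
  then show False using indep c(1) by blast
qed

text \<open>Steinitz exchange for a single vector: \<open>q\<close> takes the place of a generator
  that occurs in it.\<close>

lemma spanning_exchange:
  fixes e :: "'g \<Rightarrow> 'u \<Rightarrow> complex"
  assumes "finite G" and q: "\<And>u. u \<in> S \<Longrightarrow> q u = (\<Sum>g\<in>G. a g * e g u)" and nz: "\<exists>u\<in>S. q u \<noteq> 0"
  shows "\<exists>g0\<in>G. \<forall>b. \<exists>b0 b'. \<forall>u\<in>S. (\<Sum>g\<in>G. b g * e g u) = b0 * q u + (\<Sum>g\<in>G - {g0}. b' g * e g u)"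
proof -
  have "\<exists>g0\<in>G. a g0 \<noteq> 0"
  proof (rule ccontr)
    assume *: "\<not> ?thesis"
    have "q u = 0" if "u \<in> S" for u unfolding q[OF that] by (rule sum.neutral) (use * in simp)
    then show False using nz by blast
  qed
  then obtain g0 where g0: "g0 \<in> G" "a g0 \<noteq> 0" by blast
  have ex: "(\<Sum>g\<in>G. b g * e g u) = b g0 / a g0 * q u + (\<Sum>g\<in>G - {g0}. (b g - b g0 / a g0 * a g) * e g u)"
    if u: "u \<in> S" for b u
  proof -
    have s: "(\<Sum>g\<in>G. f g) = f g0 + (\<Sum>g\<in>G - {g0}. f g)" for f :: "'g \<Rightarrow> complex"
      using assms(1) g0(1) by (rule sum.remove)
    show ?thesis unfolding q[OF u] s
      using g0(2) by (simp add: left_diff_distrib sum_subtractf distrib_left sum_distrib_left mult.assoc)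
  qed
  show ?thesis
  proof (intro bexI[OF _ g0(1)] allI)
    fix b
    show "\<exists>b0 b'. \<forall>u\<in>S. (\<Sum>g\<in>G. b g * e g u) = b0 * q u + (\<Sum>g\<in>G - {g0}. b' g * e g u)"
      by (rule exI[of _ "b g0 / a g0"], rule exI[of _ "\<lambda>g. b g - b g0 / a g0 * a g"]) (use ex in simp)
  qed
qed

lemma mvmono_forms: "\<alpha> \<in> mons J k \<Longrightarrow> mvmono \<alpha> \<in> forms k"
proof -
  assume "\<alpha> \<in> mons J k"
  then have a: "\<alpha> \<in> mons UNIV k" by (simp add: mons_def)
  have "mvmono \<alpha> = hform k (\<lambda>\<beta>. if \<beta> = \<alpha> then 1 else 0)"
  proof
    fix u show "mvmono \<alpha> u = hform k (\<lambda>\<beta>. if \<beta> = \<alpha> then 1 else 0) u"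
      unfolding hform_def using a by (simp add: if_distrib[of "\<lambda>x. x * _"] cong: if_cong)
  qed
  then show ?thesis unfolding forms_eq_hforms by blast
qed

lemma mvmono_independent_on:
  fixes c :: "('i::finite \<Rightarrow> nat) \<Rightarrow> complex"
  assumes z: "\<And>u. (\<And>i. i \<notin> J \<Longrightarrow> u $ i = 0) \<Longrightarrow> (\<Sum>\<alpha>\<in>mons J k. c \<alpha> * mvmono \<alpha> u) = 0" and a: "\<alpha> \<in> mons J k"
  shows "c \<alpha> = 0"
proof (rule mvmono_independent[OF finite_mons _ a])
  fix u :: "complex^'i"
  define w where "w = (\<chi> i. if i \<in> J then u $ i else 0)"
  have "mvmono \<beta> u = mvmono \<beta> w" if "\<beta> \<in> mons J k" for \<beta>
    unfolding mvmono_def using that by (intro prod.cong) (auto simp: w_def mons_def)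
  then have "(\<Sum>\<alpha>\<in>mons J k. c \<alpha> * mvmono \<alpha> u) = (\<Sum>\<alpha>\<in>mons J k. c \<alpha> * mvmono \<alpha> w)"
    by (intro sum.cong) auto
  also have "\<dots> = 0" by (rule z) (simp add: w_def)
  finally show "(\<Sum>\<alpha>\<in>mons J k. c \<alpha> * mvmono \<alpha> u) = 0" .
qed

section \<open>Cones over a point and dimension counts on a hyperplane\<close>

definition cone_over :: "complex^'i \<Rightarrow> (complex^'i \<Rightarrow> complex) \<Rightarrow> bool" where
  "cone_over v b \<longleftrightarrow> (\<forall>u s. b (u + s *s v) = b u)"

lemma line_closed_coords: "line_closed {u. \<forall>i. i \<notin> J \<longrightarrow> u $ i = 0}"
  by (auto simp: line_closed_def)

text \<open>Inside \<open>x $ j2 = 0\<close>, projecting along \<open>v\<close> onto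
  \<open>x $ jj = 0\<close> does not change a cone over \<open>v\<close>, so both variables
  \<open>j2\<close> and \<open>jj\<close> disappear.\<close>

lemma cone_over_comb:
  assumes v: "v $ jj \<noteq> 0" "v $ j2 = 0" and b: "b \<in> forms m" "cone_over v b"
  shows "\<exists>c. \<forall>x. x $ j2 = 0 \<longrightarrow> b x = (\<Sum>\<alpha>\<in>mons (- {j2, jj}) m. c \<alpha> * mvmono \<alpha> (x - (x $ jj / v $ jj) *s v))"
proof -
  obtain c where c: "\<And>u. (\<forall>i. i \<notin> - {j2, jj} \<longrightarrow> u $ i = 0) \<Longrightarrow> b u = (\<Sum>\<alpha>\<in>mons (- {j2, jj}) m. c \<alpha> * mvmono \<alpha> u)"
    using forms_on_subspace[OF b(1), of "- {j2, jj}"] by blast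
  have "b x = (\<Sum>\<alpha>\<in>mons (- {j2, jj}) m. c \<alpha> * mvmono \<alpha> (x - (x $ jj / v $ jj) *s v))" if "x $ j2 = 0" for x
  proof -
    have "b (x + (- (x $ jj / v $ jj)) *s v) = b x" using b(2) unfolding cone_over_def by blast
    then have "b x = b (x - (x $ jj / v $ jj) *s v)" by simp
    also have "\<dots> = (\<Sum>\<alpha>\<in>mons (- {j2, jj}) m. c \<alpha> * mvmono \<alpha> (x - (x $ jj / v $ jj) *s v))"
      by (rule c) (use v that in auto)
    finally show ?thesis .
  qed
  then show ?thesis by blast
qed

text \<open>The products \<open>q * A\<close> and \<open>g * b\<close> overlap in
  \<open>q * g\<close>, because \<open>q\<close> is itself a cone over \<open>v\<close>. Exchanging
  \<open>q\<close> into the spanning family of cones saves one generator; this is the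
  \<open>+ 1\<close> in the count, and the reason why \<open>D_num\<close> contains
  \<open>2n - 2\<close> and not \<open>2n - 1\<close>.\<close>

lemma cone_spanning_family:
  fixes q g :: "complex^'i \<Rightarrow> complex" and E :: "'k \<Rightarrow> complex^'i \<Rightarrow> complex"
  assumes v: "v $ jj \<noteq> 0" "v $ j2 = 0" and q: "q \<in> forms m" "cone_over v q" "\<exists>x. x $ j2 = 0 \<and> q x \<noteq> 0"
    and g: "g \<in> forms c" and K: "finite K"
  shows "\<exists>(G :: (('i \<Rightarrow> nat) + ('i \<Rightarrow> nat) + 'k) set) e. finite G \<and>
    card G + 1 = card (mons (- {j2}) c) + card (mons (- {j2, jj}) m) + card K \<and>
    (\<forall>A b t. A \<in> forms c \<longrightarrow> b \<in> forms m \<longrightarrow> cone_over v b \<longrightarrow>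
      (\<exists>a. \<forall>x\<in>{x. x $ j2 = 0}. q x * A x + g x * b x + (\<Sum>k\<in>K. t k * E k x) = (\<Sum>\<gamma>\<in>G. a \<gamma> * e \<gamma> x)))"
proof -
  let ?S = "{x :: complex^'i. x $ j2 = 0}"
  let ?M = "mons (- {j2, jj}) m"
  let ?\<pi> = "\<lambda>x. x - (x $ jj / v $ jj) *s v"
  let ?e = "\<lambda>\<alpha> x. mvmono \<alpha> (?\<pi> x)"
  obtain cq where cq: "\<And>x. x \<in> ?S \<Longrightarrow> q x = (\<Sum>\<alpha>\<in>?M. cq \<alpha> * ?e \<alpha> x)" using cone_over_comb[OF v q(1,2)] by blast
  have nz: "\<exists>x\<in>?S. q x \<noteq> 0" using q(3) by blast
  obtain \<alpha>0 where \<alpha>0: "\<alpha>0 \<in> ?M" and ex: "\<And>b. \<exists>b0 b'. \<forall>u\<in>?S. (\<Sum>\<alpha>\<in>?M. b \<alpha> * ?e \<alpha> u) = b0 * q u + (\<Sum>\<alpha>\<in>?M - {\<alpha>0}. b' \<alpha> * ?e \<alpha> u)"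
    using spanning_exchange[OF finite_mons cq nz] by blast
  define G where "G = mons (- {j2}) c <+> ((?M - {\<alpha>0}) <+> K)"
  define e where "e = case_sum (\<lambda>\<alpha> x. q x * mvmono \<alpha> x) (case_sum (\<lambda>\<alpha> x. g x * ?e \<alpha> x) E)"
  have fin: "finite G" unfolding G_def using K by simp
  have "card G = card (mons (- {j2}) c) + (card (?M - {\<alpha>0}) + card K)"
    unfolding G_def using K by (simp add: card_Plus)
  moreover have "card ?M = Suc (card (?M - {\<alpha>0}))" using card.remove[OF finite_mons \<alpha>0] .
  ultimately have card: "card G + 1 = card (mons (- {j2}) c) + card ?M + card K" by simp
  have sumG: "(\<Sum>\<gamma>\<in>G. f \<gamma>) = (\<Sum>\<alpha>\<in>mons (- {j2}) c. f (Inl \<alpha>)) + ((\<Sum>\<alpha>\<in>?M - {\<alpha>0}. f (Inr (Inl \<alpha>))) + (\<Sum>k\<in>K. f (Inr (Inr k))))"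
    for f :: "('i \<Rightarrow> nat) + ('i \<Rightarrow> nat) + 'k \<Rightarrow> complex"
    unfolding G_def using K by (simp add: sum.Plus)
  have "\<exists>a. \<forall>x\<in>?S. q x * A x + g x * b x + (\<Sum>k\<in>K. t k * E k x) = (\<Sum>\<gamma>\<in>G. a \<gamma> * e \<gamma> x)"
    if A: "A \<in> forms c" and b: "b \<in> forms m" "cone_over v b" for A b t
  proof -
    obtain cb where cb: "\<And>x. x \<in> ?S \<Longrightarrow> b x = (\<Sum>\<alpha>\<in>?M. cb \<alpha> * ?e \<alpha> x)" using cone_over_comb[OF v b] by blast
    obtain b0 b' where b': "\<And>u. u \<in> ?S \<Longrightarrow> (\<Sum>\<alpha>\<in>?M. cb \<alpha> * ?e \<alpha> u) = b0 * q u + (\<Sum>\<alpha>\<in>?M - {\<alpha>0}. b' \<alpha> * ?e \<alpha> u)"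
      using ex[of cb] by blast
    \<comment> \<open>The component of \<open>b\<close> along \<open>q\<close> contributes a
      multiple of \<open>q * g\<close>, which is moved into the multiple of
      \<open>q\<close>.\<close>
    have "(\<lambda>x. A x + b0 * g x) \<in> forms c" by (intro forms_add forms_scale A g)
    then obtain cA where cA: "\<And>u. (\<forall>i. i \<notin> - {j2} \<longrightarrow> u $ i = 0) \<Longrightarrow> A u + b0 * g u = (\<Sum>\<alpha>\<in>mons (- {j2}) c. cA \<alpha> * mvmono \<alpha> u)"
      using forms_on_subspace by blast
    show ?thesis
    proof (intro exI ballI)
      fix x assume x: "x \<in> ?S"
      have "q x * A x + g x * b x = q x * (A x + b0 * g x) + g x * (\<Sum>\<alpha>\<in>?M - {\<alpha>0}. b' \<alpha> * ?e \<alpha> x)"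
        unfolding cb[OF x] b'[OF x] by (simp add: algebra_simps)
      also have "A x + b0 * g x = (\<Sum>\<alpha>\<in>mons (- {j2}) c. cA \<alpha> * mvmono \<alpha> x)" by (rule cA) (use x in auto)
      finally show "q x * A x + g x * b x + (\<Sum>k\<in>K. t k * E k x) = (\<Sum>\<gamma>\<in>G. (case_sum cA (case_sum b' t)) \<gamma> * e \<gamma> x)"
        unfolding sumG by (simp add: e_def sum_distrib_left mult_ac)
    qed
  qed
  then show ?thesis using fin card by blast
qed

text \<open>On \<open>x $ j2 = 0\<close>, the multiples of \<open>x $ j1\<close> and the products of
  \<open>q\<close> with monomials free of \<open>x $ j1\<close> are independent, since
  \<open>q\<close> is not identically zero on \<open>x $ j1 = 0\<close>. Both lie in the span
  bounded by \<open>cone_spanning_family\<close>.\<close>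

lemma count_monomials_transversal:
  fixes q g :: "complex^'i \<Rightarrow> complex" and E :: "'k \<Rightarrow> complex^'i \<Rightarrow> complex"
  assumes v: "v $ jj \<noteq> 0" "v $ j2 = 0" and j: "j1 \<noteq> j2" and q: "q \<in> forms m" "cone_over v q"
    and nz: "\<exists>x. x $ j1 = 0 \<and> x $ j2 = 0 \<and> q x \<noteq> 0"
    and g: "g \<in> forms c" and K: "finite K"
    and H: "\<And>\<psi>. \<psi> \<in> forms e \<Longrightarrow> \<exists>A b t. A \<in> forms c \<and> b \<in> forms m \<and> cone_over v b \<and>
      (\<forall>x. x $ j2 = 0 \<longrightarrow> x $ j1 * \<psi> x = q x * A x + g x * b x + (\<Sum>k\<in>K. t k * E k x))"
  shows "card (mons (- {j2}) e) + card (mons (- {j1, j2}) c) + 1 \<le>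
    card (mons (- {j2}) c) + card (mons (- {j2, jj}) m) + card K"
proof -
  let ?S = "{x :: complex^'i. x $ j2 = 0}"
  have nz': "\<exists>x. x $ j2 = 0 \<and> q x \<noteq> 0" using nz by blast
  obtain G :: "(('i \<Rightarrow> nat) + ('i \<Rightarrow> nat) + 'k) set" and ee where G: "finite G"
    "card G + 1 = card (mons (- {j2}) c) + card (mons (- {j2, jj}) m) + card K"
    and comb: "\<And>A b t. A \<in> forms c \<Longrightarrow> b \<in> forms m \<Longrightarrow> cone_over v b \<Longrightarrow>
      (\<exists>a. \<forall>x\<in>?S. q x * A x + g x * b x + (\<Sum>k\<in>K. t k * E k x) = (\<Sum>\<gamma>\<in>G. a \<gamma> * ee \<gamma> x))"
    using cone_spanning_family[OF v q nz' g K, of E] by blast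
  define J where "J = (mons (- {j2}) e <+> mons (- {j1, j2}) c :: (('i \<Rightarrow> nat) + ('i \<Rightarrow> nat)) set)"
  define w where "w = case_sum (\<lambda>\<alpha> x. x $ j1 * mvmono \<alpha> x) (\<lambda>\<beta> x. q x * mvmono \<beta> x)"
  have sumJ: "(\<Sum>\<gamma>\<in>J. f \<gamma>) = (\<Sum>\<alpha>\<in>mons (- {j2}) e. f (Inl \<alpha>)) + (\<Sum>\<beta>\<in>mons (- {j1, j2}) c. f (Inr \<beta>))"
    for f :: "('i \<Rightarrow> nat) + ('i \<Rightarrow> nat) \<Rightarrow> complex"
    unfolding J_def by (simp add: sum.Plus)
  have "card J \<le> card G"
  proof (rule card_le_spanning[OF G(1)])
    show "finite J" by (simp add: J_def)
    show "\<exists>a. \<forall>u\<in>?S. w j u = (\<Sum>g\<in>G. a g * ee g u)" if "j \<in> J" for j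
    proof (cases j)
      case (Inl \<alpha>)
      then have "mvmono \<alpha> \<in> forms e" using that mvmono_forms unfolding J_def by blast
      from H[OF this] obtain A b t where Ab: "A \<in> forms c" "b \<in> forms m" "cone_over v b"
        "\<And>x. x $ j2 = 0 \<Longrightarrow> x $ j1 * mvmono \<alpha> x = q x * A x + g x * b x + (\<Sum>k\<in>K. t k * E k x)" by blast
      from comb[OF Ab(1,2,3), of t] show ?thesis using Ab(4) by (simp add: Inl w_def)
    next
      case (Inr \<beta>)
      then have "mvmono \<beta> \<in> forms c" using that mvmono_forms unfolding J_def by blast
      from comb[OF this forms_0, of "\<lambda>_. 0"] show ?thesis by (simp add: Inr w_def cone_over_def)
    qed
    fix cc j assume z: "\<And>u. u \<in> ?S \<Longrightarrow> (\<Sum>j\<in>J. cc j * w j u) = 0" and jJ: "j \<in> J"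
    let ?P = "\<lambda>x. \<Sum>\<alpha>\<in>mons (- {j2}) e. cc (Inl \<alpha>) * mvmono \<alpha> x"
    let ?Q = "\<lambda>x. \<Sum>\<beta>\<in>mons (- {j1, j2}) c. cc (Inr \<beta>) * mvmono \<beta> x"
    have PQ: "?P \<in> vpolys" "?Q \<in> vpolys" by (intro vpolys_intros mvmono_vpolys)+
    have z': "x $ j1 * ?P x + q x * ?Q x = 0" if "x $ j2 = 0" for x
      using z[of x] that unfolding sumJ by (simp add: w_def sum_distrib_left mult_ac)
    let ?T = "{x :: complex^'i. \<forall>i. i \<notin> - {j1, j2} \<longrightarrow> x $ i = 0}"
    \<comment> \<open>On \<open>x $ j1 = 0\<close> the first family dies and \<open>q\<close> can be
      cancelled; once the second family is gone, \<open>x $ j1\<close> can be cancelled from the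
      first.\<close>
    have "(\<forall>u\<in>?T. q u = 0) \<or> (\<forall>u\<in>?T. ?Q u = 0)"
      by (rule vpolys_domain[OF forms_vpolys[OF q(1)] PQ(2) line_closed_coords]) (use z' in force)
    then have QT: "\<forall>u\<in>?T. ?Q u = 0" using nz by auto
    have Q: "cc (Inr \<beta>) = 0" if "\<beta> \<in> mons (- {j1, j2}) c" for \<beta>
      by (rule mvmono_independent_on[OF _ that, of "\<lambda>\<beta>. cc (Inr \<beta>)"]) (use QT in blast)
    then have Q0: "?Q x = 0" for x by (intro sum.neutral) auto
    let ?U = "{x :: complex^'i. \<forall>i. i \<notin> - {j2} \<longrightarrow> x $ i = 0}"
    have "(\<forall>u\<in>?U. u $ j1 = 0) \<or> (\<forall>u\<in>?U. ?P u = 0)"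
      by (rule vpolys_domain[OF vpolys_coord PQ(1) line_closed_coords]) (use z' Q0 in auto)
    moreover have "axis j1 1 \<in> ?U" "axis j1 1 $ j1 \<noteq> (0 :: complex)" using j by (auto simp: axis_def)
    ultimately have PU: "\<forall>u\<in>?U. ?P u = 0" by blast
    have P: "cc (Inl \<alpha>) = 0" if "\<alpha> \<in> mons (- {j2}) e" for \<alpha>
      by (rule mvmono_independent_on[OF _ that, of "\<lambda>\<beta>. cc (Inl \<beta>)"]) (use PU in blast)
    show "cc j = 0" using P Q jJ unfolding J_def by blast
  qed
  moreover have "card J = card (mons (- {j2}) e) + card (mons (- {j1, j2}) c)"
    unfolding J_def by (simp add: card_Plus)
  ultimately show ?thesis using G(2) by linarith
qed

text \<open>The count after the factor \<open>x $ j1\<close> has been cancelled: the left side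
  ranges over all forms of degree \<open>e\<close>.\<close>

lemma count_monomials_all:
  fixes q g :: "complex^'i \<Rightarrow> complex" and E :: "'k \<Rightarrow> complex^'i \<Rightarrow> complex"
  assumes v: "v $ jj \<noteq> 0" "v $ j2 = 0" and q: "q \<in> forms m" "cone_over v q"
    and nz: "\<exists>x. x $ j2 = 0 \<and> q x \<noteq> 0"
    and g: "g \<in> forms c" and K: "finite K"
    and H: "\<And>\<psi>. \<psi> \<in> forms e \<Longrightarrow> \<exists>A b t. A \<in> forms c \<and> b \<in> forms m \<and> cone_over v b \<and>
      (\<forall>x. x $ j2 = 0 \<longrightarrow> \<psi> x = q x * A x + g x * b x + (\<Sum>k\<in>K. t k * E k x))"
  shows "card (mons (- {j2}) e) + 1 \<le> card (mons (- {j2}) c) + card (mons (- {j2, jj}) m) + card K"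
proof -
  let ?S = "{x :: complex^'i. x $ j2 = 0}"
  obtain G :: "(('i \<Rightarrow> nat) + ('i \<Rightarrow> nat) + 'k) set" and ee where G: "finite G"
    "card G + 1 = card (mons (- {j2}) c) + card (mons (- {j2, jj}) m) + card K"
    and comb: "\<And>A b t. A \<in> forms c \<Longrightarrow> b \<in> forms m \<Longrightarrow> cone_over v b \<Longrightarrow>
      (\<exists>a. \<forall>x\<in>?S. q x * A x + g x * b x + (\<Sum>k\<in>K. t k * E k x) = (\<Sum>\<gamma>\<in>G. a \<gamma> * ee \<gamma> x))"
    using cone_spanning_family[OF v q nz g K, of E] by blast
  have "card (mons (- {j2}) e) \<le> card G"
  proof (rule card_le_spanning[OF G(1) finite_mons])
    show "\<exists>a. \<forall>u\<in>?S. mvmono \<alpha> u = (\<Sum>g\<in>G. a g * ee g u)" if "\<alpha> \<in> mons (- {j2}) e" for \<alpha>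
    proof -
      from H[OF mvmono_forms[OF that]] obtain A b t where Ab: "A \<in> forms c" "b \<in> forms m" "cone_over v b"
        "\<And>x. x $ j2 = 0 \<Longrightarrow> mvmono \<alpha> x = q x * A x + g x * b x + (\<Sum>k\<in>K. t k * E k x)" by blast
      from comb[OF Ab(1,2,3), of t] show ?thesis using Ab(4) by simp
    qed
    fix cc \<alpha> assume z: "\<And>u. u \<in> ?S \<Longrightarrow> (\<Sum>\<alpha>\<in>mons (- {j2}) e. cc \<alpha> * mvmono \<alpha> u) = 0" and a: "\<alpha> \<in> mons (- {j2}) e"
    show "cc \<alpha> = 0" by (rule mvmono_independent_on[OF _ a]) (use z in auto)
  qed
  then show ?thesis using G(2) by linarith
qed

section \<open>Linear changes of coordinates\<close>

lemma linear_map_inverse: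
  fixes f :: "complex^'i \<Rightarrow> complex^'i"
  assumes f: "linear_map f" and inj: "\<And>u. f u = 0 \<Longrightarrow> u = 0"
  shows "\<exists>g. linear_map g \<and> (\<forall>u. f (g u) = u) \<and> (\<forall>u. g (f u) = u)"
proof -
  have lin: "Vector_Spaces.linear (*s) (*s) f"
    using f unfolding linear_map_def Vector_Spaces.linear_iff using vec.vector_space_axioms by blast
  have "inj f"
  proof (rule injI)
    fix x y assume "f x = f y"
    moreover have "f (x - y) = f x - f y"
      using f unfolding linear_map_def by (metis add_diff_cancel_right' diff_add_cancel)
    ultimately show "x = y" using inj[of "x - y"] by simp
  qed
  then have "surj f" using vec.linear_inj_imp_surj[OF lin] by blast
  have fg: "f (inv f u) = u" for u using \<open>surj f\<close> by (rule surj_f_inv_f)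
  have gf: "inv f (f u) = u" for u using \<open>inj f\<close> by simp
  have "inv f (x + y) = inv f x + inv f y" for x y
    using f gf[of "inv f x + inv f y"] unfolding linear_map_def by (simp add: fg)
  moreover have "inv f (c *s x) = c *s inv f x" for c x
    using f gf[of "c *s inv f x"] unfolding linear_map_def by (simp add: fg)
  ultimately have "linear_map (inv f)" by (simp add: linear_map_def)
  then show ?thesis using fg gf by blast
qed

lemma adapted_coordinates:
  fixes l0 l1 :: "complex^'i \<Rightarrow> complex"
  assumes l: "l0 \<in> linear_forms" "l1 \<in> linear_forms" and nz: "\<exists>u. l1 u \<noteq> 0" and indep: "\<not> (\<exists>c. \<forall>u. l0 u = c * l1 u)"
  shows "\<exists>M N j1 j2. linear_map M \<and> linear_map N \<and> (\<forall>x. M (N x) = x) \<and> (\<forall>x. N (M x) = x) \<and> j1 \<noteq> j2 \<and>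
    (\<forall>x. l0 (M x) = x $ j1) \<and> (\<forall>x. l1 (M x) = x $ j2)"
proof -
  have "\<exists>j2. l1 (axis j2 1) \<noteq> 0"
  proof (rule ccontr)
    assume "\<not> ?thesis"
    then have "l1 u = 0" for u by (subst linear_forms_expand[OF l(2)]) simp
    then show False using nz by blast
  qed
  then obtain j2 where j2: "l1 (axis j2 1) \<noteq> 0" by blast
  \<comment> \<open>A nonzero two-by-two minor of the coefficients of \<open>l0\<close> and
    \<open>l1\<close>; it allows these forms to replace the coordinates \<open>j1\<close> and
    \<open>j2\<close>.\<close>
  have "\<exists>j1. l0 (axis j1 1) * l1 (axis j2 1) \<noteq> l0 (axis j2 1) * l1 (axis j1 1)"
  proof (rule ccontr)
    assume *: "\<not> ?thesis"
    have "l0 (axis j 1) = l0 (axis j2 1) / l1 (axis j2 1) * l1 (axis j 1)" for j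
      using * j2 by (simp add: field_simps)
    moreover define c where "c = l0 (axis j2 1) / l1 (axis j2 1)"
    ultimately have c: "l0 (axis j 1) = c * l1 (axis j 1)" for j by blast
    have "l0 u = c * l1 u" for u
      unfolding linear_forms_expand[OF l(1), of u] linear_forms_expand[OF l(2), of u] c
      by (simp add: sum_distrib_left mult.left_commute)
    then show False using indep by blast
  qed
  then obtain j1 where j1: "l0 (axis j1 1) * l1 (axis j2 1) \<noteq> l0 (axis j2 1) * l1 (axis j1 1)" by blast
  then have j12: "j1 \<noteq> j2" by auto
  define N where "N u = (\<chi> i. if i = j1 then l0 u else if i = j2 then l1 u else u $ i)" for u
  have N: "linear_map N"
    unfolding linear_map_def N_def by (auto simp: vec_eq_iff linear_formsD[OF l(1)] linear_formsD[OF l(2)])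
  have "u = 0" if "N u = 0" for u
  proof -
    have N0: "N u $ i = 0" for i using that by simp
    have *: "u $ i = 0" if "i \<noteq> j1" "i \<noteq> j2" for i using N0[of i] that by (simp add: N_def)
    have ex: "\<alpha> u = u $ j1 * \<alpha> (axis j1 1) + u $ j2 * \<alpha> (axis j2 1)" if "\<alpha> \<in> linear_forms" for \<alpha>
    proof -
      have "\<alpha> u = (\<Sum>i\<in>{j1, j2}. u $ i * \<alpha> (axis i 1))"
        unfolding linear_forms_expand[OF that, of u] using * by (intro sum.mono_neutral_right) auto
      then show ?thesis using j12 by simp
    qed
    have e0: "u $ j1 * l0 (axis j1 1) + u $ j2 * l0 (axis j2 1) = 0" using N0[of j1] ex[OF l(1)] by (simp add: N_def)
    have e1: "u $ j1 * l1 (axis j1 1) + u $ j2 * l1 (axis j2 1) = 0" using N0[of j2] ex[OF l(2)] j12 by (simp add: N_def)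
    have "u $ j1 * (l0 (axis j1 1) * l1 (axis j2 1) - l0 (axis j2 1) * l1 (axis j1 1)) =
      (u $ j1 * l0 (axis j1 1) + u $ j2 * l0 (axis j2 1)) * l1 (axis j2 1) - (u $ j1 * l1 (axis j1 1) + u $ j2 * l1 (axis j2 1)) * l0 (axis j2 1)"
      by (simp add: algebra_simps)
    then have u1: "u $ j1 = 0" using e0 e1 j1 by simp
    then have "u $ j2 = 0" using e1 j2 by simp
    then show ?thesis using * u1 by (metis vec_eq_iff zero_index)
  qed
  from linear_map_inverse[OF N this] obtain M where M: "linear_map M" "\<And>u. N (M u) = u" "\<And>u. M (N u) = u" by blast
  have "l0 (M x) = x $ j1" for x using M(2)[of x] j12 by (auto simp: N_def vec_eq_iff dest: spec[of _ j1])
  moreover have "l1 (M x) = x $ j2" for x using M(2)[of x] j12 by (auto simp: N_def vec_eq_iff dest: spec[of _ j2])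
  ultimately show ?thesis using M N j12 by blast
qed

section \<open>Derivatives of cones\<close>

lemma deriv_on_power: "deriv_on UNIV \<delta> \<Longrightarrow> \<delta> (x ^ n) = of_nat n * x ^ (n - 1) * \<delta> x"
proof (induction n)
  case 0 then show ?case by (simp add: deriv_on_simps)
next
  case (Suc n)
  then show ?case by (cases n) (simp_all add: deriv_on_simps(2) algebra_simps)
qed

lemma deriv_on_prod:
  assumes "deriv_on UNIV \<delta>" "finite A"
  shows "\<delta> (\<Prod>i\<in>A. x i) = (\<Sum>i\<in>A. \<delta> (x i) * (\<Prod>j\<in>A - {i}. x j))"
  using assms(2)
proof (induction A)
  case empty then show ?case by (simp add: deriv_on_simps[OF assms(1)])
next
  case (insert a A)
  have "(\<Prod>j\<in>insert a A - {i}. x j) = x a * (\<Prod>j\<in>A - {i}. x j)" if "i \<in> A" for i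
  proof -
    have "insert a A - {i} = insert a (A - {i})" using that insert.hyps by auto
    then show ?thesis using insert.hyps by simp
  qed
  then have "(\<Sum>i\<in>A. \<delta> (x i) * (\<Prod>j\<in>insert a A - {i}. x j)) = x a * (\<Sum>i\<in>A. \<delta> (x i) * (\<Prod>j\<in>A - {i}. x j))"
    by (simp add: sum_distrib_left mult.left_commute)
  moreover have "insert a A - {a} = A" using insert.hyps by auto
  ultimately show ?case using insert by (simp add: deriv_on_simps(2)[OF assms(1)])
qed

lemma nat_point_deriv: "deriv_on UNIV \<delta> \<Longrightarrow> nat_point u \<Longrightarrow> \<delta> (u $ i) = 0"
  unfolding nat_point_def using deriv_on_simps(5) by metis

text \<open>The chain rule; the \<open>G i\<close> are the partial derivatives. They are chosen
  before \<open>\<delta>\<close>, and this uniformity is what lets them belong to a fixed spanning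
  family.\<close>

lemma hform_derivation:
  "\<exists>G. (\<forall>i. G i \<in> vpolys) \<and> (\<forall>\<delta> w. deriv_on UNIV \<delta> \<longrightarrow>
    \<delta> (hform m c w) = hform m (\<lambda>\<alpha>. \<delta> (c \<alpha>)) w + (\<Sum>i\<in>UNIV. G i w * \<delta> (w $ i)))"
proof -
  define T where "T \<alpha> i w = of_nat (\<alpha> i) * (w $ i) ^ (\<alpha> i - 1) * (\<Prod>j\<in>UNIV - {i}. (w $ j) ^ \<alpha> j)" for \<alpha> :: "'a \<Rightarrow> nat" and i and w :: "complex^'a"
  define G where "G i w = (\<Sum>\<alpha>\<in>mons UNIV m. c \<alpha> * T \<alpha> i w)" for i w
  have "G i \<in> vpolys" for i unfolding G_def[abs_def] T_def by (intro vpolys_intros)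
  moreover have "\<delta> (hform m c w) = hform m (\<lambda>\<alpha>. \<delta> (c \<alpha>)) w + (\<Sum>i\<in>UNIV. G i w * \<delta> (w $ i))"
    if d: "deriv_on UNIV \<delta>" for \<delta> w
  proof -
    have m: "\<delta> (mvmono \<alpha> w) = (\<Sum>i\<in>UNIV. T \<alpha> i w * \<delta> (w $ i))" for \<alpha>
      unfolding mvmono_def deriv_on_prod[OF d finite] T_def deriv_on_power[OF d]
      by (intro sum.cong) (simp_all add: mult_ac)
    have "\<delta> (hform m c w) = (\<Sum>\<alpha>\<in>mons UNIV m. c \<alpha> * \<delta> (mvmono \<alpha> w) + \<delta> (c \<alpha>) * mvmono \<alpha> w)"
      unfolding hform_def deriv_on_simps(8)[OF d] deriv_on_simps(2)[OF d] ..
    also have "\<dots> = hform m (\<lambda>\<alpha>. \<delta> (c \<alpha>)) w + (\<Sum>\<alpha>\<in>mons UNIV m. \<Sum>i\<in>UNIV. c \<alpha> * T \<alpha> i w * \<delta> (w $ i))"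
      unfolding m by (simp add: sum.distrib hform_def sum_distrib_left mult.assoc)
    also have "(\<Sum>\<alpha>\<in>mons UNIV m. \<Sum>i\<in>UNIV. c \<alpha> * T \<alpha> i w * \<delta> (w $ i)) = (\<Sum>i\<in>UNIV. G i w * \<delta> (w $ i))"
      unfolding G_def by (subst sum.swap) (simp add: sum_distrib_right)
    finally show ?thesis .
  qed
  ultimately show ?thesis by (intro exI[of _ G]) blast
qed

lemma hform_derivation_nat:
  assumes d: "deriv_on UNIV \<delta>" and u: "nat_point u"
  shows "\<delta> (hform m c u) = hform m (\<lambda>\<alpha>. \<delta> (c \<alpha>)) u"
proof -
  obtain G where G: "\<And>\<delta> w. deriv_on UNIV \<delta> \<Longrightarrow>
      \<delta> (hform m c w) = hform m (\<lambda>\<alpha>. \<delta> (c \<alpha>)) w + (\<Sum>i\<in>UNIV. G i w * \<delta> (w $ i))"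
    using hform_derivation[of m c] by blast
  show ?thesis unfolding G[OF d] by (simp add: nat_point_deriv[OF d u])
qed

lemma forms_derivation:
  assumes "deriv_on UNIV \<delta>" "g \<in> forms c"
  shows "\<exists>g'\<in>forms c. \<forall>u. nat_point u \<longrightarrow> \<delta> (g u) = g' u"
proof -
  obtain e where "g = hform c e" using assms(2) unfolding forms_eq_hforms by blast
  then show ?thesis
    using hform_derivation_nat[OF assms(1), of _ c e] unfolding forms_eq_hforms by blast
qed

lemma linear_map_project: "linear_map (\<lambda>u. u - u $ jj *s v)"
  by (auto simp: linear_map_def vec_eq_iff algebra_simps)

text \<open>A cone is a polynomial in \<open>u - u $ jj *s v\<close>. Differentiating its
  coefficients gives another cone \<open>b\<close>; differentiating \<open>v\<close> gives the
  functions \<open>G i\<close>, fixed in advance, with scalar factors. The normalization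
  \<open>v $ jj = 1\<close> removes the index \<open>jj\<close>.\<close>

lemma cone_derivation:
  fixes v :: "complex^'i"
  assumes q: "q \<in> forms m" "cone_over v q" and v: "v $ jj = 1"
  shows "\<exists>G. (\<forall>i. G i \<in> vpolys) \<and> (\<forall>\<delta>. deriv_on UNIV \<delta> \<longrightarrow> (\<exists>b\<in>forms m. cone_over v b \<and>
    (\<forall>u. nat_point u \<longrightarrow> \<delta> (q u) = b u - (\<Sum>i\<in>UNIV - {jj}. \<delta> (v $ i) * G i u))))"
proof -
  let ?\<pi> = "\<lambda>u. u - u $ jj *s v"
  obtain c where c: "q = hform m c" using q(1) unfolding forms_eq_hforms by blast
  obtain G where G: "\<And>i. G i \<in> vpolys" "\<And>\<delta> w. deriv_on UNIV \<delta> \<Longrightarrow>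
      \<delta> (hform m c w) = hform m (\<lambda>\<alpha>. \<delta> (c \<alpha>)) w + (\<Sum>i\<in>UNIV. G i w * \<delta> (w $ i))"
    using hform_derivation[of m c] by blast
  have G': "(\<lambda>u. u $ jj * G i (?\<pi> u)) \<in> vpolys" for i
    by (intro vpolys_mult vpolys_coord vpolys_compose[OF G(1)]) (simp, intro vpolys_intros)
  have "\<exists>b\<in>forms m. cone_over v b \<and> (\<forall>u. nat_point u \<longrightarrow> \<delta> (q u) = b u - (\<Sum>i\<in>UNIV - {jj}. \<delta> (v $ i) * (u $ jj * G i (?\<pi> u))))"
    if d: "deriv_on UNIV \<delta>" for \<delta>
  proof (intro bexI conjI allI impI)
    let ?b = "\<lambda>u. hform m (\<lambda>\<alpha>. \<delta> (c \<alpha>)) (?\<pi> u)"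
    have "hform m (\<lambda>\<alpha>. \<delta> (c \<alpha>)) \<in> forms m" unfolding forms_eq_hforms by blast
    then show "?b \<in> forms m" using forms_compose[OF _ linear_map_project] by blast
    have "?\<pi> (u + s *s v) = ?\<pi> u" for u s by (simp add: vec_eq_iff v algebra_simps)
    then show "cone_over v ?b" unfolding cone_over_def by (simp only: simp_thms)
    fix u :: "complex^'i" assume u: "nat_point u"
    have "q (u + (- (u $ jj)) *s v) = q u" using q(2) unfolding cone_over_def by blast
    then have "q u = hform m c (?\<pi> u)" by (simp add: c)
    then have "\<delta> (q u) = ?b u + (\<Sum>i\<in>UNIV. G i (?\<pi> u) * \<delta> (?\<pi> u $ i))" using G(2)[OF d] by simp
    also have "(\<Sum>i\<in>UNIV. G i (?\<pi> u) * \<delta> (?\<pi> u $ i)) = (\<Sum>i\<in>UNIV. - (\<delta> (v $ i) * (u $ jj * G i (?\<pi> u))))"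
    proof (intro sum.cong refl)
      fix i
      have "\<delta> (?\<pi> u $ i) = - (u $ jj * \<delta> (v $ i))"
        by (simp add: deriv_on_simps(7,2)[OF d] nat_point_deriv[OF d u])
      then show "G i (?\<pi> u) * \<delta> (?\<pi> u $ i) = - (\<delta> (v $ i) * (u $ jj * G i (?\<pi> u)))" by (simp only: mult_ac mult_minus_right)
    qed
    also have "\<dots> = - (\<Sum>i\<in>UNIV - {jj}. \<delta> (v $ i) * (u $ jj * G i (?\<pi> u)))"
      by (simp add: sum.remove[of UNIV jj] sum_negf v deriv_on_simps(4)[OF d])
    finally show "\<delta> (q u) = ?b u - (\<Sum>i\<in>UNIV - {jj}. \<delta> (v $ i) * (u $ jj * G i (?\<pi> u)))" by simp
  qed
  then show ?thesis using G' by (intro exI[of _ "\<lambda>i u. u $ jj * G i (?\<pi> u)"]) blast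
qed

section \<open>Forms vanishing on a subspace of codimension two\<close>

text \<open>Dividing by \<open>l1\<close> and then by \<open>l0\<close> leaves as remainder the
  values on the common kernel, which are zero. The cofactor \<open>r\<close> inherits the cone
  property since \<open>l0 * r\<close> is a cone over \<open>v\<close> and \<open>l0\<close> is
  constant along \<open>v\<close>.\<close>

lemma forms_split:
  fixes q :: "complex^'i \<Rightarrow> complex"
  assumes q: "q \<in> forms m" and l: "l0 \<in> linear_forms" "l1 \<in> linear_forms"
    and w: "l0 w = 1" "l1 w = 0" "l0 w' = 0" "l1 w' = 1"
    and z: "\<And>u. l0 u = 0 \<Longrightarrow> l1 u = 0 \<Longrightarrow> q u = 0"
  shows "\<exists>r\<in>forms (m - 1). \<exists>s\<in>forms (m - 1). (\<forall>u. q u = l0 u * r u + l1 u * s u) \<and>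
    (\<forall>v. l0 v = 0 \<longrightarrow> l1 v = 0 \<longrightarrow> cone_over v q \<longrightarrow> cone_over v r)"
proof -
  obtain s where s: "s \<in> forms (m - 1)" "\<And>u. q u - q (u - l1 u *s w') = l1 u * s u"
    using forms_factor[OF q l(2), of w'] by blast
  define q1 where "q1 u = q (u - l1 u *s w')" for u
  have lm: "linear_map (\<lambda>u. u - l1 u *s w')"
    by (auto simp: linear_map_def vec_eq_iff algebra_simps linear_formsD[OF l(2)])
  have q1: "q1 \<in> forms m" unfolding q1_def[abs_def] by (rule forms_compose[OF q lm])
  obtain r where r: "r \<in> forms (m - 1)" "\<And>u. q1 u - q1 (u - l0 u *s w) = l0 u * r u"
    using forms_factor[OF q1 l(1), of w] by blast
  have z1: "q1 (u - l0 u *s w) = 0" for u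
    unfolding q1_def by (rule z) (simp_all add: linear_formsD[OF l(1)] linear_formsD[OF l(2)] w)
  have q1r: "q1 u = l0 u * r u" for u using r(2)[of u] z1[of u] by simp
  have eq: "q u = l0 u * r u + l1 u * s u" for u using s(2)[of u] q1r[of u] by (simp add: q1_def algebra_simps)
  have "cone_over v r" if v: "l0 v = 0" "l1 v = 0" "cone_over v q" for v
    unfolding cone_over_def
  proof (intro allI)
    fix u t
    have l0v: "l0 (y + t *s v) = l0 y" and l1v: "l1 (y + t *s v) = l1 y" for y
      using v by (simp_all add: linear_formsD[OF l(1)] linear_formsD[OF l(2)])
    have q1c: "q1 (y + t *s v) = q1 y" for y
    proof -
      have "q1 (y + t *s v) = q ((y - l1 y *s w') + t *s v)" unfolding q1_def l1v by (simp add: algebra_simps)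
      then show ?thesis using v(3) unfolding cone_over_def q1_def by simp
    qed
    have *: "l0 y * (r (y + t *s v) - r y) = 0" for y
    proof -
      have "l0 y * r (y + t *s v) = l0 y * r y"
        using q1c[of y] unfolding q1r l0v .
      then show ?thesis by (simp only: right_diff_distrib diff_self)
    qed
    have "(\<lambda>y. r (y + t *s v)) \<in> vpolys"
      by (rule vpolys_compose[OF forms_vpolys[OF r(1)]]) (simp, intro vpolys_intros)
    then have "(\<lambda>y. r (y + t *s v) - r y) \<in> vpolys" using forms_vpolys[OF r(1)] by (rule vpolys_diff)
    then have "(\<forall>y\<in>UNIV. l0 y = 0) \<or> (\<forall>y\<in>UNIV. r (y + t *s v) - r y = 0)"
      by (rule vpolys_domain[OF linear_forms_vpolys[OF l(1)]]) (use * in \<open>auto simp: line_closed_def\<close>)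
    then show "r (u + t *s v) = r u" using w(1) by auto
  qed
  then show ?thesis using r(1) s(1) eq by blast
qed

text \<open>The exponent is the order of vanishing of \<open>q\<close> along \<open>l1 = 0\<close>
  inside the hyperplane \<open>l0 = 0\<close>. While \<open>q\<close> vanishes on the intersection,
  a factor \<open>l1\<close> splits off modulo \<open>l0\<close>; the degree drops, so this
  stops.\<close>

lemma forms_order:
  fixes q :: "complex^'i \<Rightarrow> complex"
  assumes l: "l0 \<in> linear_forms" "l1 \<in> linear_forms" and w: "l0 w = 1" "l1 w = 0" "l0 w' = 0" "l1 w' = 1"
    and q: "q \<in> forms m" and nz: "\<exists>u. l0 u = 0 \<and> q u \<noteq> 0"
  shows "\<exists>e. \<exists>r\<in>vpolys. \<exists>s\<in>vpolys. (\<forall>u. q u = l1 u ^ e * r u + l0 u * s u) \<and> (\<exists>u. l0 u = 0 \<and> l1 u = 0 \<and> r u \<noteq> 0)"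
  using q nz
proof (induction m arbitrary: q rule: less_induct)
  case (less m)
  show ?case
  proof (cases "\<exists>u. l0 u = 0 \<and> l1 u = 0 \<and> q u \<noteq> 0")
    case True
    have "\<forall>u. q u = l1 u ^ 0 * q u + l0 u * 0" by simp
    moreover have "q \<in> vpolys" "(\<lambda>_. 0) \<in> vpolys" using forms_vpolys[OF less.prems(1)] vpolys_const by blast+
    ultimately show ?thesis using True
      by (rule_tac exI[of _ "0::nat"], rule_tac bexI[of _ q], rule_tac bexI[of _ "\<lambda>_. 0"]) simp_all
  next
    case False
    have "m \<noteq> 0"
    proof
      assume "m = 0"
      then obtain c where "q = hform 0 c" using less.prems(1) unfolding forms_eq_hforms by blast
      then have "q u = q 0" for u by (simp add: hform_0)
      moreover have "q 0 = 0" using False linear_formsD(3)[OF l(1)] linear_formsD(3)[OF l(2)] by blast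
      ultimately show False using less.prems(2) by metis
    qed
    obtain s r where sr: "s \<in> forms (m - 1)" "r \<in> forms (m - 1)" "\<And>u. q u = l0 u * s u + l1 u * r u"
      using forms_split[OF less.prems(1) l w] False by blast
    have "\<exists>u. l0 u = 0 \<and> r u \<noteq> 0" using less.prems(2) sr(3) by force
    from less.IH[OF _ sr(2) this] \<open>m \<noteq> 0\<close> obtain e r' s' where r': "r' \<in> vpolys" "s' \<in> vpolys"
      "\<And>u. r u = l1 u ^ e * r' u + l0 u * s' u" "\<exists>u. l0 u = 0 \<and> l1 u = 0 \<and> r' u \<noteq> 0" by auto
    have "q u = l1 u ^ Suc e * r' u + l0 u * (s u + l1 u * s' u)" for u
      unfolding sr(3) r'(3) by (simp add: algebra_simps)
    moreover have "(\<lambda>u. s u + l1 u * s' u) \<in> vpolys"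
      by (intro vpolys_add vpolys_mult forms_vpolys[OF sr(1)] linear_forms_vpolys l r')
    ultimately show ?thesis using r'(1,4) by (intro exI[of _ "Suc e"] bexI[of _ r'] bexI[of _ "\<lambda>u. s u + l1 u * s' u"]) auto
  qed
qed

section \<open>Numerical consequences of the hypothesis\<close>

text \<open>The negation of the bound in \<open>count_transversal\<close> for
  \<open>e = d - 1\<close>, \<open>c = d - m\<close> and \<open>2n - 1\<close> extra functions.
  Pascal's rule turns the difference of the leading terms of A and H into the number of monomials of
  degree \<open>d - 1\<close> on a hyperplane.\<close>

lemma numerical_transversal:
  assumes "n \<ge> 2" "m \<ge> 1" "d \<ge> m" and hyp: "A_num n d m - H_num n d m > D_num n m"
  shows "((2*n - 1) + (d - 1) - 1 choose (d - 1)) + ((2*n - 2) + (d - m) - 1 choose (d - m)) + 1 >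
    ((2*n - 1) + (d - m) - 1 choose (d - m)) + ((2*n - 2) + m - 1 choose m) + (2*n - 1)"
proof -
  define p where "p = 2*n - 3"
  have n: "2*n - 2 = Suc p" "2*n - 1 = Suc (Suc p)" "2*n - 3 = p" using assms(1) by (auto simp: p_def)
  have ni: "2 * int n = int p + 3" using assms(1) by (simp add: p_def)
  define c where "c = d - m"
  have d: "d = c + m" using assms by (simp add: c_def)
  obtain m' where m: "m = Suc m'" using assms(2) by (cases m) auto
  have e: "d + Suc p - m = Suc p + c" "d + p - m = p + c" using d by auto
  have pas: "(d + Suc p choose Suc p) = (d + p choose p) + (p + d choose Suc p)"
    by (simp add: add.commute)
  have "A_num n d m - H_num n d m = int (p + d choose Suc p) - int (Suc p + c choose Suc p) + int (p + c choose p)"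
    unfolding A_num_def H_num_def n e pas by (simp add: add.commute[of c])
  moreover have "D_num n m = int (m + p choose m) + int p + 1"
    unfolding D_num_def n ni by simp
  moreover have "(Suc (Suc p) + (d - 1) - 1 choose (d - 1)) = (p + d choose Suc p)"
  proof -
    have "Suc (Suc p) + (d - 1) - 1 = p + d" using d m by simp
    moreover have "(p + d choose (d - 1)) = (p + d choose Suc p)"
      using binomial_symmetric[of "Suc p" "p + d"] d m by simp
    ultimately show ?thesis by simp
  qed
  moreover have "(Suc p + (d - m) - 1 choose (d - m)) = (p + c choose p)"
    using binomial_symmetric[of c "p + c"] by (simp add: c_def)
  moreover have "(Suc (Suc p) + (d - m) - 1 choose (d - m)) = (Suc p + c choose Suc p)"
    using binomial_symmetric[of c "Suc p + c"] by (simp add: c_def)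
  moreover have "(Suc p + m - 1 choose m) = (m + p choose m)"
    by (simp add: add.commute)
  ultimately show ?thesis
    using hyp unfolding n by linarith
qed

text \<open>The negation of the bound in \<open>count_special\<close> for cones of degree
  \<open>m - 1\<close> and one extra function. Pascal's rule and monotonicity give it except for
  \<open>d = m = 2\<close>, where both sides agree but the hypothesis on A, H and D fails.\<close>

lemma numerical_special:
  assumes "n \<ge> 2" "m \<ge> 2" "d \<ge> m" and hyp: "A_num n d m - H_num n d m > D_num n m"
  shows "((2*n - 1) + (d - 1) - 1 choose (d - 1)) >
    ((2*n - 1) + (d - m) - 1 choose (d - m)) + ((2*n - 2) + (m - 1) - 1 choose (m - 1))"
proof -
  define p where "p = 2*n - 3"
  have n: "2*n - 2 = Suc p" "2*n - 1 = Suc (Suc p)" "2*n - 3 = p" and p: "p \<ge> 1" using assms(1) by (auto simp: p_def)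
  have ni: "2 * int n = int p + 3" using assms(1) by (simp add: p_def)
  define c where "c = d - m"
  have d: "d = c + m" using assms by (simp add: c_def)
  obtain m' where m: "m = Suc (Suc m')" using assms(2) by (metis add_2_eq_Suc le_Suc_ex)
  have s1: "(Suc p + (d - 1) choose (d - 1)) = (Suc p + (d - 1) choose Suc p)"
    using binomial_symmetric[of "d - 1" "Suc p + (d - 1)"] by simp
  have s2: "(p + Suc m' choose Suc m') = (p + Suc m' choose p)" using binomial_symmetric[of "Suc m'" "p + Suc m'"] by simp
  have s3: "(Suc p + c choose c) = (Suc p + c choose Suc p)" using binomial_symmetric[of c "Suc p + c"] by simp
  have pas: "(Suc p + (d - 1) choose Suc p) = (p + c + Suc m' choose p) + (p + c + Suc m' choose Suc p)"
  proof -
    have "Suc p + (d - 1) = Suc (p + c + Suc m')" using d m by simp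
    then show ?thesis by (simp only: binomial_Suc_Suc)
  qed
  have b1: "(p + Suc m' choose p) \<le> (p + c + Suc m' choose p)" by (rule binomial_right_mono) simp
  have b2: "(Suc p + c choose Suc p) \<le> (p + c + Suc m' choose Suc p)" by (rule binomial_right_mono) simp
  consider "c > 0" | "c = 0" "m' > 0" | "c = 0" "m' = 0" by blast
  then have "(Suc p + c choose Suc p) + (p + Suc m' choose p) < (p + c + Suc m' choose p) + (p + c + Suc m' choose Suc p)"
  proof cases
    case 1
    then obtain c' where c': "c = Suc c'" by (cases c) auto
    obtain p' where p': "p = Suc p'" using p by (cases p) auto
    have "(p + c + Suc m' choose p) = (p + c' + Suc m' choose p') + (p + c' + Suc m' choose p)" by (simp add: c' p')
    moreover have "(p + c' + Suc m' choose p') > 0" by (simp add: p')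
    moreover have "(p + Suc m' choose p) \<le> (p + c' + Suc m' choose p)" by (rule binomial_right_mono) simp
    ultimately show ?thesis using b2 by linarith
  next
    case 2
    then obtain m'' where m'': "m' = Suc m''" by (cases m') auto
    have "(p + c + Suc m' choose Suc p) = (p + c + m' choose p) + (p + c + m' choose Suc p)" by simp
    moreover have "(p + c + m' choose p) > 0" by simp
    moreover have "(Suc p + c choose Suc p) \<le> (p + c + m' choose Suc p)" by (rule binomial_right_mono) (simp add: m'')
    ultimately show ?thesis using b1 by linarith
  next
    case 3
    then have dm: "d = 2" "m = 2" using d m by auto
    have e: "2 + Suc p = Suc (Suc (Suc p))" "2 + p = Suc (Suc p)" by auto
    have "(Suc (Suc p) choose Suc p) = Suc (Suc p)" using binomial_symmetric[of "Suc p" "Suc (Suc p)"] by simp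
    moreover have "(Suc (Suc (Suc p)) choose Suc p) = (Suc (Suc p) choose p) + (Suc (Suc p) choose Suc p)"
      by (rule binomial_Suc_Suc)
    moreover have "A_num n d m - H_num n d m = int (Suc (Suc (Suc p)) choose Suc p) - int (Suc (Suc p) choose p)"
      unfolding A_num_def H_num_def n dm e by simp
    moreover have "D_num n m = int (Suc (Suc p) choose 2) + int p + 1"
      unfolding D_num_def n dm e ni by simp
    moreover have "(Suc (Suc p) choose 2) > 0" by (simp add: zero_less_binomial)
    ultimately have "D_num n m \<ge> A_num n d m - H_num n d m" by linarith
    then show ?thesis using hyp by linarith
  qed
  moreover have "(Suc (Suc p) + (d - 1) - 1 choose (d - 1)) = (Suc p + (d - 1) choose (d - 1))" by simp
  moreover have "(Suc (Suc p) + (d - m) - 1 choose (d - m)) = (Suc p + c choose c)" by (simp add: c_def)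
  moreover have "(Suc p + (m - 1) - 1 choose (m - 1)) = (p + Suc m' choose Suc m')" by (simp add: m)
  ultimately show ?thesis
    unfolding n using s1 s2 s3 pas by linarith
qed

section \<open>Uniqueness of the hyperplane\<close>

lemma symplectic_formD:
  assumes "symplectic_form \<omega>"
  shows "\<omega> v \<in> linear_forms" "(\<lambda>v. \<omega> v u) \<in> linear_forms" "\<omega> v v = 0" "(\<And>u. \<omega> v u = 0) \<Longrightarrow> v = 0"
    "\<omega> (v + w) u = \<omega> v u + \<omega> w u" "\<omega> (c *s v) u = c * \<omega> v u" "\<omega> (v - w) u = \<omega> v u - \<omega> w u" "\<omega> 0 u = 0"
    "\<omega> v w = - \<omega> w v"
proof -
  show a: "\<omega> v \<in> linear_forms" and b: "(\<lambda>v. \<omega> v u) \<in> linear_forms" and c: "\<omega> v v = 0" for u v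
    using assms by (auto simp: symplectic_form_def)
  show "v = 0" if "\<And>u. \<omega> v u = 0" using assms that by (auto simp: symplectic_form_def)
  show add: "\<omega> (v + w) u = \<omega> v u + \<omega> w u" for v w u using linear_formsD(1)[OF b] .
  show "\<omega> (c *s v) u = c * \<omega> v u" using linear_formsD(2)[OF b] .
  show "\<omega> (v - w) u = \<omega> v u - \<omega> w u" using linear_formsD(5)[OF b] .
  show "\<omega> 0 u = 0" using linear_formsD(3)[OF b] .
  have "\<omega> (v + w) (v + w) = \<omega> v (v + w) + \<omega> w (v + w)" by (rule add)
  also have "\<dots> = \<omega> v w + \<omega> w v" by (simp add: linear_formsD(1)[OF a] c)
  finally have "\<omega> v w + \<omega> w v = 0" using c[of "v + w"] by simp
  then show "\<omega> v w = - \<omega> w v" by (simp add: eq_neg_iff_add_eq_0)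
qed

lemma omega_expand:
  assumes "symplectic_form \<omega>"
  shows "\<omega> v u = (\<Sum>i\<in>UNIV. \<Sum>j\<in>UNIV. v $ i * (u $ j * \<omega> (axis i 1) (axis j 1)))"
proof -
  have "\<omega> v u = (\<Sum>i\<in>UNIV. v $ i * \<omega> (axis i 1) u)"
    using linear_forms_expand[OF symplectic_formD(2)[OF assms]] .
  also have "\<dots> = (\<Sum>i\<in>UNIV. v $ i * (\<Sum>j\<in>UNIV. u $ j * \<omega> (axis i 1) (axis j 1)))"
    by (intro sum.cong arg_cong2[where f = "(*)"] linear_forms_expand symplectic_formD(1)[OF assms] refl)
  finally show ?thesis by (simp add: sum_distrib_left)
qed

lemma omega_vpolys: "symplectic_form \<omega> \<Longrightarrow> \<omega> v \<in> vpolys"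
  by (intro linear_forms_vpolys symplectic_formD(1))

lemma vpolys_eq_from_nat:
  assumes "F \<in> vpolys" "G \<in> vpolys" "\<And>u. nat_point u \<Longrightarrow> F u = G u"
  shows "F u = G u"
  using vpolys_eq_on_nat[OF assms] by simp

lemma omega_derivation:
  assumes w: "symplectic_form \<omega>" and d: "deriv_on UNIV \<delta>" "\<And>i j. \<delta> (\<omega> (axis i 1) (axis j 1)) = 0" and u: "nat_point u"
  shows "\<delta> (\<omega> v u) = \<omega> (\<chi> i. \<delta> (v $ i)) u"
  unfolding omega_expand[OF w, of v u] omega_expand[OF w, of "\<chi> i. \<delta> (v $ i)" u] deriv_on_simps(8)[OF d(1)] deriv_on_simps(2)[OF d(1)]
  by (simp add: d(2) nat_point_deriv[OF d(1) u])

lemma cone_over_pullback: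
  assumes M: "linear_map M" "\<And>x. M (N x) = x" and b: "cone_over v b"
  shows "cone_over (N v) (\<lambda>x. b (M x))"
  unfolding cone_over_def
proof (intro allI)
  fix u s
  have "M (u + s *s N v) = M u + s *s v" using M unfolding linear_map_def by simp
  then show "b (M (u + s *s N v)) = b (M u)" using b unfolding cone_over_def by simp
qed

lemma card_coordinate_complements:
  fixes j1 j2 :: "'i::finite"
  assumes "CARD('i) = 2 * n" "j1 \<noteq> j2"
  shows "card (- {j2}) = 2 * n - 1" "card (- {j1, j2}) = 2 * n - 2" "card (- {j2, j1}) = 2 * n - 2"
  using assms by (auto simp: Compl_eq_Diff_UNIV card_Diff_subset)

text \<open>The coordinate-free form of \<open>count_monomials_transversal\<close>: in adapted
  coordinates \<open>l0\<close> and \<open>l1\<close> are coordinate functions and the cardinalities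
  are binomials.\<close>

lemma count_transversal:
  fixes q g :: "complex^'i \<Rightarrow> complex" and E :: "'k \<Rightarrow> complex^'i \<Rightarrow> complex"
  assumes n: "CARD('i) = 2 * n" and l: "l0 \<in> linear_forms" "l1 \<in> linear_forms" "\<exists>u. l1 u \<noteq> 0" "\<not> (\<exists>c. \<forall>u. l0 u = c * l1 u)"
    and v: "v \<noteq> 0" "l1 v = 0" and q: "q \<in> forms m" "cone_over v q" and nz: "\<exists>u. l0 u = 0 \<and> l1 u = 0 \<and> q u \<noteq> 0"
    and g: "g \<in> forms c" and K: "finite K"
    and H: "\<And>\<psi>. \<psi> \<in> forms e \<Longrightarrow> \<exists>A b t. A \<in> forms c \<and> b \<in> forms m \<and> cone_over v b \<and>
      (\<forall>u. l1 u = 0 \<longrightarrow> l0 u * \<psi> u = q u * A u + g u * b u + (\<Sum>k\<in>K. t k * E k u))"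
  shows "((2*n - 1) + e - 1 choose e) + ((2*n - 2) + c - 1 choose c) + 1 \<le>
    ((2*n - 1) + c - 1 choose c) + ((2*n - 2) + m - 1 choose m) + card K"
proof -
  obtain M N j1 j2 where MN: "linear_map M" "linear_map N" "\<And>x. M (N x) = x" "\<And>x. N (M x) = x" "j1 \<noteq> j2"
    "\<And>x. l0 (M x) = x $ j1" "\<And>x. l1 (M x) = x $ j2"
    using adapted_coordinates[OF l] by metis
  have v2: "N v $ j2 = 0" using MN(7)[of "N v"] MN(3) v(2) by simp
  have "N v \<noteq> 0"
  proof
    assume "N v = 0"
    then have "v = M 0" using MN(3)[of v] by simp
    moreover have "M (0 *s 0) = 0 *s M 0" using MN(1) unfolding linear_map_def by blast
    ultimately show False using v(1) by simp
  qed
  then obtain jj where jj: "N v $ jj \<noteq> 0" by (metis vec_eq_iff zero_index)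
  then have jj2: "jj \<noteq> j2" using v2 by auto
  have "card (mons (- {j2}) e) + card (mons (- {j1, j2}) c) + 1 \<le>
    card (mons (- {j2}) c) + card (mons (- {j2, jj}) m) + card K"
  proof (rule count_monomials_transversal[OF jj v2 MN(5) _ _ _ _ K])
    show "(\<lambda>x. q (M x)) \<in> forms m" by (rule forms_compose[OF q(1) MN(1)])
    show "cone_over (N v) (\<lambda>x. q (M x))" by (rule cone_over_pullback[OF MN(1,3) q(2)])
    show "\<exists>x. x $ j1 = 0 \<and> x $ j2 = 0 \<and> q (M x) \<noteq> 0"
    proof -
      obtain u where "l0 u = 0" "l1 u = 0" "q u \<noteq> 0" using nz by blast
      then show ?thesis using MN(6)[of "N u"] MN(7)[of "N u"] by (intro exI[of _ "N u"]) (simp add: MN(3))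
    qed
    show "(\<lambda>x. g (M x)) \<in> forms c" by (rule forms_compose[OF g MN(1)])
    fix \<psi> :: "complex^'i \<Rightarrow> complex" assume "\<psi> \<in> forms e"
    then have "(\<lambda>x. \<psi> (N x)) \<in> forms e" by (rule forms_compose[OF _ MN(2)])
    from H[OF this] obtain A b t where Ab: "A \<in> forms c" "b \<in> forms m" "cone_over v b"
      "\<And>u. l1 u = 0 \<Longrightarrow> l0 u * \<psi> (N u) = q u * A u + g u * b u + (\<Sum>k\<in>K. t k * E k u)" by blast
    show "\<exists>A b t. A \<in> forms c \<and> b \<in> forms m \<and> cone_over (N v) b \<and>
      (\<forall>x. x $ j2 = 0 \<longrightarrow> x $ j1 * \<psi> x = q (M x) * A x + g (M x) * b x + (\<Sum>k\<in>K. t k * E k (M x)))"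
    proof (intro exI conjI allI impI)
      show "(\<lambda>x. A (M x)) \<in> forms c" by (rule forms_compose[OF Ab(1) MN(1)])
      show "(\<lambda>x. b (M x)) \<in> forms m" by (rule forms_compose[OF Ab(2) MN(1)])
      show "cone_over (N v) (\<lambda>x. b (M x))" by (rule cone_over_pullback[OF MN(1,3) Ab(3)])
      fix x :: "complex^'i" assume "x $ j2 = 0"
      then show "x $ j1 * \<psi> x = q (M x) * A (M x) + g (M x) * b (M x) + (\<Sum>k\<in>K. t k * E k (M x))"
        using Ab(4)[of "M x"] by (simp add: MN(4,6,7))
    qed
  qed
  then show ?thesis
    unfolding card_mons card_coordinate_complements[OF n MN(5)] card_coordinate_complements[OF n jj2] .
qed

lemma count_special:
  fixes q g :: "complex^'i \<Rightarrow> complex" and E :: "'k \<Rightarrow> complex^'i \<Rightarrow> complex"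
  assumes n: "CARD('i) = 2 * n" and l: "l0 \<in> linear_forms" "l1 \<in> linear_forms" "\<exists>u. l1 u \<noteq> 0" "\<not> (\<exists>c. \<forall>u. l0 u = c * l1 u)"
    and v: "v \<noteq> 0" "l1 v = 0" and q: "q \<in> forms m" "cone_over v q" and nz: "\<exists>u. l1 u = 0 \<and> q u \<noteq> 0"
    and g: "g \<in> forms c" and K: "finite K"
    and H: "\<And>\<psi>. \<psi> \<in> forms e \<Longrightarrow> \<exists>A b t. A \<in> forms c \<and> b \<in> forms m \<and> cone_over v b \<and>
      (\<forall>u. l1 u = 0 \<longrightarrow> \<psi> u = q u * A u + g u * b u + (\<Sum>k\<in>K. t k * E k u))"
  shows "((2*n - 1) + e - 1 choose e) + 1 \<le>
    ((2*n - 1) + c - 1 choose c) + ((2*n - 2) + m - 1 choose m) + card K"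
proof -
  obtain M N j1 j2 where MN: "linear_map M" "linear_map N" "\<And>x. M (N x) = x" "\<And>x. N (M x) = x" "j1 \<noteq> j2"
    "\<And>x. l0 (M x) = x $ j1" "\<And>x. l1 (M x) = x $ j2"
    using adapted_coordinates[OF l] by metis
  have v2: "N v $ j2 = 0" using MN(7)[of "N v"] MN(3) v(2) by simp
  have "N v \<noteq> 0"
  proof
    assume "N v = 0"
    then have "v = M 0" using MN(3)[of v] by simp
    moreover have "M (0 *s 0) = 0 *s M 0" using MN(1) unfolding linear_map_def by blast
    ultimately show False using v(1) by simp
  qed
  then obtain jj where jj: "N v $ jj \<noteq> 0" by (metis vec_eq_iff zero_index)
  then have jj2: "jj \<noteq> j2" using v2 by auto
  have "card (mons (- {j2}) e) + 1 \<le> card (mons (- {j2}) c) + card (mons (- {j2, jj}) m) + card K"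
  proof (rule count_monomials_all[OF jj v2 _ _ _ _ K])
    show "(\<lambda>x. q (M x)) \<in> forms m" by (rule forms_compose[OF q(1) MN(1)])
    show "cone_over (N v) (\<lambda>x. q (M x))" by (rule cone_over_pullback[OF MN(1,3) q(2)])
    show "\<exists>x. x $ j2 = 0 \<and> q (M x) \<noteq> 0"
    proof -
      obtain u where "l1 u = 0" "q u \<noteq> 0" using nz by blast
      then show ?thesis using MN(7)[of "N u"] by (intro exI[of _ "N u"]) (simp add: MN(3))
    qed
    show "(\<lambda>x. g (M x)) \<in> forms c" by (rule forms_compose[OF g MN(1)])
    fix \<psi> :: "complex^'i \<Rightarrow> complex" assume "\<psi> \<in> forms e"
    then have "(\<lambda>x. \<psi> (N x)) \<in> forms e" by (rule forms_compose[OF _ MN(2)])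
    from H[OF this] obtain A b t where Ab: "A \<in> forms c" "b \<in> forms m" "cone_over v b"
      "\<And>u. l1 u = 0 \<Longrightarrow> \<psi> (N u) = q u * A u + g u * b u + (\<Sum>k\<in>K. t k * E k u)" by blast
    show "\<exists>A b t. A \<in> forms c \<and> b \<in> forms m \<and> cone_over (N v) b \<and>
      (\<forall>x. x $ j2 = 0 \<longrightarrow> \<psi> x = q (M x) * A x + g (M x) * b x + (\<Sum>k\<in>K. t k * E k (M x)))"
    proof (intro exI conjI allI impI)
      show "(\<lambda>x. A (M x)) \<in> forms c" by (rule forms_compose[OF Ab(1) MN(1)])
      show "(\<lambda>x. b (M x)) \<in> forms m" by (rule forms_compose[OF Ab(2) MN(1)])
      show "cone_over (N v) (\<lambda>x. b (M x))" by (rule cone_over_pullback[OF MN(1,3) Ab(3)])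
      fix x :: "complex^'i" assume "x $ j2 = 0"
      then show "\<psi> x = q (M x) * A (M x) + g (M x) * b (M x) + (\<Sum>k\<in>K. t k * E k (M x))"
        using Ab(4)[of "M x"] by (simp add: MN(4,6,7))
    qed
  qed
  then show ?thesis
    unfolding card_mons card_coordinate_complements[OF n MN(5)] card_coordinate_complements[OF n jj2] .
qed

text \<open>The derivations vary \<open>h0\<close> arbitrarily and kill the other data defining \<open>f\<close>, while
  every derivative of \<open>q\<close>, \<open>g\<close>, \<open>v\<close>, \<open>h\<close> is constrained by the second decomposition. Comparing
  dimensions on the second hyperplane gives the contradiction.\<close>

lemma hyperplane_unique_normalized:
  fixes \<omega> :: "complex^'i \<Rightarrow> complex^'i \<Rightarrow> complex"
  assumes n: "CARD('i) = 2 * n" and w: "symplectic_form \<omega>" and nmd: "n \<ge> 2" "m \<ge> 2" "d \<ge> m"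
    and hyp: "A_num n d m - H_num n d m > D_num n m"
    and q0: "q0 \<in> forms m" "cone_over v0 q0" "\<exists>u. \<omega> v0 u = 0 \<and> q0 u \<noteq> 0"
    and g0: "g0 \<in> forms (d - m)" "g0 v0 \<noteq> 0" and h0: "h0 \<in> vpolys"
    and q: "q \<in> forms m" "cone_over v q" "\<exists>u. \<omega> v u = 0 \<and> q u \<noteq> 0"
    and g: "g \<in> forms (d - m)" and h: "h \<in> vpolys" and v: "v $ jj = 1"
    and eq: "\<And>u. q0 u * g0 u + \<omega> v0 u * h0 u = q u * g u + \<omega> v u * h u"
    and der: "\<And>\<psi>. \<psi> \<in> forms (d - 1) \<Longrightarrow> \<exists>\<delta>. deriv_on UNIV \<delta> \<and> (\<forall>i j. \<delta> (\<omega> (axis i 1) (axis j 1)) = 0) \<and>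
      (\<forall>i. \<delta> (v0 $ i) = 0) \<and> (\<forall>u. nat_point u \<longrightarrow> \<delta> (q0 u) = 0 \<and> \<delta> (g0 u) = 0 \<and> \<delta> (h0 u) = \<psi> u)"
  shows "\<exists>c. v0 = c *s v"
proof (rule ccontr)
  assume np: "\<not> ?thesis"
  let ?l0 = "\<omega> v0" and ?l1 = "\<omega> v"
  note wD = symplectic_formD[OF w]
  have v_nz: "v \<noteq> 0" using v by auto
  have l1_nz: "\<exists>u. ?l1 u \<noteq> 0" using wD(4)[of v] v_nz by blast
  have indep: "\<not> (\<exists>c. \<forall>u. ?l0 u = c * ?l1 u)"
  proof
    assume "\<exists>c. \<forall>u. ?l0 u = c * ?l1 u"
    then obtain c where "\<And>u. ?l0 u = c * ?l1 u" by blast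
    then have "\<omega> (v0 - c *s v) u = 0" for u by (simp add: wD(6,7))
    then have "v0 = c *s v" using wD(4)[of "v0 - c *s v"] by simp
    then show False using np by blast
  qed
  note l = wD(1)[of v0] wD(1)[of v] l1_nz indep
  obtain M :: "complex^'i \<Rightarrow> complex^'i" and j1 j2 where MN: "j1 \<noteq> j2" "\<And>x. ?l0 (M x) = x $ j1" "\<And>x. ?l1 (M x) = x $ j2"
    using adapted_coordinates[OF l] by blast
  define w0 where "w0 = M (axis j1 1)"
  define w1 where "w1 = M (axis j2 1)"
  have ww: "?l0 w0 = 1" "?l1 w0 = 0" "?l0 w1 = 0" "?l1 w1 = 1"
    using MN(1) by (auto simp: w0_def w1_def MN(2,3) axis_def)
  have lc1: "line_closed {u. ?l1 u = 0}" and lc0: "line_closed {u. ?l0 u = 0}"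
    and lc01: "line_closed {u. ?l0 u = 0 \<and> ?l1 u = 0}"
    by (auto simp: line_closed_def linear_formsD[OF wD(1)])
  \<comment> \<open>Everything on the left except \<open>h0\<close> is constant for
    \<open>\<delta>\<close>.\<close>
  have lhs: "\<delta> (q0 u * g0 u + ?l0 u * h0 u) = ?l0 u * \<psi> u"
    if d: "deriv_on UNIV \<delta>" "\<And>i j. \<delta> (\<omega> (axis i 1) (axis j 1)) = 0" "\<And>i. \<delta> (v0 $ i) = 0"
      "\<delta> (q0 u) = 0" "\<delta> (g0 u) = 0" "\<delta> (h0 u) = \<psi> u" and u: "nat_point u" for \<delta> u \<psi>
  proof -
    have "(\<chi> i. \<delta> (v0 $ i)) = 0" by (simp add: vec_eq_iff d(3))
    then have "\<delta> (?l0 u) = 0" using omega_derivation[OF w d(1,2) u, of v0] wD(8) by simp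
    then show ?thesis using d(4-6) by (simp add: deriv_on_simps(1,2)[OF d(1)])
  qed
  show False
  proof (cases "\<exists>u. ?l0 u = 0 \<and> ?l1 u = 0 \<and> q u \<noteq> 0")
    case True
    obtain G where G: "\<And>i. G i \<in> vpolys" "\<And>\<delta>. deriv_on UNIV \<delta> \<Longrightarrow> (\<exists>b\<in>forms m. cone_over v b \<and>
      (\<forall>u. nat_point u \<longrightarrow> \<delta> (q u) = b u - (\<Sum>i\<in>UNIV - {jj}. \<delta> (v $ i) * G i u)))"
      using cone_derivation[OF q(1,2) v] by blast
    \<comment> \<open>The coefficient of \<open>\<delta> (v $ i)\<close> in the derivative of the
      second decomposition: \<open>v\<close> enters through the equation of the hyperplane and
      through the vertex of the cone.\<close>
    define E where "E i u = h u * \<omega> (axis i 1) u - g u * G i u" for i u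
    have "((2*n - 1) + (d - 1) - 1 choose (d - 1)) + ((2*n - 2) + (d - m) - 1 choose (d - m)) + 1 \<le>
      ((2*n - 1) + (d - m) - 1 choose (d - m)) + ((2*n - 2) + m - 1 choose m) + card (UNIV - {jj} :: 'i set)"
    proof (rule count_transversal[OF n l v_nz wD(3) q(1,2) True g, of _ _ E])
      fix \<psi> :: "complex^'i \<Rightarrow> complex" assume psi: "\<psi> \<in> forms (d - 1)"
      obtain \<delta> where d: "deriv_on UNIV \<delta>" "\<And>i j. \<delta> (\<omega> (axis i 1) (axis j 1)) = 0" "\<And>i. \<delta> (v0 $ i) = 0"
        "\<And>u. nat_point u \<Longrightarrow> \<delta> (q0 u) = 0" "\<And>u. nat_point u \<Longrightarrow> \<delta> (g0 u) = 0" "\<And>u. nat_point u \<Longrightarrow> \<delta> (h0 u) = \<psi> u"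
        using der[OF psi] by blast
      obtain b where b: "b \<in> forms m" "cone_over v b"
        "\<And>u. nat_point u \<Longrightarrow> \<delta> (q u) = b u - (\<Sum>i\<in>UNIV - {jj}. \<delta> (v $ i) * G i u)"
        using G(2)[OF d(1)] by blast
      obtain g' where g': "g' \<in> forms (d - m)" "\<And>u. nat_point u \<Longrightarrow> \<delta> (g u) = g' u"
        using forms_derivation[OF d(1) g] by blast
      obtain h' where h': "h' \<in> vpolys" "\<And>u. nat_point u \<Longrightarrow> \<delta> (h u) = h' u"
        using vpolys_derivation[OF d(1) h] by blast
      have dv: "\<omega> (\<chi> i. \<delta> (v $ i)) u = (\<Sum>i\<in>UNIV - {jj}. \<delta> (v $ i) * \<omega> (axis i 1) u)" for u
      proof -
        have "\<omega> (\<chi> i. \<delta> (v $ i)) u = (\<Sum>i\<in>UNIV. \<delta> (v $ i) * \<omega> (axis i 1) u)"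
          using linear_forms_expand[OF wD(2), of "\<chi> i. \<delta> (v $ i)"] by simp
        also have "\<dots> = (\<Sum>i\<in>UNIV - {jj}. \<delta> (v $ i) * \<omega> (axis i 1) u)"
          by (simp add: sum.remove[of UNIV jj] v deriv_on_simps(4)[OF d(1)])
        finally show ?thesis .
      qed
      let ?R = "\<lambda>u. q u * g' u + (b u - (\<Sum>i\<in>UNIV - {jj}. \<delta> (v $ i) * G i u)) * g u +
        ((\<Sum>i\<in>UNIV - {jj}. \<delta> (v $ i) * \<omega> (axis i 1) u) * h u + ?l1 u * h' u)"
      have id: "?l0 u * \<psi> u = ?R u" for u
      proof (rule vpolys_eq_from_nat)
        show "(\<lambda>u. ?l0 u * \<psi> u) \<in> vpolys"
          by (intro vpolys_mult omega_vpolys[OF w] forms_vpolys[OF psi])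
        show "?R \<in> vpolys"
          by (intro vpolys_add vpolys_mult vpolys_diff vpolys_sum vpolys_const omega_vpolys[OF w] G(1) h h'(1)
              forms_vpolys[OF q(1)] forms_vpolys[OF g'(1)] forms_vpolys[OF b(1)] forms_vpolys[OF g])
        fix u :: "complex^'i" assume u: "nat_point u"
        have "?l0 u * \<psi> u = \<delta> (q u * g u + ?l1 u * h u)"
          using lhs[where \<delta> = \<delta> and u = u and \<psi> = \<psi>, OF d(1,2,3) d(4-6)[OF u] u] unfolding eq by simp
        also have "\<dots> = ?R u"
          unfolding deriv_on_simps(1,2)[OF d(1)] b(3)[OF u] g'(2)[OF u] h'(2)[OF u] omega_derivation[OF w d(1,2) u] dv
          by (simp add: algebra_simps)
        finally show "?l0 u * \<psi> u = ?R u" .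
      qed
      show "\<exists>A b t. A \<in> forms (d - m) \<and> b \<in> forms m \<and> cone_over v b \<and>
        (\<forall>u. ?l1 u = 0 \<longrightarrow> ?l0 u * \<psi> u = q u * A u + g u * b u + (\<Sum>k\<in>UNIV - {jj}. t k * E k u))"
      proof (intro exI conjI allI impI)
        show "g' \<in> forms (d - m)" "b \<in> forms m" "cone_over v b" by fact+
        fix u assume "?l1 u = 0"
        then show "?l0 u * \<psi> u = q u * g' u + g u * b u + (\<Sum>k\<in>UNIV - {jj}. \<delta> (v $ k) * E k u)"
          unfolding id E_def by (simp add: right_diff_distrib sum_subtractf sum_distrib_left sum_distrib_right mult_ac)
      qed
    qed simp
    moreover have "card (UNIV - {jj} :: 'i set) = 2 * n - 1" using n by (simp add: card_Diff_singleton)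
    moreover have m1: "m \<ge> 1" using nmd by simp
    ultimately show False using numerical_transversal[OF nmd(1) m1 nmd(3) hyp] by linarith
  next
    case False
    then have qz: "q u = 0" if "?l0 u = 0" "?l1 u = 0" for u using that by blast
    \<comment> \<open>Otherwise each point of \<open>l1 = 0\<close> could be slid along
      \<open>v\<close> into the intersection, where \<open>q\<close> vanishes, without changing the
      value of \<open>q\<close>.\<close>
    have l0v: "?l0 v = 0"
    proof (rule ccontr)
      assume nz: "?l0 v \<noteq> 0"
      obtain u where u: "?l1 u = 0" "q u \<noteq> 0" using q(3) by blast
      let ?u = "u + (- (?l0 u / ?l0 v)) *s v"
      have "?l0 ?u = ?l0 u + (- (?l0 u / ?l0 v)) * ?l0 v" by (simp only: linear_formsD(1,2)[OF wD(1)])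
      then have "?l0 ?u = 0" using nz by simp
      moreover have "?l1 ?u = ?l1 u + (- (?l0 u / ?l0 v)) * ?l1 v" by (simp only: linear_formsD(1,2)[OF wD(1)])
      then have "?l1 ?u = 0" using u wD(3) by simp
      ultimately have "q ?u = 0" by (rule qz)
      moreover have "q ?u = q u" using q(2) unfolding cone_over_def by blast
      ultimately show False using u by simp
    qed
    \<comment> \<open>On \<open>l1 = 0\<close> the cone \<open>q\<close> is now
      \<open>l0 * r\<close>; the rest is a multiple of \<open>l1\<close> and is absorbed into
      \<open>h2\<close> below.\<close>
    obtain r s where rs: "r \<in> forms (m - 1)" "s \<in> forms (m - 1)" "\<And>u. q u = ?l0 u * r u + ?l1 u * s u" "cone_over v r"
      using forms_split[OF q(1) wD(1) wD(1) ww qz] l0v wD(3)[of v] q(2) by blast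
    have r_nz: "\<exists>u. ?l1 u = 0 \<and> r u \<noteq> 0" using q(3) rs(3) by force
    define h2 where "h2 u = s u * g u + h u" for u
    have h2: "h2 \<in> vpolys" unfolding h2_def[abs_def]
      by (intro vpolys_add vpolys_mult forms_vpolys[OF rs(2)] forms_vpolys[OF g] h)
    have eq2: "q0 u * g0 u + ?l0 u * h0 u = ?l0 u * (r u * g u) + ?l1 u * h2 u" for u
      unfolding eq rs(3) h2_def by (simp add: algebra_simps)
    \<comment> \<open>By antisymmetry \<open>v0\<close> lies in both hyperplanes, so the line
      through \<open>u\<close> in its direction stays in their intersection. There \<open>q0\<close>
      is constant, and \<open>g0\<close> would vanish along the whole line, contradicting the top
      coefficient \<open>g0 v0\<close>.\<close>
    have q0z: "q0 u = 0" if u: "?l0 u = 0" "?l1 u = 0" for u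
    proof (rule ccontr)
      assume nz: "q0 u \<noteq> 0"
      obtain F where F: "\<And>u s. g0 (u + s *s v0) = (\<Sum>j\<le>d - m. s ^ j * F j u)" "\<And>u. F (d - m) u = g0 v0"
        using forms_expand_line[OF g0(1), of v0] by blast
      define P where "P = (\<Sum>j\<le>d - m. monom (F j u) j)"
      have "poly P s = 0" for s
      proof -
        have "?l0 (u + s *s v0) = 0" using u wD(3)[of v0] by (simp add: linear_formsD[OF wD(1)])
        moreover have "?l1 (u + s *s v0) = 0" using u l0v wD(9)[of v v0] by (simp add: linear_formsD[OF wD(1)])
        ultimately have "q0 (u + s *s v0) * g0 (u + s *s v0) = 0" using eq2[of "u + s *s v0"] by simp
        moreover have "q0 (u + s *s v0) = q0 u" using q0(2) unfolding cone_over_def by blast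
        ultimately have "g0 (u + s *s v0) = 0" using nz by simp
        then show ?thesis unfolding P_def F(1) by (simp add: poly_sum poly_monom mult.commute)
      qed
      then have "P = 0" by (metis poly_all_0_iff_0)
      then have "coeff P (d - m) = 0" by simp
      then have "F (d - m) u = 0" unfolding P_def by (simp add: coeff_sum)
      then show False using F(2) g0(2) by simp
    qed
    obtain e R S where RS: "R \<in> vpolys" "S \<in> vpolys" "\<And>u. q0 u = ?l1 u ^ e * R u + ?l0 u * S u"
      "\<exists>u. ?l0 u = 0 \<and> ?l1 u = 0 \<and> R u \<noteq> 0"
      using forms_order[OF wD(1) wD(1) ww q0(1,3)] by blast
    have "e \<noteq> 0"
    proof
      assume "e = 0"
      then have "R u = 0" if "?l0 u = 0" "?l1 u = 0" for u using RS(3)[of u] q0z[OF that] that by simp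
      then show False using RS(4) by blast
    qed
    then obtain e' where e': "e = Suc e'" by (cases e) auto
    obtain G where G: "\<And>i. G i \<in> vpolys" "\<And>\<delta>. deriv_on UNIV \<delta> \<Longrightarrow> (\<exists>b\<in>forms (m - 1). cone_over v b \<and>
      (\<forall>u. nat_point u \<longrightarrow> \<delta> (r u) = b u - (\<Sum>i\<in>UNIV - {jj}. \<delta> (v $ i) * G i u)))"
      using cone_derivation[OF rs(1,4) v] by blast
    \<comment> \<open>The only direction in which the normalized \<open>v\<close> can move, as shown
      below: \<open>v0\<close> corrected by a multiple of \<open>v\<close> so that its coordinate
      \<open>jj\<close> is zero. A single extra function remains, hence the index type
      \<open>unit\<close>.\<close>
    define y where "y i = v0 $ i - v0 $ jj * v $ i" for i
    define E where "E = (\<lambda>_ :: unit. \<lambda>u. h2 u - g u * (\<Sum>i\<in>UNIV - {jj}. y i * G i u))"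
    have "((2*n - 1) + (d - 1) - 1 choose (d - 1)) + 1 \<le>
      ((2*n - 1) + (d - m) - 1 choose (d - m)) + ((2*n - 2) + (m - 1) - 1 choose (m - 1)) + card {()}"
    proof (rule count_special[OF n l v_nz wD(3) rs(1,4) r_nz g, of _ _ E])
      fix \<psi> :: "complex^'i \<Rightarrow> complex" assume psi: "\<psi> \<in> forms (d - 1)"
      obtain \<delta> where d: "deriv_on UNIV \<delta>" "\<And>i j. \<delta> (\<omega> (axis i 1) (axis j 1)) = 0" "\<And>i. \<delta> (v0 $ i) = 0"
        "\<And>u. nat_point u \<Longrightarrow> \<delta> (q0 u) = 0" "\<And>u. nat_point u \<Longrightarrow> \<delta> (g0 u) = 0" "\<And>u. nat_point u \<Longrightarrow> \<delta> (h0 u) = \<psi> u"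
        using der[OF psi] by blast
      define dv where "dv = (\<chi> i. \<delta> (v $ i))"
      have dl1: "\<delta> (?l1 u) = \<omega> dv u" if "nat_point u" for u
        unfolding dv_def by (rule omega_derivation[OF w d(1,2) that])
      have dl0: "\<delta> (?l0 u) = 0" if "nat_point u" for u
      proof -
        have "(\<chi> i. \<delta> (v0 $ i)) = 0" by (simp add: vec_eq_iff d(3))
        then show ?thesis using omega_derivation[OF w d(1,2) that, of v0] wD(8) by simp
      qed
      obtain b where b: "b \<in> forms (m - 1)" "cone_over v b"
        "\<And>u. nat_point u \<Longrightarrow> \<delta> (r u) = b u - (\<Sum>i\<in>UNIV - {jj}. \<delta> (v $ i) * G i u)"
        using G(2)[OF d(1)] by blast
      obtain g' where g': "g' \<in> forms (d - m)" "\<And>u. nat_point u \<Longrightarrow> \<delta> (g u) = g' u"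
        using forms_derivation[OF d(1) g] by blast
      obtain h' where h': "h' \<in> vpolys" "\<And>u. nat_point u \<Longrightarrow> \<delta> (h2 u) = h' u"
        using vpolys_derivation[OF d(1) h2] by blast
      obtain R' where R': "R' \<in> vpolys" "\<And>u. nat_point u \<Longrightarrow> \<delta> (R u) = R' u"
        using vpolys_derivation[OF d(1) RS(1)] by blast
      obtain S' where S': "S' \<in> vpolys" "\<And>u. nat_point u \<Longrightarrow> \<delta> (S u) = S' u"
        using vpolys_derivation[OF d(1) RS(2)] by blast
      let ?T = "\<lambda>u. of_nat e * (\<omega> dv u * R u) + ?l1 u * R' u"
      have T_poly: "?T \<in> vpolys"
        by (intro vpolys_add vpolys_mult vpolys_const omega_vpolys[OF w] RS(1) R'(1))
      \<comment> \<open>This is \<open>\<delta> (q0 u) = 0\<close> expanded through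
        \<open>RS\<close>. Modulo \<open>l0\<close>, and with the power of \<open>l1\<close>
        cancelled, it shows that the derivative of \<open>l1\<close> vanishes on the intersection,
        because \<open>R\<close> is not identically zero there.\<close>
      have idq: "?l1 u ^ e' * ?T u + ?l0 u * S' u = 0" for u
      proof (rule vpolys_eq_from_nat[of "\<lambda>u. ?l1 u ^ e' * ?T u + ?l0 u * S' u" "\<lambda>_. 0"])
        show "(\<lambda>u. ?l1 u ^ e' * ?T u + ?l0 u * S' u) \<in> vpolys"
          by (intro vpolys_add vpolys_mult vpolys_power vpolys_const omega_vpolys[OF w] RS(1) R'(1) S'(1))
        show "(\<lambda>_. 0) \<in> vpolys" by (rule vpolys_const)
        fix u :: "complex^'i" assume u: "nat_point u"
        have "0 = \<delta> (?l1 u ^ e * R u + ?l0 u * S u)" using d(4)[OF u] unfolding RS(3) by simp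
        also have "\<dots> = ?l1 u ^ e' * ?T u + ?l0 u * S' u"
          unfolding deriv_on_simps(1,2)[OF d(1)] deriv_on_power[OF d(1)] dl1[OF u] dl0[OF u] R'(2)[OF u] S'(2)[OF u] e'
          by (simp add: algebra_simps)
        finally show "?l1 u ^ e' * ?T u + ?l0 u * S' u = 0" by simp
      qed
      have idq0: "?l1 u ^ e' * ?T u = 0" if "?l0 u = 0" for u
        using idq[of u] unfolding that by (simp only: mult_zero_left add_0_right)
      have "(\<forall>u\<in>{u. ?l0 u = 0}. ?l1 u ^ e' = 0) \<or> (\<forall>u\<in>{u. ?l0 u = 0}. ?T u = 0)"
        by (rule vpolys_domain[OF vpolys_power[OF omega_vpolys[OF w]] T_poly lc0]) (rule idq0, simp)
      moreover have "?l1 w1 ^ e' \<noteq> 0" "w1 \<in> {u. ?l0 u = 0}" using ww by simp_all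
      ultimately have T0: "\<forall>u\<in>{u. ?l0 u = 0}. ?T u = 0" by blast
      have "(\<forall>u\<in>{u. ?l0 u = 0 \<and> ?l1 u = 0}. \<omega> dv u = 0) \<or> (\<forall>u\<in>{u. ?l0 u = 0 \<and> ?l1 u = 0}. R u = 0)"
      proof (rule vpolys_domain[OF omega_vpolys[OF w] RS(1) lc01])
        fix u assume "u \<in> {u. ?l0 u = 0 \<and> ?l1 u = 0}"
        then have "?T u = 0" "?l1 u = 0" using T0 by auto
        then show "\<omega> dv u * R u = 0" using \<open>e \<noteq> 0\<close> by simp
      qed
      then have dvz: "\<omega> dv u = 0" if "?l0 u = 0" "?l1 u = 0" for u using RS(4) that by blast
      define a where "a = \<omega> dv w0"
      define a1 where "a1 = \<omega> dv w1"
      \<comment> \<open>A linear form vanishing on the intersection is a combination of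
        \<open>l0\<close> and \<open>l1\<close>; by nondegeneracy, \<open>dv\<close> is then the
        same combination of \<open>v0\<close> and \<open>v\<close>.\<close>
      have dvu: "\<omega> dv u = a * ?l0 u + a1 * ?l1 u" for u
      proof -
        have "\<omega> dv (u - ?l0 u *s w0 - ?l1 u *s w1) = 0"
          by (rule dvz) (simp_all add: linear_formsD[OF wD(1)] ww)
        then show ?thesis by (simp add: linear_formsD[OF wD(1)] a_def a1_def algebra_simps)
      qed
      have "\<omega> (dv - (a *s v0 + a1 *s v)) u = 0" for u
        unfolding wD(5-7) dvu by simp
      then have "dv - (a *s v0 + a1 *s v) = 0" by (rule wD(4))
      then have dveq: "\<delta> (v $ i) = a * v0 $ i + a1 * v $ i" for i
        unfolding dv_def by (simp add: vec_eq_iff)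
      \<comment> \<open>The coordinate \<open>v $ jj = 1\<close> has derivative zero.\<close>
      have "a1 = - a * v0 $ jj" using dveq[of jj] v deriv_on_simps(4)[OF d(1)] by (simp add: eq_neg_iff_add_eq_0 add.commute)
      then have dvy: "\<delta> (v $ i) = a * y i" for i unfolding dveq y_def by (simp add: algebra_simps)
      let ?R = "\<lambda>u. ?l0 u * (r u * g' u + (b u - (\<Sum>i\<in>UNIV - {jj}. a * y i * G i u)) * g u) + (\<omega> dv u * h2 u + ?l1 u * h' u)"
      have id: "?l0 u * \<psi> u = ?R u" for u
      proof (rule vpolys_eq_from_nat)
        show "(\<lambda>u. ?l0 u * \<psi> u) \<in> vpolys"
          by (intro vpolys_mult omega_vpolys[OF w] forms_vpolys[OF psi])
        show "?R \<in> vpolys"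
          by (intro vpolys_add vpolys_mult vpolys_diff vpolys_sum vpolys_const omega_vpolys[OF w] G(1) h2 h'(1)
              forms_vpolys[OF rs(1)] forms_vpolys[OF g'(1)] forms_vpolys[OF b(1)] forms_vpolys[OF g])
        fix u :: "complex^'i" assume u: "nat_point u"
        have "?l0 u * \<psi> u = \<delta> (?l0 u * (r u * g u) + ?l1 u * h2 u)"
          using lhs[where \<delta> = \<delta> and u = u and \<psi> = \<psi>, OF d(1,2,3) d(4-6)[OF u] u] unfolding eq2 by simp
        also have "\<dots> = ?R u"
          unfolding deriv_on_simps(1,2)[OF d(1)] b(3)[OF u] g'(2)[OF u] h'(2)[OF u] dl1[OF u] dl0[OF u] dvy
          by (simp add: algebra_simps)
        finally show "?l0 u * \<psi> u = ?R u" .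
      qed
      let ?D = "\<lambda>u. r u * g' u + (b u - (\<Sum>i\<in>UNIV - {jj}. a * y i * G i u)) * g u + a * h2 u"
      have "(\<lambda>u. \<psi> u - ?D u) \<in> vpolys"
        by (intro vpolys_add vpolys_mult vpolys_diff vpolys_sum vpolys_const omega_vpolys[OF w] G(1) h2
              forms_vpolys[OF psi] forms_vpolys[OF rs(1)] forms_vpolys[OF g'(1)] forms_vpolys[OF b(1)] forms_vpolys[OF g])
      \<comment> \<open>On \<open>l1 = 0\<close> both sides carry the factor \<open>l0\<close>,
        which is not identically zero there and can be cancelled.\<close>
      then have "(\<forall>u\<in>{u. ?l1 u = 0}. ?l0 u = 0) \<or> (\<forall>u\<in>{u. ?l1 u = 0}. \<psi> u - ?D u = 0)"
      proof (rule vpolys_domain[OF omega_vpolys[OF w] _ lc1])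
        fix u assume "u \<in> {u. ?l1 u = 0}"
        then have "?l0 u * \<psi> u = ?l0 u * ?D u" unfolding id dvu by (simp add: algebra_simps)
        then show "?l0 u * (\<psi> u - ?D u) = 0" by (simp only: right_diff_distrib diff_self)
      qed
      moreover have "w0 \<in> {u. ?l1 u = 0}" "?l0 w0 \<noteq> 0" using ww by simp_all
      ultimately have psiD: "\<forall>u\<in>{u. ?l1 u = 0}. \<psi> u - ?D u = 0" by blast
      show "\<exists>A b t. A \<in> forms (d - m) \<and> b \<in> forms (m - 1) \<and> cone_over v b \<and>
        (\<forall>u. ?l1 u = 0 \<longrightarrow> \<psi> u = r u * A u + g u * b u + (\<Sum>k\<in>{()}. t k * E k u))"
      proof (intro exI conjI allI impI)
        show "g' \<in> forms (d - m)" "b \<in> forms (m - 1)" "cone_over v b" by fact+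
        fix u assume "?l1 u = 0"
        then have "\<psi> u = ?D u" using psiD by simp
        then show "\<psi> u = r u * g' u + g u * b u + (\<Sum>k\<in>{()}. (\<lambda>_. a) k * E k u)"
          unfolding E_def by (simp add: sum_distrib_left sum_distrib_right algebra_simps)
      qed
    qed simp
    then show False using numerical_special[OF nmd hyp] by simp
  qed
qed

text \<open>Rescaling \<open>v\<close> makes one coordinate equal to 1; the factor is compensated in
  \<open>h\<close>.\<close>

lemma hyperplane_unique:
  fixes \<omega> :: "complex^'i \<Rightarrow> complex^'i \<Rightarrow> complex"
  assumes n: "CARD('i) = 2 * n" and w: "symplectic_form \<omega>" and nmd: "n \<ge> 2" "m \<ge> 2" "d \<ge> m"
    and hyp: "A_num n d m - H_num n d m > D_num n m"
    and q0: "q0 \<in> forms m" "cone_over v0 q0" "\<exists>u. \<omega> v0 u = 0 \<and> q0 u \<noteq> 0"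
    and g0: "g0 \<in> forms (d - m)" "g0 v0 \<noteq> 0" and h0: "h0 \<in> vpolys"
    and q: "q \<in> forms m" "cone_over v q" "\<exists>u. \<omega> v u = 0 \<and> q u \<noteq> 0"
    and g: "g \<in> forms (d - m)" and h: "h \<in> vpolys" and v: "v \<noteq> 0"
    and eq: "\<And>u. q0 u * g0 u + \<omega> v0 u * h0 u = q u * g u + \<omega> v u * h u"
    and der: "\<And>\<psi>. \<psi> \<in> forms (d - 1) \<Longrightarrow> \<exists>\<delta>. deriv_on UNIV \<delta> \<and> (\<forall>i j. \<delta> (\<omega> (axis i 1) (axis j 1)) = 0) \<and>
      (\<forall>i. \<delta> (v0 $ i) = 0) \<and> (\<forall>u. nat_point u \<longrightarrow> \<delta> (q0 u) = 0 \<and> \<delta> (g0 u) = 0 \<and> \<delta> (h0 u) = \<psi> u)"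
  shows "\<exists>c. v0 = c *s v"
proof -
  obtain jj where jj: "v $ jj \<noteq> 0" using v by (metis vec_eq_iff zero_index)
  define v' where "v' = inverse (v $ jj) *s v"
  define h' where "h' u = v $ jj * h u" for u
  have w': "\<omega> v' u = inverse (v $ jj) * \<omega> v u" for u unfolding v'_def by (rule symplectic_formD(6)[OF w])
  have "cone_over v' q" unfolding cone_over_def
  proof (intro allI)
    fix u s
    have "u + s *s v' = u + (s * inverse (v $ jj)) *s v" by (simp add: v'_def)
    then show "q (u + s *s v') = q u" using q(2) unfolding cone_over_def by metis
  qed
  moreover have "\<exists>u. \<omega> v' u = 0 \<and> q u \<noteq> 0" using q(3) w' by auto
  moreover have "h' \<in> vpolys" unfolding h'_def[abs_def] by (intro vpolys_mult vpolys_const h)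
  moreover have "v' $ jj = 1" using jj by (simp add: v'_def)
  moreover have "q0 u * g0 u + \<omega> v0 u * h0 u = q u * g u + \<omega> v' u * h' u" for u
    unfolding eq w' h'_def using jj by simp
  ultimately obtain c where "v0 = c *s v'"
    using hyperplane_unique_normalized[OF n w nmd hyp q0 g0 h0 q(1) _ _ g _ _ _ der] by blast
  then show ?thesis unfolding v'_def by auto
qed

section \<open>The parameter space\<close>

text \<open>A point \<open>t\<close> of the affine parameter space consists of the coefficients of a vector \<open>v\<close>, a linear form \<open>\<xi>\<close> and
  forms \<open>p\<close>, \<open>g\<close>, \<open>h\<close>, \<open>r\<close>, indexed by \<open>0, \<dots>, 5\<close>. Substituting \<open>\<xi>(v) u - \<xi>(u) v\<close> into \<open>p\<close> gives a cone over \<open>v\<close>.\<close>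

definition unit_exp :: "'i \<Rightarrow> 'i \<Rightarrow> nat" where
  "unit_exp i = (\<lambda>j. if j = i then 1 else 0)"

text \<open>Coordinates of vectors and linear forms sit at the exponents \<open>unit_exp i\<close>,
  so that all parameters share one countable index type and a single generic sequence fills
  them.\<close>

type_synonym 'i params = "nat \<times> ('i \<Rightarrow> nat) \<Rightarrow> complex"

definition par_v :: "'i params \<Rightarrow> complex^'i" where
  "par_v t = (\<chi> i. t (0, unit_exp i))"

definition par_xi :: "'i params \<Rightarrow> complex^'i \<Rightarrow> complex" where
  "par_xi t u = (\<Sum>i\<in>UNIV. t (1, unit_exp i) * u $ i)"

definition par_form :: "nat \<Rightarrow> nat \<Rightarrow> 'i params \<Rightarrow> complex^'i \<Rightarrow> complex" where
  "par_form j e t = hform e (\<lambda>\<alpha>. t (j, \<alpha>))"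

definition par_q :: "nat \<Rightarrow> 'i params \<Rightarrow> complex^'i \<Rightarrow> complex" where
  "par_q m t u = par_form 2 m t (par_xi t (par_v t) *s u - par_xi t u *s par_v t)"

definition par_f :: "(complex^'i \<Rightarrow> complex^'i \<Rightarrow> complex) \<Rightarrow> nat \<Rightarrow> nat \<Rightarrow> 'i params \<Rightarrow> complex^'i \<Rightarrow> complex" where
  "par_f \<omega> m d t u = par_q m t u * par_form 3 (d - m) t u + \<omega> (par_v t) u * par_form 4 (d - 1) t u"

text \<open>Block 5 accounts for the lifts: a representative carries any form \<open>p\<close> with
  the prescribed restriction to the hyperplane.\<close>

definition par_p :: "(complex^'i \<Rightarrow> complex^'i \<Rightarrow> complex) \<Rightarrow> nat \<Rightarrow> 'i params \<Rightarrow> complex^'i \<Rightarrow> complex" where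
  "par_p \<omega> m t u = par_q m t u + \<omega> (par_v t) u * par_form 5 (m - 1) t u"

text \<open>A finite index set containing everything on which \<open>par_f \<omega> m d\<close>
  depends, so that extending to finitely many elements is enough.\<close>

definition par_idx :: "nat \<Rightarrow> (nat \<times> ('i::finite \<Rightarrow> nat)) set" where
  "par_idx d = {..5} \<times> (\<Union>e\<le>d. mons UNIV e)"

text \<open>A point of the hyperplane with polar vector \<open>v\<close>, polynomial in
  \<open>v\<close>. A nonzero value of \<open>q\<close> there certifies, by one polynomial condition
  on the parameters, that \<open>q\<close> is not zero on the hyperplane.\<close>

definition hyper_pt :: "(complex^'i \<Rightarrow> complex^'i \<Rightarrow> complex) \<Rightarrow> complex^'i \<Rightarrow> complex^'i \<Rightarrow> complex^'i \<Rightarrow> complex^'i" where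
  "hyper_pt \<omega> a b v = \<omega> v a *s b - \<omega> v b *s a"

lemma unit_exp_inj: "unit_exp i = unit_exp j \<longleftrightarrow> i = j"
  by (auto simp: unit_exp_def fun_eq_iff split: if_splits)

lemma unit_exp_mons: "unit_exp (i :: 'i::finite) \<in> mons UNIV 1"
  by (simp add: mons_def unit_exp_def)

lemma finite_par_idx: "finite (par_idx d)"
  by (simp add: par_idx_def)

lemma par_idxI: "j \<le> 5 \<Longrightarrow> e \<le> d \<Longrightarrow> \<alpha> \<in> mons UNIV e \<Longrightarrow> (j, \<alpha>) \<in> par_idx d"
  by (auto simp: par_idx_def)

lemma par_form_forms: "par_form j e t \<in> forms e"
  unfolding forms_eq_hforms par_form_def by blast

lemma par_xi_linear: "par_xi t \<in> linear_forms"
  unfolding linear_forms_iff par_xi_def by (simp add: algebra_simps sum.distrib sum_distrib_left)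

lemma linear_map_par: "linear_map (\<lambda>u. par_xi t (par_v t) *s u - par_xi t u *s par_v t)"
  by (auto simp: linear_map_def vec_eq_iff algebra_simps linear_formsD[OF par_xi_linear])

lemma par_q_forms: "par_q m t \<in> forms m"
  unfolding par_q_def[abs_def] by (rule forms_compose[OF par_form_forms linear_map_par])

lemma par_q_cone: "cone_over (par_v t) (par_q m t)"
  unfolding cone_over_def
proof (intro allI)
  fix u s
  have "par_xi t (par_v t) *s (u + s *s par_v t) - par_xi t (u + s *s par_v t) *s par_v t =
      par_xi t (par_v t) *s u - par_xi t u *s par_v t"
    by (simp add: vec_eq_iff algebra_simps linear_formsD[OF par_xi_linear])
  then show "par_q m t (u + s *s par_v t) = par_q m t u" unfolding par_q_def by (simp only:)
qed

lemma forms_times_linear: "l \<in> linear_forms \<Longrightarrow> h \<in> forms (d - 1) \<Longrightarrow> d \<ge> 1 \<Longrightarrow> (\<lambda>u. l u * h u) \<in> forms d"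
  using forms_mult[OF forms_linear, of l h "d - 1"] by simp

lemma par_f_forms:
  assumes "symplectic_form \<omega>" "m \<le> d" "d \<ge> 1"
  shows "par_f \<omega> m d t \<in> forms d"
proof -
  have "(\<lambda>u. par_q m t u * par_form 3 (d - m) t u) \<in> forms d"
    using forms_mult[OF par_q_forms[of m t] par_form_forms[of 3 "d - m" t]] assms(2) by simp
  moreover have "(\<lambda>u. \<omega> (par_v t) u * par_form 4 (d - 1) t u) \<in> forms d"
    by (rule forms_times_linear[OF symplectic_formD(1)[OF assms(1)] par_form_forms assms(3)])
  ultimately show ?thesis unfolding par_f_def[abs_def] by (rule forms_add)
qed

lemma par_p_forms:
  assumes "symplectic_form \<omega>" "m \<ge> 1"
  shows "par_p \<omega> m t \<in> forms m"
  unfolding par_p_def[abs_def]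
  by (rule forms_add[OF par_q_forms forms_times_linear[OF symplectic_formD(1)[OF assms(1)] par_form_forms assms(2)]])

lemma ex_params:
  fixes v :: "complex^'i"
  assumes x: "x \<in> linear_forms" and p: "p \<in> forms m" and g: "g \<in> forms c" and h: "h \<in> forms e" and r: "r \<in> forms a"
  shows "\<exists>t. par_v t = v \<and> par_xi t = x \<and> par_form 2 m t = p \<and> par_form 3 c t = g \<and> par_form 4 e t = h \<and> par_form 5 a t = r"
proof -
  obtain p' g' h' r' where f: "p = hform m p'" "g = hform c g'" "h = hform e h'" "r = hform a r'"
    using p g h r unfolding forms_eq_hforms by blast
  define t where "t = (\<lambda>(j, \<alpha>). if j = (0::nat) then v $ (THE i. \<alpha> = unit_exp i) else if j = 1 then x (axis (THE i. \<alpha> = unit_exp i) 1)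
    else if j = 2 then p' \<alpha> else if j = 3 then g' \<alpha> else if j = 4 then h' \<alpha> else r' \<alpha>)"
  have the: "(THE i. unit_exp j = unit_exp i) = j" for j :: 'i by (simp add: unit_exp_inj)
  have "par_v t = v" by (simp add: par_v_def t_def the vec_eq_iff)
  moreover have "par_xi t = x"
  proof
    fix u show "par_xi t u = x u" unfolding linear_forms_expand[OF x, of u]
      by (simp add: par_xi_def t_def the mult.commute)
  qed
  moreover have "par_form 2 m t = p" "par_form 3 c t = g" "par_form 4 e t = h" "par_form 5 a t = r"
    unfolding par_form_def f t_def by simp_all
  ultimately show ?thesis by blast
qed

context
  fixes k :: "complex set" and \<omega> :: "complex^'i \<Rightarrow> complex^'i \<Rightarrow> complex" and C :: "('a \<Rightarrow> complex) set"
  assumes k: "complex_subfield k" and w: "symplectic_form \<omega>" and wk: "\<And>i j. \<omega> (axis i 1) (axis j 1) \<in> k"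
begin

lemma omega_kpolys:
  assumes "\<And>i. (\<lambda>t. v t $ i) \<in> kpolys k C" "\<And>i. (\<lambda>t. u t $ i) \<in> kpolys k C"
  shows "(\<lambda>t. \<omega> (v t) (u t)) \<in> kpolys k C"
proof -
  have "(\<lambda>t. \<Sum>i\<in>UNIV. \<Sum>j\<in>UNIV. v t $ i * (u t $ j * \<omega> (axis i 1) (axis j 1))) \<in> kpolys k C"
    by (intro kpolys_sum[OF k] kpolys.mult assms kpolys.const wk)
  then show ?thesis by (subst omega_expand[OF w])
qed

lemma hyper_pt_kpolys:
  assumes "\<And>i. (\<lambda>t. v t $ i) \<in> kpolys k C" "\<And>i. a $ i \<in> k" "\<And>i. b $ i \<in> k"
  shows "(\<lambda>t. hyper_pt \<omega> a b (v t) $ i) \<in> kpolys k C"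
  unfolding hyper_pt_def
  by (simp, intro kpolys_diff[OF k] kpolys.mult omega_kpolys assms kpolys.const)

end

context
  fixes k :: "complex set" and B :: "(nat \<times> ('i::finite \<Rightarrow> nat)) set"
  assumes k: "complex_subfield k"
begin

lemma par_coord_kpolys: "x \<in> B \<Longrightarrow> (\<lambda>t. t x) \<in> kpolys k ((\<lambda>x t. t x) ` B)"
  by (intro kpolys.coord) blast

lemma par_v_kpolys:
  assumes "\<And>i. (0, unit_exp i) \<in> B"
  shows "(\<lambda>t. par_v t $ i) \<in> kpolys k ((\<lambda>x t. t x) ` B)"
  by (simp add: par_v_def par_coord_kpolys assms)

lemma hform_kpolys:
  assumes "\<And>\<alpha>. \<alpha> \<in> mons UNIV e \<Longrightarrow> (j, \<alpha>) \<in> B" "\<And>i. (\<lambda>t. u t $ i) \<in> kpolys k ((\<lambda>x t. t x) ` B)"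
  shows "(\<lambda>t. par_form j e t (u t)) \<in> kpolys k ((\<lambda>x t. t x) ` B)"
  unfolding par_form_def hform_def mvmono_def
  by (intro kpolys_sum[OF k] kpolys.mult kpolys_prod[OF k] kpolys_power[OF k] par_coord_kpolys assms)

lemma par_q_kpolys:
  assumes B: "\<And>i. (0, unit_exp i) \<in> B" "\<And>i. (1, unit_exp i) \<in> B" "\<And>\<alpha>. \<alpha> \<in> mons UNIV m \<Longrightarrow> (2, \<alpha>) \<in> B"
    and u: "\<And>i. (\<lambda>t. u t $ i) \<in> kpolys k ((\<lambda>x t. t x) ` B)"
  shows "(\<lambda>t. par_q m t (u t)) \<in> kpolys k ((\<lambda>x t. t x) ` B)"
proof -
  have xi: "(\<lambda>t. par_xi t (w t)) \<in> kpolys k ((\<lambda>x t. t x) ` B)"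
    if "\<And>i. (\<lambda>t. w t $ i) \<in> kpolys k ((\<lambda>x t. t x) ` B)" for w
    unfolding par_xi_def by (intro kpolys_sum[OF k] kpolys.mult par_coord_kpolys B that)
  show ?thesis
    unfolding par_q_def
  proof (rule hform_kpolys)
    show "(2, \<alpha>) \<in> B" if "\<alpha> \<in> mons UNIV m" for \<alpha> by (rule B(3)[OF that])
    show "(\<lambda>t. (par_xi t (par_v t) *s u t - par_xi t (u t) *s par_v t) $ i) \<in> kpolys k ((\<lambda>x t. t x) ` B)" for i
      unfolding vector_minus_component vector_smult_component
      by (intro kpolys_diff[OF k] kpolys.mult xi par_v_kpolys u B)
  qed
qed

end

lemma par_f_kpolys:
  fixes \<omega> :: "complex^'i \<Rightarrow> complex^'i \<Rightarrow> complex"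
  assumes k: "complex_subfield k" and w: "symplectic_form \<omega>" and wk: "\<And>i j. \<omega> (axis i 1) (axis j 1) \<in> k"
    and md: "m \<le> d" "d \<ge> 1" and u: "\<And>i. u $ i \<in> k"
  shows "(\<lambda>t. par_f \<omega> m d t u) \<in> kpolys k ((\<lambda>x t. t x) ` par_idx d)"
proof -
  have uk: "(\<lambda>t. u $ i) \<in> kpolys k ((\<lambda>x t. t x) ` par_idx d)" for i by (rule kpolys.const[OF u])
  have idx: "(0, unit_exp i) \<in> par_idx d" "(1, unit_exp i) \<in> par_idx d" for i :: 'i
    using md by (auto intro!: par_idxI[OF _ _ unit_exp_mons])
  have idx': "(j, \<alpha>) \<in> par_idx d" if "j \<le> 5" "e \<le> d" "\<alpha> \<in> mons UNIV e" for j e and \<alpha> :: "'i \<Rightarrow> nat"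
    using par_idxI[OF that] .
  have "(\<lambda>t. par_q m t u) \<in> kpolys k ((\<lambda>x t. t x) ` par_idx d)"
    by (rule par_q_kpolys[OF k idx _ uk]) (rule idx'[OF _ md(1)], simp_all)
  moreover have "(\<lambda>t. par_form 3 (d - m) t u) \<in> kpolys k ((\<lambda>x t. t x) ` par_idx d)"
    by (rule hform_kpolys[OF k _ uk]) (rule idx'[of _ "d - m"], simp_all)
  moreover have "(\<lambda>t. \<omega> (par_v t) u) \<in> kpolys k ((\<lambda>x t. t x) ` par_idx d)"
    by (rule omega_kpolys[OF k w wk par_v_kpolys[OF k idx(1)] uk])
  moreover have "(\<lambda>t. par_form 4 (d - 1) t u) \<in> kpolys k ((\<lambda>x t. t x) ` par_idx d)"
    by (rule hform_kpolys[OF k _ uk]) (rule idx'[of _ "d - 1"], simp_all)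
  ultimately show ?thesis unfolding par_f_def by (intro kpolys.add kpolys.mult)
qed

section \<open>The generic point\<close>

definition generic_point :: "complex set \<Rightarrow> 'i::finite params" where
  "generic_point k x = generic_seq k (to_nat x)"

text \<open>A transfer principle: a polynomial relation over \<open>k\<close> at the generic point
  holds for all parameters, and a nonvanishing condition over \<open>k\<close> that holds somewhere
  holds at the generic point.\<close>

lemma generic_point_zero:
  fixes F :: "'i::finite params \<Rightarrow> complex"
  assumes k: "complex_subfield k" "countable k" and F: "F \<in> kpolys k coords" and z: "F (generic_point k) = 0"
  shows "F t = 0"
proof -
  have "(\<lambda>y. F (\<lambda>x. y (to_nat x))) \<in> kpolys k coords"
    by (rule kpolys_compose[OF F]) (auto intro: kpolys.coord)
  moreover have "F (\<lambda>x. generic_seq k (to_nat x)) = 0"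
  proof -
    have "(\<lambda>x. generic_seq k (to_nat x)) = (generic_point k :: 'i params)" by (simp add: generic_point_def fun_eq_iff)
    then show ?thesis using z by simp
  qed
  ultimately have "F (\<lambda>x. (\<lambda>n. t (from_nat n)) (to_nat x)) = 0" by (rule generic_seq_zero[OF k])
  then show ?thesis by simp
qed

lemma generic_point_derivation:
  fixes c :: "'i::finite params"
  assumes k: "complex_subfield k" "countable k"
  shows "\<exists>\<delta>. deriv_on UNIV \<delta> \<and> (\<forall>x\<in>k. \<delta> x = 0) \<and> (\<forall>x\<in>par_idx d. \<delta> (generic_point k x) = c x)"
proof -
  have "finite (to_nat ` (par_idx d :: (nat \<times> ('i \<Rightarrow> nat)) set))" by (intro finite_imageI finite_par_idx)
  then obtain N where "\<forall>y \<in> to_nat ` (par_idx d :: (nat \<times> ('i \<Rightarrow> nat)) set). y < N"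
    unfolding finite_nat_set_iff_bounded by blast
  then have N: "to_nat x < N" if "x \<in> par_idx d" for x :: "nat \<times> ('i \<Rightarrow> nat)" using that by blast
  obtain \<delta> where "deriv_on UNIV \<delta>" "\<forall>x\<in>k. \<delta> x = 0" "\<forall>i<N. \<delta> (generic_seq k i) = c (from_nat i)"
    using ex_derivation[OF k, of N "\<lambda>i. c (from_nat i)"] by blast
  then show ?thesis using N by (intro exI[of _ \<delta>]) (simp add: generic_point_def)
qed

lemma deriv_on_kpolys_zero:
  assumes d: "deriv_on UNIV \<delta>" "\<And>x. x \<in> k \<Longrightarrow> \<delta> x = 0" "\<And>x. x \<in> B \<Longrightarrow> \<delta> (t x) = 0" and F: "F \<in> kpolys k ((\<lambda>x t. t x) ` B)"
  shows "\<delta> (F t) = 0"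
  using F by induction (auto simp: d deriv_on_simps(1,2)[OF d(1)])

lemma fractions_subfield:
  assumes R: "0 \<in> R" "1 \<in> R" "\<And>x y. x \<in> R \<Longrightarrow> y \<in> R \<Longrightarrow> x + y \<in> R" "\<And>x y. x \<in> R \<Longrightarrow> y \<in> R \<Longrightarrow> x * y \<in> R"
    "\<And>x. x \<in> R \<Longrightarrow> - x \<in> R"
  shows "complex_subfield {x / y | x y. x \<in> R \<and> y \<in> R \<and> y \<noteq> 0}" (is "complex_subfield ?K")
proof -
  have mem: "x / y \<in> ?K" if "x \<in> R" "y \<in> R" "y \<noteq> 0" for x y using that by blast
  have "0 / 1 \<in> ?K" "1 / 1 \<in> ?K" by (rule mem; use R in simp)+
  moreover have "x + y \<in> ?K" "x * y \<in> ?K" if xy: "x \<in> ?K" "y \<in> ?K" for x y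
  proof -
    obtain a b where a: "a \<in> R" "b \<in> R" "b \<noteq> 0" "x = a / b" using xy(1) by blast
    obtain c e where c: "c \<in> R" "e \<in> R" "e \<noteq> 0" "y = c / e" using xy(2) by blast
    have "x + y = (a * e + c * b) / (b * e)" using a c by (simp add: add_frac_eq)
    moreover have "(a * e + c * b) / (b * e) \<in> ?K" using a c R(3,4) by (intro mem) auto
    ultimately show "x + y \<in> ?K" by simp
    have "x * y = (a * c) / (b * e)" using a c by simp
    moreover have "(a * c) / (b * e) \<in> ?K" using a c R(4) by (intro mem) auto
    ultimately show "x * y \<in> ?K" by simp
  qed
  moreover have "- x \<in> ?K" "inverse x \<in> ?K" if x: "x \<in> ?K" for x
  proof -
    obtain a b where a: "a \<in> R" "b \<in> R" "b \<noteq> 0" "x = a / b" using x by blast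
    have "- x = (- a) / b" using a by simp
    moreover have "(- a) / b \<in> ?K" using a R(5) by (intro mem) auto
    ultimately show "- x \<in> ?K" by simp
    show "inverse x \<in> ?K"
    proof (cases "a = 0")
      case True
      then have "inverse x = 0 / 1" using a by simp
      then show ?thesis using \<open>0 / 1 \<in> ?K\<close> by simp
    next
      case False
      then have "inverse x = b / a" using a by simp
      then show ?thesis using mem[OF a(2,1) False] by simp
    qed
  qed
  ultimately show ?thesis unfolding complex_subfield_def by simp
qed

lemma ex_countable_subfield:
  assumes "finite S"
  shows "\<exists>k. complex_subfield k \<and> countable k \<and> S \<subseteq> k"
  using assms
proof (induction S)
  case empty
  have "complex_subfield \<rat>" by (auto simp: complex_subfield_def)
  moreover have "countable (\<rat> :: complex set)" unfolding Rats_def by (intro countable_image) simp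
  ultimately show ?case by blast
next
  case (insert a S)
  then obtain k where "complex_subfield k" "countable k" "S \<subseteq> k" by blast
  then show ?case using adjoin_subfield[of k a] adjoin_countable[of k a] adjoin_superset[of k a] adjoin_mem[of k a]
    by (intro exI[of _ "adjoin k a"]) auto
qed

section \<open>Recovering the hyperplane rationally\<close>

text \<open>Only the countably many natural points serve as coordinates of a form. The field
  generated by the values of \<open>f\<close> stays countable, so homomorphisms can be extended from
  it, and forms are still determined by these values.\<close>

definition nat_evals :: "((complex^'i \<Rightarrow> complex) \<Rightarrow> complex) set" where
  "nat_evals = (\<lambda>u f. f u) ` {u. nat_point u}"

lemma countable_nat_evals: "countable (nat_evals :: ((complex^'i \<Rightarrow> complex) \<Rightarrow> complex) set)"
proof -
  have "{u :: complex^'i. nat_point u} \<subseteq> range (\<lambda>e :: 'i \<Rightarrow> nat. \<chi> i. of_nat (e i))"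
  proof
    fix u :: "complex^'i" assume "u \<in> {u. nat_point u}"
    then have "\<forall>i. \<exists>n. u $ i = of_nat n" by (simp add: nat_point_def)
    from choice[OF this] obtain e where "\<forall>i. u $ i = of_nat (e i)" by blast
    then have "u = (\<chi> i. of_nat (e i))" by (simp add: vec_eq_iff)
    then show "u \<in> range (\<lambda>e :: 'i \<Rightarrow> nat. \<chi> i. of_nat (e i))" by blast
  qed
  then have "countable {u :: complex^'i. nat_point u}" by (rule countable_subset) simp
  then show ?thesis unfolding nat_evals_def by (rule countable_image)
qed

text \<open>If a ratio of coordinates of \<open>v\<close> were not in the field generated by the values of \<open>f\<close>, an
  field homomorphism moving it would produce a second hyperplane for the same \<open>f\<close>.\<close>

lemma generic_ratio:
  fixes \<omega> :: "complex^'i \<Rightarrow> complex^'i \<Rightarrow> complex" and k :: "complex set"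
  defines "t0 \<equiv> generic_point k"
  assumes n: "CARD('i) = 2 * n" and w: "symplectic_form \<omega>" and nmd: "n \<ge> 2" "m \<ge> 2" "d \<ge> m"
    and hyp: "A_num n d m - H_num n d m > D_num n m"
    and k: "complex_subfield k" "countable k" and wk: "\<And>i j. \<omega> (axis i 1) (axis j 1) \<in> k"
    and ab: "\<And>i. a $ i \<in> k" "\<And>i. b $ i \<in> k"
    and E: "par_q m t0 (hyper_pt \<omega> a b (par_v t0)) \<noteq> 0" and g0: "par_form 3 (d - m) t0 (par_v t0) \<noteq> 0"
    and j0: "par_v t0 $ j0 \<noteq> 0"
  shows "\<exists>P\<in>kpolys k nat_evals. \<exists>Q\<in>kpolys k nat_evals. Q (par_f \<omega> m d t0) \<noteq> 0 \<and>
    par_v t0 $ i * Q (par_f \<omega> m d t0) = par_v t0 $ j0 * P (par_f \<omega> m d t0)"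
proof -
  let ?f = "par_f \<omega> m d"
  note wD = symplectic_formD[OF w]
  \<comment> \<open>\<open>R\<close> is the ring generated over \<open>k\<close> by the values of
    the generic \<open>f\<close>, and \<open>K\<close> below its field of fractions; the claim is
    that the ratio lies in \<open>K\<close>.\<close>
  define R where "R = {P (?f t0) | P. P \<in> kpolys k nat_evals}"
  have R: "0 \<in> R" "1 \<in> R" "\<And>x y. x \<in> R \<Longrightarrow> y \<in> R \<Longrightarrow> x + y \<in> R" "\<And>x y. x \<in> R \<Longrightarrow> y \<in> R \<Longrightarrow> x * y \<in> R"
    "\<And>x. x \<in> R \<Longrightarrow> - x \<in> R" and kR: "k \<subseteq> R"
  proof -
    show kR: "k \<subseteq> R" using kpolys.const unfolding R_def by fastforce
    then show "0 \<in> R" "1 \<in> R" using complex_subfieldD(1,2)[OF k(1)] by blast+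
    show "x + y \<in> R" if "x \<in> R" "y \<in> R" for x y
    proof -
      from that obtain P Q where "P \<in> kpolys k nat_evals" "Q \<in> kpolys k nat_evals" "x = P (?f t0)" "y = Q (?f t0)"
        unfolding R_def by blast
      then show ?thesis unfolding R_def using kpolys.add[of P k nat_evals Q] by (intro CollectI exI[of _ "\<lambda>z. P z + Q z"]) simp
    qed
    show "x * y \<in> R" if "x \<in> R" "y \<in> R" for x y
    proof -
      from that obtain P Q where "P \<in> kpolys k nat_evals" "Q \<in> kpolys k nat_evals" "x = P (?f t0)" "y = Q (?f t0)"
        unfolding R_def by blast
      then show ?thesis unfolding R_def using kpolys.mult[of P k nat_evals Q] by (intro CollectI exI[of _ "\<lambda>z. P z * Q z"]) simp
    qed
    show "- x \<in> R" if "x \<in> R" for x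
    proof -
      from that obtain P where "P \<in> kpolys k nat_evals" "x = P (?f t0)" unfolding R_def by blast
      then show ?thesis unfolding R_def using kpolys_minus[OF k(1), of P nat_evals] by (intro CollectI exI[of _ "\<lambda>z. - P z"]) simp
    qed
  qed
  define K where "K = {x / y | x y. x \<in> R \<and> y \<in> R \<and> y \<noteq> 0}"
  have K: "complex_subfield K" unfolding K_def by (rule fractions_subfield) (use R in auto)
  have RK: "R \<subseteq> K"
  proof
    fix x assume "x \<in> R"
    then have "x / 1 \<in> K" unfolding K_def using R(2) by (intro CollectI exI[of _ x] exI[of _ 1]) simp
    then show "x \<in> K" by simp
  qed
  have "countable R"
  proof -
    have "R = (\<lambda>P. P (?f t0)) ` kpolys k nat_evals" by (auto simp: R_def)
    then show ?thesis using countable_image[OF kpolys_countable[OF k(2) countable_nat_evals]] by (simp only:)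
  qed
  then have "countable ((\<lambda>(x, y). x / y) ` (R \<times> R))" by (intro countable_image countable_SIGMA)
  moreover have "K \<subseteq> (\<lambda>(x, y). x / y) ` (R \<times> R)" unfolding K_def by force
  ultimately have Kc: "countable K" by (rule countable_subset[rotated])
  have "par_v t0 $ i / par_v t0 $ j0 \<in> K"
  proof (rule ccontr)
    assume notK: "par_v t0 $ i / par_v t0 $ j0 \<notin> K"
    obtain L \<sigma> where L: "complex_subfield L" "hom_on L (\<sigma> :: complex \<Rightarrow> complex)"
      "K \<union> t0 ` par_idx d \<union> {par_v t0 $ i / par_v t0 $ j0} \<subseteq> L" "\<forall>x\<in>K. \<sigma> x = x"
      "\<sigma> (par_v t0 $ i / par_v t0 $ j0) \<noteq> par_v t0 $ i / par_v t0 $ j0"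
      using hom_on_moving[OF K Kc notK, of "t0 ` par_idx d"] finite_par_idx by blast
    \<comment> \<open>The conjugate parameters. As \<open>\<sigma>\<close> fixes \<open>k\<close>
      and the values of \<open>f\<close>, they decompose the same form, but with a different ratio
      of the coordinates \<open>i\<close> and \<open>j0\<close>.\<close>
    define t1 where "t1 x = \<sigma> (t0 x)" for x
    have kL: "k \<subseteq> L" "\<And>x. x \<in> k \<Longrightarrow> \<sigma> x = x" using kR RK L(3,4) by blast+
    have tL: "\<And>x. x \<in> par_idx d \<Longrightarrow> t0 x \<in> L" using L(3) by blast
    have \<sigma>F: "F t0 \<in> L \<and> \<sigma> (F t0) = F t1" if "F \<in> kpolys k ((\<lambda>x t. t x) ` par_idx d)" for F
      using hom_on_kpolys[where t = t0 and A = "par_idx d", OF L(1,2) kL tL that] unfolding t1_def[abs_def] by blast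
    have idx: "(0, unit_exp i) \<in> par_idx d" "(1, unit_exp i) \<in> par_idx d" for i :: 'i
      using nmd by (auto intro!: par_idxI[OF _ _ unit_exp_mons])
    have vk: "(\<lambda>t. par_v t $ i) \<in> kpolys k ((\<lambda>x t. t x) ` par_idx d)" for i :: 'i
      by (rule par_v_kpolys[OF k(1) idx(1)])
    have feq: "?f t0 = ?f t1"
    proof (rule vpolys_eq_on_nat)
      have "d \<ge> 1" using nmd by simp
      then show "?f t0 \<in> vpolys" "?f t1 \<in> vpolys" using forms_vpolys[OF par_f_forms[OF w nmd(3)]] by blast+
      fix u :: "complex^'i" assume u: "nat_point u"
      then have uk: "u $ i \<in> k" for i using complex_subfield_of_nat[OF k(1)] unfolding nat_point_def by metis
      have "(\<lambda>t. par_f \<omega> m d t u) \<in> kpolys k ((\<lambda>x t. t x) ` par_idx d)"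
        using nmd by (intro par_f_kpolys[OF k(1) w wk _ _ uk]) auto
      then have "\<sigma> (?f t0 u) = ?f t1 u" using \<sigma>F by blast
      moreover have "?f t0 u \<in> R" unfolding R_def
        by (intro CollectI exI[of _ "\<lambda>f. f u"] conjI refl kpolys.coord) (auto simp: nat_evals_def u)
      then have "\<sigma> (?f t0 u) = ?f t0 u" using RK L(4) by blast
      ultimately show "?f t0 u = ?f t1 u" by simp
    qed
    have "(\<lambda>t. par_q m t (hyper_pt \<omega> a b (par_v t))) \<in> kpolys k ((\<lambda>x t. t x) ` par_idx d)"
    proof (rule par_q_kpolys[OF k(1) idx])
      show "(2, \<alpha>) \<in> par_idx d" if "\<alpha> \<in> mons UNIV m" for \<alpha> :: "'i \<Rightarrow> nat" using that nmd by (auto intro: par_idxI)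
      show "(\<lambda>t. hyper_pt \<omega> a b (par_v t) $ i) \<in> kpolys k ((\<lambda>x t. t x) ` par_idx d)" for i
        by (rule hyper_pt_kpolys[OF k(1) w wk vk ab])
    qed
    \<comment> \<open>The test value at \<open>hyper_pt\<close> is a polynomial over
      \<open>k\<close> in the parameters, so its nonvanishing survives
      \<open>\<sigma>\<close>.\<close>
    from \<sigma>F[OF this] have E1: "par_q m t1 (hyper_pt \<omega> a b (par_v t1)) \<noteq> 0"
      using hom_on_unit[OF L(1,2)] E by (metis mult_zero_left zero_neq_one)
    have on: "\<omega> (par_v t) (hyper_pt \<omega> a b (par_v t)) = 0" for t
      unfolding hyper_pt_def by (simp add: linear_formsD[OF wD(1)])
    have v1: "\<sigma> (par_v t0 $ l) = par_v t1 $ l \<and> par_v t0 $ l \<in> L" for l using \<sigma>F[OF vk[of l]] by blast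
    have v1j: "par_v t1 $ j0 \<noteq> 0"
      using hom_on_unit[OF L(1,2), of "par_v t0 $ j0"] v1[of j0] j0 by (metis mult_zero_left zero_neq_one)
    have eq: "par_q m t0 u * par_form 3 (d - m) t0 u + \<omega> (par_v t0) u * par_form 4 (d - 1) t0 u =
        par_q m t1 u * par_form 3 (d - m) t1 u + \<omega> (par_v t1) u * par_form 4 (d - 1) t1 u" for u
      using fun_cong[OF feq, of u] unfolding par_f_def .
    have "\<exists>c. par_v t0 = c *s par_v t1"
    proof (rule hyperplane_unique[OF n w nmd hyp par_q_forms par_q_cone _ par_form_forms g0 forms_vpolys[OF par_form_forms]
          par_q_forms par_q_cone _ par_form_forms forms_vpolys[OF par_form_forms] _ eq])
      show "\<exists>u. \<omega> (par_v t0) u = 0 \<and> par_q m t0 u \<noteq> 0" "\<exists>u. \<omega> (par_v t1) u = 0 \<and> par_q m t1 u \<noteq> 0"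
        using E E1 on by blast+
      show "par_v t1 \<noteq> 0" using v1j by auto
      fix \<psi> :: "complex^'i \<Rightarrow> complex" assume "\<psi> \<in> forms (d - 1)"
      then obtain e where e: "\<psi> = hform (d - 1) e" unfolding forms_eq_hforms by blast
      \<comment> \<open>Block 4 holds the coefficients of \<open>h\<close>; within
        \<open>par_idx d\<close> only they are moved, with the coefficients of \<open>\<psi>\<close>
        as derivatives.\<close>
      obtain \<delta> where d: "deriv_on UNIV \<delta>" "\<forall>x\<in>k. \<delta> x = 0" "\<forall>x\<in>par_idx d. \<delta> (t0 x) = (if fst x = 4 then e (snd x) else 0)"
        using generic_point_derivation[OF k, of d "\<lambda>x. if fst x = 4 then e (snd x) else 0"] unfolding t0_def by blast
      let ?B = "{x \<in> par_idx d. fst x \<noteq> 4}"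
      have dB: "\<delta> (F t0) = 0" if "F \<in> kpolys k ((\<lambda>x t. t x) ` ?B)" for F
        by (rule deriv_on_kpolys_zero[OF d(1) _ _ that]) (use d in auto)
      have idxB: "(0, unit_exp i) \<in> ?B" "(1, unit_exp i) \<in> ?B" for i :: 'i using idx by auto
      show "\<exists>\<delta>. deriv_on UNIV \<delta> \<and> (\<forall>i j. \<delta> (\<omega> (axis i 1) (axis j 1)) = 0) \<and> (\<forall>i. \<delta> (par_v t0 $ i) = 0) \<and>
        (\<forall>u. nat_point u \<longrightarrow> \<delta> (par_q m t0 u) = 0 \<and> \<delta> (par_form 3 (d - m) t0 u) = 0 \<and> \<delta> (par_form 4 (d - 1) t0 u) = \<psi> u)"
      proof (intro exI[of _ \<delta>] conjI allI impI d(1))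
        show "\<delta> (\<omega> (axis i 1) (axis j 1)) = 0" for i j using d(2) wk by blast
        show "\<delta> (par_v t0 $ i) = 0" for i by (rule dB[OF par_v_kpolys[OF k(1) idxB(1)]])
        fix u :: "complex^'i" assume u: "nat_point u"
        then have "u $ i \<in> k" for i using complex_subfield_of_nat[OF k(1)] unfolding nat_point_def by metis
        then have uk: "(\<lambda>t. u $ i) \<in> kpolys k ((\<lambda>x t. t x) ` ?B)" for i by (rule kpolys.const)
        show "\<delta> (par_q m t0 u) = 0"
          by (rule dB[OF par_q_kpolys[OF k(1) idxB _ uk]]) (use nmd in \<open>auto intro: par_idxI\<close>)
        show "\<delta> (par_form 3 (d - m) t0 u) = 0"
          by (rule dB[OF hform_kpolys[OF k(1) _ uk]]) (use par_idxI[of 3 "d - m" d] in simp)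
        have "\<delta> (par_form 4 (d - 1) t0 u) = hform (d - 1) (\<lambda>\<alpha>. \<delta> (t0 (4, \<alpha>))) u"
          unfolding par_form_def by (rule hform_derivation_nat[OF d(1) u])
        also have "\<dots> = \<psi> u"
          unfolding e hform_def
        proof (intro sum.cong refl)
          fix \<alpha> :: "'i \<Rightarrow> nat" assume "\<alpha> \<in> mons UNIV (d - 1)"
          then have "(4, \<alpha>) \<in> par_idx d" by (intro par_idxI[of 4 "d - 1"]) simp_all
          then show "\<delta> (t0 (4, \<alpha>)) * mvmono \<alpha> u = e \<alpha> * mvmono \<alpha> u" using d(3) by simp
        qed
        finally show "\<delta> (par_form 4 (d - 1) t0 u) = \<psi> u" .
      qed
    qed
    then obtain c where c: "par_v t0 = c *s par_v t1" by blast
    have "par_v t0 $ i / par_v t0 $ j0 = par_v t1 $ i / par_v t1 $ j0" using j0 unfolding c by simp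
    moreover have "\<sigma> (par_v t0 $ i / par_v t0 $ j0) * par_v t1 $ j0 = par_v t1 $ i"
    proof -
      have "\<sigma> (par_v t0 $ i / par_v t0 $ j0 * par_v t0 $ j0) = \<sigma> (par_v t0 $ i / par_v t0 $ j0) * \<sigma> (par_v t0 $ j0)"
        using L(3) v1 by (intro hom_onD(3)[OF L(2)]) auto
      then show ?thesis using v1 j0 by simp
    qed
    then have "\<sigma> (par_v t0 $ i / par_v t0 $ j0) = par_v t1 $ i / par_v t1 $ j0" using v1j by (simp add: eq_divide_eq)
    ultimately show False using L(5) by simp
  qed
  then obtain x y where xy: "x \<in> R" "y \<in> R" "y \<noteq> 0" "par_v t0 $ i / par_v t0 $ j0 = x / y" unfolding K_def by blast
  then obtain P Q where PQ: "P \<in> kpolys k nat_evals" "Q \<in> kpolys k nat_evals" "x = P (?f t0)" "y = Q (?f t0)"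
    unfolding R_def by blast
  have "par_v t0 $ i * y = par_v t0 $ j0 * x" using xy(3,4) j0 by (simp add: frac_eq_eq mult.commute)
  then show ?thesis using PQ xy(3) by blast
qed

text \<open>With \<open>\<omega> v a = 1\<close> and \<open>b\<close> in the hyperplane the point is
  \<open>b\<close> itself, so it suffices that the hyperplane is more than the line of
  \<open>v\<close>, which holds in dimension at least three. A power of the coordinate found here is
  a cone over the axis vector that is nonzero at the point.\<close>

lemma ex_hyper_pt_nonzero:
  fixes \<omega> :: "complex^'i \<Rightarrow> complex^'i \<Rightarrow> complex"
  assumes w: "symplectic_form \<omega>" and card: "CARD('i) \<ge> 3"
  shows "\<exists>a b i i0. i \<noteq> i0 \<and> hyper_pt \<omega> a b (axis i0 1) $ i \<noteq> 0"
proof -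
  note wD = symplectic_formD[OF w]
  obtain i0 :: 'i where True by blast
  let ?v = "axis i0 1 :: complex^'i"
  have "?v \<noteq> 0" by (simp add: axis_eq_0_iff)
  then obtain a' where "\<omega> ?v a' \<noteq> 0" using wD(4)[of ?v] by blast
  then obtain a where a: "\<omega> ?v a = 1"
    using linear_formsD(2)[OF wD(1), of ?v "inverse (\<omega> ?v a')" a'] by (metis left_inverse)
  have "\<exists>i j :: 'i. i \<noteq> i0 \<and> j \<noteq> i0 \<and> i \<noteq> j"
  proof -
    have "card {i0, i} < card (UNIV :: 'i set)" for i
      using card card_insert_le_m1[of 2 "{i}" i0] by simp
    then have *: "\<exists>j. j \<notin> {i0, i}" for i by (metis UNIV_eq_I less_irrefl)
    obtain i where i: "i \<noteq> i0" using *[of i0] by blast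
    obtain j where "j \<notin> {i0, i}" using * by blast
    then show ?thesis using i by blast
  qed
  then obtain i j :: 'i where ij: "i \<noteq> i0" "j \<noteq> i0" "i \<noteq> j" by blast
  have "\<exists>b l. l \<noteq> i0 \<and> \<omega> ?v b = 0 \<and> b $ l \<noteq> 0"
  proof (cases "\<omega> ?v (axis i 1) = 0")
    case True
    then show ?thesis using ij by (intro exI[of _ "axis i 1"] exI[of _ i]) (simp add: axis_def)
  next
    case False
    let ?b = "\<omega> ?v (axis i 1) *s axis j 1 - \<omega> ?v (axis j 1) *s axis i 1"
    have "\<omega> ?v ?b = 0" by (simp add: linear_formsD[OF wD(1)])
    moreover have "?b $ j \<noteq> 0" using False ij by (simp add: axis_def)
    ultimately show ?thesis using ij by blast
  qed
  then obtain b l where b: "l \<noteq> i0" "\<omega> ?v b = 0" "b $ l \<noteq> 0" by blast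
  then have "hyper_pt \<omega> a b ?v $ l \<noteq> 0" by (simp add: hyper_pt_def a)
  then show ?thesis using b(1) by blast
qed

text \<open>Spreads the ratios found at the generic point to identities in all parameters, with one
  common denominator.\<close>

lemma rational_inverse:
  fixes \<omega> :: "complex^'i \<Rightarrow> complex^'i \<Rightarrow> complex"
  assumes n: "CARD('i) = 2 * n" and w: "symplectic_form \<omega>" and nmd: "n \<ge> 2" "m \<ge> 2" "d \<ge> m"
    and hyp: "A_num n d m - H_num n d m > D_num n m"
  shows "\<exists>t0 a b j0 Q P. par_q m t0 (hyper_pt \<omega> a b (par_v t0)) \<noteq> 0 \<and> par_form 3 (d - m) t0 (par_v t0) \<noteq> 0 \<and>
    par_v t0 $ j0 \<noteq> 0 \<and> Q (par_f \<omega> m d t0) \<noteq> 0 \<and> Q \<in> kpolys UNIV nat_evals \<and> (\<forall>i. P i \<in> kpolys UNIV nat_evals) \<and>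
    (\<forall>t i. par_v t $ i * Q (par_f \<omega> m d t) = par_v t $ j0 * P i (par_f \<omega> m d t))"
proof -
  have card: "CARD('i) \<ge> 3" using n nmd by simp
  obtain a b :: "complex^'i" and i i0 where ab: "i \<noteq> i0" "hyper_pt \<omega> a b (axis i0 1) $ i \<noteq> 0"
    using ex_hyper_pt_nonzero[OF w card] by blast
  define S where "S = range (\<lambda>(i, j). \<omega> (axis i 1) (axis j 1)) \<union> range (\<lambda>i. a $ i) \<union> range (\<lambda>i. b $ i)"
  have "finite S" unfolding S_def by simp
  then obtain k where k: "complex_subfield k" "countable k" "S \<subseteq> k" using ex_countable_subfield by blast
  have wk: "\<omega> (axis i 1) (axis j 1) \<in> k" for i j using k(3) unfolding S_def by (auto simp: image_subset_iff)
  have abk: "a $ i \<in> k" "b $ i \<in> k" for i using k(3) unfolding S_def by (auto simp: image_subset_iff)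
  let ?t0 = "generic_point k :: 'i params"
  \<comment> \<open>Sample parameters meeting the nonvanishing conditions: \<open>v\<close> is a
    basis vector, \<open>q\<close> becomes a power of another coordinate, and \<open>g\<close> is a
    power of the coordinate \<open>i0\<close>. The generic point then meets them as well.\<close>
  let ?x = "\<lambda>u :: complex^'i. u $ i0" and ?p = "\<lambda>u :: complex^'i. (u $ i) ^ m" and ?g = "\<lambda>u :: complex^'i. (u $ i0) ^ (d - m)"
  obtain t where t: "par_v t = axis i0 1" "par_xi t = ?x" "par_form 2 m t = ?p" "par_form 3 (d - m) t = ?g"
    using ex_params[of ?x ?p m ?g "d - m" "\<lambda>_. 0" 0 "\<lambda>_. 0" 0 "axis i0 1"] linear_forms_coord
      forms_power[OF linear_forms_coord] forms_0 by blast
  have vk: "(\<lambda>t. par_v t $ i) \<in> kpolys k coords" for i :: 'i by (rule par_v_kpolys[OF k(1)]) simp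
  have "(\<lambda>t. par_q m t (hyper_pt \<omega> a b (par_v t))) \<in> kpolys k coords"
    by (rule par_q_kpolys[OF k(1) _ _ _ hyper_pt_kpolys[OF k(1) w wk vk abk]]) simp_all
  moreover have "par_q m t (hyper_pt \<omega> a b (par_v t)) \<noteq> 0"
    using ab unfolding par_q_def t by (simp add: axis_def)
  ultimately have E: "par_q m ?t0 (hyper_pt \<omega> a b (par_v ?t0)) \<noteq> 0"
    using generic_point_zero[OF k(1,2)] by blast
  have "(\<lambda>t :: 'i params. par_form 3 (d - m) t (par_v t)) \<in> kpolys k coords"
    using hform_kpolys[OF k(1), of "d - m" 3 "UNIV :: (nat \<times> ('i \<Rightarrow> nat)) set" par_v] vk by simp
  moreover have "par_form 3 (d - m) t (par_v t) \<noteq> 0" unfolding t by (simp add: axis_def)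
  ultimately have g0: "par_form 3 (d - m) ?t0 (par_v ?t0) \<noteq> 0"
    using generic_point_zero[OF k(1,2)] by blast
  have "par_v t $ i0 \<noteq> 0" unfolding t by (simp add: axis_def)
  then have v0: "par_v ?t0 $ i0 \<noteq> 0" using generic_point_zero[OF k(1,2) vk] by blast
  have "\<forall>i. \<exists>P Q. P \<in> kpolys k nat_evals \<and> Q \<in> kpolys k nat_evals \<and> Q (par_f \<omega> m d ?t0) \<noteq> 0 \<and>
    par_v ?t0 $ i * Q (par_f \<omega> m d ?t0) = par_v ?t0 $ i0 * P (par_f \<omega> m d ?t0)"
    using generic_ratio[OF n w nmd hyp k(1,2) wk abk E g0 v0] by blast
  from choice[OF this] obtain P where "\<forall>i. \<exists>Q. P i \<in> kpolys k nat_evals \<and> Q \<in> kpolys k nat_evals \<and> Q (par_f \<omega> m d ?t0) \<noteq> 0 \<and>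
    par_v ?t0 $ i * Q (par_f \<omega> m d ?t0) = par_v ?t0 $ i0 * P i (par_f \<omega> m d ?t0)" by blast
  from choice[OF this] obtain Q where PQ: "\<And>i. P i \<in> kpolys k nat_evals" "\<And>i. Q i \<in> kpolys k nat_evals" "\<And>i. Q i (par_f \<omega> m d ?t0) \<noteq> 0"
    "\<And>i. par_v ?t0 $ i * Q i (par_f \<omega> m d ?t0) = par_v ?t0 $ i0 * P i (par_f \<omega> m d ?t0)" by blast
  \<comment> \<open>Each coordinate came with its own denominator; their product is a common
    one.\<close>
  define Q' where "Q' f = (\<Prod>l\<in>UNIV. Q l f)" for f
  define P' where "P' i f = P i f * (\<Prod>l\<in>UNIV - {i}. Q l f)" for i f
  have Q'k: "Q' \<in> kpolys k nat_evals" unfolding Q'_def[abs_def] by (intro kpolys_prod[OF k(1)] PQ)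
  have P'k: "P' i \<in> kpolys k nat_evals" for i unfolding P'_def[abs_def] by (intro kpolys.mult kpolys_prod[OF k(1)] PQ)
  have Q'0: "Q' (par_f \<omega> m d ?t0) \<noteq> 0" using PQ(3) by (simp add: Q'_def)
  have QP0: "par_v ?t0 $ i * Q' (par_f \<omega> m d ?t0) = par_v ?t0 $ i0 * P' i (par_f \<omega> m d ?t0)" for i
  proof -
    have "Q' (par_f \<omega> m d ?t0) = Q i (par_f \<omega> m d ?t0) * (\<Prod>l\<in>UNIV - {i}. Q l (par_f \<omega> m d ?t0))"
      unfolding Q'_def by (rule prod.remove) simp_all
    then show ?thesis using PQ(4)[of i] unfolding P'_def by (simp add: mult.assoc[symmetric])
  qed
  have fk: "(\<lambda>t. c (par_f \<omega> m d t)) \<in> kpolys k coords" if "c \<in> nat_evals" for c :: "(complex^'i \<Rightarrow> complex) \<Rightarrow> complex"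
  proof -
    obtain u where u: "nat_point u" "c = (\<lambda>f. f u)" using \<open>c \<in> nat_evals\<close> unfolding nat_evals_def by blast
    have uk: "u $ i \<in> k" for i using u(1) complex_subfield_of_nat[OF k(1)] unfolding nat_point_def by metis
    have d1: "d \<ge> 1" using nmd by simp
    show ?thesis unfolding u(2)
      by (rule kpolys_mono[OF par_f_kpolys[OF k(1) w wk nmd(3) d1 uk]]) auto
  qed
  have "par_v t $ i * Q' (par_f \<omega> m d t) = par_v t $ i0 * P' i (par_f \<omega> m d t)" for t i
  proof -
    have "(\<lambda>t. par_v t $ i * Q' (par_f \<omega> m d t) - par_v t $ i0 * P' i (par_f \<omega> m d t)) \<in> kpolys k coords"
      by (intro kpolys_diff[OF k(1)] kpolys.mult vk kpolys_compose[OF Q'k fk] kpolys_compose[OF P'k fk])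
    then have "par_v t $ i * Q' (par_f \<omega> m d t) - par_v t $ i0 * P' i (par_f \<omega> m d t) = 0"
      by (rule generic_point_zero[OF k(1,2)]) (simp add: QP0)
    then show ?thesis by simp
  qed
  moreover have "Q' \<in> kpolys UNIV nat_evals" "P' i \<in> kpolys UNIV nat_evals" for i
    by (rule kpolys_mono[OF Q'k]; simp) (rule kpolys_mono[OF P'k]; simp)
  ultimately show ?thesis using E g0 v0 Q'0 by blast
qed

section \<open>Interpolation\<close>

text \<open>Lagrange polynomials for the nodes \<open>0, ..., d\<close>: the difference to the
  interpolant has degree at most \<open>d\<close> and \<open>d + 1\<close> roots.\<close>

lemma lagrange_basis:
  fixes d :: nat
  shows "\<exists>L :: nat \<Rightarrow> complex poly. \<forall>P. degree P \<le> d \<longrightarrow> P = (\<Sum>k\<le>d. smult (poly P (of_nat k)) (L k))"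
proof -
  define L :: "nat \<Rightarrow> complex poly" where
    "L k = (\<Prod>j\<in>{..d} - {k}. smult (inverse (of_nat k - of_nat j)) [:- of_nat j, 1:])" for k
  have deg: "degree (L k) \<le> d" if "k \<le> d" for k
  proof -
    have "degree (L k) \<le> (\<Sum>j\<in>{..d} - {k}. degree (smult (inverse (of_nat k - of_nat j)) [:- of_nat j, 1 :: complex:]))"
      unfolding L_def by (rule degree_prod_sum_le[unfolded o_def]) simp
    also have "\<dots> \<le> (\<Sum>j\<in>{..d} - {k}. 1)"
      by (intro sum_mono order.trans[OF degree_smult_le]) simp
    also have "\<dots> = d" using that by simp
    finally show ?thesis .
  qed
  have val: "poly (L k) (of_nat l) = (if k = l then 1 else 0)" if "k \<le> d" "l \<le> d" for k l
  proof (cases "k = l")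
    case True
    have "poly (L k) (of_nat l) = (\<Prod>j\<in>{..d} - {k}. 1)"
      unfolding L_def poly_prod     proof (intro prod.cong refl)
      fix j assume "j \<in> {..d} - {k}"
      then have "(of_nat l :: complex) - of_nat j \<noteq> 0" using True by auto
      then show "poly (smult (inverse (of_nat k - of_nat j)) [:- of_nat j, 1:]) (of_nat l) = (1 :: complex)"
        unfolding poly_smult True by (simp add: field_simps)
    qed
    then show ?thesis using True by simp
  next
    case False
    have "poly (L k) (of_nat l) = 0"
      unfolding L_def poly_prod using that False by (intro prod_zero bexI[of _ l]) auto
    then show ?thesis using False by simp
  qed
  have "P = (\<Sum>k\<le>d. smult (poly P (of_nat k)) (L k))" if P: "degree P \<le> d" for P
  proof -
    let ?D = "P - (\<Sum>k\<le>d. smult (poly P (of_nat k)) (L k))"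
    have "degree ?D \<le> d"
      by (intro degree_diff_le P degree_sum_le order.trans[OF degree_smult_le] deg) auto
    have z: "poly ?D (of_nat l) = 0" if "l \<le> d" for l
    proof -
      have "(\<Sum>k\<le>d. poly P (of_nat k) * poly (L k) (of_nat l)) = (\<Sum>k\<le>d. if k = l then poly P (of_nat l) else 0)"
        by (intro sum.cong) (auto simp: val that)
      also have "\<dots> = poly P (of_nat l)" using that by simp
      finally show ?thesis by (simp add: poly_sum)
    qed
    have "?D = 0"
    proof (rule ccontr)
      assume D: "?D \<noteq> 0"
      have "card ((of_nat :: nat \<Rightarrow> complex) ` {..d}) \<le> card {x. poly ?D x = 0}"
        by (intro card_mono poly_roots_finite D) (use z in auto)
      also have "\<dots> \<le> degree ?D" by (rule card_poly_roots_bound[OF D])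
      also have "card ((of_nat :: nat \<Rightarrow> complex) ` {..d}) = Suc d" by (subst card_image) (auto simp: inj_on_def)
      finally show False using \<open>degree ?D \<le> d\<close> by simp
    qed
    then show ?thesis by simp
  qed
  then show ?thesis by blast
qed

lemma poly_from_coeffs:
  fixes c :: "nat \<Rightarrow> complex"
  shows "degree (\<Sum>j\<le>d. monom (c j) j) \<le> d" "poly (\<Sum>j\<le>d. monom (c j) j) s = (\<Sum>j\<le>d. s ^ j * c j)"
    "j \<le> d \<Longrightarrow> coeff (\<Sum>j\<le>d. monom (c j) j) j = c j"
  by (auto intro!: degree_sum_le order.trans[OF degree_monom_le] simp: poly_sum poly_monom mult.commute coeff_sum)

text \<open>Lagrange interpolation at the grid of natural points expresses a value of a form at a point depending
  polynomially on the form as a polynomial in its values at fixed points.\<close>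

lemma forms_eval_polynomial:
  fixes y :: "(complex^'i \<Rightarrow> complex) \<Rightarrow> complex^'i"
  assumes "\<And>i. (\<lambda>f. y f $ i) \<in> kpolys UNIV evaluations"
  shows "\<exists>F\<in>kpolys UNIV evaluations. \<forall>f\<in>forms d. f (y f) = F f"
proof -
  obtain L :: "nat \<Rightarrow> complex poly" where L: "\<And>P. degree P \<le> d \<Longrightarrow> P = (\<Sum>k\<le>d. smult (poly P (of_nat k)) (L k))"
    using lagrange_basis[of d] by blast
  \<comment> \<open>Induction on the set of coordinates that may depend on \<open>f\<close>: the
    coordinate \<open>j\<close> is frozen at the nodes and restored by interpolation.\<close>
  have "\<forall>y. (\<forall>i\<in>J. (\<lambda>f. y f $ i) \<in> kpolys UNIV evaluations) \<longrightarrow> (\<forall>i. i \<notin> J \<longrightarrow> (\<exists>c. \<forall>f. y f $ i = c)) \<longrightarrow>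
    (\<exists>F\<in>kpolys UNIV evaluations. \<forall>f\<in>forms d. f (y f) = F f)"
    if "finite J" for J :: "'i set"
    using that
  proof (induction J)
    case empty
    show ?case
    proof (intro allI impI)
      fix y :: "(complex^'i \<Rightarrow> complex) \<Rightarrow> complex^'i" assume "\<forall>i. i \<notin> {} \<longrightarrow> (\<exists>c. \<forall>f. y f $ i = c)"
      then have y0: "y f = y (\<lambda>_. 0)" for f by (simp add: vec_eq_iff) metis
      show "\<exists>F\<in>kpolys UNIV evaluations. \<forall>f\<in>forms d. f (y f) = F f"
      proof (intro bexI[of _ "\<lambda>f. f (y (\<lambda>_. 0))"] kpolys.coord ballI)
        show "f (y f) = f (y (\<lambda>_. 0))" for f by (rule arg_cong[OF y0])
      qed (auto simp: evaluations_def)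
    qed
  next
    case (insert j J)
    show ?case
    proof (intro allI impI)
      fix y :: "(complex^'i \<Rightarrow> complex) \<Rightarrow> complex^'i"
      assume y: "\<forall>i\<in>insert j J. (\<lambda>f. y f $ i) \<in> kpolys UNIV evaluations" "\<forall>i. i \<notin> insert j J \<longrightarrow> (\<exists>c. \<forall>f. y f $ i = c)"
      define z where "z s f = (\<chi> i. if i = j then s else y f $ i)" for s :: complex and f
      have "\<exists>F\<in>kpolys UNIV evaluations. \<forall>f\<in>forms d. f (z s f) = F f" for s
      proof (rule insert.IH[THEN spec, THEN mp, THEN mp])
        show "\<forall>i\<in>J. (\<lambda>f. z s f $ i) \<in> kpolys UNIV evaluations"
        proof
          fix i assume "i \<in> J"
          then have "i \<noteq> j" using insert.hyps by blast
          then show "(\<lambda>f. z s f $ i) \<in> kpolys UNIV evaluations" using y(1) \<open>i \<in> J\<close> by (simp add: z_def)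
        qed
        show "\<forall>i. i \<notin> J \<longrightarrow> (\<exists>c. \<forall>f. z s f $ i = c)"
          using y(2) by (auto simp: z_def)
      qed
      then have "\<forall>s. \<exists>F. F \<in> kpolys UNIV evaluations \<and> (\<forall>f\<in>forms d. f (z s f) = F f)" by blast
      from choice[OF this] obtain F where F: "\<And>s. F s \<in> kpolys UNIV evaluations" "\<And>s f. f \<in> forms d \<Longrightarrow> f (z s f) = F s f" by blast
      have pL: "(\<lambda>f. poly (L k) (y f $ j)) \<in> kpolys UNIV evaluations" for k
        unfolding poly_altdef using y(1)
        by (intro kpolys_sum[OF complex_subfield_UNIV] kpolys.mult kpolys.const kpolys_power[OF complex_subfield_UNIV]) auto
      show "\<exists>F\<in>kpolys UNIV evaluations. \<forall>f\<in>forms d. f (y f) = F f"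
      proof (intro bexI ballI)
        show "(\<lambda>f. \<Sum>k\<le>d. F (of_nat k) f * poly (L k) (y f $ j)) \<in> kpolys UNIV evaluations"
          by (intro kpolys_sum[OF complex_subfield_UNIV] kpolys.mult F pL)
        fix f :: "complex^'i \<Rightarrow> complex" assume f: "f \<in> forms d"
        obtain G where G: "\<And>u s. f (u + s *s axis j 1) = (\<Sum>l\<le>d. s ^ l * G l u)" using forms_expand_line[OF f, of "axis j 1"] by blast
        define P where "P = (\<Sum>l\<le>d. monom (G l (z 0 f)) l)"
        have zP: "f (z s f) = poly P s" for s
        proof -
          have "z s f = z 0 f + s *s axis j 1" by (simp add: vec_eq_iff z_def axis_def)
          then show ?thesis using G[of "z 0 f" s] by (simp add: P_def poly_from_coeffs)
        qed
        have "f (y f) = poly P (y f $ j)"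
        proof -
          have "z (y f $ j) f = y f" by (simp add: z_def vec_eq_iff)
          then show ?thesis using zP[of "y f $ j"] by simp
        qed
        also have "\<dots> = poly (\<Sum>k\<le>d. smult (poly P (of_nat k)) (L k)) (y f $ j)"
          by (rule arg_cong[where f = "\<lambda>p. poly p (y f $ j)"], rule L) (simp only: P_def poly_from_coeffs(1))
        also have "\<dots> = (\<Sum>k\<le>d. F (of_nat k) f * poly (L k) (y f $ j))"
          by (simp add: poly_sum zP[symmetric] F(2)[OF f])
        finally show "f (y f) = (\<Sum>k\<le>d. F (of_nat k) f * poly (L k) (y f $ j))" .
      qed
    qed
  qed
  note this[of UNIV, THEN spec, THEN mp, THEN mp]
  then show ?thesis using assms by simp
qed

text \<open>Coefficients are read off from evaluations alone, which makes the recovery of the cone a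
  polynomial operation on the values of \<open>f\<close>.\<close>

lemma ex_coeff_weights:
  "\<exists>\<kappa> :: nat \<Rightarrow> complex. \<forall>P. degree P \<le> d \<longrightarrow> coeff P c = (\<Sum>k\<le>d. \<kappa> k * poly P (of_nat k))"
proof -
  obtain L :: "nat \<Rightarrow> complex poly" where L: "\<And>P. degree P \<le> d \<Longrightarrow> P = (\<Sum>k\<le>d. smult (poly P (of_nat k)) (L k))"
    using lagrange_basis[of d] by blast
  have "coeff P c = (\<Sum>k\<le>d. coeff (L k) c * poly P (of_nat k))" if "degree P \<le> d" for P
  proof -
    have "coeff P c = coeff (\<Sum>k\<le>d. smult (poly P (of_nat k)) (L k)) c"
      by (rule arg_cong[where f = "\<lambda>p. coeff p c"], rule L[OF that])
    then show ?thesis by (simp add: coeff_sum mult.commute)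
  qed
  then show ?thesis by (intro exI[of _ "\<lambda>k. coeff (L k) c"]) simp
qed

definition coeff_weights :: "nat \<Rightarrow> nat \<Rightarrow> nat \<Rightarrow> complex" where
  "coeff_weights d c = (SOME \<kappa>. \<forall>P. degree P \<le> d \<longrightarrow> coeff P c = (\<Sum>k\<le>d. \<kappa> k * poly P (of_nat k)))"

lemma coeff_weights:
  assumes "degree P \<le> d"
  shows "(\<Sum>k\<le>d. coeff_weights d c k * poly P (of_nat k)) = coeff P c"
proof -
  have "\<forall>P. degree P \<le> d \<longrightarrow> coeff P c = (\<Sum>k\<le>d. coeff_weights d c k * poly P (of_nat k))"
    unfolding coeff_weights_def by (rule someI_ex[OF ex_coeff_weights])
  from spec[OF this, of P] assms show ?thesis by simp
qed

text \<open>The coefficient of \<open>s^(d - m)\<close> in \<open>f (u + s v)\<close>.\<close>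

definition cone_part :: "nat \<Rightarrow> nat \<Rightarrow> complex^'i \<Rightarrow> (complex^'i \<Rightarrow> complex) \<Rightarrow> complex^'i \<Rightarrow> complex" where
  "cone_part m d v f u = (\<Sum>k\<le>d. coeff_weights d (d - m) k * f (u + of_nat k *s v))"

lemma cone_part_forms:
  assumes f: "f \<in> forms d" and "m \<le> d"
  shows "cone_part m d v f \<in> forms m"
proof -
  obtain F where F: "\<And>j. j \<le> d \<Longrightarrow> F j \<in> forms (d - j)" "\<And>u s. f (u + s *s v) = (\<Sum>j\<le>d. s ^ j * F j u)"
    using forms_expand_line[OF f, of v] by blast
  have "cone_part m d v f u = F (d - m) u" for u
  proof -
    have "cone_part m d v f u = (\<Sum>k\<le>d. coeff_weights d (d - m) k * poly (\<Sum>j\<le>d. monom (F j u) j) (of_nat k))"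
      unfolding cone_part_def F(2) poly_from_coeffs(2) ..
    also have "\<dots> = coeff (\<Sum>j\<le>d. monom (F j u) j) (d - m)" by (rule coeff_weights[OF poly_from_coeffs(1)])
    finally show ?thesis by (simp only: poly_from_coeffs(3)[OF diff_le_self])
  qed
  then have "cone_part m d v f = F (d - m)" by blast
  then show ?thesis using F(1)[of "d - m"] assms(2) by simp
qed

text \<open>The number \<open>q\<close> is the constant value of the cone along the line, so the
  coefficient of \<open>s^(d - m)\<close> is \<open>q\<close> times the top coefficient of
  \<open>g\<close> in the direction \<open>v\<close>.\<close>

lemma cone_part_product:
  assumes g: "g \<in> forms (d - m)" and "m \<le> d" and f: "\<And>s. f (u + s *s v) = q * g (u + s *s v)"
  shows "cone_part m d v f u = q * g v"
proof -
  obtain F where F: "\<And>u s. g (u + s *s v) = (\<Sum>j\<le>d - m. s ^ j * F j u)" "\<And>u. F (d - m) u = g v"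
    using forms_expand_line[OF g, of v] by blast
  let ?P = "smult q (\<Sum>j\<le>d - m. monom (F j u) j)"
  have deg: "degree ?P \<le> d"
    using order.trans[OF degree_smult_le poly_from_coeffs(1)[of "\<lambda>j. F j u" "d - m"]] by (meson diff_le_self order.trans)
  have "cone_part m d v f u = (\<Sum>k\<le>d. coeff_weights d (d - m) k * poly ?P (of_nat k))"
    unfolding cone_part_def f F(1) poly_smult poly_from_coeffs(2) ..
  also have "\<dots> = coeff ?P (d - m)" by (rule coeff_weights[OF deg])
  also have "\<dots> = q * g v" unfolding coeff_smult poly_from_coeffs(3)[OF order.refl] F(2) ..
  finally show ?thesis .
qed

text \<open>The direction may depend on \<open>f\<close>, because the polar vector is itself
  recovered from \<open>f\<close>.\<close>

lemma cone_part_polynomial: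
  fixes v y :: "(complex^'i \<Rightarrow> complex) \<Rightarrow> complex^'i"
  assumes v: "\<And>i. (\<lambda>f. v f $ i) \<in> kpolys UNIV evaluations" and y: "\<And>i. (\<lambda>f. y f $ i) \<in> kpolys UNIV evaluations"
  shows "\<exists>F\<in>kpolys UNIV evaluations. \<forall>f\<in>forms d. cone_part m d (v f) f (y f) = F f"
proof -
  have "\<exists>F. F \<in> kpolys UNIV evaluations \<and> (\<forall>f\<in>forms d. f (y f + of_nat k *s v f) = F f)" for k
  proof -
    have "(\<lambda>f. (y f + of_nat k *s v f) $ i) \<in> kpolys UNIV evaluations" for i
      by (simp, intro kpolys.add kpolys.mult y v kpolys.const) simp
    from forms_eval_polynomial[OF this] show ?thesis by blast
  qed
  then have "\<forall>k. \<exists>F. F \<in> kpolys UNIV evaluations \<and> (\<forall>f\<in>forms d. f (y f + of_nat k *s v f) = F f)" by blast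
  from choice[OF this] obtain F where F: "\<And>k. F k \<in> kpolys UNIV evaluations" "\<And>k f. f \<in> forms d \<Longrightarrow> f (y f + of_nat k *s v f) = F k f" by blast
  show ?thesis
  proof (intro bexI ballI)
    show "(\<lambda>f. \<Sum>k\<le>d. coeff_weights d (d - m) k * F k f) \<in> kpolys UNIV evaluations"
      by (intro kpolys_sum[OF complex_subfield_UNIV] kpolys.mult kpolys.const F UNIV_I)
    show "cone_part m d (v f) f (y f) = (\<Sum>k\<le>d. coeff_weights d (d - m) k * F k f)" if "f \<in> forms d" for f
      unfolding cone_part_def F(2)[OF that] ..
  qed
qed

section \<open>Representatives and parameters\<close>

text \<open>Nondegeneracy makes sending \<open>v\<close> to \<open>\<omega> v\<close> injective, and
  the dual space has the same dimension.\<close>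

lemma linear_form_omega:
  fixes \<omega> :: "complex^'i \<Rightarrow> complex^'i \<Rightarrow> complex"
  assumes w: "symplectic_form \<omega>" and l: "l \<in> linear_forms"
  shows "\<exists>v. l = \<omega> v"
proof -
  note wD = symplectic_formD[OF w]
  define \<Omega> where "\<Omega> v = (\<chi> i. \<omega> v (axis i 1))" for v
  have "linear_map \<Omega>" by (simp add: linear_map_def \<Omega>_def vec_eq_iff wD(5,6))
  moreover have "v = 0" if "\<Omega> v = 0" for v
  proof (rule wD(4))
    fix u
    have "\<omega> v (axis i 1) = 0" for i using that by (simp add: \<Omega>_def vec_eq_iff)
    then show "\<omega> v u = 0" unfolding linear_forms_expand[OF wD(1), of v u] by simp
  qed
  ultimately obtain g where g: "\<And>u. \<Omega> (g u) = u" using linear_map_inverse[of \<Omega>] by blast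
  define v where "v = g (\<chi> i. l (axis i 1))"
  have ax: "\<omega> v (axis i 1) = l (axis i 1)" for i
    using g[of "\<chi> i. l (axis i 1)"] unfolding v_def[symmetric] by (simp add: \<Omega>_def vec_eq_iff)
  have "l u = \<omega> v u" for u
    unfolding linear_forms_expand[OF wD(1), of v u] linear_forms_expand[OF l, of u] ax ..
  then show ?thesis by blast
qed

lemma zero_set_proportional:
  assumes l: "l \<in> linear_forms" "l' \<in> linear_forms" and nz: "l w \<noteq> 0" and z: "zero_set l = zero_set l'"
  shows "l' u = l' w / l w * l u"
proof -
  have "u - (l u / l w) *s w \<in> zero_set l" using nz by (simp add: zero_set_def linear_formsD[OF l(1)])
  then have "l' (u - (l u / l w) *s w) = 0" unfolding z by (simp add: zero_set_def)
  then show ?thesis by (simp add: linear_formsD[OF l(2)])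
qed

lemma line_self: "f \<in> line f"
  unfolding line_def by (intro CollectI exI[of _ 1]) simp

lemma line_eqD: "line f = line g \<Longrightarrow> \<exists>c. f = (\<lambda>u. c * g u)"
  using line_self[of f] by (auto simp: line_def)

lemma line_scale:
  assumes "c \<noteq> 0"
  shows "line (\<lambda>u. c * f u) = line f"
proof (intro set_eqI iffI)
  fix g assume "g \<in> line (\<lambda>u. c * f u)"
  then obtain e where "g = (\<lambda>u. e * (c * f u))" unfolding line_def by blast
  then show "g \<in> line f" unfolding line_def by (intro CollectI exI[of _ "e * c"]) (simp add: mult.assoc)
next
  fix g assume "g \<in> line f"
  then obtain e where "g = (\<lambda>u. e * f u)" unfolding line_def by blast
  then show "g \<in> line (\<lambda>u. c * f u)" unfolding line_def
    by (intro CollectI exI[of _ "e / c"]) (simp add: assms)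
qed

lemma forms_vanishing_factor:
  assumes p: "p \<in> forms e" and l: "l \<in> linear_forms" and w: "l w = 1" and z: "\<And>u. l u = 0 \<Longrightarrow> p u = 0"
  shows "\<exists>r\<in>forms (e - 1). \<forall>u. p u = l u * r u"
proof -
  obtain r where r: "r \<in> forms (e - 1)" "\<And>u. p u - p (u - l u *s w) = l u * r u"
    using forms_factor[OF p l, of w] by blast
  have "p (u - l u *s w) = 0" for u by (rule z) (simp add: linear_formsD[OF l] w)
  then show ?thesis using r by force
qed

text \<open>The parametrization reaches every representative. The representatives are thus the image
  of part of an affine space, which later takes the place of irreducibility.\<close>

lemma representatives_params:
  fixes \<omega> :: "complex^'i \<Rightarrow> complex^'i \<Rightarrow> complex"
  assumes w: "symplectic_form \<omega>" and md: "m \<le> d" and z: "(l, p, f) \<in> representatives \<omega> m d"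
  shows "\<exists>t. l = \<omega> (par_v t) \<and> p = par_p \<omega> m t \<and> f = par_f \<omega> m d t \<and> par_v t \<noteq> 0 \<and>
    (\<exists>u. \<omega> (par_v t) u = 0 \<and> par_q m t u \<noteq> 0)"
proof -
  note wD = symplectic_formD[OF w]
  let ?H = "zero_set l"
  from z have l: "l \<in> linear_forms" "l \<noteq> (\<lambda>_. 0)" and p: "p \<in> forms m" and f: "f \<in> forms d"
    and inc: "represent (l, p, f) \<in> incidence_points \<omega> m d"
    by (auto simp: representatives_def)
  from inc have Y: "line (restr ?H p) \<in> proj (sym_power m ?H (G_fiber \<omega> ?H))"
    and F: "line f \<in> proj (F_fiber m d ?H (line (restr ?H p)))"
    by (auto simp: represent_def incidence_points_def Y_points_def)
  obtain v where v: "l = \<omega> v" using linear_form_omega[OF w l(1)] by blast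
  have vH: "l v = 0" by (simp add: v wD(3))
  have v0: "v \<noteq> 0" using l(2) wD(8) unfolding v by auto
  obtain w1 where "l w1 \<noteq> 0" using l(2) by auto
  then have w2: "l (inverse (l w1) *s w1) = 1" by (simp add: linear_formsD[OF l(1)])
  obtain jj where jj: "v $ jj \<noteq> 0" using v0 by (metis vec_eq_iff zero_index)
  \<comment> \<open>Since \<open>x v = 1\<close>, the map \<open>pi\<close> below is a projection
    along \<open>v\<close>. Composing \<open>p\<close> with it gives a cone on the whole space that
    agrees with \<open>p\<close> on the hyperplane.\<close>
  define x where "x u = inverse (v $ jj) * u $ jj" for u :: "complex^'i"
  have x: "x \<in> linear_forms" unfolding x_def[abs_def] by (intro linear_forms_comb linear_forms_coord)
  have xv: "x v = 1" using jj by (simp add: x_def)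
  obtain q where q: "q \<in> sym_power m ?H (G_fiber \<omega> ?H)" "q \<noteq> (\<lambda>_. 0)" "line (restr ?H p) = line q"
    using Y unfolding proj_def by blast
  obtain c where c: "restr ?H p = (\<lambda>u. c * q u)" using line_eqD[OF q(3)] by blast
  obtain c' where c': "q = (\<lambda>u. c' * restr ?H p u)" using line_eqD[OF q(3)[symmetric]] by blast
  \<comment> \<open>Each factor is a linear form on the hyperplane that vanishes at the polar
    vector, hence constant along it.\<close>
  have q_cone: "q (u + s *s v) = q u" if u: "l u = 0" for u s
  proof -
    obtain N :: nat and e \<alpha> where qe: "q = restr ?H (\<lambda>u. \<Sum>j<N. e j * (\<Prod>i<m. \<alpha> j i u))" and \<alpha>: "\<forall>j<N. \<forall>i<m. \<alpha> j i \<in> G_fiber \<omega> ?H"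
      using q(1) unfolding sym_power_def by blast
    have us: "u \<in> ?H" "u + s *s v \<in> ?H" using u vH by (simp_all add: zero_set_def linear_formsD[OF l(1)])
    have "\<alpha> j i (u + s *s v) = \<alpha> j i u" if "j < N" "i < m" for j i
    proof -
      have "\<alpha> j i \<in> G_fiber \<omega> ?H" using \<alpha> that by blast
      then obtain \<beta> where \<beta>: "\<beta> \<in> linear_forms" "\<alpha> j i = restr ?H \<beta>" and z: "\<forall>y\<in>polar_vectors \<omega> ?H. \<alpha> j i y = 0"
        unfolding G_fiber_def Q_fiber_def by blast
      have "v \<in> polar_vectors \<omega> ?H" unfolding polar_vectors_def using l v by blast
      then have "\<alpha> j i v = 0" using z by blast
      then have "\<beta> v = 0" using vH unfolding \<beta>(2) by (simp add: restr_def zero_set_def)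
      then show ?thesis unfolding \<beta>(2) using us by (simp add: restr_def linear_formsD[OF \<beta>(1)])
    qed
    then show ?thesis unfolding qe using us by (auto simp: restr_def intro!: sum.cong prod.cong)
  qed
  have pq: "p u = c * q u" if "l u = 0" for u using fun_cong[OF c, of u] that by (simp add: restr_def zero_set_def)
  have q0: "q u = 0" if "l u \<noteq> 0" for u using fun_cong[OF c', of u] that by (simp add: restr_def zero_set_def)
  have qp: "q u = c' * p u" if "l u = 0" for u using fun_cong[OF c', of u] that by (simp add: restr_def zero_set_def)
  obtain u0 where "q u0 \<noteq> 0" using q(2) by auto
  have u0: "l u0 = 0" by (rule ccontr) (use q0[of u0] \<open>q u0 \<noteq> 0\<close> in blast)
  have pu0: "p u0 \<noteq> 0" using qp[OF u0] \<open>q u0 \<noteq> 0\<close> by auto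
  define pi where "pi u = x v *s u - x u *s v" for u
  define qq where "qq u = p (pi u)" for u
  have pi: "linear_map pi" unfolding pi_def[abs_def]
    by (auto simp: linear_map_def vec_eq_iff algebra_simps linear_formsD[OF x])
  have qq: "qq \<in> forms m" unfolding qq_def[abs_def] by (rule forms_compose[OF p pi])
  have qqp: "qq u = p u" if u: "l u = 0" for u
  proof -
    have e: "pi u = u + (- x u) *s v" by (simp add: pi_def xv)
    have "l (pi u) = 0" using u vH by (simp add: pi_def linear_formsD[OF l(1)])
    then have "p (pi u) = c * q (pi u)" by (rule pq)
    also have "\<dots> = c * q u" unfolding e by (simp only: q_cone[OF u])
    also have "\<dots> = p u" by (rule pq[OF u, symmetric])
    finally show ?thesis by (simp add: qq_def)
  qed
  have "(\<lambda>u. p u - qq u) \<in> forms m" by (rule forms_diff[OF p qq])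
  from forms_vanishing_factor[OF this l(1) w2] qqp obtain r where r: "r \<in> forms (m - 1)" "\<And>u. p u - qq u = l u * r u" by auto
  obtain f' where f': "f' \<in> F_fiber m d ?H (line (restr ?H p))" "line f = line f'" using F unfolding proj_def by blast
  obtain e1 where e1: "f = (\<lambda>u. e1 * f' u)" using line_eqD[OF f'(2)] by blast
  obtain q1 g1 where q1: "q1 \<in> line (restr ?H p)" "g1 \<in> sym_power (d - m) ?H (Q_fiber ?H)" "restr ?H f' = (\<lambda>u. q1 u * g1 u)"
    using f'(1) unfolding F_fiber_def by blast
  obtain e2 where e2: "q1 = (\<lambda>u. e2 * restr ?H p u)" using q1(1) unfolding line_def by blast
  obtain g where g: "g \<in> forms (d - m)" "restr ?H g = g1" using sym_power_restr_lift[OF q1(2)] by blast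
  define g' where "g' u = (e1 * e2) * g u" for u
  have g': "g' \<in> forms (d - m)" unfolding g'_def[abs_def] by (rule forms_scale[OF g(1)])
  have fq: "f u = qq u * g' u" if u: "l u = 0" for u
  proof -
    have "f' u = q1 u * g1 u" using fun_cong[OF q1(3), of u] u by (simp add: restr_def zero_set_def)
    also have "\<dots> = e2 * p u * g u" unfolding e2 g(2)[symmetric] using u by (simp add: restr_def zero_set_def)
    finally show ?thesis unfolding e1 g'_def qqp[OF u] by (simp add: mult_ac)
  qed
  have "(\<lambda>u. qq u * g' u) \<in> forms d" using forms_mult[OF qq g'] md by simp
  then have "(\<lambda>u. f u - qq u * g' u) \<in> forms d" by (rule forms_diff[OF f])
  from forms_vanishing_factor[OF this l(1) w2] fq obtain h where h: "h \<in> forms (d - 1)" "\<And>u. f u - qq u * g' u = l u * h u" by auto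
  obtain t where t: "par_v t = v" "par_xi t = x" "par_form 2 m t = p" "par_form 3 (d - m) t = g'" "par_form 4 (d - 1) t = h" "par_form 5 (m - 1) t = r"
    using ex_params[OF x p g' h(1) r(1), of v] by blast
  have tq: "par_q m t = qq" unfolding par_q_def[abs_def] t qq_def[abs_def] pi_def ..
  have "p = par_p \<omega> m t"
  proof
    fix u show "p u = par_p \<omega> m t u" unfolding par_p_def tq t v[symmetric] using r(2)[of u] by (simp add: algebra_simps)
  qed
  moreover have "f = par_f \<omega> m d t"
  proof
    fix u show "f u = par_f \<omega> m d t u" unfolding par_f_def tq t v[symmetric] using h(2)[of u] by (simp add: algebra_simps)
  qed
  moreover have "\<omega> (par_v t) u0 = 0 \<and> par_q m t u0 \<noteq> 0" unfolding t tq v[symmetric] using u0 pu0 qqp[OF u0] by simp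
  ultimately show ?thesis using v v0 t(1) by (intro exI[of _ t]) blast
qed

lemma forms_restr_sym_power:
  assumes g: "g \<in> forms e"
  shows "restr H g \<in> sym_power e H (Q_fiber H)"
proof -
  obtain N :: nat and c \<alpha> where g: "g = (\<lambda>u. \<Sum>j<N. c j * (\<Prod>i<e. \<alpha> j i u))" "\<forall>j<N. \<forall>i<e. \<alpha> j i \<in> linear_forms"
    using assms unfolding forms_def' by blast
  have "restr H g = restr H (\<lambda>u. \<Sum>j<N. c j * (\<Prod>i<e. restr H (\<alpha> j i) u))"
    unfolding g(1) by (auto simp: restr_def fun_eq_iff)
  moreover have "\<forall>j<N. \<forall>i<e. restr H (\<alpha> j i) \<in> Q_fiber H" using g(2) by (simp add: Q_fiber_def)
  ultimately show ?thesis unfolding sym_power_def mem_Collect_eq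
    by (intro exI[of _ N] exI[of _ c] exI[of _ "\<lambda>j i. restr H (\<alpha> j i)"] conjI)
qed

lemma params_representatives:
  fixes \<omega> :: "complex^'i \<Rightarrow> complex^'i \<Rightarrow> complex"
  assumes w: "symplectic_form \<omega>" and md: "m \<ge> 1" "m \<le> d" and v: "par_v t \<noteq> 0"
    and q: "\<exists>u. \<omega> (par_v t) u = 0 \<and> par_q m t u \<noteq> 0" and f: "par_f \<omega> m d t \<noteq> (\<lambda>_. 0)"
  shows "(\<omega> (par_v t), par_p \<omega> m t, par_f \<omega> m d t) \<in> representatives \<omega> m d"
proof -
  note wD = symplectic_formD[OF w]
  let ?v = "par_v t" and ?l = "\<omega> (par_v t)"
  let ?H = "zero_set ?l"
  have d1: "d \<ge> 1" using md by simp
  obtain w1 where w1: "?l w1 \<noteq> 0" using wD(4)[of ?v] v by blast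
  then have l: "?l \<in> linear_forms - {\<lambda>_. 0}" using wD(1) by auto
  have rp: "restr ?H (par_p \<omega> m t) = restr ?H (par_q m t)"
    by (auto simp: restr_def par_p_def zero_set_def fun_eq_iff)
  have qnz: "restr ?H (par_q m t) \<noteq> (\<lambda>_. 0)"
  proof
    assume z: "restr ?H (par_q m t) = (\<lambda>_. 0)"
    obtain u where u: "?l u = 0" "par_q m t u \<noteq> 0" using q by blast
    then show False using fun_cong[OF z, of u] by (simp add: restr_def zero_set_def)
  qed
  let ?\<pi> = "\<lambda>u. par_xi t ?v *s u - par_xi t u *s ?v"
  have "par_form 2 m t \<in> forms m" by (rule par_form_forms)
  then obtain N :: nat and c \<alpha> where p: "par_form 2 m t = (\<lambda>u. \<Sum>j<N. c j * (\<Prod>i<m. \<alpha> j i u))" "\<forall>j<N. \<forall>i<m. \<alpha> j i \<in> linear_forms"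
    unfolding forms_def' by blast
  let ?\<beta> = "\<lambda>j i. restr ?H (\<lambda>u. \<alpha> j i (?\<pi> u))"
  have "restr ?H (par_q m t) = restr ?H (\<lambda>u. \<Sum>j<N. c j * (\<Prod>i<m. ?\<beta> j i u))"
    unfolding par_q_def[abs_def] p(1) by (auto simp: restr_def fun_eq_iff)
  moreover have "?\<beta> j i \<in> G_fiber \<omega> ?H" if ji: "j < N" "i < m" for j i
  proof -
    have a: "\<alpha> j i \<in> linear_forms" using p(2) ji by blast
    have lin: "(\<lambda>u. \<alpha> j i (?\<pi> u)) \<in> linear_forms" by (rule linear_forms_compose[OF a linear_map_par])
    \<comment> \<open>Two equations of the same hyperplane are proportional, so \<open>y\<close> is
      a multiple of \<open>par_v t\<close> and the projection kills it.\<close>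
    have "?\<beta> j i y = 0" if y: "y \<in> polar_vectors \<omega> ?H" for y
    proof -
      obtain l' where l': "l' \<in> linear_forms" "?H = zero_set l'" "\<forall>u. l' u = \<omega> y u" using y unfolding polar_vectors_def by blast
      define e where "e = l' w1 / ?l w1"
      have "\<omega> y u = e * ?l u" for u
        using zero_set_proportional[OF wD(1) l'(1) w1 l'(2), of u] l'(3) by (simp add: e_def)
      then have "\<omega> (y - e *s ?v) u = 0" for u by (simp add: wD(6,7))
      then have y: "y = e *s ?v" using wD(4)[of "y - e *s ?v"] by simp
      have "?\<pi> y = 0" unfolding y linear_formsD(2)[OF par_xi_linear] by (simp add: vec_eq_iff mult_ac)
      then show ?thesis using linear_formsD(3)[OF a] by (simp add: restr_def)
    qed
    then show ?thesis unfolding G_fiber_def Q_fiber_def using lin by blast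
  qed
  ultimately have qG: "restr ?H (par_q m t) \<in> sym_power m ?H (G_fiber \<omega> ?H)"
    unfolding sym_power_def mem_Collect_eq
    by (intro exI[of _ N] exI[of _ c] exI[of _ ?\<beta>] conjI) blast+
  have "(?H, line (restr ?H (par_p \<omega> m t))) \<in> Y_points \<omega> m"
    unfolding Y_points_def hyperplanes_def proj_def rp using l qG qnz by blast
  moreover have "par_f \<omega> m d t \<in> F_fiber m d ?H (line (restr ?H (par_p \<omega> m t)))"
    unfolding F_fiber_def mem_Collect_eq rp
  proof (intro conjI bexI)
    show "par_f \<omega> m d t \<in> forms d" by (rule par_f_forms[OF w md(2) d1])
    show "restr ?H (par_f \<omega> m d t) = (\<lambda>u. restr ?H (par_q m t) u * restr ?H (par_form 3 (d - m) t) u)"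
      by (auto simp: restr_def par_f_def zero_set_def fun_eq_iff)
    show "restr ?H (par_q m t) \<in> line (restr ?H (par_q m t))" by (rule line_self)
    show "restr ?H (par_form 3 (d - m) t) \<in> sym_power (d - m) ?H (Q_fiber ?H)"
      by (rule forms_restr_sym_power[OF par_form_forms])
  qed
  then have "line (par_f \<omega> m d t) \<in> proj (F_fiber m d ?H (line (restr ?H (par_p \<omega> m t))))"
    unfolding proj_def using f by blast
  ultimately have "represent (?l, par_p \<omega> m t, par_f \<omega> m d t) \<in> incidence_points \<omega> m d"
    by (simp add: represent_def incidence_points_def)
  then show ?thesis
    using l par_p_forms[OF w md(1), of t] par_f_forms[OF w md(2) d1, of t] by (simp add: representatives_def)
qed

section \<open>The punctured cone over the image and the functions on both spaces\<close>

lemma incidence_map_represent: "incidence_map (represent (l, p, f)) = line f"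
  by (simp add: incidence_map_def represent_def)

text \<open>The punctured affine cone over the image; the structure of \<open>cone_locus\<close> is
  the quotient of this set by scalars.\<close>

definition locus_cone :: "(complex^'i \<Rightarrow> complex^'i \<Rightarrow> complex) \<Rightarrow> nat \<Rightarrow> nat \<Rightarrow> (complex^'i \<Rightarrow> complex) set" where
  "locus_cone \<omega> m d = {f \<in> forms d - {\<lambda>_. 0}. line f \<in> incidence_map ` incidence_points \<omega> m d}"

text \<open>The represented point depends on the third component only through its line, so
  \<open>f\<close> itself can be put in that place.\<close>

lemma locus_cone_iff: "f \<in> locus_cone \<omega> m d \<longleftrightarrow> (\<exists>l p. (l, p, f) \<in> representatives \<omega> m d)"
proof
  assume f: "f \<in> locus_cone \<omega> m d"
  then obtain x where x: "x \<in> incidence_points \<omega> m d" "line f = incidence_map x" and ff: "f \<in> forms d" unfolding locus_cone_def by blast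
  have "x \<in> represent ` representatives \<omega> m d"
    using x(1) points_cone_incidence[of \<omega> m d] unfolding cone_incidence_def quotient_space_def by simp
  then obtain l p f' where r: "(l, p, f') \<in> representatives \<omega> m d" "x = represent (l, p, f')" by (metis imageE prod_cases3)
  then have "line f = line f'" using x(2) incidence_map_represent by metis
  then have "represent (l, p, f) = represent (l, p, f')" by (simp add: represent_def)
  then have "(l, p, f) \<in> representatives \<omega> m d" using r(1) ff by (simp add: representatives_def)
  then show "\<exists>l p. (l, p, f) \<in> representatives \<omega> m d" by blast
next
  assume "\<exists>l p. (l, p, f) \<in> representatives \<omega> m d"
  then obtain l p where r: "(l, p, f) \<in> representatives \<omega> m d" by blast
  then have f: "f \<in> forms d" and x: "represent (l, p, f) \<in> incidence_points \<omega> m d" by (auto simp: representatives_def)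
  have "line f \<in> proj (F_fiber m d (zero_set l) (line (restr (zero_set l) p)))"
    using x by (simp add: represent_def incidence_points_def)
  then obtain g where g: "g \<noteq> (\<lambda>_. 0)" "line f = line g" unfolding proj_def by blast
  obtain c where "g = (\<lambda>u. c * f u)" using line_eqD[OF g(2)[symmetric]] by blast
  then have "f \<noteq> (\<lambda>_. 0)" using g(1) by auto
  moreover have "line f \<in> incidence_map ` incidence_points \<omega> m d"
    using x incidence_map_represent by (metis image_eqI)
  ultimately show "f \<in> locus_cone \<omega> m d" using f by (simp add: locus_cone_def)
qed

lemma representatives_cong_line:
  assumes "(l, p, f) \<in> representatives \<omega> m d" "line f = line f'" "f' \<in> forms d"
  shows "(l, p, f') \<in> representatives \<omega> m d" "represent (l, p, f') = represent (l, p, f)"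
  using assms by (simp_all add: representatives_def represent_def)

lemma cone_locus_simps:
  "points (cone_locus \<omega> m d) = line ` locus_cone \<omega> m d"
  "opens (cone_locus \<omega> m d) = {U. U \<subseteq> line ` locus_cone \<omega> m d \<and> zariski_open evaluations (locus_cone \<omega> m d) (line -` U \<inter> locus_cone \<omega> m d)}"
  "regular (cone_locus \<omega> m d) U = {h. regular_on evaluations (line -` U \<inter> locus_cone \<omega> m d) (h \<circ> line)}"
  unfolding cone_locus_def proj_subspace_def points_cone_incidence locus_cone_def[symmetric] quotient_space_def by simp_all

lemma cone_incidence_simps:
  "points (cone_incidence \<omega> m d) = represent ` representatives \<omega> m d"
  "opens (cone_incidence \<omega> m d) = {U. U \<subseteq> represent ` representatives \<omega> m d \<and>
    zariski_open triple_evaluations (representatives \<omega> m d) (represent -` U \<inter> representatives \<omega> m d)}"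
  "regular (cone_incidence \<omega> m d) U = {h. regular_on triple_evaluations (represent -` U \<inter> representatives \<omega> m d) (h \<circ> represent)}"
  unfolding cone_incidence_def quotient_space_def by simp_all

lemma evaluations_triple:
  fixes F :: "(complex^'i \<Rightarrow> complex) \<Rightarrow> complex"
  shows "F \<in> polynomials evaluations \<Longrightarrow> (\<lambda>z. F (snd (snd z))) \<in> polynomials triple_evaluations"
  unfolding polynomials_eq_kpolys
proof (erule kpolys_compose)
  fix c :: "(complex^'i \<Rightarrow> complex) \<Rightarrow> complex" assume "c \<in> evaluations"
  then obtain u where "c = (\<lambda>f. f u)" unfolding evaluations_def by blast
  then have eq: "(\<lambda>z. c (snd (snd z))) = (\<lambda>(l, p, f). f u)" by (simp add: fun_eq_iff split_beta)
  show "(\<lambda>z. c (snd (snd z))) \<in> kpolys UNIV triple_evaluations"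
    unfolding eq by (rule kpolys.coord) (auto simp: triple_evaluations_def)
qed

section \<open>The inverse of the incidence map\<close>

text \<open>By \<open>ratio\<close>, the vector with coordinates \<open>P i f\<close> is a nonzero
  multiple of the polar vector wherever \<open>Q f\<close> and that vector are nonzero. The
  parameters \<open>t0\<close> certify that the recovery works somewhere.\<close>

locale cone_recovery =
  fixes \<omega> :: "complex^'i \<Rightarrow> complex^'i \<Rightarrow> complex" and m d :: nat and a b :: "complex^'i" and j0 :: 'i
    and Q :: "(complex^'i \<Rightarrow> complex) \<Rightarrow> complex" and P :: "'i \<Rightarrow> (complex^'i \<Rightarrow> complex) \<Rightarrow> complex" and t0 :: "'i params"
  assumes w: "symplectic_form \<omega>" and md: "m \<ge> 1" "m \<le> d"
    and q0: "par_q m t0 (hyper_pt \<omega> a b (par_v t0)) \<noteq> 0" and g0: "par_form 3 (d - m) t0 (par_v t0) \<noteq> 0"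
    and v0: "par_v t0 $ j0 \<noteq> 0" and Q0: "Q (par_f \<omega> m d t0) \<noteq> 0"
    and Q_poly: "Q \<in> kpolys UNIV nat_evals" and P_poly: "\<And>i. P i \<in> kpolys UNIV nat_evals"
    and ratio: "\<And>t i. par_v t $ i * Q (par_f \<omega> m d t) = par_v t $ j0 * P i (par_f \<omega> m d t)"
begin

definition vhat :: "(complex^'i \<Rightarrow> complex) \<Rightarrow> complex^'i" where
  "vhat f = (\<chi> i. P i f)"

text \<open>From \<open>f\<close> alone: an equation of the hyperplane, a form whose restriction is
  a multiple of the cone, and \<open>f\<close>. Where \<open>disc\<close> is nonzero this is a
  section of the quotient by representatives, with polynomial values.\<close>

definition lift :: "(complex^'i \<Rightarrow> complex) \<Rightarrow> (complex^'i \<Rightarrow> complex) \<times> (complex^'i \<Rightarrow> complex) \<times> (complex^'i \<Rightarrow> complex)" where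
  "lift f = (\<omega> (vhat f), cone_part m d (vhat f) f, f)"

text \<open>The first factor ensures that \<open>vhat f\<close> is a nonzero multiple of the polar
  vector, the second that the recovered cone is not zero on the hyperplane.\<close>

definition disc :: "(complex^'i \<Rightarrow> complex) \<Rightarrow> complex" where
  "disc f = Q f * cone_part m d (vhat f) f (hyper_pt \<omega> a b (vhat f))"

lemma nat_evals_evaluations: "nat_evals \<subseteq> (evaluations :: ((complex^'i \<Rightarrow> complex) \<Rightarrow> complex) set)"
  by (auto simp: nat_evals_def evaluations_def)

lemma vhat_poly: "(\<lambda>f. vhat f $ i) \<in> kpolys UNIV evaluations"
  unfolding vhat_def using kpolys_mono[OF P_poly[of i] order.refl nat_evals_evaluations] by simp

lemma hyper_pt_on: "\<omega> v (hyper_pt \<omega> a b v) = 0"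
  unfolding hyper_pt_def by (simp add: linear_formsD[OF symplectic_formD(1)[OF w]])

lemma vhat_par:
  assumes v: "par_v t \<noteq> 0" and Q: "Q (par_f \<omega> m d t) \<noteq> 0"
  shows "\<exists>\<kappa>. \<kappa> \<noteq> 0 \<and> vhat (par_f \<omega> m d t) = \<kappa> *s par_v t"
proof -
  have j: "par_v t $ j0 \<noteq> 0"
  proof
    assume "par_v t $ j0 = 0"
    then have "par_v t $ i = 0" for i using ratio[of t i] Q by simp
    then show False using v by (simp add: vec_eq_iff)
  qed
  let ?k = "Q (par_f \<omega> m d t) / par_v t $ j0"
  have "P i (par_f \<omega> m d t) = ?k * par_v t $ i" for i using ratio[of t i] j by (simp add: field_simps)
  then have "vhat (par_f \<omega> m d t) = ?k *s par_v t" by (simp add: vhat_def vec_eq_iff)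
  then show ?thesis using j Q by (intro exI[of _ ?k]) simp
qed

lemma cone_part_par:
  assumes vh: "vhat (par_f \<omega> m d t) = \<kappa> *s par_v t" and u: "\<omega> (par_v t) u = 0"
  shows "cone_part m d (vhat (par_f \<omega> m d t)) (par_f \<omega> m d t) u = par_q m t u * par_form 3 (d - m) t (vhat (par_f \<omega> m d t))"
proof (rule cone_part_product[OF par_form_forms md(2)])
  fix s
  let ?y = "u + s *s vhat (par_f \<omega> m d t)"
  have y: "?y = u + (s * \<kappa>) *s par_v t" by (simp add: vh)
  have "\<omega> (par_v t) ?y = 0"
    unfolding y using u symplectic_formD(3)[OF w] by (simp add: linear_formsD[OF symplectic_formD(1)[OF w]])
  moreover have "par_q m t ?y = par_q m t u"
    unfolding y using par_q_cone[of t m] unfolding cone_over_def by blast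
  ultimately show "par_f \<omega> m d t ?y = par_q m t u * par_form 3 (d - m) t ?y"
    unfolding par_f_def by simp
qed

lemma disc_generic: "disc (par_f \<omega> m d t0) \<noteq> 0"
proof -
  let ?f = "par_f \<omega> m d t0" and ?v = "par_v t0"
  have "?v \<noteq> 0" using v0 by auto
  then obtain \<kappa> where k: "\<kappa> \<noteq> 0" "vhat ?f = \<kappa> *s ?v" using vhat_par Q0 by blast
  have h: "hyper_pt \<omega> a b (\<kappa> *s ?v) = \<kappa> *s hyper_pt \<omega> a b ?v"
    by (simp add: hyper_pt_def vec_eq_iff symplectic_formD(6)[OF w] algebra_simps)
  have on: "\<omega> ?v (hyper_pt \<omega> a b (vhat ?f)) = 0"
    unfolding k(2) h using hyper_pt_on[of ?v] by (simp add: linear_formsD[OF symplectic_formD(1)[OF w]])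
  have "cone_part m d (vhat ?f) ?f (hyper_pt \<omega> a b (vhat ?f)) = par_q m t0 (\<kappa> *s hyper_pt \<omega> a b ?v) * par_form 3 (d - m) t0 (\<kappa> *s ?v)"
    unfolding cone_part_par[OF k(2) on] unfolding k(2) h ..
  also have "\<dots> = \<kappa> ^ m * par_q m t0 (hyper_pt \<omega> a b ?v) * (\<kappa> ^ (d - m) * par_form 3 (d - m) t0 ?v)"
    unfolding forms_homogeneous[OF par_q_forms] forms_homogeneous[OF par_form_forms] ..
  finally show ?thesis unfolding disc_def using k(1) q0 g0 Q0 by simp
qed

text \<open>On the hyperplane the recovered form is \<open>p\<close> times the number
  \<open>\<gamma>\<close>, the value of the cofactor at \<open>vhat f\<close>, which
  \<open>disc\<close> keeps from being zero. As \<open>lift f\<close> is built from \<open>f\<close>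
  alone, this also shows that only one point lies over \<open>line f\<close>.\<close>

lemma lift_represents:
  assumes r: "(l, p, f) \<in> representatives \<omega> m d" and D: "disc f \<noteq> 0"
  shows "lift f \<in> representatives \<omega> m d" "represent (lift f) = represent (l, p, f)"
proof -
  note wD = symplectic_formD[OF w]
  obtain t where t: "l = \<omega> (par_v t)" "p = par_p \<omega> m t" "f = par_f \<omega> m d t" "par_v t \<noteq> 0"
    using representatives_params[OF w md(2) r] by blast
  have "Q f \<noteq> 0" using D by (auto simp: disc_def)
  then obtain \<kappa> where k: "\<kappa> \<noteq> 0" "vhat f = \<kappa> *s par_v t" using vhat_par[OF t(4)] unfolding t(3) by blast
  have om: "\<omega> (vhat f) u = \<kappa> * \<omega> (par_v t) u" for u unfolding k(2) wD(6) ..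
  have z: "zero_set (\<omega> (vhat f)) = zero_set l" unfolding t(1) zero_set_def om using k(1) by simp
  define \<gamma> where "\<gamma> = par_form 3 (d - m) t (vhat f)"
  have cp: "cone_part m d (vhat f) f u = par_q m t u * \<gamma>" if "\<omega> (par_v t) u = 0" for u
    using cone_part_par[of t \<kappa> u] k(2) that unfolding t(3) \<gamma>_def by blast
  have "\<omega> (par_v t) (hyper_pt \<omega> a b (vhat f)) = 0"
    using hyper_pt_on[of "vhat f"] unfolding om using k(1) by simp
  then have g: "\<gamma> \<noteq> 0" using D cp by (auto simp: disc_def)
  have "restr (zero_set l) (cone_part m d (vhat f) f) = (\<lambda>u. \<gamma> * restr (zero_set l) p u)"
  proof
    fix u show "restr (zero_set l) (cone_part m d (vhat f) f) u = \<gamma> * restr (zero_set l) p u"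
      unfolding restr_def zero_set_def t(1,2) par_p_def using cp[of u] by simp
  qed
  then have eq: "line (restr (zero_set l) (cone_part m d (vhat f) f)) = line (restr (zero_set l) p)"
    using line_scale[OF g] by simp
  show rep: "represent (lift f) = represent (l, p, f)"
    unfolding represent_def lift_def by (simp add: z eq)
  obtain u where "\<omega> (par_v t) u \<noteq> 0" using wD(4)[of "par_v t"] t(4) by blast
  then have "\<omega> (vhat f) u \<noteq> 0" using om k(1) by simp
  then have "\<omega> (vhat f) \<in> linear_forms - {\<lambda>_. 0}" using wD(1) by auto
  moreover have f: "f \<in> forms d" and i: "represent (l, p, f) \<in> incidence_points \<omega> m d"
    using r by (simp_all add: representatives_def)
  moreover have "cone_part m d (vhat f) f \<in> forms m" by (rule cone_part_forms[OF f md(2)])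
  moreover have "represent (\<omega> (vhat f), cone_part m d (vhat f) f, f) \<in> incidence_points \<omega> m d"
    using i rep unfolding lift_def by simp
  ultimately show "lift f \<in> representatives \<omega> m d" unfolding lift_def representatives_def by simp
qed

lemma disc_polynomial: "\<exists>F\<in>polynomials evaluations. \<forall>f\<in>forms d. disc f = F f"
proof -
  have h: "(\<lambda>f. hyper_pt \<omega> a b (vhat f) $ i) \<in> kpolys UNIV evaluations" for i
    by (rule hyper_pt_kpolys[OF complex_subfield_UNIV w UNIV_I vhat_poly UNIV_I UNIV_I])
  obtain F where F: "F \<in> kpolys UNIV evaluations" "\<And>f. f \<in> forms d \<Longrightarrow> cone_part m d (vhat f) f (hyper_pt \<omega> a b (vhat f)) = F f"
    using cone_part_polynomial[OF vhat_poly h] by blast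
  have Q: "Q \<in> kpolys UNIV evaluations" by (rule kpolys_mono[OF Q_poly order.refl nat_evals_evaluations])
  show ?thesis unfolding polynomials_eq_kpolys
    by (rule bexI[OF _ kpolys.mult[OF Q F(1)]]) (simp add: disc_def F(2))
qed

lemma lift_polynomial:
  assumes "F \<in> polynomials triple_evaluations"
  shows "\<exists>F'\<in>polynomials evaluations. \<forall>f\<in>forms d. F (lift f) = F' f"
  using assms
proof induction
  case (const c)
  show ?case by (rule bexI[OF _ polynomials.const[of c]]) simp
next
  case (coord x)
  consider u where "x = (\<lambda>(l, p, f). l u)" | u where "x = (\<lambda>(l, p, f). p u)" | u where "x = (\<lambda>(l, p, f). f u)"
    using coord unfolding triple_evaluations_def by blast
  then show ?case
  proof cases
    case (1 u)
    have "(\<lambda>f. \<omega> (vhat f) u) \<in> kpolys UNIV evaluations"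
      by (rule omega_kpolys[OF complex_subfield_UNIV w UNIV_I vhat_poly kpolys.const[OF UNIV_I]])
    moreover have "x (lift f) = \<omega> (vhat f) u" for f by (simp add: 1 lift_def)
    ultimately show ?thesis unfolding polynomials_eq_kpolys by (intro bexI[of _ "\<lambda>f. \<omega> (vhat f) u"]) simp_all
  next
    case (2 u)
    obtain F where F: "F \<in> kpolys UNIV evaluations" "\<forall>f\<in>forms d. cone_part m d (vhat f) f u = F f"
      using cone_part_polynomial[of vhat "\<lambda>_. u" d m, OF vhat_poly kpolys.const[OF UNIV_I]] by blast
    have "x (lift f) = cone_part m d (vhat f) f u" for f by (simp add: 2 lift_def)
    then show ?thesis unfolding polynomials_eq_kpolys using F by (intro bexI[of _ F]) simp_all
  next
    case (3 u)
    have "(\<lambda>f. f u) \<in> polynomials (evaluations :: ((complex^'i \<Rightarrow> complex) \<Rightarrow> complex) set)"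
      by (rule polynomials.coord) (auto simp: evaluations_def)
    moreover have "x (lift f) = f u" for f by (simp add: 3 lift_def)
    ultimately show ?thesis by (intro bexI[of _ "\<lambda>f. f u"]) simp_all
  qed
next
  case (add F G)
  obtain F' where F: "F' \<in> polynomials evaluations" "\<forall>f\<in>forms d. F (lift f) = F' f" using add.IH(1) by blast
  obtain G' where G: "G' \<in> polynomials evaluations" "\<forall>f\<in>forms d. G (lift f) = G' f" using add.IH(2) by blast
  show ?case using F(2) G(2) by (intro bexI[OF _ polynomials.add[OF F(1) G(1)]]) simp
next
  case (mult F G)
  obtain F' where F: "F' \<in> polynomials evaluations" "\<forall>f\<in>forms d. F (lift f) = F' f" using mult.IH(1) by blast
  obtain G' where G: "G' \<in> polynomials evaluations" "\<forall>f\<in>forms d. G (lift f) = G' f" using mult.IH(2) by blast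
  show ?case using F(2) G(2) by (intro bexI[OF _ polynomials.mult[OF F(1) G(1)]]) simp
qed

lemma scale_polynomial:
  fixes F :: "(complex^'i \<Rightarrow> complex) \<Rightarrow> complex"
  assumes "F \<in> polynomials evaluations"
  shows "(\<lambda>f. F (\<lambda>u. c * f u)) \<in> polynomials evaluations"
  using assms unfolding polynomials_eq_kpolys
proof (rule kpolys_compose)
  fix x :: "(complex^'i \<Rightarrow> complex) \<Rightarrow> complex" assume "x \<in> evaluations"
  then obtain u where x: "x = (\<lambda>f. f u)" unfolding evaluations_def by blast
  have "(\<lambda>f :: complex^'i \<Rightarrow> complex. f u) \<in> evaluations" by (auto simp: evaluations_def)
  then show "(\<lambda>f. x (\<lambda>u. c * f u)) \<in> kpolys UNIV evaluations"
    unfolding x by (intro kpolys.mult kpolys.const kpolys.coord UNIV_I)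
qed

lemma params_polynomial:
  assumes "F \<in> polynomials triple_evaluations"
  shows "(\<lambda>t. F (\<omega> (par_v t), par_p \<omega> m t, par_f \<omega> m d t)) \<in> kpolys UNIV coords"
  using assms unfolding polynomials_eq_kpolys
proof (rule kpolys_compose)
  fix x :: "(complex^'i \<Rightarrow> complex) \<times> (complex^'i \<Rightarrow> complex) \<times> (complex^'i \<Rightarrow> complex) \<Rightarrow> complex"
  assume "x \<in> triple_evaluations"
  then consider u where "x = (\<lambda>(l, p, f). l u)" | u where "x = (\<lambda>(l, p, f). p u)" | u where "x = (\<lambda>(l, p, f). f u)"
    unfolding triple_evaluations_def by blast
  then show "(\<lambda>t. x (\<omega> (par_v t), par_p \<omega> m t, par_f \<omega> m d t)) \<in> kpolys UNIV coords"
  proof cases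
    case 1
    have v: "(\<lambda>t :: 'i params. par_v t $ i) \<in> kpolys UNIV coords" for i :: 'i
      by (rule par_v_kpolys[OF complex_subfield_UNIV]) simp
    show ?thesis unfolding 1 prod.case
      by (rule omega_kpolys[OF complex_subfield_UNIV w UNIV_I v kpolys.const[OF UNIV_I]])
  next
    case 2
    have v: "(\<lambda>t :: 'i params. par_v t $ i) \<in> kpolys UNIV coords" for i :: 'i
      by (rule par_v_kpolys[OF complex_subfield_UNIV]) simp
    have "(\<lambda>t. \<omega> (par_v t) u) \<in> kpolys UNIV coords"
      by (rule omega_kpolys[OF complex_subfield_UNIV w UNIV_I v kpolys.const[OF UNIV_I]])
    moreover have "(\<lambda>t. par_q m t u) \<in> kpolys UNIV coords"
      by (rule par_q_kpolys[OF complex_subfield_UNIV _ _ _ kpolys.const[OF UNIV_I]]) simp_all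
    moreover have "(\<lambda>t. par_form 5 (m - 1) t u) \<in> kpolys UNIV coords"
      by (rule hform_kpolys[OF complex_subfield_UNIV _ kpolys.const[OF UNIV_I]]) simp
    ultimately show ?thesis unfolding 2 prod.case par_p_def by (intro kpolys.add kpolys.mult)
  next
    case 3
    have "d \<ge> 1" using md by simp
    then have "(\<lambda>t. par_f \<omega> m d t u) \<in> kpolys UNIV ((\<lambda>x t. t x) ` par_idx d)"
      by (intro par_f_kpolys complex_subfield_UNIV w md) simp_all
    then show ?thesis unfolding 3 prod.case by (rule kpolys_mono) auto
  qed
qed

section \<open>The open sets and the inverse morphism\<close>

abbreviation "X \<equiv> cone_incidence \<omega> m d"
abbreviation "Y \<equiv> cone_locus \<omega> m d"
abbreviation "Rep \<equiv> representatives \<omega> m d"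
abbreviation "Z \<equiv> locus_cone \<omega> m d"

text \<open>\<open>disc\<close> need not be homogeneous, so its vanishing is no property of the
  line; what is asked for is some generator with nonzero \<open>disc\<close>.\<close>

definition W :: "(complex^'i \<Rightarrow> complex) set set" where
  "W = {y \<in> points Y. \<exists>f\<in>forms d. y = line f \<and> disc f \<noteq> 0}"

definition U where
  "U = incidence_map -` W \<inter> points X"

text \<open>The chosen generator is immaterial: any generator with nonzero \<open>disc\<close> lifts
  to a representative of the same point, as \<open>inv_map_lift\<close> shows.\<close>

definition inv_map where
  "inv_map y = represent (lift (SOME f. f \<in> Z \<and> y = line f \<and> disc f \<noteq> 0))"

lemma Z_forms: "f \<in> Z \<Longrightarrow> f \<in> forms d" "f \<in> Z \<Longrightarrow> f \<noteq> (\<lambda>_. 0)"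
  by (simp_all add: locus_cone_def)

lemma Z_scale: "f \<in> Z \<Longrightarrow> c \<noteq> 0 \<Longrightarrow> (\<lambda>u. c * f u) \<in> Z"
  by (auto simp: locus_cone_def forms_scale line_scale fun_eq_iff)

lemma disc_0: "disc (\<lambda>_. 0) = 0"
  by (simp add: disc_def cone_part_def)

lemma line_in_W: "f \<in> Z \<Longrightarrow> line f \<in> W \<longleftrightarrow> (\<exists>c. c \<noteq> 0 \<and> disc (\<lambda>u. c * f u) \<noteq> 0)"
proof
  assume f: "f \<in> Z" and "line f \<in> W"
  then obtain f' where f': "line f = line f'" "disc f' \<noteq> 0" unfolding W_def by blast
  obtain c where c: "f' = (\<lambda>u. c * f u)" using line_eqD[OF f'(1)[symmetric]] by blast
  have "c \<noteq> 0" using f'(2) disc_0 unfolding c by auto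
  then show "\<exists>c. c \<noteq> 0 \<and> disc (\<lambda>u. c * f u) \<noteq> 0" using f'(2) unfolding c by blast
next
  assume f: "f \<in> Z" and "\<exists>c. c \<noteq> 0 \<and> disc (\<lambda>u. c * f u) \<noteq> 0"
  then obtain c where c: "c \<noteq> 0" "disc (\<lambda>u. c * f u) \<noteq> 0" by blast
  then show "line f \<in> W" unfolding W_def cone_locus_simps using f Z_forms(1)[OF f]
    by (intro CollectI conjI bexI[of _ "\<lambda>u. c * f u"]) (auto simp: line_scale forms_scale)
qed

lemma inv_map_lift:
  assumes f: "f \<in> Z" "disc f \<noteq> 0"
  shows "inv_map (line f) = represent (lift f)" "lift f \<in> Rep"
proof -
  let ?P = "\<lambda>g. g \<in> Z \<and> line f = line g \<and> disc g \<noteq> 0"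
  define g where "g = (SOME g. ?P g)"
  have g: "g \<in> Z" "line f = line g" "disc g \<noteq> 0"
    unfolding g_def using someI[of ?P f] f by blast+
  obtain l p where r: "(l, p, g) \<in> Rep" using g(1) unfolding locus_cone_iff by blast
  note r' = representatives_cong_line[OF r g(2)[symmetric] Z_forms(1)[OF f(1)]]
  show "lift f \<in> Rep" by (rule lift_represents(1)[OF r'(1) f(2)])
  have "represent (lift g) = represent (l, p, g)" by (rule lift_represents(2)[OF r g(3)])
  also have "\<dots> = represent (lift f)" using lift_represents(2)[OF r'(1) f(2)] r'(2) by simp
  finally show "inv_map (line f) = represent (lift f)" unfolding inv_map_def g_def .
qed

text \<open>Regularity is local: near a given line one fixed scalar \<open>c\<close> works, and this
  formula describes the inverse there.\<close>

lemma inv_map_scaled: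
  assumes f: "f \<in> Z" and c: "c \<noteq> 0" "disc (\<lambda>u. c * f u) \<noteq> 0"
  shows "inv_map (line f) = represent (lift (\<lambda>u. c * f u))" "lift (\<lambda>u. c * f u) \<in> Rep" "line f \<in> W"
  using inv_map_lift[OF Z_scale[OF f c(1)] c(2)] line_in_W[OF f] c by (auto simp: line_scale)

lemma inv_map_inverse: "x \<in> U \<Longrightarrow> inv_map (incidence_map x) = x"
proof -
  assume "x \<in> U"
  then have x: "x \<in> points X" "incidence_map x \<in> W" by (auto simp: U_def)
  then obtain l p f where r: "(l, p, f) \<in> Rep" "x = represent (l, p, f)"
    unfolding cone_incidence_simps by auto
  have f: "f \<in> Z" unfolding locus_cone_iff using r(1) by blast
  have "line f \<in> W" using x(2) unfolding r(2) incidence_map_represent .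
  then obtain c where c: "c \<noteq> 0" "disc (\<lambda>u. c * f u) \<noteq> 0" using line_in_W[OF f] by blast
  note r' = representatives_cong_line[OF r(1) line_scale[OF c(1), symmetric] forms_scale[OF Z_forms(1)[OF f]]]
  have "represent (lift (\<lambda>u. c * f u)) = represent (l, p, f)"
    using lift_represents(2)[OF r'(1) c(2)] r'(2) by simp
  then show ?thesis
    unfolding r(2) incidence_map_represent inv_map_scaled(1)[OF f c] .
qed

lemma incidence_inv_map: "y \<in> W \<Longrightarrow> incidence_map (inv_map y) = y \<and> inv_map y \<in> U"
proof -
  assume y: "y \<in> W"
  then obtain f where f: "f \<in> Z" "y = line f" unfolding W_def cone_locus_simps by blast
  then obtain c where c: "c \<noteq> 0" "disc (\<lambda>u. c * f u) \<noteq> 0" using line_in_W[OF f(1)] y by blast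
  have "incidence_map (inv_map y) = y"
    unfolding f(2) inv_map_scaled(1)[OF f(1) c] lift_def incidence_map_represent by (rule line_scale[OF c(1)])
  moreover have "inv_map y \<in> points X"
    unfolding f(2) inv_map_scaled(1)[OF f(1) c] cone_incidence_simps using inv_map_scaled(2)[OF f(1) c] by blast
  ultimately show ?thesis using y by (simp add: U_def)
qed

lemma incidence_preimage:
  assumes T: "T \<subseteq> line ` Z"
  shows "represent -` (incidence_map -` T \<inter> points X) \<inter> Rep = {z \<in> Rep. snd (snd z) \<in> line -` T \<inter> Z}"
proof -
  have "represent z \<in> incidence_map -` T \<inter> points X \<longleftrightarrow> snd (snd z) \<in> line -` T \<inter> Z" if z: "z \<in> Rep" for z
  proof -
    obtain l p f where lpf: "z = (l, p, f)" by (cases z)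
    have "f \<in> Z" unfolding locus_cone_iff using z lpf by blast
    moreover have "represent z \<in> points X" unfolding cone_incidence_simps using z by blast
    ultimately show ?thesis by (simp add: lpf incidence_map_represent)
  qed
  then show ?thesis by blast
qed

lemma incidence_morphism: "morphism X Y incidence_map"
  unfolding morphism_def
proof (intro conjI ballI)
  show "incidence_map ` points X \<subseteq> points Y"
    unfolding points_cone_incidence points_cone_locus ..
  fix T assume T: "T \<in> opens Y"
  then have sub: "T \<subseteq> line ` Z" by (simp add: cone_locus_simps)
  obtain S where S: "S \<subseteq> polynomials evaluations" "line -` T \<inter> Z = {f \<in> Z. \<exists>F\<in>S. F f \<noteq> 0}"
    using T unfolding cone_locus_simps zariski_open_def by blast
  show "incidence_map -` T \<inter> points X \<in> opens X"
    unfolding cone_incidence_simps(2) mem_Collect_eq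
  proof (intro conjI)
    show "incidence_map -` T \<inter> points X \<subseteq> represent ` Rep" unfolding cone_incidence_simps(1) by blast
    show "zariski_open triple_evaluations Rep (represent -` (incidence_map -` T \<inter> points X) \<inter> Rep)"
      unfolding zariski_open_def incidence_preimage[OF sub]
    proof (intro exI conjI)
      show "(\<lambda>F z. F (snd (snd z))) ` S \<subseteq> polynomials triple_evaluations"
        using S(1) evaluations_triple by blast
      have "snd (snd z) \<in> Z" if "z \<in> Rep" for z unfolding locus_cone_iff using that by (metis prod.collapse)
      then show "{z \<in> Rep. snd (snd z) \<in> line -` T \<inter> Z} = {z \<in> Rep. \<exists>p\<in>(\<lambda>F z. F (snd (snd z))) ` S. p z \<noteq> 0}"
        unfolding S(2) by auto
    qed
  qed
  fix h assume "h \<in> regular Y T"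
  then have h: "regular_on evaluations (line -` T \<inter> Z) (h \<circ> line)" by (simp add: cone_locus_simps)
  show "h \<circ> incidence_map \<in> regular X (incidence_map -` T \<inter> points X)"
    unfolding cone_incidence_simps(3) mem_Collect_eq incidence_preimage[OF sub] regular_on_def
  proof
    fix z assume z: "z \<in> {z \<in> Rep. snd (snd z) \<in> line -` T \<inter> Z}"
    then obtain p q where pq: "p \<in> polynomials evaluations" "q \<in> polynomials evaluations" "q (snd (snd z)) \<noteq> 0"
      "\<And>f. f \<in> line -` T \<inter> Z \<Longrightarrow> q f \<noteq> 0 \<Longrightarrow> (h \<circ> line) f = p f / q f"
      using h unfolding regular_on_def by blast
    show "\<exists>p\<in>polynomials triple_evaluations. \<exists>q\<in>polynomials triple_evaluations. q z \<noteq> 0 \<and>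
      (\<forall>y\<in>{z \<in> Rep. snd (snd z) \<in> line -` T \<inter> Z}. q y \<noteq> 0 \<longrightarrow> (h \<circ> incidence_map \<circ> represent) y = p y / q y)"
    proof (intro bexI conjI ballI impI)
      show "(\<lambda>z. q (snd (snd z))) \<in> polynomials triple_evaluations" by (rule evaluations_triple[OF pq(2)])
      show "(\<lambda>z. p (snd (snd z))) \<in> polynomials triple_evaluations" by (rule evaluations_triple[OF pq(1)])
      show "q (snd (snd z)) \<noteq> 0" by (rule pq(3))
      fix y assume y: "y \<in> {z \<in> Rep. snd (snd z) \<in> line -` T \<inter> Z}" "q (snd (snd y)) \<noteq> 0"
      obtain l k f where "y = (l, k, f)" by (cases y)
      then show "(h \<circ> incidence_map \<circ> represent) y = p (snd (snd y)) / q (snd (snd y))"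
        using pq(4)[of f] y by (simp add: incidence_map_represent)
    qed
  qed
qed

lemma W_open: "W \<in> opens Y"
  unfolding cone_locus_simps mem_Collect_eq
proof (intro conjI)
  show "W \<subseteq> line ` Z" unfolding W_def cone_locus_simps by blast
  obtain D where D: "D \<in> polynomials evaluations" "\<And>f. f \<in> forms d \<Longrightarrow> disc f = D f" using disc_polynomial by blast
  \<comment> \<open>One polynomial for each scalar, since \<open>W\<close> pulls back to the union
    of the loci where \<open>disc\<close> of a scaled form is nonzero.\<close>
  define S where "S = {\<lambda>f. D (\<lambda>u. c * f u) | c. c \<noteq> 0}"
  have "(\<exists>p\<in>S. p f \<noteq> 0) \<longleftrightarrow> line f \<in> W" if f: "f \<in> Z" for f
  proof -
    have "(\<exists>p\<in>S. p f \<noteq> 0) \<longleftrightarrow> (\<exists>c. c \<noteq> 0 \<and> D (\<lambda>u. c * f u) \<noteq> 0)"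
      unfolding S_def by auto
    also have "\<dots> \<longleftrightarrow> line f \<in> W"
      unfolding line_in_W[OF f] D(2)[OF forms_scale[OF Z_forms(1)[OF f]]] ..
    finally show ?thesis .
  qed
  then have "line -` W \<inter> Z = {f \<in> Z. \<exists>p\<in>S. p f \<noteq> 0}" by blast
  moreover have "S \<subseteq> polynomials evaluations" unfolding S_def using scale_polynomial[OF D(1)] by blast
  ultimately show "zariski_open evaluations Z (line -` W \<inter> Z)"
    unfolding zariski_open_def by blast
qed

lemma inv_map_morphism: "morphism (open_subspace Y W) (open_subspace X U) inv_map"
  unfolding morphism_def
proof (intro conjI ballI)
  show "inv_map ` points (open_subspace Y W) \<subseteq> points (open_subspace X U)"
    using incidence_inv_map by (auto simp: open_subspace_def)
  obtain D where D: "D \<in> polynomials evaluations" "\<And>f. f \<in> forms d \<Longrightarrow> disc f = D f" using disc_polynomial by blast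
  have DZ: "D (\<lambda>u. c * f u) = disc (\<lambda>u. c * f u)" if "f \<in> Z" for f c
    using D(2)[OF forms_scale[OF Z_forms(1)[OF that]]] by simp
  fix T assume "T \<in> opens (open_subspace X U)"
  then have T: "T \<in> opens X" "T \<subseteq> U" by (auto simp: open_subspace_def)
  obtain S where S: "S \<subseteq> polynomials triple_evaluations" "represent -` T \<inter> Rep = {z \<in> Rep. \<exists>F\<in>S. F z \<noteq> 0}"
    using T(1) unfolding cone_incidence_simps zariski_open_def by blast
  have pts: "points (open_subspace Y W) = W" by (simp add: open_subspace_def)
  let ?V = "inv_map -` T \<inter> W"
  have V: "line f \<in> ?V \<longleftrightarrow> (\<exists>c. c \<noteq> 0 \<and> disc (\<lambda>u. c * f u) \<noteq> 0 \<and> lift (\<lambda>u. c * f u) \<in> represent -` T \<inter> Rep)"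
    if f: "f \<in> Z" for f
  proof
    assume "line f \<in> ?V"
    then have "line f \<in> W" "inv_map (line f) \<in> T" by auto
    then obtain c where c: "c \<noteq> 0" "disc (\<lambda>u. c * f u) \<noteq> 0" using line_in_W[OF f] by blast
    then show "\<exists>c. c \<noteq> 0 \<and> disc (\<lambda>u. c * f u) \<noteq> 0 \<and> lift (\<lambda>u. c * f u) \<in> represent -` T \<inter> Rep"
      using inv_map_scaled[OF f c] \<open>inv_map (line f) \<in> T\<close> by (intro exI[of _ c]) simp
  next
    assume "\<exists>c. c \<noteq> 0 \<and> disc (\<lambda>u. c * f u) \<noteq> 0 \<and> lift (\<lambda>u. c * f u) \<in> represent -` T \<inter> Rep"
    then obtain c where c: "c \<noteq> 0" "disc (\<lambda>u. c * f u) \<noteq> 0" "lift (\<lambda>u. c * f u) \<in> represent -` T \<inter> Rep" by blast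
    then show "line f \<in> ?V" using inv_map_scaled[OF f c(1,2)] by simp
  qed
  have lift_in: "lift (\<lambda>u. c * f u) \<in> Rep" if "f \<in> Z" "c \<noteq> 0" "disc (\<lambda>u. c * f u) \<noteq> 0" for f c
    by (rule inv_map_scaled(2)[OF that])
  have "\<forall>F. \<exists>F'. F \<in> polynomials triple_evaluations \<longrightarrow> F' \<in> polynomials evaluations \<and> (\<forall>f\<in>forms d. F (lift f) = F' f)"
    using lift_polynomial by blast
  from choice[OF this] obtain pb where pb: "\<And>F. F \<in> polynomials triple_evaluations \<Longrightarrow> pb F \<in> polynomials evaluations"
    "\<And>F f. F \<in> polynomials triple_evaluations \<Longrightarrow> f \<in> forms d \<Longrightarrow> F (lift f) = pb F f" by blast
  have pbZ: "pb F (\<lambda>u. c * f u) = F (lift (\<lambda>u. c * f u))" if "F \<in> polynomials triple_evaluations" "f \<in> Z" for F f c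
    using pb(2)[OF that(1) forms_scale[OF Z_forms(1)[OF that(2)]]] by simp
  \<comment> \<open>The factor \<open>D\<close> guarantees that \<open>c\<close> is an admissible
    scalar wherever \<open>G F c\<close> is nonzero; in quotients it cancels.\<close>
  define G where "G F c = (\<lambda>f. D (\<lambda>u. c * f u) * pb F (\<lambda>u. c * f u))" for F c
  have G: "G F c \<in> polynomials evaluations" if "F \<in> polynomials triple_evaluations" for F c
    unfolding G_def by (rule polynomials.mult[OF scale_polynomial[OF D(1)] scale_polynomial[OF pb(1)[OF that]]])
  have Vopen: "?V \<in> opens Y"
    unfolding cone_locus_simps mem_Collect_eq
  proof (intro conjI)
    show "?V \<subseteq> line ` Z" unfolding W_def cone_locus_simps by blast
    show "zariski_open evaluations Z (line -` ?V \<inter> Z)"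
      unfolding zariski_open_def
    proof (intro exI conjI)
      show "case_prod G ` (S \<times> - {0}) \<subseteq> polynomials evaluations" using G S(1) by auto
      have "(\<exists>p\<in>case_prod G ` (S \<times> - {0}). p f \<noteq> 0) \<longleftrightarrow> line f \<in> ?V" if f: "f \<in> Z" for f
      proof -
        have G_iff: "G F c f \<noteq> 0 \<longleftrightarrow> disc (\<lambda>u. c * f u) \<noteq> 0 \<and> F (lift (\<lambda>u. c * f u)) \<noteq> 0" if "F \<in> S" for F c
          using DZ[OF f, of c] pbZ[OF subsetD[OF S(1) that] f, of c] unfolding G_def by simp
        have "(\<exists>p\<in>case_prod G ` (S \<times> - {0}). p f \<noteq> 0) \<longleftrightarrow> (\<exists>F\<in>S. \<exists>c. c \<noteq> 0 \<and> G F c f \<noteq> 0)" by auto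
        also have "\<dots> \<longleftrightarrow> (\<exists>F\<in>S. \<exists>c. c \<noteq> 0 \<and> disc (\<lambda>u. c * f u) \<noteq> 0 \<and> F (lift (\<lambda>u. c * f u)) \<noteq> 0)"
          by (rule bex_cong[OF refl]) (simp only: G_iff)
        also have "\<dots> \<longleftrightarrow> (\<exists>c. c \<noteq> 0 \<and> disc (\<lambda>u. c * f u) \<noteq> 0 \<and> lift (\<lambda>u. c * f u) \<in> represent -` T \<inter> Rep)"
          unfolding S(2) using lift_in[OF f] by blast
        also have "\<dots> \<longleftrightarrow> line f \<in> ?V" by (rule V[OF f, symmetric])
        finally show ?thesis .
      qed
      then show "line -` ?V \<inter> Z = {f \<in> Z. \<exists>p\<in>case_prod G ` (S \<times> - {0}). p f \<noteq> 0}" by blast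
    qed
  qed
  then show "inv_map -` T \<inter> points (open_subspace Y W) \<in> opens (open_subspace Y W)"
    unfolding pts by (simp add: open_subspace_def)
  fix h assume "h \<in> regular (open_subspace X U) T"
  then have h: "regular_on triple_evaluations (represent -` T \<inter> Rep) (h \<circ> represent)"
    by (simp add: open_subspace_def cone_incidence_simps)
  have "regular_on evaluations (line -` ?V \<inter> Z) (h \<circ> inv_map \<circ> line)"
    unfolding regular_on_def
  proof
    fix f assume "f \<in> line -` ?V \<inter> Z"
    then have f: "f \<in> Z" "line f \<in> ?V" by simp_all
    then obtain c where c: "c \<noteq> 0" "disc (\<lambda>u. c * f u) \<noteq> 0" "lift (\<lambda>u. c * f u) \<in> represent -` T \<inter> Rep"
      using V by blast
    then obtain p q where pq: "p \<in> polynomials triple_evaluations" "q \<in> polynomials triple_evaluations" "q (lift (\<lambda>u. c * f u)) \<noteq> 0"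
      "\<And>z. z \<in> represent -` T \<inter> Rep \<Longrightarrow> q z \<noteq> 0 \<Longrightarrow> (h \<circ> represent) z = p z / q z"
      using h unfolding regular_on_def by blast
    show "\<exists>p\<in>polynomials evaluations. \<exists>q\<in>polynomials evaluations. q f \<noteq> 0 \<and>
      (\<forall>g\<in>line -` ?V \<inter> Z. q g \<noteq> 0 \<longrightarrow> (h \<circ> inv_map \<circ> line) g = p g / q g)"
    proof (intro bexI conjI ballI impI)
      show "G q c \<in> polynomials evaluations" by (rule G[OF pq(2)])
      show "G p c \<in> polynomials evaluations" by (rule G[OF pq(1)])
      show "G q c f \<noteq> 0" using c(2) pq(3) pbZ[OF pq(2) f(1), of c] DZ[OF f(1), of c] by (simp add: G_def)
      fix g assume g: "g \<in> line -` ?V \<inter> Z" "G q c g \<noteq> 0"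
      have gZ: "g \<in> Z" "line g \<in> ?V" using g(1) by simp_all
      have dg: "disc (\<lambda>u. c * g u) \<noteq> 0" using g(2) DZ[OF gZ(1), of c] by (auto simp: G_def)
      have im: "inv_map (line g) = represent (lift (\<lambda>u. c * g u))" by (rule inv_map_scaled(1)[OF gZ(1) c(1) dg])
      have "lift (\<lambda>u. c * g u) \<in> represent -` T \<inter> Rep" using gZ(2) lift_in[OF gZ(1) c(1) dg] im by simp
      moreover have "q (lift (\<lambda>u. c * g u)) \<noteq> 0" using g(2) pbZ[OF pq(2) gZ(1), of c] by (auto simp: G_def)
      ultimately have "h (inv_map (line g)) = p (lift (\<lambda>u. c * g u)) / q (lift (\<lambda>u. c * g u))"
        using pq(4) im by simp
      then show "(h \<circ> inv_map \<circ> line) g = G p c g / G q c g"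
        using dg DZ[OF gZ(1), of c] pbZ[OF pq(1) gZ(1), of c] pbZ[OF pq(2) gZ(1), of c] by (simp add: G_def)
    qed
  qed
  then show "h \<circ> inv_map \<in> regular (open_subspace Y W) (inv_map -` T \<inter> points (open_subspace Y W))"
    unfolding pts by (simp add: open_subspace_def cone_locus_simps)
qed

text \<open>The parameter space is an affine space, so nonempty open sets of parameters meet.\<close>

lemma U_dense: "dense_open X U"
  unfolding dense_open_def
proof (intro conjI ballI impI)
  show "U \<in> opens X"
    using incidence_morphism W_open unfolding morphism_def U_def by blast
  fix T assume T: "T \<in> opens X" "T \<noteq> {}"
  obtain S where S: "S \<subseteq> polynomials triple_evaluations" "represent -` T \<inter> Rep = {z \<in> Rep. \<exists>F\<in>S. F z \<noteq> 0}"
    using T(1) unfolding cone_incidence_simps zariski_open_def by blast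
  have "T \<subseteq> represent ` Rep" using T(1) by (simp add: cone_incidence_simps)
  then obtain z where "z \<in> Rep" "represent z \<in> T" using T(2) by blast
  then have "z \<in> represent -` T \<inter> Rep" by simp
  then obtain F where F: "F \<in> S" "F z \<noteq> 0" unfolding S(2) by blast
  let ?\<Phi> = "\<lambda>t. (\<omega> (par_v t), par_p \<omega> m t, par_f \<omega> m d t)"
  obtain l p f where z: "z = (l, p, f)" by (cases z)
  then obtain t1 where t1: "z = ?\<Phi> t1"
    using representatives_params[OF w md(2), of l p f] \<open>z \<in> Rep\<close> by blast
  obtain D where D: "D \<in> polynomials evaluations" "\<And>f. f \<in> forms d \<Longrightarrow> disc f = D f" using disc_polynomial by blast
  have d1: "d \<ge> 1" using md by simp
  have pf: "par_f \<omega> m d t \<in> forms d" for t by (rule par_f_forms[OF w md(2) d1])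
  \<comment> \<open>\<open>?A\<close> is nonzero at \<open>t1\<close> and keeps the point in
    \<open>T\<close>. \<open>?B\<close> is nonzero at \<open>t0\<close>; it ensures that the
    recovery works and that the parameters give a representative.\<close>
  let ?A = "\<lambda>t. F (?\<Phi> t)" and ?B = "\<lambda>t. D (par_f \<omega> m d t) * par_q m t (hyper_pt \<omega> a b (par_v t))"
  have A: "?A \<in> kpolys UNIV coords" using params_polynomial F(1) S(1) by blast
  have v: "(\<lambda>t :: 'i params. par_v t $ i) \<in> kpolys UNIV coords" for i :: 'i
    by (rule par_v_kpolys[OF complex_subfield_UNIV]) simp
  have h: "(\<lambda>t. hyper_pt \<omega> a b (par_v t) $ i) \<in> kpolys UNIV coords" for i
    by (rule hyper_pt_kpolys[OF complex_subfield_UNIV w UNIV_I v UNIV_I UNIV_I])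
  have "(\<lambda>t. par_q m t (hyper_pt \<omega> a b (par_v t))) \<in> kpolys UNIV coords"
    by (rule par_q_kpolys[OF complex_subfield_UNIV _ _ _ h]) simp_all
  moreover have "(\<lambda>t. D (par_f \<omega> m d t)) \<in> kpolys UNIV coords"
    using params_polynomial[OF evaluations_triple[OF D(1)]] by simp
  ultimately have B: "?B \<in> kpolys UNIV coords" by (intro kpolys.mult)
  \<comment> \<open>The line from \<open>t1\<close> to \<open>t0\<close>, along which both
    conditions become one-variable polynomials.\<close>
  define \<gamma> where "\<gamma> s x = t1 x + s * (t0 x - t1 x)" for s x
  have \<gamma>01: "\<gamma> 0 = t1" "\<gamma> 1 = t0" by (simp_all add: \<gamma>_def fun_eq_iff)
  have "\<exists>s. ?A (\<gamma> s) \<noteq> 0 \<and> ?B (\<gamma> s) \<noteq> 0"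
  proof (rule kpolys_common_nonzero[OF A B])
    show "?A (\<gamma> 0) \<noteq> 0" unfolding \<gamma>01 using F(2) t1 by simp
    show "?B (\<gamma> 1) \<noteq> 0" unfolding \<gamma>01 using disc_generic q0 D(2)[OF pf] by simp
    fix c :: "'i params \<Rightarrow> complex" assume "c \<in> coords"
    then obtain x where "c = (\<lambda>t. t x)" by blast
    then show "\<exists>P. \<forall>s. c (\<gamma> s) = poly P s"
      by (intro exI[of _ "[:t1 x, t0 x - t1 x:]"]) (simp add: \<gamma>_def)
  qed
  then obtain t where t: "?A t \<noteq> 0" "?B t \<noteq> 0" by blast
  have Dt: "disc (par_f \<omega> m d t) \<noteq> 0" and qt: "par_q m t (hyper_pt \<omega> a b (par_v t)) \<noteq> 0" using t(2) D(2)[OF pf] by auto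
  \<comment> \<open>For \<open>v = 0\<close> the test point is zero, and a form of positive degree
    vanishes there.\<close>
  have vt: "par_v t \<noteq> 0"
  proof
    assume v0: "par_v t = 0"
    have "hyper_pt \<omega> a b (par_v t) = 0" unfolding v0 by (simp add: hyper_pt_def symplectic_formD(8)[OF w])
    then have "par_q m t (0 *s hyper_pt \<omega> a b (par_v t)) \<noteq> 0" using qt by simp
    then show False unfolding forms_homogeneous[OF par_q_forms] using md(1) by simp
  qed
  have "par_f \<omega> m d t \<noteq> (\<lambda>_. 0)" using Dt disc_0 by metis
  then have R: "?\<Phi> t \<in> Rep"
    using params_representatives[OF w md vt] qt hyper_pt_on[of "par_v t"] by blast
  then have "?\<Phi> t \<in> represent -` T \<inter> Rep" unfolding S(2) using F(1) t(1) by blast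
  then have "represent (?\<Phi> t) \<in> T" by simp
  moreover have "represent (?\<Phi> t) \<in> U"
  proof -
    have fZ: "par_f \<omega> m d t \<in> Z" unfolding locus_cone_iff using R by blast
    have "line (par_f \<omega> m d t) \<in> W"
      using line_in_W[OF fZ] Dt by (intro iffD2[OF line_in_W[OF fZ]] exI[of _ 1]) simp
    then show ?thesis unfolding U_def cone_incidence_simps using R by (simp add: incidence_map_represent)
  qed
  ultimately show "T \<inter> U \<noteq> {}" by blast
qed

text \<open>The map is onto, so a nonempty open set has a nonempty open preimage, which meets the
  dense set \<open>U\<close>.\<close>

lemma W_dense: "dense_open Y W"
  unfolding dense_open_def
proof (intro conjI ballI impI)
  show "W \<in> opens Y" by (rule W_open)
  fix T assume T: "T \<in> opens Y" "T \<noteq> {}"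
  have op: "incidence_map -` T \<inter> points X \<in> opens X"
    using incidence_morphism T(1) unfolding morphism_def by blast
  have "T \<subseteq> points Y" using T(1) by (simp add: cone_locus_simps)
  then have "T \<subseteq> incidence_map ` points X" unfolding points_cone_locus points_cone_incidence .
  then have ne: "incidence_map -` T \<inter> points X \<noteq> {}" using T(2) by blast
  have "\<forall>T\<in>opens X. T \<noteq> {} \<longrightarrow> T \<inter> U \<noteq> {}" using U_dense unfolding dense_open_def by (rule conjunct2)
  from mp[OF bspec[OF this op] ne] have "(incidence_map -` T \<inter> points X) \<inter> U \<noteq> {}" .
  then obtain x where "incidence_map x \<in> T" "x \<in> U" by auto
  then have "incidence_map x \<in> T \<inter> W" by (simp add: U_def)
  then show "T \<inter> W \<noteq> {}" by blast
qed

lemma birational: "birational_morphism X Y incidence_map"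
  unfolding birational_morphism_def
proof (intro conjI exI)
  show "morphism X Y incidence_map" by (rule incidence_morphism)
  show "dense_open X U" by (rule U_dense)
  show "dense_open Y W" by (rule W_dense)
  show "isomorphism (open_subspace X U) (open_subspace Y W) incidence_map"
    unfolding isomorphism_def
  proof (intro conjI exI)
    show "morphism (open_subspace X U) (open_subspace Y W) incidence_map"
      unfolding morphism_def
    proof (intro conjI ballI)
      show "incidence_map ` points (open_subspace X U) \<subseteq> points (open_subspace Y W)"
        by (auto simp: open_subspace_def U_def)
      fix T assume "T \<in> opens (open_subspace Y W)"
      then have T: "T \<in> opens Y" "T \<subseteq> W" by (auto simp: open_subspace_def)
      have eq: "incidence_map -` T \<inter> points (open_subspace X U) = incidence_map -` T \<inter> points X"
        using T(2) by (auto simp: open_subspace_def U_def)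
      show "incidence_map -` T \<inter> points (open_subspace X U) \<in> opens (open_subspace X U)"
        unfolding eq using incidence_morphism T unfolding morphism_def by (auto simp: open_subspace_def U_def)
      fix h assume "h \<in> regular (open_subspace Y W) T"
      then have "h \<in> regular Y T" by (simp add: open_subspace_def)
      then have "h \<circ> incidence_map \<in> regular X (incidence_map -` T \<inter> points X)"
        using incidence_morphism T(1) unfolding morphism_def by blast
      then show "h \<circ> incidence_map \<in> regular (open_subspace X U) (incidence_map -` T \<inter> points (open_subspace X U))"
        unfolding eq by (simp add: open_subspace_def)
    qed
    show "morphism (open_subspace Y W) (open_subspace X U) inv_map" by (rule inv_map_morphism)
    show "\<forall>x\<in>points (open_subspace X U). inv_map (incidence_map x) = x"
      using inv_map_inverse by (simp add: open_subspace_def)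
    show "\<forall>y\<in>points (open_subspace Y W). incidence_map (inv_map y) = y"
      using incidence_inv_map by (simp add: open_subspace_def)
  qed
qed

end

theorem theorem8p1:
  fixes \<omega> :: "complex^'i \<Rightarrow> complex^'i \<Rightarrow> complex" and n m d :: nat
  assumes "CARD('i) = 2 * n"
    and "symplectic_form \<omega>"
    and "n \<ge> 2" and "m \<ge> 2" and "d \<ge> m"
    and "A_num n d m - H_num n d m > D_num n m"
  shows "birational_morphism (cone_incidence \<omega> m d) (cone_locus \<omega> m d) incidence_map"
proof -
  obtain t0 a b j0 Q P where *: "par_q m t0 (hyper_pt \<omega> a b (par_v t0)) \<noteq> 0" "par_form 3 (d - m) t0 (par_v t0) \<noteq> 0"
    "par_v t0 $ j0 \<noteq> 0" "Q (par_f \<omega> m d t0) \<noteq> 0" "Q \<in> kpolys UNIV nat_evals" "\<And>i. P i \<in> kpolys UNIV nat_evals"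
    "\<And>t i. par_v t $ i * Q (par_f \<omega> m d t) = par_v t $ j0 * P i (par_f \<omega> m d t)"
    using rational_inverse[OF assms] by blast
  interpret cone_recovery \<omega> m d a b j0 Q P t0
    using assms(2,4,5) * by unfold_locales simp_all
  show ?thesis by (rule birational)
qed

end
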